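(* Let $n\ge 2$ and $N\ge 1$ be integers. Define a map $\mathcal F:\mathfrak D(N,n)\to SYD(N,n)$ by $$\mathcal F(D(\mathbf l,\mathbf r))=\begin{cases}(l_n,l_{n-1},\ldots,l_1)^t,& n\text{ even},\\ (r_n,l_{n-1},\ldots,l_1)^t,& n\text{ odd},\end{cases}$$ where $(c_1,\dots,c_n)^t$ denotes the Young diagram with column lengths $c_1\ge c_2\ge\dots\ge c_n$. Then $\mathcal F$ is a bijection. Moreover, for every $\lambda\in\Delta^N$, the multiplicity space $U_\lambda$ is isomorphic, as an $O_N(\mathbb C)$-module, to $R_\nu$ with $\nu=\mathcal F(D^N_\lambda)$.
   Context: Orthogonal Lie algebra and spinor representation. $E$ is an $n$-dimensional complex vector space with basis $e_1,\dots,e_n$, $\tilde E=E\oplus E^*$ with the symmetric form $(x+x^*,y+y^* )=\langle x,y^*\rangle+\langle x^*,y\rangle$; $\mathfrak o(\tilde E)\cong\mathfrak o_{2n}(\mathbb C)$ is written in matrices in the basis $(e_1,\dots,e_n,e_1^*,\dots,e_n^* )$. The Cartan subalgebra is spanned by $h_i=E_{ii}-E_{i+n,i+n}$; weights are written as $n$-tuples in the dual basis $h_i^*$; positive roots are $h_i^*\pm h_j^*$, $i<j$. The dominant integral weights $P_+$ are the tuples with all entries in $\mathbb Z$ or all in $\frac12+\mathbb Z$ and $\lambda_1\ge\dots\ge\lambda_{n-1}\ge|\lambda_n|$. $L_\lambda$ is the irreducible representation of highest weight $\lambda$. The spinor representation is $S=\Lambda E$, where, with $M_{e_i}$ = left exterior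 multiplication by $e_i$ and $D_{e_i^*}$ = contraction with $e_i^*$, $E_{ij}-E_{j+n,i+n}$ acts by $\frac12(M_{e_i}D_{e_j^*}-D_{e_j^*}M_{e_i})$, $E_{i+n,j}-E_{j+n,i}$ by $D_{e_i^*}D_{e_j^*}$, and $E_{i,j+n}-E_{j,i+n}$ by $M_{e_i}M_{e_j}$. Its set of weights is $P[S]=\{(\pm\frac12,\dots,\pm\frac12)\}$. Multiplicity spaces. $T^N$ is the set of $(\mu_1,\dots,\mu_N)\in P[S]^N$ with $\mu_1=\omega_\pm=(\frac12,\dots,\frac12,\pm\frac12)$ and $\sum_{i\le k}\mu_i\in P_+$ for all $k\le N$; $\Delta^N=\{\sum_{i=1}^N\mu_i:(\mu_1,\dots,\mu_N)\in T^N\}$ is the set of highest weights of irreducible subrepresentations of $S^{\otimes N}$. For $\lambda\in\Delta^N$, $U_\lambda=\mathrm{Hom}_{\mathfrak o(\tilde E)}(L_\lambda,S^{\otimes N})$, identified with the space of singular vectors of weight $\lambda$ in $S^{\otimes N}$. $O_N$-action. $V$ is an $N$-dimensional complex space with nondegenerate symmetric form and orthonormal basis $v_1,\dots,v_N$; $O_N=O(V)$ acts on $V\otimes E$ through the left factor and hence by algebra automorphisms on $\Lambda(V\otimes E)$. This is transported to $S^{\otimes N}=(\Lambda E)^{\otimes N}$ by the linear isomorphism $\bigotimes_{j=1}^N (e_{i_{j1}}\wedge\dots\wedge e_{i_{jk_j}})\mapsto \bigwedge_{j=1}^N\bigwedge_{r=1}^{k_j}(v_j\otimes e_{i_{jr}})$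 (wedge factors in increasing order of $j$). This action commutes with $\mathfrak o(\tilde E)$, so $O_N$ acts on $U_\lambda$. Regular cell diagrams. $\mathfrak D(N,n)$ is the set of regular cell diagrams $D(\mathbf l,\mathbf r)$ of length $N$ and height $n$, i.e. pairs of $n$-tuples of non-negative integers $\mathbf l=(l_i)$, $\mathbf r=(r_i)$ with $r_i+l_i=N$ for all $i$, $r_1\ge r_2\ge\dots\ge r_n$, and $r_{n-1}\ge l_n$ (drawn with $r_i$ cells to the right and $l_i$ cells to the left of a vertical axis in row $i$). For $\lambda\in\Delta^N$, $D^N_\lambda=D(\mathbf l,\mathbf r)$ with $r_i=\frac N2+\lambda_i$, $l_i=\frac N2-\lambda_i$. Short Young diagrams. $SYD(N,n)$ is the set of Young diagrams with at most $n$ columns such that the sum of the lengths of the first two columns is at most $N$. The irreducible (holomorphic) finite-dimensional representations of $O_N(\mathbb C)$ are indexed (Weyl's construction) by the Young diagrams $\nu$ whose first two columns have total length at most $N$; $R_\nu$ denotes the representation indexed by $\nu$ (the intersection of the Schur functor $\mathbb S_\nu V\subset V^{\otimes|\nu|}$ with the traceless tensors). *)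

theory Defs
  imports
    Complex_Main
    "HOL-Library.FuncSet"
    "HOL-Library.Function_Algebras"
    "HOL-Combinatorics.Permutations"
    "Jordan_Normal_Form.Matrix"
begin

text \<open>
  All indices start at 0: the basis of \<open>E\<close> is \<open>e\<^sub>0, \<dots>, e\<^sub>n\<^sub>-\<^sub>1\<close>, the orthonormal
  basis of \<open>V\<close> is \<open>v\<^sub>0, \<dots>, v\<^sub>N\<^sub>-\<^sub>1\<close>, and so on.
\<close>


section \<open>Complex vector spaces and representations\<close>

text \<open>
  A vector space is a subspace of an ambient type of class \<open>complex_vector\<close>; actions
  are only specified on that subspace.
\<close>

class complex_vector = ab_group_add +
  fixes scaleC :: "complex \<Rightarrow> 'a \<Rightarrow> 'a" (infixr "*\<^sub>C" 75)
  assumes scaleC_add_right: "a *\<^sub>C (x + y) = a *\<^sub>C x + a *\<^sub>C y"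
    and scaleC_add_left: "(a + b) *\<^sub>C x = a *\<^sub>C x + b *\<^sub>C x"
    and scaleC_scaleC: "a *\<^sub>C (b *\<^sub>C x) = (a * b) *\<^sub>C x"
    and scaleC_one: "1 *\<^sub>C x = x"

global_interpretation cvec: vector_space "scaleC :: complex \<Rightarrow> 'a \<Rightarrow> 'a::complex_vector"
  by unfold_locales (simp_all add: scaleC_add_right scaleC_add_left scaleC_scaleC scaleC_one)

instantiation complex :: complex_vector
begin

definition scaleC_complex :: "complex \<Rightarrow> complex \<Rightarrow> complex" where
  "scaleC_complex = (*)"

instance
  by standard (simp_all add: scaleC_complex_def algebra_simps)

end

instantiation "fun" :: (type, complex_vector) complex_vector
begin

definition scaleC_fun :: "complex \<Rightarrow> ('a \<Rightarrow> 'b) \<Rightarrow> 'a \<Rightarrow> 'b" where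
  "scaleC_fun c f = (\<lambda>x. c *\<^sub>C f x)"

instance
  by standard (simp_all add: scaleC_fun_def fun_eq_iff scaleC_add_right scaleC_add_left
      scaleC_scaleC scaleC_one)

end

definition clinear_on :: "'a::complex_vector set \<Rightarrow> ('a \<Rightarrow> 'b::complex_vector) \<Rightarrow> bool" where
  "clinear_on W f \<longleftrightarrow>
     (\<forall>x\<in>W. \<forall>y\<in>W. f (x + y) = f x + f y) \<and> (\<forall>c. \<forall>x\<in>W. f (c *\<^sub>C x) = c *\<^sub>C f x)"

definition O_group :: "nat \<Rightarrow> complex mat set" where
  "O_group N = {g \<in> carrier_mat N N. transpose_mat g * g = 1\<^sub>m N}"

definition O_module ::
    "nat \<Rightarrow> 'a::complex_vector set \<Rightarrow> (complex mat \<Rightarrow> 'a \<Rightarrow> 'a) \<Rightarrow> bool" where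
  "O_module N W \<rho> \<longleftrightarrow>
     cvec.subspace W \<and>
     (\<forall>g\<in>O_group N. \<rho> g ` W \<subseteq> W \<and> clinear_on W (\<rho> g)) \<and>
     (\<forall>g\<in>O_group N. \<forall>h\<in>O_group N. \<forall>x\<in>W. \<rho> (g * h) x = \<rho> g (\<rho> h x)) \<and>
     (\<forall>x\<in>W. \<rho> (1\<^sub>m N) x = x)"

definition O_isomorphic ::
    "nat \<Rightarrow> 'a::complex_vector set \<Rightarrow> (complex mat \<Rightarrow> 'a \<Rightarrow> 'a) \<Rightarrow>
     'b::complex_vector set \<Rightarrow> (complex mat \<Rightarrow> 'b \<Rightarrow> 'b) \<Rightarrow> bool" where
  "O_isomorphic N W \<rho> W' \<rho>' \<longleftrightarrow>
     O_module N W \<rho> \<and> O_module N W' \<rho>' \<and>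
     (\<exists>f. clinear_on W f \<and> bij_betw f W W' \<and>
          (\<forall>g\<in>O_group N. \<forall>x\<in>W. f (\<rho> g x) = \<rho>' g (f x)))"


section \<open>The orthogonal Lie algebra and its highest weight representations\<close>

text \<open>
  The form on \<open>E \<oplus> E\<^sup>*\<close> has Gram matrix \<open>J\<close> with off-diagonal identity blocks in the basis
  \<open>(e\<^sub>0, \<dots>, e\<^sub>n\<^sub>-\<^sub>1, e\<^sub>0\<^sup>*, \<dots>, e\<^sub>n\<^sub>-\<^sub>1\<^sup>*)\<close>.
\<close>

definition form_mat :: "nat \<Rightarrow> complex mat" where
  "form_mat n = four_block_mat (0\<^sub>m n n) (1\<^sub>m n) (1\<^sub>m n) (0\<^sub>m n n)"

definition o_alg :: "nat \<Rightarrow> complex mat set" where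
  "o_alg n = {A \<in> carrier_mat (2 * n) (2 * n).
     transpose_mat A * form_mat n + form_mat n * A = 0\<^sub>m (2 * n) (2 * n)}"

definition elem_mat :: "nat \<Rightarrow> nat \<Rightarrow> nat \<Rightarrow> complex mat" where
  "elem_mat m i j = mat m m (\<lambda>(a, b). if a = i \<and> b = j then 1 else 0)"

definition cartan :: "nat \<Rightarrow> nat \<Rightarrow> complex mat" where
  "cartan n i = elem_mat (2 * n) i i - elem_mat (2 * n) (i + n) (i + n)"

text \<open>Root vectors for the positive roots \<open>h\<^sub>i\<^sup>* - h\<^sub>j\<^sup>*\<close> and \<open>h\<^sub>i\<^sup>* + h\<^sub>j\<^sup>*\<close>, \<open>i < j\<close>.\<close>

definition pos_root_vectors :: "nat \<Rightarrow> complex mat set" where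
  "pos_root_vectors n =
     {elem_mat (2 * n) i j - elem_mat (2 * n) (j + n) (i + n) |i j. i < j \<and> j < n} \<union>
     {elem_mat (2 * n) i (j + n) - elem_mat (2 * n) j (i + n) |i j. i < j \<and> j < n}"

definition o_rep ::
    "nat \<Rightarrow> 'a::complex_vector set \<Rightarrow> (complex mat \<Rightarrow> 'a \<Rightarrow> 'a) \<Rightarrow> bool" where
  "o_rep n W \<rho> \<longleftrightarrow>
     cvec.subspace W \<and>
     (\<forall>A\<in>o_alg n. \<rho> A ` W \<subseteq> W \<and> clinear_on W (\<rho> A)) \<and>
     (\<forall>A\<in>o_alg n. \<forall>B\<in>o_alg n. \<forall>x\<in>W.
        \<rho> (A + B) x = \<rho> A x + \<rho> B x \<and>
        \<rho> (A * B - B * A) x = \<rho> A (\<rho> B x) - \<rho> B (\<rho> A x)) \<and>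
     (\<forall>c. \<forall>A\<in>o_alg n. \<forall>x\<in>W. \<rho> (c \<cdot>\<^sub>m A) x = c *\<^sub>C \<rho> A x)"

definition o_irreducible ::
    "nat \<Rightarrow> 'a::complex_vector set \<Rightarrow> (complex mat \<Rightarrow> 'a \<Rightarrow> 'a) \<Rightarrow> bool" where
  "o_irreducible n W \<rho> \<longleftrightarrow>
     o_rep n W \<rho> \<and> W \<noteq> {0} \<and>
     (\<forall>W'. cvec.subspace W' \<and> W' \<subseteq> W \<and> (\<forall>A\<in>o_alg n. \<rho> A ` W' \<subseteq> W') \<longrightarrow> W' = {0} \<or> W' = W)"

text \<open>
  A weight is the list of its coordinates in the basis dual to \<open>cartan n 0, \<dots>, cartan n (n - 1)\<close>.
\<close>

definition singular_vectors ::
    "nat \<Rightarrow> 'a::complex_vector set \<Rightarrow> (complex mat \<Rightarrow> 'a \<Rightarrow> 'a) \<Rightarrow> real list \<Rightarrow> 'a set" where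
  "singular_vectors n W \<rho> lam =
     {x \<in> W. (\<forall>i<n. \<rho> (cartan n i) x = complex_of_real (lam ! i) *\<^sub>C x) \<and>
             (\<forall>X\<in>pos_root_vectors n. \<rho> X x = 0)}"

text \<open>\<open>is_L n lam L \<rho>\<close>: the representation \<open>(L, \<rho>)\<close> is a model of \<open>L\<^sub>\<lambda>\<close>.\<close>

definition is_L ::
    "nat \<Rightarrow> real list \<Rightarrow> 'a::complex_vector set \<Rightarrow> (complex mat \<Rightarrow> 'a \<Rightarrow> 'a) \<Rightarrow> bool" where
  "is_L n lam L \<rho> \<longleftrightarrow>
     o_irreducible n L \<rho> \<and> (\<exists>x\<in>singular_vectors n L \<rho> lam. x \<noteq> 0)"

text \<open>
  Homomorphisms are extended by 0 outside \<open>L\<close>, so that each of them is a unique function.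
\<close>

definition o_Hom ::
    "nat \<Rightarrow> 'a::complex_vector set \<Rightarrow> (complex mat \<Rightarrow> 'a \<Rightarrow> 'a) \<Rightarrow>
     'b::complex_vector set \<Rightarrow> (complex mat \<Rightarrow> 'b \<Rightarrow> 'b) \<Rightarrow> ('a \<Rightarrow> 'b) set" where
  "o_Hom n L \<rho> W \<sigma> =
     {f. (\<forall>x. x \<notin> L \<longrightarrow> f x = 0) \<and> f ` L \<subseteq> W \<and> clinear_on L f \<and>
         (\<forall>A\<in>o_alg n. \<forall>x\<in>L. f (\<rho> A x) = \<sigma> A (f x))}"


section \<open>Exterior algebras and the spinor representation\<close>

text \<open>
  An element of the exterior algebra on ordered generators \<open>x\<^sub>0, x\<^sub>1, \<dots>\<close> is the function giving
  its coefficients: its value at \<open>I = {i\<^sub>1 < \<dots> < i\<^sub>k}\<close> is the coefficient of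
  \<open>x\<^sub>i\<^sub>1 \<and> \<dots> \<and> x\<^sub>i\<^sub>k\<close>.
\<close>

type_synonym ext = "nat set \<Rightarrow> complex"

definition ext_space :: "nat \<Rightarrow> ext set" where
  "ext_space m = {x. \<forall>I. x I \<noteq> 0 \<longrightarrow> I \<subseteq> {..<m}}"

definition ext_one :: ext where
  "ext_one = (\<lambda>I. if I = {} then 1 else 0)"

definition ext_gen :: "nat \<Rightarrow> ext" where
  "ext_gen i = (\<lambda>I. if I = {i} then 1 else 0)"

definition wedge :: "ext \<Rightarrow> ext \<Rightarrow> ext" where
  "wedge x y = (\<lambda>K. \<Sum>I\<in>Pow K.
     (-1) ^ card {(i, j). i \<in> I \<and> j \<in> K - I \<and> j < i} * x I * y (K - I))"

definition wedge_list :: "ext list \<Rightarrow> ext" where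
  "wedge_list xs = foldr wedge xs ext_one"

definition ext_M :: "nat \<Rightarrow> ext \<Rightarrow> ext" where
  "ext_M i x = wedge (ext_gen i) x"

text \<open>
  Contraction with the \<open>i\<close>-th dual basis vector, the antiderivation with \<open>x\<^sub>j \<mapsto> \<delta>\<^sub>i\<^sub>j\<close>: moving
  \<open>x\<^sub>i\<close> to the front of \<open>x\<^sub>I\<close> passes the generators \<open>x\<^sub>j\<close> with \<open>j \<in> I\<close>, \<open>j < i\<close>.
\<close>

definition ext_D :: "nat \<Rightarrow> ext \<Rightarrow> ext" where
  "ext_D i x = (\<lambda>J. if i \<in> J then 0 else (-1) ^ card {j \<in> J. j < i} * x (insert i J))"

text \<open>
  Every \<open>A\<close> in \<open>o_alg n\<close> is, with \<open>E\<close> the elementary matrices, uniquely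
  \<open>\<Sum>\<^sub>i\<^sub>,\<^sub>j A\<^sub>i\<^sub>,\<^sub>j (E\<^sub>i\<^sub>,\<^sub>j - E\<^sub>j\<^sub>+\<^sub>n\<^sub>,\<^sub>i\<^sub>+\<^sub>n)
    + \<Sum>\<^sub>i\<^sub><\<^sub>j A\<^sub>i\<^sub>+\<^sub>n\<^sub>,\<^sub>j (E\<^sub>i\<^sub>+\<^sub>n\<^sub>,\<^sub>j - E\<^sub>j\<^sub>+\<^sub>n\<^sub>,\<^sub>i)
    + \<Sum>\<^sub>i\<^sub><\<^sub>j A\<^sub>i\<^sub>,\<^sub>j\<^sub>+\<^sub>n (E\<^sub>i\<^sub>,\<^sub>j\<^sub>+\<^sub>n - E\<^sub>j\<^sub>,\<^sub>i\<^sub>+\<^sub>n)\<close>;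
  the action is prescribed on these matrices.
\<close>

definition spin_act :: "nat \<Rightarrow> complex mat \<Rightarrow> ext \<Rightarrow> ext" where
  "spin_act n A x =
     (\<Sum>i<n. \<Sum>j<n. (A $$ (i, j) / 2) *\<^sub>C (ext_M i (ext_D j x) - ext_D j (ext_M i x))) +
     (\<Sum>j<n. \<Sum>i<j. A $$ (i + n, j) *\<^sub>C ext_D i (ext_D j x)) +
     (\<Sum>j<n. \<Sum>i<j. A $$ (i, j + n) *\<^sub>C ext_M i (ext_M j x))"


section \<open>Tensor powers\<close>

text \<open>
  Let \<open>W\<close> have a basis indexed by \<open>B\<close>. A tensor in the tensor product of copies of \<open>W\<close> indexed by
  \<open>K\<close> is the function giving its coefficients; the basis tensors correspond to the functions
  \<open>K \<rightarrow> B\<close>.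
\<close>

definition tensor_space :: "'k set \<Rightarrow> 'b set \<Rightarrow> (('k \<Rightarrow> 'b) \<Rightarrow> complex) set" where
  "tensor_space K B = {t. \<forall>w. t w \<noteq> 0 \<longrightarrow> w \<in> K \<rightarrow>\<^sub>E B}"

definition on_factor ::
    "'k \<Rightarrow> (('b \<Rightarrow> complex) \<Rightarrow> 'b \<Rightarrow> complex) \<Rightarrow> (('k \<Rightarrow> 'b) \<Rightarrow> complex) \<Rightarrow> ('k \<Rightarrow> 'b) \<Rightarrow> complex" where
  "on_factor k f t = (\<lambda>w. f (\<lambda>b. t (w(k := b))) (w k))"

type_synonym spin_tensor = "(nat \<Rightarrow> nat set) \<Rightarrow> complex"

definition S_tensor :: "nat \<Rightarrow> nat \<Rightarrow> spin_tensor set" where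
  "S_tensor N n = tensor_space {..<N} (Pow {..<n})"

definition S_tensor_o :: "nat \<Rightarrow> nat \<Rightarrow> complex mat \<Rightarrow> spin_tensor \<Rightarrow> spin_tensor" where
  "S_tensor_o N n A t = (\<Sum>k<N. on_factor k (spin_act n A) t)"


section \<open>The action of the orthogonal group on the spinor tensor power\<close>

text \<open>
  In the exterior algebra of \<open>V \<otimes> E\<close>, which is \<open>ext_space (N * n)\<close>, the generator with index
  \<open>j * n + i\<close> (\<open>j < N\<close>, \<open>i < n\<close>) is \<open>v\<^sub>j \<otimes> e\<^sub>i\<close>.
\<close>

definition ve_gen :: "nat \<Rightarrow> nat \<Rightarrow> nat \<Rightarrow> ext" where
  "ve_gen n j i = ext_gen (j * n + i)"

definition O_on_gen :: "nat \<Rightarrow> nat \<Rightarrow> complex mat \<Rightarrow> nat \<Rightarrow> ext" where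
  "O_on_gen N n g m = (\<Sum>k<N. g $$ (k, m div n) *\<^sub>C ve_gen n k (m mod n))"

definition O_on_ext :: "nat \<Rightarrow> nat \<Rightarrow> complex mat \<Rightarrow> ext \<Rightarrow> ext" where
  "O_on_ext N n g x =
     (\<Sum>I\<in>Pow {..<N * n}. x I *\<^sub>C wedge_list (map (O_on_gen N n g) (sorted_list_of_set I)))"

definition S_tensor_to_ext :: "nat \<Rightarrow> nat \<Rightarrow> spin_tensor \<Rightarrow> ext" where
  "S_tensor_to_ext N n t =
     (\<Sum>w\<in>{..<N} \<rightarrow>\<^sub>E Pow {..<n}. t w *\<^sub>C
        wedge_list (concat (map (\<lambda>j. map (ve_gen n j) (sorted_list_of_set (w j))) [0..<N])))"

definition S_tensor_O :: "nat \<Rightarrow> nat \<Rightarrow> complex mat \<Rightarrow> spin_tensor \<Rightarrow> spin_tensor" where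
  "S_tensor_O N n g t =
     inv_into (S_tensor N n) (S_tensor_to_ext N n) (O_on_ext N n g (S_tensor_to_ext N n t))"


section \<open>Weights and multiplicity spaces\<close>

definition P_plus :: "nat \<Rightarrow> real list set" where
  "P_plus n = {lam. length lam = n \<and>
     ((\<forall>x\<in>set lam. x \<in> \<int>) \<or> (\<forall>x\<in>set lam. x - 1/2 \<in> \<int>)) \<and>
     (\<forall>i. i + 2 < n \<longrightarrow> lam ! i \<ge> lam ! (i + 1)) \<and>
     lam ! (n - 2) \<ge> \<bar>lam ! (n - 1)\<bar>}"

definition P_S :: "nat \<Rightarrow> real list set" where
  "P_S n = {mu. length mu = n \<and> set mu \<subseteq> {1/2, -1/2}}"

definition omega_plus :: "nat \<Rightarrow> real list" where
  "omega_plus n = replicate (n - 1) (1/2) @ [1/2]"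

definition omega_minus :: "nat \<Rightarrow> real list" where
  "omega_minus n = replicate (n - 1) (1/2) @ [-1/2]"

definition weight_sum :: "nat \<Rightarrow> real list list \<Rightarrow> real list" where
  "weight_sum n mus = map (\<lambda>i. \<Sum>mu\<leftarrow>mus. mu ! i) [0..<n]"

definition T_set :: "nat \<Rightarrow> nat \<Rightarrow> real list list set" where
  "T_set N n = {mus. length mus = N \<and> set mus \<subseteq> P_S n \<and>
     hd mus \<in> {omega_plus n, omega_minus n} \<and>
     (\<forall>k\<in>{1..N}. weight_sum n (take k mus) \<in> P_plus n)}"

definition Delta_set :: "nat \<Rightarrow> nat \<Rightarrow> real list set" where
  "Delta_set N n = weight_sum n ` T_set N n"

definition U_space ::
    "nat \<Rightarrow> nat \<Rightarrow> 'a::complex_vector set \<Rightarrow> (complex mat \<Rightarrow> 'a \<Rightarrow> 'a) \<Rightarrow> ('a \<Rightarrow> spin_tensor) set" where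
  "U_space N n L \<rho> = o_Hom n L \<rho> (S_tensor N n) (S_tensor_o N n)"

definition U_act :: "nat \<Rightarrow> nat \<Rightarrow> complex mat \<Rightarrow> ('a \<Rightarrow> spin_tensor) \<Rightarrow> 'a \<Rightarrow> spin_tensor" where
  "U_act N n g f = (\<lambda>x. S_tensor_O N n g (f x))"


section \<open>Cell diagrams and Young diagrams\<close>

definition cell_diagrams :: "nat \<Rightarrow> nat \<Rightarrow> (nat list \<times> nat list) set" where
  "cell_diagrams N n = {(l, r). length l = n \<and> length r = n \<and>
     (\<forall>i<n. r ! i + l ! i = N) \<and>
     (\<forall>i. i + 1 < n \<longrightarrow> r ! i \<ge> r ! (i + 1)) \<and>
     r ! (n - 2) \<ge> l ! (n - 1)}"

text \<open>For \<open>lam\<close> in \<open>Delta_set N n\<close> the numbers \<open>N/2 \<plusminus> lam ! i\<close> are non-negative integers.\<close>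

definition D_of :: "nat \<Rightarrow> real list \<Rightarrow> nat list \<times> nat list" where
  "D_of N lam =
     (map (\<lambda>x. nat \<lfloor>real N / 2 - x\<rfloor>) lam, map (\<lambda>x. nat \<lfloor>real N / 2 + x\<rfloor>) lam)"

text \<open>A Young diagram is its set of cells \<open>(row, column)\<close>.\<close>

type_synonym diagram = "(nat \<times> nat) set"

definition young_diagram :: "diagram \<Rightarrow> bool" where
  "young_diagram \<nu> \<longleftrightarrow> finite \<nu> \<and>
     (\<forall>i j i' j'. (i, j) \<in> \<nu> \<and> i' \<le> i \<and> j' \<le> j \<longrightarrow> (i', j') \<in> \<nu>)"

definition column_length :: "diagram \<Rightarrow> nat \<Rightarrow> nat" where
  "column_length \<nu> j = card {i. (i, j) \<in> \<nu>}"

definition SYD :: "nat \<Rightarrow> nat \<Rightarrow> diagram set" where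
  "SYD N n = {\<nu>. young_diagram \<nu> \<and> (\<forall>(i, j)\<in>\<nu>. j < n) \<and>
     column_length \<nu> 0 + column_length \<nu> 1 \<le> N}"

definition of_columns :: "nat list \<Rightarrow> diagram" where
  "of_columns c = {(i, j). j < length c \<and> i < c ! j}"

fun F_map :: "nat list \<times> nat list \<Rightarrow> diagram" where
  "F_map (l, r) =
     (if even (length l) then of_columns (rev l) else of_columns (last r # rev (butlast l)))"


section \<open>Weyl's construction\<close>

text \<open>
  The tensor factors of \<open>V\<^sup>\<otimes>\<^sup>d\<close>, where \<open>d\<close> is the number of cells of \<open>\<nu>\<close>, are indexed by the
  cells of \<open>\<nu>\<close> instead of \<open>{1..d}\<close>; this amounts to the choice of a tableau of shape \<open>\<nu>\<close>.
\<close>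

type_synonym cell_tensor = "(nat \<times> nat \<Rightarrow> nat) \<Rightarrow> complex"

definition row_group :: "diagram \<Rightarrow> (nat \<times> nat \<Rightarrow> nat \<times> nat) set" where
  "row_group \<nu> = {\<sigma>. \<sigma> permutes \<nu> \<and> (\<forall>c\<in>\<nu>. fst (\<sigma> c) = fst c)}"

definition column_group :: "diagram \<Rightarrow> (nat \<times> nat \<Rightarrow> nat \<times> nat) set" where
  "column_group \<nu> = {\<sigma>. \<sigma> permutes \<nu> \<and> (\<forall>c\<in>\<nu>. snd (\<sigma> c) = snd c)}"

definition row_symmetrizer :: "diagram \<Rightarrow> cell_tensor \<Rightarrow> cell_tensor" where
  "row_symmetrizer \<nu> t = (\<lambda>w. \<Sum>\<sigma>\<in>row_group \<nu>. t (w \<circ> \<sigma>))"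

definition column_antisymmetrizer :: "diagram \<Rightarrow> cell_tensor \<Rightarrow> cell_tensor" where
  "column_antisymmetrizer \<nu> t = (\<lambda>w. \<Sum>\<sigma>\<in>column_group \<nu>. of_int (sign \<sigma>) * t (w \<circ> \<sigma>))"

definition schur_space :: "nat \<Rightarrow> diagram \<Rightarrow> cell_tensor set" where
  "schur_space N \<nu> =
     (\<lambda>t. column_antisymmetrizer \<nu> (row_symmetrizer \<nu> t)) ` tensor_space \<nu> {..<N}"

definition traceless :: "nat \<Rightarrow> diagram \<Rightarrow> cell_tensor set" where
  "traceless N \<nu> = {t \<in> tensor_space \<nu> {..<N}.
     \<forall>p\<in>\<nu>. \<forall>q\<in>\<nu>. p \<noteq> q \<longrightarrow> (\<forall>w. (\<Sum>a<N. t (w(p := a, q := a))) = 0)}"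

definition R_space :: "nat \<Rightarrow> diagram \<Rightarrow> cell_tensor set" where
  "R_space N \<nu> = schur_space N \<nu> \<inter> traceless N \<nu>"

definition R_act :: "nat \<Rightarrow> diagram \<Rightarrow> complex mat \<Rightarrow> cell_tensor \<Rightarrow> cell_tensor" where
  "R_act N \<nu> g t = (\<lambda>w. if w \<in> \<nu> \<rightarrow>\<^sub>E {..<N}
     then \<Sum>u\<in>\<nu> \<rightarrow>\<^sub>E {..<N}. (\<Prod>c\<in>\<nu>. g $$ (w c, u c)) * t u else 0)"

end

theory Submission
  imports Defs "Jordan_Normal_Form.Determinant"
begin

text \<open>
  Identify \<open>S\<^sup>\<otimes>\<^sup>N\<close> with the exterior algebra of \<open>V \<otimes> E\<close>, a Fock space with creation and
  annihilation operators for the vectors \<open>v\<^sub>k \<otimes> e\<^sub>i\<close>. A homomorphism from \<open>L\<^sub>\<lambda>\<close> is determined by a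
  singular vector of weight \<open>\<lambda>\<close>; conversely every singular vector extends to a homomorphism, since
  the Fock space is unitary.

  Exchange particles and holes in an even number of columns, namely \<open>i < 2 * (n div 2)\<close>. The new
  vacuum is invariant under the orthogonal group because the columns can be filled in pairs by powers
  of the invariant operators \<open>\<Sum>\<^sub>k M\<^sub>k\<^sub>i M\<^sub>k\<^sub>j\<close>. With respect to it a vector of weight \<open>\<lambda>\<close> is a tensor,
  indexed by the cells of \<open>\<nu>\<close>, which is antisymmetric in every column. The positive root vectors become
  the operators that move a cell to a longer column and the contractions between two columns, so the
  singular vectors are the traceless tensors satisfying the one-cell Garnir relations.

  It remains to see that these relations cut out the image of the Young symmetrizer. The
  symmetrizer preserves the space \<open>X\<close> they define, so by finite dimension it is enough that it is
  injective on \<open>X\<close>, that is, that \<open>x \<in> X\<close> vanishes if its row symmetrization does. This is done one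
  column at a time: averaging the row symmetrizer over the permutations of a column gives, by the
  Garnir relations, a positive combination of antisymmetrizers including the identity.
\<close>

section \<open>Young symmetrizers and Garnir relations\<close>

text \<open>Two obstacles shape the argument. The model \<open>L\<close> is an arbitrary irreducible
  module, with no weight decomposition or complete reducibility at hand; so a homomorphism is
  obtained as a graph, generated by the pair of highest weight vectors, and positivity on the Fock
  side makes it single-valued. Positivity also replaces any count of dimensions for the Young
  symmetrizer: a single term of a row sum is not positive, but conjugating by the permutations of
  one column costs only a sign common to all terms, because the tensor is antisymmetric there, and
  the average of each term is a positive multiple of an antisymmetrizer.

  Exchanging particles and holes in one column replaces \<Lambda>^r V by \<Lambda>^(N-r) V \<otimes>
  det. An even number of exchanges cancels the determinants, so for odd n one column is left alone.
  It is the last one and becomes the longest column of the diagram, of length r_n: this is the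
  second case of \<open>F_map\<close>. For that column the roots h_i^* - h_n^* and h_i^* + h_n^*
  trade places, as under the diagram automorphism of type D.\<close>

abbreviation swp :: "'a \<Rightarrow> 'a \<Rightarrow> 'a \<Rightarrow> 'a" where
  "swp \<equiv> Transposition.transpose"

abbreviation pinv :: "('a \<Rightarrow> 'b) \<Rightarrow> 'b \<Rightarrow> 'a" where
  "pinv \<equiv> inv_into UNIV"

section \<open>The invariant inner product on tensors and sums over permutation groups\<close>

definition tinner :: "'k set \<Rightarrow> 'b set \<Rightarrow> (('k \<Rightarrow> 'b) \<Rightarrow> complex) \<Rightarrow> (('k \<Rightarrow> 'b) \<Rightarrow> complex) \<Rightarrow> complex" where
  "tinner K B s t = (\<Sum>w\<in>K \<rightarrow>\<^sub>E B. s w * cnj (t w))"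

lemma comp_permutes_PiE_iff:
  assumes "p permutes K"
  shows "w \<circ> p \<in> K \<rightarrow>\<^sub>E B \<longleftrightarrow> w \<in> K \<rightarrow>\<^sub>E B"
proof -
  have *: "v \<circ> q \<in> K \<rightarrow>\<^sub>E B" if "v \<in> K \<rightarrow>\<^sub>E B" "q permutes K" for v q
    using that permutes_in_image[OF that(2)] permutes_not_in[OF that(2)]
    by (auto simp: PiE_iff extensional_def)
  have "w \<circ> p \<circ> pinv p = w"
    using permutes_inv_o(1)[OF assms] by (simp add: comp_assoc)
  then show ?thesis
    using *[OF _ assms, of w] *[OF _ permutes_inv[OF assms], of "w \<circ> p"] by auto
qed

lemma tensor_space_comp_permutes:
  assumes "t \<in> tensor_space K B" "p permutes K" "w \<notin> K \<rightarrow>\<^sub>E B"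
  shows "t (w \<circ> p) = 0"
proof -
  have "w \<circ> p \<notin> K \<rightarrow>\<^sub>E B"
    using assms(3) comp_permutes_PiE_iff[OF assms(2), of w B] by blast
  then show ?thesis
    using assms(1) by (auto simp: tensor_space_def)
qed

lemma bij_betw_comp_permutes:
  assumes "p permutes K"
  shows "bij_betw (\<lambda>w. w \<circ> p) (K \<rightarrow>\<^sub>E B) (K \<rightarrow>\<^sub>E B)"
proof (rule bij_betw_byWitness[where f' = "\<lambda>w. w \<circ> pinv p"])
  show "\<forall>w\<in>K \<rightarrow>\<^sub>E B. w \<circ> p \<circ> pinv p = w" "\<forall>w\<in>K \<rightarrow>\<^sub>E B. w \<circ> pinv p \<circ> p = w"
    using permutes_inv_o[OF assms] by (auto simp: comp_assoc)
  show "(\<lambda>w. w \<circ> p) ` (K \<rightarrow>\<^sub>E B) \<subseteq> K \<rightarrow>\<^sub>E B"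
    using comp_permutes_PiE_iff[OF assms, of _ B] by blast
  show "(\<lambda>w. w \<circ> pinv p) ` (K \<rightarrow>\<^sub>E B) \<subseteq> K \<rightarrow>\<^sub>E B"
    using comp_permutes_PiE_iff[OF permutes_inv[OF assms], of _ B] by blast
qed

lemma tinner_self: "tinner K B t t = of_real (\<Sum>w\<in>K \<rightarrow>\<^sub>E B. (cmod (t w))\<^sup>2)"
  by (simp add: tinner_def complex_norm_square del: of_real_power)

lemma Re_tinner_self_nonneg: "Re (tinner K B t t) \<ge> 0"
  by (simp add: tinner_self sum_nonneg)

lemma tinner_self_eq_0:
  assumes "finite K" "finite B" "t \<in> tensor_space K B" "Re (tinner K B t t) \<le> 0"
  shows "t = (\<lambda>_. 0)"
proof
  fix w
  have fin: "finite (K \<rightarrow>\<^sub>E B)"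
    using assms by (intro finite_PiE)
  have "(\<Sum>w\<in>K \<rightarrow>\<^sub>E B. (cmod (t w))\<^sup>2) = 0"
    using assms(4) Re_tinner_self_nonneg[of K B t] by (simp add: tinner_self)
  then have "\<forall>w\<in>K \<rightarrow>\<^sub>E B. (cmod (t w))\<^sup>2 = 0"
    by (subst (asm) sum_nonneg_eq_0_iff[OF fin]) auto
  then show "t w = 0"
    using assms(3) unfolding tensor_space_def by (cases "w \<in> K \<rightarrow>\<^sub>E B") auto
qed

definition group_sum :: "('k \<Rightarrow> 'k) set \<Rightarrow> (('k \<Rightarrow> 'k) \<Rightarrow> complex) \<Rightarrow> (('k \<Rightarrow> 'b) \<Rightarrow> complex)
    \<Rightarrow> ('k \<Rightarrow> 'b) \<Rightarrow> complex" where
  "group_sum H \<chi> t = (\<lambda>w. \<Sum>h\<in>H. \<chi> h * t (w \<circ> h))"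

text \<open>A character with values \<plusminus>1 covers the trivial and the sign character at once,
  hence both row symmetrizers and column antisymmetrizers. Since \<open>\<chi>\<close> agrees on
  \<open>h\<close> and its inverse, group sums are self-adjoint for \<open>tinner\<close>.\<close>

locale perm_char =
  fixes K :: "'k set" and H :: "('k \<Rightarrow> 'k) set" and \<chi> :: "('k \<Rightarrow> 'k) \<Rightarrow> complex"
  assumes finite_K: "finite K"
    and permutes: "h \<in> H \<Longrightarrow> h permutes K"
    and id_mem: "id \<in> H"
    and comp_mem: "g \<in> H \<Longrightarrow> h \<in> H \<Longrightarrow> g \<circ> h \<in> H"
    and inv_mem: "h \<in> H \<Longrightarrow> pinv h \<in> H"
    and char_mult: "g \<in> H \<Longrightarrow> h \<in> H \<Longrightarrow> \<chi> (g \<circ> h) = \<chi> g * \<chi> h"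
    and char_square: "h \<in> H \<Longrightarrow> \<chi> h * \<chi> h = 1"
    and char_real: "h \<in> H \<Longrightarrow> cnj (\<chi> h) = \<chi> h"
begin

lemma finite_H: "finite H"
  by (rule finite_subset[OF _ finite_permutations[OF finite_K]]) (auto dest: permutes)

lemma bij_betw_comp_left: "g \<in> H \<Longrightarrow> bij_betw (\<lambda>h. g \<circ> h) H H"
  by (rule bij_betw_byWitness[where f' = "\<lambda>h. pinv g \<circ> h"])
     (auto simp: comp_assoc[symmetric] permutes_inv_o[OF permutes] intro: comp_mem inv_mem)

lemma bij_betw_inv: "bij_betw pinv H H"
  by (rule bij_betw_byWitness[where f' = pinv])
     (auto simp: inv_inv_eq permutes_bij[OF permutes] intro: inv_mem)

lemma char_inv: "h \<in> H \<Longrightarrow> \<chi> (pinv h) = \<chi> h"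
proof -
  assume h: "h \<in> H"
  have "\<chi> h * \<chi> (pinv h) = \<chi> id"
    using char_mult[OF h inv_mem[OF h]] permutes_inv_o[OF permutes[OF h]] by simp
  moreover have "\<chi> id = 1"
    using char_mult[OF id_mem id_mem] char_square[OF id_mem] by simp
  ultimately have "\<chi> h * (\<chi> h * \<chi> (pinv h)) = \<chi> h"
    by simp
  then show ?thesis
    using char_square[OF h] by (simp flip: mult.assoc)
qed

lemma group_sum_comp:
  assumes "g \<in> H"
  shows "group_sum H \<chi> t (w \<circ> g) = \<chi> g * group_sum H \<chi> t w"
proof -
  have "\<chi> g * group_sum H \<chi> t w = \<chi> g * (\<Sum>h\<in>H. \<chi> (g \<circ> h) * t (w \<circ> (g \<circ> h)))"
    unfolding group_sum_def
    by (subst sum.reindex_bij_betw[OF bij_betw_comp_left[OF assms], symmetric]) simp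
  also have "\<dots> = (\<Sum>h\<in>H. (\<chi> g * \<chi> g) * \<chi> h * t (w \<circ> (g \<circ> h)))"
    by (simp add: sum_distrib_left char_mult[OF assms] mult_ac)
  also have "\<dots> = group_sum H \<chi> t (w \<circ> g)"
    by (simp add: group_sum_def char_square[OF assms] comp_assoc)
  finally show ?thesis ..
qed

lemma group_sum_group_sum: "group_sum H \<chi> (group_sum H \<chi> t) w = of_nat (card H) * group_sum H \<chi> t w"
proof -
  have "group_sum H \<chi> (group_sum H \<chi> t) w = (\<Sum>h\<in>H. \<chi> h * group_sum H \<chi> t (w \<circ> h))"
    by (simp add: group_sum_def)
  also have "\<dots> = (\<Sum>h\<in>H. (\<chi> h * \<chi> h) * group_sum H \<chi> t w)"
    by (intro sum.cong) (simp_all add: group_sum_comp mult_ac)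
  finally show ?thesis
    by (simp add: char_square)
qed

lemma group_sum_tensor_space:
  assumes "t \<in> tensor_space K B"
  shows "group_sum H \<chi> t \<in> tensor_space K B"
proof -
  have "group_sum H \<chi> t w = 0" if "w \<notin> K \<rightarrow>\<^sub>E B" for w
    unfolding group_sum_def
    using tensor_space_comp_permutes[OF assms permutes that] by (intro sum.neutral) auto
  then show ?thesis
    unfolding tensor_space_def by auto
qed

lemma tinner_group_sum: "tinner K B (group_sum H \<chi> s) t = tinner K B s (group_sum H \<chi> t)"
proof -
  have *: "(\<Sum>w\<in>K \<rightarrow>\<^sub>E B. s (w \<circ> h) * cnj (t w)) = (\<Sum>w\<in>K \<rightarrow>\<^sub>E B. s w * cnj (t (w \<circ> pinv h)))"
    if "h \<in> H" for h
    by (subst sum.reindex_bij_betw[OF bij_betw_comp_permutes[OF permutes[OF that]], symmetric])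
       (simp add: comp_assoc permutes_inv_o[OF permutes[OF that]])
  have "tinner K B (group_sum H \<chi> s) t
      = (\<Sum>w\<in>K \<rightarrow>\<^sub>E B. \<Sum>h\<in>H. \<chi> h * (s (w \<circ> h) * cnj (t w)))"
    by (simp add: tinner_def group_sum_def sum_distrib_right mult.assoc)
  also have "\<dots> = (\<Sum>h\<in>H. \<chi> h * (\<Sum>w\<in>K \<rightarrow>\<^sub>E B. s (w \<circ> h) * cnj (t w)))"
    by (subst sum.swap) (simp add: sum_distrib_left)
  also have "\<dots> = (\<Sum>h\<in>H. \<chi> (pinv h) * (\<Sum>w\<in>K \<rightarrow>\<^sub>E B. s w * cnj (t (w \<circ> pinv h))))"
    by (intro sum.cong) (simp_all add: * char_inv)
  also have "\<dots> = (\<Sum>h\<in>H. \<chi> h * (\<Sum>w\<in>K \<rightarrow>\<^sub>E B. s w * cnj (t (w \<circ> h))))"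
    by (rule sum.reindex_bij_betw[OF bij_betw_inv])
  also have "\<dots> = (\<Sum>w\<in>K \<rightarrow>\<^sub>E B. \<Sum>h\<in>H. s w * cnj (\<chi> h * t (w \<circ> h)))"
    by (subst sum.swap) (simp add: sum_distrib_left char_real mult_ac)
  also have "\<dots> = tinner K B s (group_sum H \<chi> t)"
    by (simp add: tinner_def group_sum_def sum_distrib_left)
  finally show ?thesis .
qed

text \<open>The group sum is \<open>card H\<close> times an orthogonal projection P, and (Pt, t) =
  (Pt, Pt). This is where antisymmetrizers become positive semidefinite.\<close>

lemma tinner_group_sum_self:
  "of_nat (card H) * tinner K B (group_sum H \<chi> t) t = tinner K B (group_sum H \<chi> t) (group_sum H \<chi> t)"
proof -
  have "tinner K B (group_sum H \<chi> t) (group_sum H \<chi> t) = tinner K B (group_sum H \<chi> (group_sum H \<chi> t)) t"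
    by (simp add: tinner_group_sum)
  also have "group_sum H \<chi> (group_sum H \<chi> t) = (\<lambda>w. of_nat (card H) * group_sum H \<chi> t w)"
    by (simp add: group_sum_group_sum fun_eq_iff)
  also have "tinner K B \<dots> t = of_nat (card H) * tinner K B (group_sum H \<chi> t) t"
    by (simp add: tinner_def sum_distrib_left mult_ac)
  finally show ?thesis ..
qed

lemma card_H_pos: "card H > 0"
  using finite_H id_mem card_gt_0_iff by blast

lemma Re_tinner_group_sum_nonneg: "Re (tinner K B (group_sum H \<chi> t) t) \<ge> 0"
proof -
  have "real (card H) * Re (tinner K B (group_sum H \<chi> t) t) \<ge> 0"
    using arg_cong[OF tinner_group_sum_self[of B t], of Re] Re_tinner_self_nonneg[of K B "group_sum H \<chi> t"]
    by simp
  then show ?thesis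
    using card_H_pos by (simp add: zero_le_mult_iff)
qed

end

section \<open>Symmetric, row and column groups with their characters\<close>

lemma permutes_finite_permutation: "p permutes K \<Longrightarrow> finite K \<Longrightarrow> permutation p"
  unfolding permutation_permutes by blast

lemma sign_char:
  assumes "finite K" "p permutes K" "q permutes K"
  shows "sign (p \<circ> q) = sign p * sign q"
  using assms permutes_finite_permutation sign_compose by blast

lemma perm_char_sign:
  assumes "finite K" "\<And>h. h \<in> H \<Longrightarrow> h permutes K" "id \<in> H"
    "\<And>g h. g \<in> H \<Longrightarrow> h \<in> H \<Longrightarrow> g \<circ> h \<in> H" "\<And>h. h \<in> H \<Longrightarrow> pinv h \<in> H"
  shows "perm_char K H (\<lambda>h. of_int (sign h))"
proof
  fix g h assume "g \<in> H" "h \<in> H"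
  then show "of_int (sign (g \<circ> h)) = (of_int (sign g) * of_int (sign h) :: complex)"
    using sign_char[OF assms(1) assms(2) assms(2)] by simp
  show "of_int (sign h) * of_int (sign h) = (1 :: complex)"
    by (simp add: sign_def)
qed (auto intro: assms)

lemma perm_char_trivial:
  assumes "finite K" "\<And>h. h \<in> H \<Longrightarrow> h permutes K" "id \<in> H"
    "\<And>g h. g \<in> H \<Longrightarrow> h \<in> H \<Longrightarrow> g \<circ> h \<in> H" "\<And>h. h \<in> H \<Longrightarrow> pinv h \<in> H"
  shows "perm_char K H (\<lambda>h. 1)"
  by standard (auto intro: assms)

lemma perm_char_symmetric_group:
  assumes "finite K" "Q \<subseteq> K"
  shows "perm_char K {p. p permutes Q} (\<lambda>h. of_int (sign h))"
  by (rule perm_char_sign)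
     (simp_all add: assms permutes_id permutes_compose permutes_inv permutes_subset[OF _ assms(2)])

text \<open>A descending chain from the whole row group at \<open>k = 0\<close> to the trivial group
  once \<open>k\<close> exceeds every column index; an induction on \<open>k\<close> releases one
  column at a time.\<close>

definition row_group_from :: "diagram \<Rightarrow> nat \<Rightarrow> (nat \<times> nat \<Rightarrow> nat \<times> nat) set" where
  "row_group_from \<nu> k = {\<sigma> \<in> row_group \<nu>. \<forall>c\<in>\<nu>. snd c < k \<longrightarrow> \<sigma> c = c}"

lemma row_groupD: "\<sigma> \<in> row_group \<nu> \<Longrightarrow> fst (\<sigma> c) = fst c"
  by (cases "c \<in> \<nu>") (auto simp: row_group_def permutes_not_in)

lemma column_groupD: "\<sigma> \<in> column_group \<nu> \<Longrightarrow> snd (\<sigma> c) = snd c"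
  by (cases "c \<in> \<nu>") (auto simp: column_group_def permutes_not_in)

lemma row_group_permutes: "\<sigma> \<in> row_group \<nu> \<Longrightarrow> \<sigma> permutes \<nu>"
  by (simp add: row_group_def)

lemma column_group_permutes: "\<sigma> \<in> column_group \<nu> \<Longrightarrow> \<sigma> permutes \<nu>"
  by (simp add: column_group_def)

lemma row_group_from_fix: "\<sigma> \<in> row_group_from \<nu> k \<Longrightarrow> snd c < k \<Longrightarrow> \<sigma> c = c"
  unfolding row_group_from_def by (cases "c \<in> \<nu>") (auto dest: row_group_permutes permutes_not_in)

lemma row_group_inv: "\<sigma> \<in> row_group \<nu> \<Longrightarrow> pinv \<sigma> \<in> row_group \<nu>"
proof -
  assume s: "\<sigma> \<in> row_group \<nu>"
  note p = row_group_permutes[OF s]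
  have "fst (pinv \<sigma> c) = fst c" for c
    using row_groupD[OF s, of "pinv \<sigma> c"] permutes_inverses(1)[OF p] by simp
  then show ?thesis
    using permutes_inv[OF p] by (simp add: row_group_def)
qed

lemma column_group_inv: "\<sigma> \<in> column_group \<nu> \<Longrightarrow> pinv \<sigma> \<in> column_group \<nu>"
proof -
  assume s: "\<sigma> \<in> column_group \<nu>"
  note p = column_group_permutes[OF s]
  have "snd (pinv \<sigma> c) = snd c" for c
    using column_groupD[OF s, of "pinv \<sigma> c"] permutes_inverses(1)[OF p] by simp
  then show ?thesis
    using permutes_inv[OF p] by (simp add: column_group_def)
qed

lemma row_group_from_inv: "\<sigma> \<in> row_group_from \<nu> k \<Longrightarrow> pinv \<sigma> \<in> row_group_from \<nu> k"
proof -
  assume s: "\<sigma> \<in> row_group_from \<nu> k"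
  then have r: "\<sigma> \<in> row_group \<nu>" by (simp add: row_group_from_def)
  have "pinv \<sigma> c = c" if "snd c < k" for c
    using row_group_from_fix[OF s that] permutes_inverses(2)[OF row_group_permutes[OF r], of c] by simp
  then show ?thesis
    using row_group_inv[OF r] by (simp add: row_group_from_def)
qed

lemma row_group_comp: "\<sigma> \<in> row_group \<nu> \<Longrightarrow> \<tau> \<in> row_group \<nu> \<Longrightarrow> \<sigma> \<circ> \<tau> \<in> row_group \<nu>"
  using row_groupD[of \<sigma> \<nu>] row_groupD[of \<tau> \<nu>] permutes_compose[of \<tau> \<nu> \<sigma>]
  by (auto simp: row_group_def)

lemma column_group_comp: "\<sigma> \<in> column_group \<nu> \<Longrightarrow> \<tau> \<in> column_group \<nu> \<Longrightarrow> \<sigma> \<circ> \<tau> \<in> column_group \<nu>"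
  using column_groupD[of \<sigma> \<nu>] column_groupD[of \<tau> \<nu>] permutes_compose[of \<tau> \<nu> \<sigma>]
  by (auto simp: column_group_def)

lemma row_group_from_comp:
  "\<sigma> \<in> row_group_from \<nu> k \<Longrightarrow> \<tau> \<in> row_group_from \<nu> k \<Longrightarrow> \<sigma> \<circ> \<tau> \<in> row_group_from \<nu> k"
  using row_group_from_fix[of \<sigma> \<nu> k] row_group_from_fix[of \<tau> \<nu> k] row_group_comp
  by (auto simp: row_group_from_def)

lemma id_row_group: "id \<in> row_group \<nu>"
  and id_column_group: "id \<in> column_group \<nu>"
  and id_row_group_from: "id \<in> row_group_from \<nu> k"
  by (simp_all add: row_group_from_def row_group_def column_group_def permutes_id)

lemma row_group_from_permutes: "\<sigma> \<in> row_group_from \<nu> k \<Longrightarrow> \<sigma> permutes \<nu>"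
  by (simp add: row_group_from_def row_group_def)

lemma perm_char_row_group: "finite \<nu> \<Longrightarrow> perm_char \<nu> (row_group \<nu>) (\<lambda>h. 1)"
  by (rule perm_char_trivial)
     (rule row_group_inv row_group_comp row_group_permutes id_row_group | assumption)+

lemma perm_char_column_group: "finite \<nu> \<Longrightarrow> perm_char \<nu> (column_group \<nu>) (\<lambda>h. of_int (sign h))"
  by (rule perm_char_sign)
     (rule column_group_inv column_group_comp column_group_permutes id_column_group | assumption)+

lemma perm_char_row_group_from: "finite \<nu> \<Longrightarrow> perm_char \<nu> (row_group_from \<nu> k) (\<lambda>h. 1)"
  by (rule perm_char_trivial)
     (rule row_group_from_inv row_group_from_comp row_group_from_permutes id_row_group_from | assumption)+

lemma row_symmetrizer_eq: "row_symmetrizer \<nu> t = group_sum (row_group \<nu>) (\<lambda>h. 1) t"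
  by (simp add: row_symmetrizer_def group_sum_def)

lemma column_antisymmetrizer_eq:
  "column_antisymmetrizer \<nu> t = group_sum (column_group \<nu>) (\<lambda>h. of_int (sign h)) t"
  by (simp add: column_antisymmetrizer_def group_sum_def)

text \<open>Given antisymmetry in column \<open>k\<close>, the second condition says that
  antisymmetrising this column together with the single further cell \<open>q\<close> gives 0: the
  cosets are represented by the identity and by the swaps of \<open>q\<close> with the cells of the
  column, which carry the sign -1.\<close>

definition garnir_space :: "nat \<Rightarrow> diagram \<Rightarrow> cell_tensor set" where
  "garnir_space N \<nu> = {t \<in> tensor_space \<nu> {..<N}.
     (\<forall>\<sigma>\<in>column_group \<nu>. \<forall>w. t (w \<circ> \<sigma>) = of_int (sign \<sigma>) * t w) \<and>
     (\<forall>q\<in>\<nu>. \<forall>k<snd q. \<forall>w. (\<Sum>p\<in>{p\<in>\<nu>. snd p = k}. t (w \<circ> swp p q)) = t w)}"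

text \<open>A sign-reversing involution on the pairs (\<open>\<sigma>\<close>, \<open>p\<close>).
  For each \<open>\<sigma>\<close> one cell \<open>p0 \<sigma>\<close> of column \<open>k\<close>
  has its preimage in the same row as the preimage of \<open>q\<close>; there the swap passes
  through \<open>\<sigma>\<close> and becomes a row swap, which \<open>u\<close> absorbs, and these
  terms make up the right-hand side. All other pairs cancel.\<close>

lemma garnir_relation_young_symmetrizer:
  fixes u :: cell_tensor
  assumes young: "young_diagram \<nu>" and q: "q \<in> \<nu>" and k: "k < snd q"
    and u: "\<And>\<rho> w. \<rho> \<in> row_group \<nu> \<Longrightarrow> u (w \<circ> \<rho>) = u w"
  shows "(\<Sum>p\<in>{p\<in>\<nu>. snd p = k}. column_antisymmetrizer \<nu> u (w \<circ> swp p q)) = column_antisymmetrizer \<nu> u w"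
proof -
  let ?G = "column_group \<nu>" and ?C = "{p\<in>\<nu>. snd p = k}"
  define s where "s \<sigma> = (of_int (sign \<sigma>) :: complex)" for \<sigma> :: "nat \<times> nat \<Rightarrow> nat \<times> nat"
  define p0 where "p0 \<sigma> = \<sigma> (fst (pinv \<sigma> q), k)" for \<sigma> :: "nat \<times> nat \<Rightarrow> nat \<times> nat"
  define h where "h = (\<lambda>(\<sigma>, p). s \<sigma> * u (w \<circ> swp p q \<circ> \<sigma>))"
  have fin: "finite \<nu>"
    using young by (simp add: young_diagram_def)
  interpret col: perm_char \<nu> ?G s
    unfolding s_def by (rule perm_char_column_group[OF fin])
  \<comment> \<open>Rows are left-justified, so the row containing the preimage of \<open>q\<close>
    also has a cell in the earlier column \<open>k\<close>.\<close>
  have c0: "(fst (pinv \<sigma> q), k) \<in> \<nu>" and c: "pinv \<sigma> q \<in> \<nu>" if "\<sigma> \<in> ?G" for \<sigma>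
  proof -
    have i: "pinv \<sigma> \<in> ?G" using column_group_inv[OF that] .
    then show c: "pinv \<sigma> q \<in> \<nu>"
      using q permutes_in_image[OF column_group_permutes[OF i]] by simp
    have "snd (pinv \<sigma> q) = snd q" using column_groupD[OF i] .
    then show "(fst (pinv \<sigma> q), k) \<in> \<nu>"
      using young c k unfolding young_diagram_def
      by (metis less_imp_le_nat order_refl prod.collapse)
  qed
  have p0: "p0 \<sigma> \<in> ?C" if "\<sigma> \<in> ?G" for \<sigma>
    using c0[OF that] permutes_in_image[OF column_group_permutes[OF that]] column_groupD[OF that]
    by (simp add: p0_def)
  have qC: "q \<notin> ?C" using k by simp
  have row: "swp (fst (pinv \<sigma> q), k) (pinv \<sigma> q) \<in> row_group \<nu>" if "\<sigma> \<in> ?G" for \<sigma>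
    using c0[OF that] c[OF that] unfolding row_group_def
    by (auto intro!: permutes_swap_id simp: Transposition.transpose_def)
  have conj: "swp (p0 \<sigma>) q \<circ> \<sigma> = \<sigma> \<circ> swp (fst (pinv \<sigma> q), k) (pinv \<sigma> q)" if "\<sigma> \<in> ?G" for \<sigma>
  proof -
    note P = column_group_permutes[OF that]
    have "pinv \<sigma> (p0 \<sigma>) = (fst (pinv \<sigma> q), k)"
      by (simp add: p0_def permutes_inverses(2)[OF P])
    then show ?thesis
      using transpose_comp_eq[OF permutes_bij[OF P], of "p0 \<sigma>" q] by simp
  qed
  have hp0: "h (\<sigma>, p0 \<sigma>) = s \<sigma> * u (w \<circ> \<sigma>)" if "\<sigma> \<in> ?G" for \<sigma>
    using u[OF row[OF that], of "w \<circ> \<sigma>"] conj[OF that] by (simp add: h_def comp_assoc)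
  \<comment> \<open>Composing \<open>\<sigma>\<close> with the swap of \<open>p\<close> and
    \<open>p0 \<sigma>\<close> reverses its sign and exchanges the roles of the two cells; the
    permuted words then differ by a row swap, so \<open>u\<close> takes the same value on
    both.\<close>
  define D where "D = (SIGMA \<sigma>:?G. ?C - {p0 \<sigma>})"
  define \<iota> where "\<iota> = (\<lambda>(\<sigma>, p). (swp p (p0 \<sigma>) \<circ> \<sigma>, p0 \<sigma>))"
  have \<iota>: "\<iota> x \<in> D \<and> \<iota> (\<iota> x) = x \<and> h (\<iota> x) = - h x" if xD: "x \<in> D" for x
  proof -
    obtain \<sigma> p where x: "x = (\<sigma>, p)" and \<sigma>: "\<sigma> \<in> ?G" and p: "p \<in> ?C" "p \<noteq> p0 \<sigma>"
      using xD by (auto simp: D_def)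
    note P = column_group_permutes[OF \<sigma>]
    have pq: "p \<noteq> q" "p0 \<sigma> \<noteq> q"
      using p p0[OF \<sigma>] qC by blast+
    have sw: "swp p (p0 \<sigma>) \<in> ?G"
      using p p0[OF \<sigma>] unfolding column_group_def
      by (auto intro!: permutes_swap_id simp: Transposition.transpose_def)
    have \<sigma>': "swp p (p0 \<sigma>) \<circ> \<sigma> \<in> ?G"
      using column_group_comp[OF sw \<sigma>] .
    have "pinv (swp p (p0 \<sigma>) \<circ> \<sigma>) q = pinv \<sigma> q"
      using pq by (simp add: o_inv_distrib permutes_bij[OF P])
    then have p0': "p0 (swp p (p0 \<sigma>) \<circ> \<sigma>) = p"
      by (simp add: p0_def)
    have "u (w \<circ> swp (p0 \<sigma>) q \<circ> (swp p (p0 \<sigma>) \<circ> \<sigma>)) = u (w \<circ> swp p q \<circ> \<sigma>)"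
    proof -
      have "swp (p0 \<sigma>) q \<circ> swp p (p0 \<sigma>) = swp p q \<circ> swp (p0 \<sigma>) q"
        using pq p(2) by (auto simp: fun_eq_iff Transposition.transpose_def)
      then have "swp (p0 \<sigma>) q \<circ> (swp p (p0 \<sigma>) \<circ> \<sigma>) = swp p q \<circ> (swp (p0 \<sigma>) q \<circ> \<sigma>)"
        by (metis comp_assoc)
      then show ?thesis
        using u[OF row[OF \<sigma>], of "w \<circ> swp p q \<circ> \<sigma>"] conj[OF \<sigma>] by (simp add: comp_assoc)
    qed
    moreover have "s (swp p (p0 \<sigma>) \<circ> \<sigma>) = - s \<sigma>"
      using col.char_mult[OF sw \<sigma>] p(2) by (simp add: s_def sign_swap_id)
    ultimately have "h (\<iota> x) = - h x"
      by (simp add: h_def \<iota>_def x)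
    moreover have "\<iota> (\<iota> x) = x"
      by (simp add: \<iota>_def x p0' comp_assoc[symmetric] transpose_commute[of "p0 \<sigma>" p])
    moreover have "\<iota> x \<in> D"
      using \<sigma>' p0[OF \<sigma>] p p0' by (simp add: D_def \<iota>_def x)
    ultimately show ?thesis by blast
  qed
  have "sum h D = (\<Sum>x\<in>D. - h x)"
    by (rule sum.reindex_bij_witness[of _ \<iota> \<iota>]) (use \<iota> in auto)
  then have Z: "sum h D = 0"
    by (simp add: sum_negf)
  have "(\<Sum>p\<in>?C. column_antisymmetrizer \<nu> u (w \<circ> swp p q)) = (\<Sum>\<sigma>\<in>?G. \<Sum>p\<in>?C. h (\<sigma>, p))"
    by (subst sum.swap) (simp add: column_antisymmetrizer_def h_def s_def)
  also have "\<dots> = (\<Sum>\<sigma>\<in>?G. h (\<sigma>, p0 \<sigma>) + (\<Sum>p\<in>?C - {p0 \<sigma>}. h (\<sigma>, p)))"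
    by (intro sum.cong refl sum.remove) (use fin p0 in auto)
  also have "\<dots> = (\<Sum>\<sigma>\<in>?G. h (\<sigma>, p0 \<sigma>)) + sum h D"
    using fin col.finite_H by (simp add: sum.distrib D_def sum.Sigma)
  also have "\<dots> = column_antisymmetrizer \<nu> u w"
    by (simp add: Z hp0 column_antisymmetrizer_def s_def)
  finally show ?thesis .
qed

lemma schur_space_subset_garnir_space:
  assumes young: "young_diagram \<nu>"
  shows "schur_space N \<nu> \<subseteq> garnir_space N \<nu>"
proof
  fix y assume "y \<in> schur_space N \<nu>"
  then obtain t where t: "t \<in> tensor_space \<nu> {..<N}"
    and y: "y = column_antisymmetrizer \<nu> (row_symmetrizer \<nu> t)"
    by (auto simp: schur_space_def)
  have fin: "finite \<nu>"
    using young by (simp add: young_diagram_def)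
  interpret row: perm_char \<nu> "row_group \<nu>" "\<lambda>h. 1"
    by (rule perm_char_row_group[OF fin])
  interpret col: perm_char \<nu> "column_group \<nu>" "\<lambda>h. of_int (sign h)"
    by (rule perm_char_column_group[OF fin])
  have "row_symmetrizer \<nu> t (w \<circ> \<rho>) = row_symmetrizer \<nu> t w" if "\<rho> \<in> row_group \<nu>" for \<rho> w
    using row.group_sum_comp[OF that] by (simp add: row_symmetrizer_eq)
  note rel = garnir_relation_young_symmetrizer[OF young _ _ this]
  moreover have "y \<in> tensor_space \<nu> {..<N}"
    using col.group_sum_tensor_space[OF row.group_sum_tensor_space[OF t]]
    by (simp add: y row_symmetrizer_eq column_antisymmetrizer_eq)
  moreover have "y (w \<circ> \<sigma>) = of_int (sign \<sigma>) * y w" if "\<sigma> \<in> column_group \<nu>" for w \<sigma>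
    using col.group_sum_comp[OF that] by (simp add: y column_antisymmetrizer_eq)
  ultimately show "y \<in> garnir_space N \<nu>"
    by (simp add: garnir_space_def y)
qed

text \<open>Where \<open>f i = k\<close>, nothing moves in row \<open>i\<close>. These products of
  one transposition per row serve as representatives of \<open>row_group_from \<nu> k\<close> modulo
  \<open>row_group_from \<nu> (Suc k)\<close>.\<close>

definition row_swap :: "nat \<Rightarrow> (nat \<Rightarrow> nat) \<Rightarrow> nat \<times> nat \<Rightarrow> nat \<times> nat" where
  "row_swap k f c = (fst c, swp k (f (fst c)) (snd c))"

lemma row_swap_row_swap [simp]: "row_swap k f (row_swap k f c) = c"
  by (simp add: row_swap_def)

lemma bij_row_swap: "bij (row_swap k f)"
  by (rule bij_betw_byWitness[where f' = "row_swap k f"]) auto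

lemma comp_transpose_bij:
  assumes "bij f"
  shows "f \<circ> swp a b = swp (f a) (f b) \<circ> f"
  using transpose_comp_eq[OF assms, of "f a" "f b"] bij_is_inj[OF assms] by simp

text \<open>Induction on the set of rows that are really swapped. For a new row \<open>r\<close>
  with target cell \<open>q r\<close>, the Garnir relation sums over all cells of column
  \<open>k\<close>: those in rows outside \<open>S\<close> contribute equally after averaging over
  \<open>\<pi>\<close>, and the one in a row \<open>i \<in> S\<close> contributes the previous
  average with \<open>q r\<close> and \<open>q i\<close> exchanged. This is the coset recursion of
  the antisymmetrizer on the target cells. The constant starts as the number of permutations of
  column \<open>k\<close> and is divided by \<open>card R - card S\<close> at each step, so it stays
  positive.\<close>

lemma garnir_conjugate_sum:
  fixes y :: cell_tensor and f :: "nat \<Rightarrow> nat"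
  defines "C \<nu> k \<equiv> {p\<in>\<nu>. snd p = k}"
  assumes fin: "finite \<nu>"
    and rel: "\<And>q w. q \<in> \<nu> \<Longrightarrow> k < snd q \<Longrightarrow> (\<Sum>p\<in>C \<nu> k. y (w \<circ> swp p q)) = y w"
    and S: "finite S" "\<And>i. i \<in> S \<Longrightarrow> (i, k) \<in> \<nu> \<and> (i, f i) \<in> \<nu> \<and> k < f i"
  shows "\<exists>c>0. \<forall>w. (\<Sum>\<pi>\<in>{p. p permutes C \<nu> k}.
      y (w \<circ> (\<pi> \<circ> row_swap k (\<lambda>i. if i \<in> S then f i else k) \<circ> pinv \<pi>)))
    = of_real c * group_sum {p. p permutes (\<lambda>i. (i, f i)) ` S} (\<lambda>h. of_int (sign h)) y w"
  using S
proof (induction S rule: finite_induct)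
  case empty
  have "row_swap k (\<lambda>i. k) = id"
    by (auto simp: row_swap_def)
  moreover have "\<pi> \<circ> pinv \<pi> = id" if "\<pi> permutes C \<nu> k" for \<pi>
    using permutes_inv_o(1)[OF that] .
  moreover have "card {p. p permutes C \<nu> k} > 0"
    using card_permutations[of "C \<nu> k"] fin by (simp add: C_def)
  ultimately show ?case
    by (intro exI[of _ "real (card {p. p permutes C \<nu> k})"]) (simp add: group_sum_def)
next
  case (insert r S)
  let ?P = "{p. p permutes C \<nu> k}"
  define g where "g = (\<lambda>i. if i \<in> S then f i else k)"
  define g' where "g' = (\<lambda>i. if i \<in> insert r S then f i else k)"
  define q where "q i = (i, f i)" for i
  define Q where "Q = q ` S"
  define U where "U \<pi> = \<pi> \<circ> row_swap k g \<circ> pinv \<pi>" for \<pi> :: "nat \<times> nat \<Rightarrow> nat \<times> nat"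
  define F where "F h w = (\<Sum>\<pi>\<in>?P. y (w \<circ> (\<pi> \<circ> row_swap k h \<circ> pinv \<pi>)))" for h w
  define R where "R = {i. (i, k) \<in> \<nu>}"
  have g: "g r = k" "\<And>i. i \<notin> S \<Longrightarrow> g i = k" "\<And>i. i \<in> S \<Longrightarrow> g i = f i"
    using insert.hyps by (auto simp: g_def)
  have r: "(r, k) \<in> \<nu>" "(r, f r) \<in> \<nu>" "k < f r"
    using insert.prems by auto
  have "\<exists>c>0. \<forall>w. F g w = of_real c * group_sum {p. p permutes Q} (\<lambda>h. of_int (sign h)) y w"
    unfolding F_def g_def Q_def q_def using insert.prems by (intro insert.IH) simp
  then obtain c where c: "c > 0"
    and IH: "F g w = of_real c * group_sum {p. p permutes Q} (\<lambda>h. of_int (sign h)) y w" for w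
    by blast
  have finC: "finite (C \<nu> k)"
    using fin by (simp add: C_def)
  have CR: "C \<nu> k = (\<lambda>i. (i, k)) ` R"
    by (auto simp: C_def R_def)
  have finR: "finite R"
    using finC unfolding CR by (rule finite_imageD) (auto simp: inj_on_def)
  have SR: "insert r S \<subseteq> R"
    using insert.prems r by (auto simp: R_def)
  define m where "m = card R - card S"
  have cardS: "card S < card R"
    using card_mono[OF finR SR] insert.hyps by simp
  have m: "m > 0" "card (R - S) = m"
    using cardS SR insert.hyps by (auto simp: m_def card_Diff_subset)
  have bijU: "bij (U \<pi>)" if "\<pi> \<in> ?P" for \<pi>
    using that permutes_bij[of \<pi>] permutes_inv[of \<pi>] permutes_bij[of "pinv \<pi>"]
    unfolding U_def by (intro bij_comp bij_row_swap) auto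
  have fixq: "\<pi> (i, j) = (i, j)" "pinv \<pi> (i, j) = (i, j)" if "\<pi> \<in> ?P" "j \<noteq> k" for \<pi> i j
    using that permutes_not_in[of \<pi> "C \<nu> k" "(i, j)"] permutes_not_in[of "pinv \<pi>" "C \<nu> k" "(i, j)"]
      permutes_inv[of \<pi>] by (auto simp: C_def)
  \<comment> \<open>The swap in the new row, conjugated by \<open>\<pi>\<close>, exchanges
    \<open>\<pi> (r, k)\<close> with \<open>q r\<close>, because \<open>\<pi>\<close> fixes every
    cell outside column \<open>k\<close>.\<close>
  have Ug': "\<pi> \<circ> row_swap k g' \<circ> pinv \<pi> = U \<pi> \<circ> swp (\<pi> (r, k)) (q r)" if "\<pi> \<in> ?P" for \<pi>
  proof -
    have "row_swap k g' = row_swap k g \<circ> swp (r, k) (q r)"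
    proof
      fix x :: "nat \<times> nat"
      show "row_swap k g' x = (row_swap k g \<circ> swp (r, k) (q r)) x"
        using g r(3) insert.hyps
        by (cases x) (auto simp: row_swap_def g'_def q_def Transposition.transpose_def split: if_splits)
    qed
    moreover have "swp (r, k) (q r) \<circ> pinv \<pi> = pinv \<pi> \<circ> swp (\<pi> (r, k)) (q r)"
      using transpose_comp_eq[OF permutes_bij[OF permutes_inv], of \<pi> "C \<nu> k" "(r, k)" "q r"] that
        fixq(1)[OF that, of "f r" r] r(3) by (simp add: permutes_bij inv_inv_eq q_def)
    ultimately show ?thesis
      by (simp add: U_def comp_assoc)
  qed
  \<comment> \<open>Replacing \<open>\<pi>\<close> by its product with the swap of
    \<open>(r, k)\<close> and \<open>(r', k)\<close> turns row \<open>r'\<close> into row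
    \<open>r\<close>. Both rows lie outside \<open>S\<close>, so \<open>U \<pi>\<close> does not
    notice.\<close>
  have move: "(\<Sum>\<pi>\<in>?P. y (w \<circ> U \<pi> \<circ> swp (\<pi> (r', k)) (q r))) = F g' w" if r': "r' \<in> R - S" for r' w
  proof -
    let ?s = "swp (r, k) (r', k)"
    have s: "?s permutes C \<nu> k"
      using r r' by (intro permutes_swap_id) (auto simp: C_def R_def)
    have "?s \<circ> row_swap k g \<circ> ?s = row_swap k g"
    proof -
      have "row_swap k g (r, k) = (r, k)" "row_swap k g (r', k) = (r', k)"
        using g r' by (auto simp: row_swap_def)
      then have "row_swap k g \<circ> ?s = ?s \<circ> row_swap k g"
        using comp_transpose_bij[OF bij_row_swap, of k g "(r, k)" "(r', k)"] by simp
      then have "?s \<circ> row_swap k g \<circ> ?s = ?s \<circ> (?s \<circ> row_swap k g)"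
        by (simp add: comp_assoc)
      then show ?thesis
        by (simp add: comp_assoc[symmetric])
    qed
    then have U: "U (\<pi> \<circ> ?s) = U \<pi>" if "\<pi> \<in> ?P" for \<pi>
    proof -
      have "pinv (\<pi> \<circ> ?s) = ?s \<circ> pinv \<pi>"
        using that by (simp add: o_inv_distrib permutes_bij)
      then have "U (\<pi> \<circ> ?s) = \<pi> \<circ> (?s \<circ> row_swap k g \<circ> ?s) \<circ> pinv \<pi>"
        by (simp add: U_def comp_assoc)
      then show ?thesis
        using \<open>?s \<circ> row_swap k g \<circ> ?s = row_swap k g\<close> by (simp add: U_def)
    qed
    have "(\<Sum>\<pi>\<in>?P. y (w \<circ> U \<pi> \<circ> swp (\<pi> (r', k)) (q r)))
        = (\<Sum>\<pi>\<in>?P. y (w \<circ> U (\<pi> \<circ> ?s) \<circ> swp ((\<pi> \<circ> ?s) (r', k)) (q r)))"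
      by (rule sum_permutations_compose_right[OF s])
    also have "\<dots> = (\<Sum>\<pi>\<in>?P. y (w \<circ> (\<pi> \<circ> row_swap k g' \<circ> pinv \<pi>)))"
    proof (rule sum.cong[OF refl])
      fix \<pi> assume p: "\<pi> \<in> ?P"
      show "y (w \<circ> U (\<pi> \<circ> ?s) \<circ> swp ((\<pi> \<circ> ?s) (r', k)) (q r)) = y (w \<circ> (\<pi> \<circ> row_swap k g' \<circ> pinv \<pi>))"
        unfolding Ug'[OF p] U[OF p] by (simp add: comp_assoc)
    qed
    finally show ?thesis
      by (simp add: F_def)
  qed
  have full: "(\<Sum>i\<in>R. y (v \<circ> swp (\<pi> (i, k)) (q r))) = y v" if "\<pi> \<in> ?P" for v \<pi>
  proof -
    have "(\<Sum>i\<in>R. y (v \<circ> swp (\<pi> (i, k)) (q r))) = (\<Sum>p\<in>C \<nu> k. y (v \<circ> swp (\<pi> p) (q r)))"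
      unfolding CR by (subst sum.reindex) (auto simp: inj_on_def)
    also have "\<dots> = (\<Sum>p\<in>C \<nu> k. y (v \<circ> swp p (q r)))"
      using that by (intro sum.reindex_bij_betw) (auto intro: permutes_imp_bij)
    also have "\<dots> = y v"
      using r by (intro rel) (auto simp: q_def)
    finally show ?thesis .
  qed
  \<comment> \<open>For a row already swapped, \<open>U \<pi>\<close> carries
    \<open>\<pi> (i, k)\<close> to \<open>q i\<close> and fixes \<open>q r\<close>, so the
    transposition passes to the other side as an exchange of two target cells.\<close>
  have S_term: "w \<circ> U \<pi> \<circ> swp (\<pi> (i, k)) (q r) = w \<circ> swp (q r) (q i) \<circ> U \<pi>"
    if "\<pi> \<in> ?P" "i \<in> S" for w :: "nat \<times> nat \<Rightarrow> nat" and \<pi> i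
  proof -
    have fi: "f i \<noteq> k" "f r \<noteq> k" using insert.prems[of i] that r(3) by auto
    have "pinv \<pi> (\<pi> (i, k)) = (i, k)"
      using that(1) permutes_inverses(2) by auto
    moreover have "row_swap k g (i, k) = q i" "row_swap k g (q r) = q r"
      using g that(2) by (auto simp: row_swap_def q_def)
    ultimately have "U \<pi> (\<pi> (i, k)) = q i" "U \<pi> (q r) = q r"
      using fixq[OF that(1) fi(1), of i] fixq[OF that(1) fi(2), of r] by (simp_all add: U_def q_def)
    then show ?thesis
      using comp_transpose_bij[OF bijU[OF that(1)], of "\<pi> (i, k)" "q r"]
      by (simp add: comp_assoc transpose_commute[of "q i"])
  qed
  \<comment> \<open>\<open>m\<close> counts the rows not yet swapped. Taking the rows of
    \<open>S\<close> to the other side of the Garnir relation leaves \<open>m\<close> equal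
    terms.\<close>
  have rec: "of_nat m * F g' w = F g w - (\<Sum>i\<in>S. F g (w \<circ> swp (q r) (q i)))" for w
  proof -
    have "of_nat m * F g' w = (\<Sum>r'\<in>R - S. \<Sum>\<pi>\<in>?P. y (w \<circ> U \<pi> \<circ> swp (\<pi> (r', k)) (q r)))"
      using m(2) by (simp add: move)
    also have "\<dots> = (\<Sum>\<pi>\<in>?P. \<Sum>r'\<in>R - S. y (w \<circ> U \<pi> \<circ> swp (\<pi> (r', k)) (q r)))"
      by (rule sum.swap)
    also have "\<dots> = (\<Sum>\<pi>\<in>?P. y (w \<circ> U \<pi>) - (\<Sum>i\<in>S. y (w \<circ> U \<pi> \<circ> swp (\<pi> (i, k)) (q r))))"
      using SR finR by (intro sum.cong refl) (simp add: sum_diff full)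
    also have "\<dots> = (\<Sum>\<pi>\<in>?P. y (w \<circ> U \<pi>)) - (\<Sum>i\<in>S. \<Sum>\<pi>\<in>?P. y (w \<circ> swp (q r) (q i) \<circ> U \<pi>))"
      by (subst sum.swap) (simp add: sum_subtractf S_term)
    finally show ?thesis
      by (simp add: F_def U_def comp_assoc)
  qed
  have qS: "q r \<notin> Q" and finQ: "finite Q"
    using insert.hyps by (auto simp: Q_def q_def)
  have injq: "inj_on q S"
    by (auto simp: inj_on_def q_def)
  have ant: "group_sum {p. p permutes insert (q r) Q} (\<lambda>h. of_int (sign h)) y w
      = group_sum {p. p permutes Q} (\<lambda>h. of_int (sign h)) y w
        - (\<Sum>i\<in>S. group_sum {p. p permutes Q} (\<lambda>h. of_int (sign h)) y (w \<circ> swp (q r) (q i)))" for w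
  proof -
    have sgn: "sign (swp (q r) b \<circ> p) = - sign p" if "b \<in> Q" "p permutes Q" for b p
    proof -
      have "sign (swp (q r) b \<circ> p) = sign (swp (q r) b) * sign p"
        using that finQ by (intro sign_compose) (auto simp: permutation_swap_id intro: permutes_finite_permutation)
      then show ?thesis
        using that qS by (auto simp: sign_swap_id)
    qed
    have "group_sum {p. p permutes insert (q r) Q} (\<lambda>h. of_int (sign h)) y w
      = (\<Sum>p | p permutes Q. of_int (sign p) * y (w \<circ> p)) +
        (\<Sum>b\<in>Q. \<Sum>p | p permutes Q. of_int (sign (swp (q r) b \<circ> p)) * y (w \<circ> (swp (q r) b \<circ> p)))"
      unfolding group_sum_def using qS finQ by (subst sum_over_permutations_insert) auto
    also have "(\<Sum>b\<in>Q. \<Sum>p | p permutes Q. of_int (sign (swp (q r) b \<circ> p)) * y (w \<circ> (swp (q r) b \<circ> p)))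
      = (\<Sum>b\<in>Q. - (\<Sum>p | p permutes Q. of_int (sign p) * y (w \<circ> swp (q r) b \<circ> p)))"
      unfolding sum_negf[symmetric] by (intro sum.cong refl) (simp add: sgn comp_assoc)
    also have "\<dots> = - (\<Sum>i\<in>S. \<Sum>p | p permutes Q. of_int (sign p) * y (w \<circ> swp (q r) (q i) \<circ> p))"
      unfolding Q_def by (subst sum.reindex[OF injq]) (simp add: sum_negf)
    finally show ?thesis
      by (simp only: group_sum_def diff_conv_add_uminus)
  qed
  have "F g' w = of_real (c / real m) * group_sum {p. p permutes insert (q r) Q} (\<lambda>h. of_int (sign h)) y w" for w
  proof -
    have "of_nat m * F g' w = of_real c * group_sum {p. p permutes insert (q r) Q} (\<lambda>h. of_int (sign h)) y w"
      unfolding rec IH ant by (simp add: algebra_simps sum_distrib_left)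
    then show ?thesis
      using m(1) by (simp add: field_simps)
  qed
  moreover have "insert (q r) Q = (\<lambda>i. (i, f i)) ` insert r S"
    by (simp add: Q_def q_def)
  moreover have "c / real m > 0"
    using c m(1) by simp
  ultimately show ?case
    unfolding F_def g'_def by metis
qed

section \<open>Releasing the row group column by column\<close>

lemma sum_fun_apply: "(\<Sum>a\<in>A. f a) x = (\<Sum>a\<in>A. f a x)"
  for f :: "'a \<Rightarrow> 'b \<Rightarrow> 'c::comm_monoid_add"
  by (induction A rule: infinite_finite_induct) simp_all

lemma scaleC_fun_complex_apply [simp]: "(c *\<^sub>C t) x = c * t x" for t :: "'a \<Rightarrow> complex"
  by (simp add: scaleC_fun_def scaleC_complex_def)

lemma subspace_finitely_supported: "cvec.subspace {t :: 'i \<Rightarrow> complex. \<forall>w. t w \<noteq> 0 \<longrightarrow> w \<in> A}"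
proof (rule cvec.subspaceI)
  fix s t :: "'i \<Rightarrow> complex"
  assume "s \<in> {t. \<forall>w. t w \<noteq> 0 \<longrightarrow> w \<in> A}" "t \<in> {t. \<forall>w. t w \<noteq> 0 \<longrightarrow> w \<in> A}"
  moreover have "s w + t w \<noteq> 0 \<longrightarrow> s w \<noteq> 0 \<or> t w \<noteq> 0" for w by auto
  ultimately show "s + t \<in> {t. \<forall>w. t w \<noteq> 0 \<longrightarrow> w \<in> A}"
    by auto
qed auto

lemma subspace_tensor_space: "cvec.subspace (tensor_space K B)"
  unfolding tensor_space_def by (rule subspace_finitely_supported)

text \<open>A permutation in \<open>row_group_from \<nu> k\<close> amounts to the column
  \<open>f i\<close> to which it sends \<open>(i, k)\<close>, never before \<open>k\<close> because
  those cells are fixed, and a remainder that fixes column \<open>k\<close> as well. Taking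
  \<open>f\<close> from \<open>PiE\<close> makes the choice unique; \<open>e f\<close> extends it by
  \<open>k\<close>, that is by no swap, to the rows that do not reach column
  \<open>k\<close>.\<close>

lemma row_group_from_decomposition:
  fixes x :: cell_tensor and k :: nat
  assumes fin: "finite \<nu>"
  defines "R \<equiv> {i. (i, k) \<in> \<nu>}"
  defines "Ch \<equiv> PiE R (\<lambda>i. {j. k \<le> j \<and> (i, j) \<in> \<nu>})"
  defines "e \<equiv> \<lambda>f i. if i \<in> R then f i else k"
  shows "(\<Sum>\<sigma>\<in>row_group_from \<nu> k. x (w \<circ> \<sigma>)) =
    (\<Sum>f\<in>Ch. \<Sum>\<rho>\<in>row_group_from \<nu> (Suc k). x (w \<circ> row_swap k (e f) \<circ> \<rho>))"
proof -
  define ch where "ch = (\<lambda>\<sigma> :: nat \<times> nat \<Rightarrow> nat \<times> nat. \<lambda>i\<in>R. snd (\<sigma> (i, k)))"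
  have rs: "row_swap k (e f) \<in> row_group_from \<nu> k" if f: "f \<in> Ch" for f
  proof -
    have fi: "k \<le> f i" "(i, f i) \<in> \<nu>" if "i \<in> R" for i
      using f that by (auto simp: Ch_def)
    have "row_swap k (e f) permutes \<nu>"
      unfolding permutes_def
    proof (intro conjI allI impI)
      show "\<exists>!c. row_swap k (e f) c = d" for d
        using bij_row_swap[of k "e f"] unfolding bij_iff by blast
      fix c assume "c \<notin> \<nu>"
      then show "row_swap k (e f) c = c"
        using fi by (cases c) (auto simp: row_swap_def e_def R_def Transposition.transpose_def)
    qed
    then show ?thesis
      using fi(1)[THEN leD] by (auto simp: row_group_from_def row_group_def row_swap_def e_def Transposition.transpose_def)
  qed
  have mono: "row_group_from \<nu> (Suc k) \<subseteq> row_group_from \<nu> k"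
    by (auto simp: row_group_from_def)
  have ch: "ch \<sigma> \<in> Ch" if s: "\<sigma> \<in> row_group_from \<nu> k" for \<sigma>
  proof -
    note P = row_group_from_permutes[OF s]
    have "k \<le> snd (\<sigma> (i, k)) \<and> (i, snd (\<sigma> (i, k))) \<in> \<nu>" if i: "i \<in> R" for i
    proof
      have "fst (\<sigma> (i, k)) = i"
        using s row_groupD by (fastforce simp: row_group_from_def)
      then have "(i, snd (\<sigma> (i, k))) = \<sigma> (i, k)" by (metis prod.collapse)
      then show "(i, snd (\<sigma> (i, k))) \<in> \<nu>"
        using i permutes_in_image[OF P] by (simp add: R_def)
      show "k \<le> snd (\<sigma> (i, k))"
      proof (rule ccontr)
        assume "\<not> k \<le> snd (\<sigma> (i, k))"
        then have "\<sigma> (\<sigma> (i, k)) = \<sigma> (i, k)"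
          by (intro row_group_from_fix[OF s]) simp
        then have "\<sigma> (i, k) = (i, k)"
          using permutes_inj[OF P] by (simp add: inj_eq)
        with \<open>\<not> k \<le> snd (\<sigma> (i, k))\<close> show False by simp
      qed
    qed
    then show ?thesis
      by (auto simp: Ch_def ch_def)
  qed
  have rest: "row_swap k (e (ch \<sigma>)) \<circ> \<sigma> \<in> row_group_from \<nu> (Suc k)" if s: "\<sigma> \<in> row_group_from \<nu> k" for \<sigma>
  proof -
    have m: "row_swap k (e (ch \<sigma>)) \<circ> \<sigma> \<in> row_group_from \<nu> k"
      using rs[OF ch[OF s]] s by (rule row_group_from_comp)
    have "(row_swap k (e (ch \<sigma>)) \<circ> \<sigma>) c = c" if "c \<in> \<nu>" "snd c = k" for c
    proof -
      define i where "i = fst c"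
      have c: "c = (i, k)" using that(2) by (simp add: i_def prod_eq_iff)
      have "fst (\<sigma> c) = i"
        using s row_groupD by (fastforce simp: row_group_from_def c)
      then show ?thesis
        using that by (simp add: c row_swap_def e_def ch_def R_def)
    qed
    then show ?thesis
      using m by (auto simp: row_group_from_def less_Suc_eq)
  qed
  have chr: "ch (row_swap k (e f) \<circ> \<rho>) = f" if f: "f \<in> Ch" and r: "\<rho> \<in> row_group_from \<nu> (Suc k)" for f \<rho>
  proof
    fix i
    show "ch (row_swap k (e f) \<circ> \<rho>) i = f i"
      using f row_group_from_fix[OF r, of "(i, k)"]
      by (auto simp: ch_def row_swap_def e_def Ch_def PiE_iff extensional_def)
  qed
  have inv: "row_swap k g \<circ> (row_swap k g \<circ> \<rho>) = \<rho>" for g \<rho>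
    by (simp add: fun_eq_iff)
  have fCh: "finite Ch"
  proof -
    have "finite R"
      by (rule finite_subset[OF _ finite_imageI[OF fin, of fst]]) (force simp: R_def)
    moreover have "finite {j. k \<le> j \<and> (i, j) \<in> \<nu>}" for i
      by (rule finite_subset[OF _ finite_imageI[OF fin, of snd]]) force
    ultimately show ?thesis
      by (simp add: Ch_def finite_PiE)
  qed
  have "(\<Sum>f\<in>Ch. \<Sum>\<rho>\<in>row_group_from \<nu> (Suc k). x (w \<circ> row_swap k (e f) \<circ> \<rho>))
     = (\<Sum>z\<in>Ch \<times> row_group_from \<nu> (Suc k). x (w \<circ> (row_swap k (e (fst z)) \<circ> snd z)))"
    by (simp add: sum.cartesian_product comp_assoc case_prod_unfold)
  also have "\<dots> = (\<Sum>\<sigma>\<in>row_group_from \<nu> k. x (w \<circ> \<sigma>))"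
    by (rule sum.reindex_bij_witness[where i = "\<lambda>\<sigma>. (ch \<sigma>, row_swap k (e (ch \<sigma>)) \<circ> \<sigma>)"
          and j = "\<lambda>z. row_swap k (e (fst z)) \<circ> snd z"])
       (use rs ch rest mono row_group_from_comp in \<open>auto simp: chr inv subset_iff\<close>)
  finally show ?thesis ..
qed

text \<open>Let \<open>y\<close> be the sum over the smaller group. The assumption says that the
  translates of \<open>y\<close> by the coset representatives add up to 0. After averaging over
  conjugation by column \<open>k\<close>, each translate becomes a positive multiple of an
  antisymmetrizer applied to \<open>y\<close>, so its product with \<open>y\<close> is nonnegative;
  all these products vanish, and the identity representative gives \<open>y = 0\<close>.\<close>

lemma garnir_row_group_from_step:
  assumes fin: "finite \<nu>" and x: "x \<in> garnir_space N \<nu>"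
    and zero: "\<And>w. (\<Sum>\<sigma>\<in>row_group_from \<nu> k. x (w \<circ> \<sigma>)) = 0"
  shows "(\<Sum>\<sigma>\<in>row_group_from \<nu> (Suc k). x (w \<circ> \<sigma>)) = 0"
proof -
  let ?H = "row_group_from \<nu> (Suc k)"
  define y where "y = (\<lambda>w. \<Sum>\<sigma>\<in>?H. x (w \<circ> \<sigma>))"
  define C where "C = {p\<in>\<nu>. snd p = k}"
  define R where "R = {i. (i, k) \<in> \<nu>}"
  define Ch where "Ch = PiE R (\<lambda>i. {j. k \<le> j \<and> (i, j) \<in> \<nu>})"
  define e where "e = (\<lambda>f i. if i \<in> R then f i else k)"
  let ?P = "{p. p permutes C}"
  interpret H: perm_char \<nu> ?H "\<lambda>h. 1"
    by (rule perm_char_row_group_from[OF fin])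
  have y_ts: "y \<in> tensor_space \<nu> {..<N}"
    using H.group_sum_tensor_space[of x "{..<N}"] x by (simp add: group_sum_def y_def garnir_space_def)
  \<comment> \<open>Elements of the smaller group fix the columns up to \<open>k\<close>, so they
    keep later columns among themselves and conjugate a Garnir swap for \<open>q\<close> into one
    for the preimage of \<open>q\<close>, with the same \<open>k\<close>.\<close>
  have yrel: "(\<Sum>p\<in>C. y (w \<circ> swp p q)) = y w" if q: "q \<in> \<nu>" "k < snd q" for q w
  proof -
    have "(\<Sum>p\<in>C. x (w \<circ> swp p q \<circ> \<rho>)) = x (w \<circ> \<rho>)" if r: "\<rho> \<in> ?H" for \<rho>
    proof -
      note P = row_group_from_permutes[OF r] and i = row_group_from_inv[OF r]
      define q' where "q' = pinv \<rho> q"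
      have q': "q' \<in> \<nu>" "\<rho> q' = q"
        using q permutes_in_image[OF row_group_from_permutes[OF i]] permutes_inverses(1)[OF P]
        by (auto simp: q'_def)
      have "k < snd q'"
        using row_group_from_fix[OF r, of q'] q'(2) q(2) by (cases "k < snd q'") auto
      have "(\<Sum>p\<in>C. x (w \<circ> swp p q \<circ> \<rho>)) = (\<Sum>p\<in>C. x ((w \<circ> \<rho>) \<circ> swp p q'))"
      proof (rule sum.cong[OF refl])
        fix p assume "p \<in> C"
        then have "pinv \<rho> p = p"
          by (intro row_group_from_fix[OF i]) (simp add: C_def)
        then have "swp p q \<circ> \<rho> = \<rho> \<circ> swp p q'"
          using transpose_comp_eq[OF permutes_bij[OF P], of p q] by (simp add: q'_def)
        then show "x (w \<circ> swp p q \<circ> \<rho>) = x ((w \<circ> \<rho>) \<circ> swp p q')"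
          by (simp add: comp_assoc)
      qed
      also have "\<dots> = x (w \<circ> \<rho>)"
        using x q'(1) \<open>k < snd q'\<close> by (simp add: garnir_space_def C_def)
      finally show ?thesis .
    qed
    then show ?thesis
      unfolding y_def by (subst sum.swap) simp
  qed
  have yanti: "y (w \<circ> \<pi>) = of_int (sign \<pi>) * y w" if p: "\<pi> permutes C" for \<pi> w
  proof -
    have "C \<subseteq> \<nu>" by (auto simp: C_def)
    have "snd (\<pi> c) = snd c" for c
      using permutes_in_image[OF p, of c] permutes_not_in[OF p, of c] by (cases "c \<in> C") (auto simp: C_def)
    then have pc: "\<pi> \<in> column_group \<nu>"
      using permutes_subset[OF p \<open>C \<subseteq> \<nu>\<close>] by (simp add: column_group_def)
    have comm: "\<pi> \<circ> \<rho> = \<rho> \<circ> \<pi>" if r: "\<rho> \<in> ?H" for \<rho>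
    proof
      fix c
      have fixC: "\<rho> d = d" if "d \<in> C" for d
        using that by (intro row_group_from_fix[OF r]) (simp add: C_def)
      show "(\<pi> \<circ> \<rho>) c = (\<rho> \<circ> \<pi>) c"
      proof (cases "c \<in> C")
        case True
        then have "\<pi> c \<in> C" using permutes_in_image[OF p] by simp
        then show ?thesis using fixC True by simp
      next
        case False
        have "\<rho> c \<notin> C"
        proof
          assume a: "\<rho> c \<in> C"
          then have "\<rho> (\<rho> c) = \<rho> c" by (rule fixC)
          then have "\<rho> c = c"
            using permutes_inj[OF row_group_from_permutes[OF r]] by (simp add: inj_eq)
          with a False show False by simp
        qed
        then show ?thesis using False permutes_not_in[OF p] by simp
      qed
    qed
    have "x (w \<circ> \<pi> \<circ> \<rho>) = of_int (sign \<pi>) * x (w \<circ> \<rho>)" if "\<rho> \<in> ?H" for \<rho>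
      using x pc comm[OF that] by (simp add: garnir_space_def comp_assoc)
        (simp add: comp_assoc[symmetric])
    then show ?thesis
      by (simp add: y_def sum_distrib_left)
  qed
  have finC: "finite C" and CR: "C = (\<lambda>i. (i, k)) ` R"
    using fin by (auto simp: C_def R_def)
  have finR: "finite R"
    using finC unfolding CR by (rule finite_imageD) (auto simp: inj_on_def)
  have finCh: "finite Ch"
  proof -
    have "finite {j. k \<le> j \<and> (i, j) \<in> \<nu>}" for i
      by (rule finite_subset[OF _ finite_imageI[OF fin, of snd]]) force
    then show ?thesis
      using finR by (simp add: Ch_def finite_PiE)
  qed
  have zero': "(\<Sum>f\<in>Ch. y (w \<circ> row_swap k (e f))) = 0" for w
    using row_group_from_decomposition[OF fin, where x = x and k = k and w = w] zero[of w]
    by (simp add: y_def Ch_def e_def R_def)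
  define F where "F f w = (\<Sum>\<pi>\<in>?P. y (w \<circ> (\<pi> \<circ> row_swap k (e f) \<circ> pinv \<pi>)))" for f w
  \<comment> \<open>Conjugation is harmless for the vanishing sum: the left factor
    \<open>\<pi>\<close> is absorbed into \<open>w\<close>, the right one, by antisymmetry, into a
    sign common to all \<open>f\<close>.\<close>
  have sumF: "(\<Sum>f\<in>Ch. F f w) = 0" for w
  proof -
    have "(\<Sum>f\<in>Ch. y (w \<circ> (\<pi> \<circ> row_swap k (e f) \<circ> pinv \<pi>))) = 0" if "\<pi> \<in> ?P" for \<pi>
    proof -
      have "pinv \<pi> permutes C" using that permutes_inv by auto
      from yanti[OF this] have "y (w \<circ> (\<pi> \<circ> row_swap k (e f) \<circ> pinv \<pi>))
          = of_int (sign (pinv \<pi>)) * y ((w \<circ> \<pi>) \<circ> row_swap k (e f))" for f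
        by (simp add: comp_assoc[symmetric])
      then show ?thesis
        by (simp add: sum_distrib_left[symmetric] zero')
    qed
    then show ?thesis
      unfolding F_def by (subst sum.swap) simp
  qed
  have pos: "Re (tinner \<nu> {..<N} (F f) y) \<ge> 0" if f: "f \<in> Ch" for f
  proof -
    define S where "S = {i \<in> R. f i \<noteq> k}"
    have Si: "(i, k) \<in> \<nu> \<and> (i, f i) \<in> \<nu> \<and> k < f i" if "i \<in> S" for i
      using f that by (auto simp: S_def R_def Ch_def PiE_iff)
    have finS: "finite S" using finR by (simp add: S_def)
    have ef: "e f = (\<lambda>i. if i \<in> S then f i else k)"
      by (auto simp: S_def e_def)
    have "\<exists>c>0. \<forall>w. F f w = of_real c * group_sum {p. p permutes (\<lambda>i. (i, f i)) ` S} (\<lambda>h. of_int (sign h)) y w"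
      unfolding F_def C_def ef
      by (rule garnir_conjugate_sum[OF fin yrel[unfolded C_def] finS Si])
    then obtain c where c: "c > 0"
      "\<And>w. F f w = of_real c * group_sum {p. p permutes (\<lambda>i. (i, f i)) ` S} (\<lambda>h. of_int (sign h)) y w"
      by blast
    interpret Q: perm_char \<nu> "{p. p permutes (\<lambda>i. (i, f i)) ` S}" "\<lambda>h. of_int (sign h)"
      by (rule perm_char_symmetric_group[OF fin]) (use Si in auto)
    have "tinner \<nu> {..<N} (F f) y = of_real c *
        tinner \<nu> {..<N} (group_sum {p. p permutes (\<lambda>i. (i, f i)) ` S} (\<lambda>h. of_int (sign h)) y) y"
      by (simp add: tinner_def c(2) sum_distrib_left mult.assoc)
    then show ?thesis
      using mult_nonneg_nonneg[OF less_imp_le[OF c(1)] Q.Re_tinner_group_sum_nonneg[of "{..<N}" y]] by simp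
  qed
  \<comment> \<open>No row is swapped: this choice contributes \<open>card ?P\<close> times
    \<open>y\<close> itself.\<close>
  define f0 where "f0 = (\<lambda>i\<in>R. k)"
  have f0: "f0 \<in> Ch" by (auto simp: f0_def Ch_def R_def)
  have "row_swap k (e f0) = id"
    by (auto simp: row_swap_def e_def f0_def)
  then have Ff0: "F f0 w = of_nat (card ?P) * y w" for w
  proof -
    have "y (w \<circ> (\<pi> \<circ> row_swap k (e f0) \<circ> pinv \<pi>)) = y w" if "\<pi> \<in> ?P" for \<pi>
      using that \<open>row_swap k (e f0) = id\<close> permutes_inv_o(1)[of \<pi> C] by simp
    then show ?thesis by (simp add: F_def)
  qed
  have "(\<Sum>f\<in>Ch. tinner \<nu> {..<N} (F f) y) = tinner \<nu> {..<N} (\<lambda>w. \<Sum>f\<in>Ch. F f w) y"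
    unfolding tinner_def by (subst sum.swap) (simp add: sum_distrib_right)
  also have "\<dots> = 0"
    by (simp add: sumF tinner_def)
  finally have "(\<Sum>f\<in>Ch. Re (tinner \<nu> {..<N} (F f) y)) = 0"
    by (metis Re_sum zero_complex.simps(1))
  then have "Re (tinner \<nu> {..<N} (F f0) y) = 0"
    using sum_nonneg_eq_0_iff[OF finCh, of "\<lambda>f. Re (tinner \<nu> {..<N} (F f) y)"] pos f0 by simp
  moreover have "tinner \<nu> {..<N} (F f0) y = of_nat (card ?P) * tinner \<nu> {..<N} y y"
    by (simp add: tinner_def Ff0 sum_distrib_left mult.assoc)
  moreover have "card ?P > 0"
    using card_permutations[OF refl finC] by simp
  ultimately have "Re (tinner \<nu> {..<N} y y) \<le> 0"
    by simp
  then have "y = (\<lambda>_. 0)"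
    using tinner_self_eq_0[OF fin _ y_ts] by simp
  then show ?thesis
    by (metis y_def)
qed

lemma garnir_row_symmetrizer_eq_0:
  assumes fin: "finite \<nu>" and x: "x \<in> garnir_space N \<nu>"
    and zero: "row_symmetrizer \<nu> x = (\<lambda>_. 0)"
  shows "x = (\<lambda>_. 0)"
proof -
  have all: "(\<Sum>\<sigma>\<in>row_group_from \<nu> k. x (w \<circ> \<sigma>)) = 0" for k w
  proof (induction k arbitrary: w)
    case 0
    have "row_group_from \<nu> 0 = row_group \<nu>"
      by (simp add: row_group_from_def)
    then show ?case
      using fun_cong[OF zero, of w] by (simp only: row_symmetrizer_def)
  next
    case (Suc k)
    show ?case by (rule garnir_row_group_from_step[OF fin x Suc])
  qed
  obtain m where m: "\<And>c. c \<in> \<nu> \<Longrightarrow> snd c < m"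
    using finite_nat_set_iff_bounded[of "snd ` \<nu>"] fin by auto
  have "\<sigma> = id" if s: "\<sigma> \<in> row_group_from \<nu> m" for \<sigma>
  proof
    fix c show "\<sigma> c = id c"
      using row_group_from_fix[OF s m, of c] permutes_not_in[OF row_group_from_permutes[OF s], of c]
      by (cases "c \<in> \<nu>") auto
  qed
  then have "row_group_from \<nu> m = {id}"
    using id_row_group_from by auto
  then show ?thesis
    using all[where k = m] by auto
qed

text \<open>If the image of a basis of \<open>X\<close> missed a vector of \<open>X\<close>, adding
  that vector would give an independent set larger than the basis. Finiteness of the basis comes
  from the spanning set \<open>A\<close>.\<close>

lemma linear_injective_subspace_surjective:
  fixes T :: "'a::complex_vector \<Rightarrow> 'a"
  assumes T: "Vector_Spaces.linear scaleC scaleC T"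
    and X: "cvec.subspace X" "X \<subseteq> cvec.span A" "finite A"
    and maps: "\<And>x. x \<in> X \<Longrightarrow> T x \<in> X"
    and inj: "\<And>x. x \<in> X \<Longrightarrow> T x = 0 \<Longrightarrow> x = 0"
  shows "X \<subseteq> T ` X"
proof -
  interpret T: Vector_Spaces.linear scaleC scaleC T by (rule T)
  obtain B where B: "B \<subseteq> X" "cvec.independent B" "X \<subseteq> cvec.span B"
    using cvec.maximal_independent_subset by metis
  have sB: "cvec.span B = X"
    using B(1,3) X(1) cvec.span_minimal by blast
  have finB: "finite B"
    using cvec.independent_span_bound[OF X(3) B(2)] B(1) X(2) by blast
  have injX: "inj_on T X"
  proof (rule inj_onI)
    fix x y assume "x \<in> X" "y \<in> X" "T x = T y"
    then show "x = y"
      using inj[of "x - y"] cvec.subspace_diff[OF X(1)] by (simp add: T.diff)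
  qed
  have ind: "cvec.independent (T ` B)"
    using T.independent_injective_image[OF B(2)] injX sB by simp
  have cardTB: "card (T ` B) = card B"
    using injX B(1) card_image inj_on_subset by blast
  have "X \<subseteq> cvec.span (T ` B)"
  proof (rule ccontr)
    assume "\<not> X \<subseteq> cvec.span (T ` B)"
    then obtain x where x: "x \<in> X" "x \<notin> cvec.span (T ` B)" by blast
    then have "cvec.independent (insert x (T ` B))"
      using ind cvec.independent_insert by metis
    moreover have "insert x (T ` B) \<subseteq> cvec.span B"
      using x B(1) maps sB by auto
    ultimately have "card (insert x (T ` B)) \<le> card B"
      using cvec.independent_span_bound[OF finB] by blast
    moreover have "x \<notin> T ` B"
      using x(2) cvec.span_base by blast
    ultimately show False
      using finB cardTB by simp
  qed
  then show ?thesis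
    using T.span_image[of B] sB by simp
qed

lemma finitely_supported_subset_span:
  fixes A :: "'i set"
  assumes "finite A"
  shows "{t :: 'i \<Rightarrow> complex. \<forall>w. t w \<noteq> 0 \<longrightarrow> w \<in> A} \<subseteq> cvec.span ((\<lambda>a w. if w = a then 1 else 0) ` A)"
proof
  fix t :: "'i \<Rightarrow> complex"
  assume t: "t \<in> {t. \<forall>w. t w \<noteq> 0 \<longrightarrow> w \<in> A}"
  have "t = (\<Sum>a\<in>A. t a *\<^sub>C (\<lambda>w. if w = a then 1 else 0))"
  proof
    fix w
    have "(\<Sum>a\<in>A. t a *\<^sub>C (\<lambda>w. if w = a then 1 else 0)) w = (\<Sum>a\<in>A. if w = a then t a else 0)"
      by (simp add: sum_fun_apply if_distrib cong: if_cong)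
    also have "\<dots> = t w"
      using t assms by auto
    finally show "t w = (\<Sum>a\<in>A. t a *\<^sub>C (\<lambda>w. if w = a then 1 else 0)) w" ..
  qed
  then show "t \<in> cvec.span ((\<lambda>a w. if w = a then 1 else 0) ` A)"
    by (metis (no_types, lifting) cvec.span_sum cvec.span_scale cvec.span_base image_eqI)
qed

theorem schur_space_eq_garnir_space:
  assumes young: "young_diagram \<nu>"
  shows "schur_space N \<nu> = garnir_space N \<nu>"
proof
  show "schur_space N \<nu> \<subseteq> garnir_space N \<nu>"
    by (rule schur_space_subset_garnir_space[OF young])
  have fin: "finite \<nu>"
    using young by (simp add: young_diagram_def)
  let ?T = "\<lambda>t. column_antisymmetrizer \<nu> (row_symmetrizer \<nu> t)"
  interpret row: perm_char \<nu> "row_group \<nu>" "\<lambda>h. 1"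
    by (rule perm_char_row_group[OF fin])
  interpret col: perm_char \<nu> "column_group \<nu>" "\<lambda>h. of_int (sign h)"
    by (rule perm_char_column_group[OF fin])
  have sub: "garnir_space N \<nu> \<subseteq> tensor_space \<nu> {..<N}"
    by (auto simp: garnir_space_def)
  have "garnir_space N \<nu> \<subseteq> ?T ` garnir_space N \<nu>"
  proof (rule linear_injective_subspace_surjective)
    show "Vector_Spaces.linear scaleC scaleC ?T"
      by unfold_locales
        (simp_all add: column_antisymmetrizer_def row_symmetrizer_def fun_eq_iff sum.distrib
          algebra_simps sum_distrib_left)
    show "cvec.subspace (garnir_space N \<nu>)"
    proof (rule cvec.subspaceI)
      show "0 \<in> garnir_space N \<nu>"
        by (simp add: garnir_space_def tensor_space_def)
    next
      fix s t assume s: "s \<in> garnir_space N \<nu>" and t: "t \<in> garnir_space N \<nu>"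
      then have "s + t \<in> tensor_space \<nu> {..<N}"
        using cvec.subspace_add[OF subspace_tensor_space] sub by blast
      with s t show "s + t \<in> garnir_space N \<nu>"
        by (simp add: garnir_space_def sum.distrib algebra_simps)
    next
      fix c t assume "t \<in> garnir_space N \<nu>"
      then show "c *\<^sub>C t \<in> garnir_space N \<nu>"
        by (simp add: garnir_space_def tensor_space_def sum_distrib_left[symmetric])
    qed
    show "garnir_space N \<nu> \<subseteq> cvec.span ((\<lambda>a w. if w = a then 1 else 0) ` (\<nu> \<rightarrow>\<^sub>E {..<N}))"
      using finitely_supported_subset_span[of "\<nu> \<rightarrow>\<^sub>E {..<N}"] sub fin
      by (auto simp: tensor_space_def finite_PiE)
    show "finite ((\<lambda>a w. if w = a then 1 else (0::complex)) ` (\<nu> \<rightarrow>\<^sub>E {..<N}))"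
      using fin by (simp add: finite_PiE)
  next
    fix x assume x: "x \<in> garnir_space N \<nu>"
    then show "?T x \<in> garnir_space N \<nu>"
      using schur_space_subset_garnir_space[OF young] sub by (auto simp: schur_space_def)
  next
    fix x assume x: "x \<in> garnir_space N \<nu>" and z: "?T x = 0"
    let ?B = "{..<N}"
    \<comment> \<open>On the Garnir space the column antisymmetrizer is the scalar
      \<open>card (column_group \<nu>)\<close>. By self-adjointness, \<open>?T x = 0\<close> makes
      the product of the row symmetrization with \<open>x\<close> vanish, and that is a multiple of
      its squared norm.\<close>
    have "of_int (sign \<sigma>) * x (w \<circ> \<sigma>) = x w" if "\<sigma> \<in> column_group \<nu>" for \<sigma> w
      using x that col.char_square[OF that] by (simp add: garnir_space_def mult.assoc[symmetric])
    then have b: "column_antisymmetrizer \<nu> x = (\<lambda>w. of_nat (card (column_group \<nu>)) * x w)"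
      by (simp add: column_antisymmetrizer_def fun_eq_iff)
    have "0 = tinner \<nu> ?B (?T x) x"
      by (simp add: z tinner_def)
    also have "\<dots> = tinner \<nu> ?B (row_symmetrizer \<nu> x) (column_antisymmetrizer \<nu> x)"
      by (simp add: column_antisymmetrizer_eq col.tinner_group_sum)
    also have "\<dots> = of_nat (card (column_group \<nu>)) * tinner \<nu> ?B (row_symmetrizer \<nu> x) x"
      by (simp add: b tinner_def sum_distrib_left mult_ac)
    finally have "tinner \<nu> ?B (row_symmetrizer \<nu> x) x = 0"
      using col.card_H_pos by simp
    then have "tinner \<nu> ?B (row_symmetrizer \<nu> x) (row_symmetrizer \<nu> x) = 0"
      using row.tinner_group_sum_self[of ?B x] by (simp add: row_symmetrizer_eq)
    then have "row_symmetrizer \<nu> x = (\<lambda>_. 0)"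
      using x sub row.group_sum_tensor_space[of x ?B]
      by (intro tinner_self_eq_0[OF fin, of ?B]) (auto simp: row_symmetrizer_eq)
    then show "x = 0"
      using garnir_row_symmetrizer_eq_0[OF fin x] by (simp add: fun_eq_iff)
  qed
  then show "garnir_space N \<nu> \<subseteq> schur_space N \<nu>"
    using sub unfolding schur_space_def by blast
qed

lemmas fun_apply_simps = plus_fun_apply zero_fun_apply minus_apply uminus_apply scaleC_fun_complex_apply

declare fun_apply_simps [simp del]

section \<open>Creation and annihilation operators on the exterior algebra\<close>

definition flip :: "nat \<Rightarrow> nat set \<Rightarrow> nat set" where
  "flip m K = (if m \<in> K then K - {m} else insert m K)"

lemma mem_flip [simp]: "x \<in> flip m K \<longleftrightarrow> (if x = m then m \<notin> K else x \<in> K)"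
  by (auto simp: flip_def)

lemma flip_flip [simp]: "flip m (flip m K) = K"
  by (auto simp: flip_def)

lemma flip_commute: "flip p (flip q K) = flip q (flip p K)"
  by (auto simp: flip_def)

lemma flip_eq_iff: "flip m K = I \<longleftrightarrow> K = flip m I"
  by (metis flip_flip)

lemma flip_subset_iff: "p \<in> A \<Longrightarrow> flip p K \<subseteq> A \<longleftrightarrow> K \<subseteq> A"
  by (auto simp: flip_def)

text \<open>The sign of carrying the generator \<open>m\<close> past the smaller ones in
  \<open>K\<close>: the Jordan-Wigner string of a fermionic operator.\<close>

definition nsign :: "nat \<Rightarrow> nat set \<Rightarrow> complex" where
  "nsign m K = (-1) ^ card {j \<in> K. j < m}"

lemma nsign_square [simp]: "nsign m K * nsign m K = 1"
  by (simp add: nsign_def power_mult_distrib[symmetric])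

lemma nsign_square' [simp]: "nsign m K * (nsign m K * z) = z"
  by (simp add: mult.assoc[symmetric])

lemma nsign_nonzero [simp]: "nsign m K \<noteq> 0"
  by (simp add: nsign_def)

lemma nsign_flip: "nsign m (flip q K) = (if q < m then - nsign m K else nsign m K)"
proof -
  have fin: "finite {j \<in> K. j < m}" for K by simp
  consider "\<not> q < m" | "q < m" "q \<in> K" | "q < m" "q \<notin> K" by blast
  then show ?thesis
  proof cases
    case 1
    then have "{j \<in> flip q K. j < m} = {j \<in> K. j < m}" by (auto simp del: mem_flip simp: flip_def)
    then show ?thesis using 1 by (simp add: nsign_def)
  next
    case 2
    then have "{j \<in> K. j < m} = insert q {j \<in> flip q K. j < m}" by auto
    moreover have "q \<notin> {j \<in> flip q K. j < m}" using 2 by simp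
    ultimately show ?thesis using 2 fin[of "flip q K"] by (simp add: nsign_def)
  next
    case 3
    then have "{j \<in> flip q K. j < m} = insert q {j \<in> K. j < m}" by (auto simp del: mem_flip simp: flip_def)
    moreover have "q \<notin> {j \<in> K. j < m}" using 3 by simp
    ultimately show ?thesis using 3 fin[of K] by (simp add: nsign_def)
  qed
qed

text \<open>\<open>fop True m\<close> and \<open>fop False m\<close> are the creation and annihilation operators of the generator \<open>m\<close>.\<close>

definition fop :: "bool \<Rightarrow> nat \<Rightarrow> ext \<Rightarrow> ext" where
  "fop b m x = (\<lambda>K. if (m \<in> K) = b then nsign m K * x (flip m K) else 0)"

text \<open>The canonical anticommutation relations. With the kind of operator as a flag, one
  computation covers all combinations, and the later exchange of particles and holes is a change of
  flag.\<close>

lemma fop_anticommutator: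
  "fop b p (fop c q x) + fop c q (fop b p x) = (if p = q \<and> b \<noteq> c then x else 0)"
proof
  fix K
  show "(fop b p (fop c q x) + fop c q (fop b p x)) K = (if p = q \<and> b \<noteq> c then x else 0) K"
  proof (cases "p = q")
    case True
    then show ?thesis by (auto simp: fop_def nsign_flip fun_apply_simps)
  next
    case False
    then show ?thesis
      by (cases "p < q") (auto simp: fop_def nsign_flip flip_commute[of p q] fun_apply_simps)
  qed
qed

lemma fop_anticommute: "fop b p (fop c q x) = (if p = q \<and> b \<noteq> c then x else 0) - fop c q (fop b p x)"
  using fop_anticommutator[of b p c q x] by (simp add: eq_diff_eq)

lemma fop_add: "fop b m (x + y) = fop b m x + fop b m y"
  by (auto simp: fop_def fun_eq_iff fun_apply_simps algebra_simps)

lemma fop_scaleC: "fop b m (c *\<^sub>C x) = c *\<^sub>C fop b m x"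
  by (auto simp: fop_def fun_eq_iff fun_apply_simps)

lemma fop_zero [simp]: "fop b m 0 = 0"
  by (auto simp: fop_def fun_eq_iff fun_apply_simps)

lemma fop_minus: "fop b m (- x) = - fop b m x"
  by (auto simp: fop_def fun_eq_iff fun_apply_simps)

lemma fop_diff: "fop b m (x - y) = fop b m x - fop b m y"
  by (auto simp: fop_def fun_eq_iff fun_apply_simps algebra_simps)

lemma fop_sum: "fop b m (\<Sum>a\<in>A. f a) = (\<Sum>a\<in>A. fop b m (f a))"
  by (induction A rule: infinite_finite_induct) (simp_all add: fop_add)

lemma ext_space_eq_finitely_supported: "ext_space m = {x. \<forall>I. x I \<noteq> 0 \<longrightarrow> I \<in> Pow {..<m}}"
  by (simp add: ext_space_def)

lemma subspace_ext_space: "cvec.subspace (ext_space m)"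
  unfolding ext_space_eq_finitely_supported by (rule subspace_finitely_supported)

lemmas ext_space_add = cvec.subspace_add[OF subspace_ext_space]
  and ext_space_scale = cvec.subspace_scale[OF subspace_ext_space]
  and ext_space_sum = cvec.subspace_sum[OF subspace_ext_space]
  and ext_space_diff = cvec.subspace_diff[OF subspace_ext_space]

lemma fop_ext_space: "x \<in> ext_space m \<Longrightarrow> p < m \<Longrightarrow> fop b p x \<in> ext_space m"
  unfolding ext_space_def using flip_subset_iff[of p "{..<m}"] by (auto simp: fop_def split: if_splits)

lemma ext_D_eq_fop: "ext_D i x = fop False i x"
  by (auto simp: ext_D_def fop_def nsign_def flip_def fun_eq_iff)

lemma ext_M_eq_fop:
  assumes "x \<in> ext_space m"
  shows "ext_M i x = fop True i x"
proof
  fix K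
  show "ext_M i x K = fop True i x K"
  proof (cases "finite K")
    case False
    \<comment> \<open>A sum over an infinite set is 0 by convention; the other side is 0 too,
      because \<open>x\<close> is supported on bounded index sets.\<close>
    then have "infinite (Pow K)" "infinite (K - {i})" by simp_all
    then have "x (K - {i}) = 0"
      using assms finite_subset by (fastforce simp: ext_space_def)
    with \<open>infinite (Pow K)\<close> show ?thesis
      by (simp add: ext_M_def wedge_def fop_def flip_def)
  next
    case True
    let ?f = "\<lambda>I. (-1) ^ card {(a, j). a \<in> I \<and> j \<in> K - I \<and> j < a} * ext_gen i I * x (K - I)"
    have "ext_M i x K = sum ?f (Pow K \<inter> {{i}})"
      unfolding ext_M_def wedge_def using True
      by (intro sum.mono_neutral_right) (auto simp: ext_gen_def)
    also have "\<dots> = fop True i x K"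
    proof (cases "i \<in> K")
      case True
      have "{(a, j). a \<in> {i} \<and> j \<in> K - {i} \<and> j < a} = (\<lambda>j. (i, j)) ` {j \<in> K. j < i}"
        by auto
      then have "card {(a, j). a \<in> {i} \<and> j \<in> K - {i} \<and> j < a} = card {j \<in> K. j < i}"
        by (simp add: card_image inj_on_def)
      then show ?thesis
        using True by (simp add: fop_def nsign_def flip_def ext_gen_def)
    qed (simp add: fop_def)
    finally show ?thesis .
  qed
qed

definition bvec :: "nat set \<Rightarrow> ext" where
  "bvec I = (\<lambda>K. if K = I then 1 else 0)"

lemma ext_one_eq_bvec: "ext_one = bvec {}"
  by (simp add: ext_one_def bvec_def)

lemma bvec_ext_space: "I \<subseteq> {..<m} \<Longrightarrow> bvec I \<in> ext_space m"
  by (auto simp: bvec_def ext_space_def)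

lemma ext_one_ext_space: "ext_one \<in> ext_space m"
  by (simp add: ext_one_eq_bvec bvec_ext_space)

lemma fop_bvec: "fop b m (bvec I) = (if (m \<in> I) \<noteq> b then nsign m I *\<^sub>C bvec (flip m I) else 0)"
  by (rule ext) (auto simp: fop_def bvec_def flip_eq_iff nsign_flip fun_apply_simps)

lemma fop_ext_one: "fop False m ext_one = 0"
  by (simp add: ext_one_eq_bvec fop_bvec)

lemma ext_space_expand:
  assumes "x \<in> ext_space m"
  shows "x = (\<Sum>I\<in>Pow {..<m}. x I *\<^sub>C bvec I)"
proof
  fix K
  have "(\<Sum>I\<in>Pow {..<m}. x I *\<^sub>C bvec I) K = (\<Sum>I\<in>Pow {..<m}. if K = I then x I else 0)"
    by (simp add: sum_fun_apply bvec_def fun_apply_simps if_distrib cong: if_cong)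
  also have "\<dots> = x K"
    using assms by (auto simp: ext_space_def)
  finally show "x K = (\<Sum>I\<in>Pow {..<m}. x I *\<^sub>C bvec I) K" ..
qed

lemma ext_space_induct_basis [consumes 1, case_names add scale bvec]:
  assumes x: "x \<in> ext_space m"
    and add: "\<And>x y. P x \<Longrightarrow> P y \<Longrightarrow> P (x + y)"
    and scale: "\<And>c x. P x \<Longrightarrow> P (c *\<^sub>C x)"
    and bvec: "\<And>I. I \<subseteq> {..<m} \<Longrightarrow> P (bvec I)"
  shows "P x"
proof -
  have zero: "P 0"
    using scale[OF bvec[of "{}"], of 0] by simp
  have "P (\<Sum>I\<in>A. x I *\<^sub>C bvec I)" if "finite A" "A \<subseteq> Pow {..<m}" for A
    using that by (induction A rule: finite_induct) (auto simp: zero intro: add scale bvec)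
  from this[of "Pow {..<m}"] show ?thesis
    using ext_space_expand[OF x] by simp
qed

text \<open>The exterior algebra is generated from the vacuum by creation operators, so an
  intertwining property can be checked against those alone.\<close>

lemma ext_space_induct [consumes 1, case_names add scale one create]:
  assumes x: "x \<in> ext_space m"
    and add: "\<And>x y. x \<in> ext_space m \<Longrightarrow> y \<in> ext_space m \<Longrightarrow> P x \<Longrightarrow> P y \<Longrightarrow> P (x + y)"
    and scale: "\<And>c x. x \<in> ext_space m \<Longrightarrow> P x \<Longrightarrow> P (c *\<^sub>C x)"
    and one: "P ext_one"
    and create: "\<And>p x. p < m \<Longrightarrow> x \<in> ext_space m \<Longrightarrow> P x \<Longrightarrow> P (fop True p x)"
  shows "P x"
proof -
  have "P (bvec I)" if "I \<subseteq> {..<m}" for I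
    using finite_subset[OF that finite_lessThan] that
  proof (induction I rule: finite_induct)
    case empty
    then show ?case using one by (simp add: ext_one_eq_bvec)
  next
    case (insert p I)
    have "bvec (insert p I) = nsign p I *\<^sub>C fop True p (bvec I)"
      using insert.hyps by (simp add: fop_bvec flip_def)
    then show ?case
      using insert bvec_ext_space[of I m] by (simp add: scale create fop_ext_space)
  qed
  with x have "x \<in> ext_space m \<and> P x"
    by (induction x rule: ext_space_induct_basis)
       (auto intro: add scale ext_space_add ext_space_scale bvec_ext_space)
  then show ?thesis ..
qed

section \<open>The action of the orthogonal group\<close>

text \<open>The operator attached to \<open>g v_j\<close> in place of \<open>v_j\<close>. The same
  column of \<open>g\<close> serves creation and annihilation, because an orthogonal matrix is its
  own contragredient.\<close>

definition rotop :: "nat \<Rightarrow> nat \<Rightarrow> complex mat \<Rightarrow> bool \<Rightarrow> nat \<Rightarrow> nat \<Rightarrow> ext \<Rightarrow> ext" where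
  "rotop N n g b j i x = (\<Sum>k<N. g $$ (k, j) *\<^sub>C fop b (k * n + i) x)"

lemma rotop_add: "rotop N n g b j i (x + y) = rotop N n g b j i x + rotop N n g b j i y"
  by (simp add: rotop_def fop_add scaleC_add_right sum.distrib)

lemma rotop_scaleC: "rotop N n g b j i (c *\<^sub>C x) = c *\<^sub>C rotop N n g b j i x"
  by (simp add: rotop_def fop_scaleC cvec.scale_sum_right mult.commute)

lemma rotop_zero [simp]: "rotop N n g b j i 0 = 0"
  by (simp add: rotop_def)

lemma rotop_sum: "rotop N n g b j i (\<Sum>a\<in>A. f a) = (\<Sum>a\<in>A. rotop N n g b j i (f a))"
  by (induction A rule: infinite_finite_induct) (simp_all add: rotop_add)

lemma index_eq_iff: "i < n \<Longrightarrow> i' < n \<Longrightarrow> k * n + i = k' * n + i' \<longleftrightarrow> k = k' \<and> i = i'"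
  for n :: nat
  by (metis add.commute div_mult_self3 mod_less mod_mult_self3 div_less add_0_right not_less0)

lemma index_less: "i < n \<Longrightarrow> k < N \<Longrightarrow> k * n + i < N * n" for n :: nat
proof -
  assume "i < n" "k < N"
  then have "k * n + i < Suc k * n" by simp
  also have "\<dots> \<le> N * n" using \<open>k < N\<close> by (intro mult_le_mono1) simp
  finally show ?thesis .
qed

lemma rotop_ext_space: "x \<in> ext_space (N * n) \<Longrightarrow> i < n \<Longrightarrow> rotop N n g b j i x \<in> ext_space (N * n)"
  unfolding rotop_def by (intro ext_space_sum ext_space_scale fop_ext_space index_less) auto

lemma rotop_anticommutator:
  assumes "i < n" "i' < n"
  shows "rotop N n g b j i (rotop N n h c j' i' x) + rotop N n h c j' i' (rotop N n g b j i x)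
    = (if b \<noteq> c \<and> i = i' then \<Sum>k<N. g $$ (k, j) * h $$ (k, j') else 0) *\<^sub>C x"
proof -
  have "rotop N n g b j i (rotop N n h c j' i' x) + rotop N n h c j' i' (rotop N n g b j i x)
    = (\<Sum>k<N. \<Sum>l<N. (g $$ (k, j) * h $$ (l, j')) *\<^sub>C
        (fop b (k * n + i) (fop c (l * n + i') x) + fop c (l * n + i') (fop b (k * n + i) x)))"
    unfolding rotop_def fop_sum fop_scaleC cvec.scale_sum_right scaleC_add_right sum.distrib
    by (subst (3) sum.swap) (simp add: mult.commute)
  also have "\<dots> = (\<Sum>k<N. \<Sum>l<N. if k = l then (g $$ (k, j) * h $$ (l, j')) *\<^sub>C (if b \<noteq> c \<and> i = i' then x else 0) else 0)"
    using assms by (intro sum.cong refl) (simp add: fop_anticommutator index_eq_iff)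
  also have "\<dots> = (\<Sum>k<N. (g $$ (k, j) * h $$ (k, j')) *\<^sub>C (if b \<noteq> c \<and> i = i' then x else 0))"
    by simp
  finally show ?thesis
    by (simp add: cvec.scale_sum_left)
qed

lemma foldr_anticommuting_insort:
  fixes c :: "nat \<Rightarrow> ext \<Rightarrow> ext"
  assumes anti: "\<And>p q x. p \<in> A \<Longrightarrow> q \<in> A \<Longrightarrow> c p (c q x) = - c q (c p x)"
    and scale: "\<And>p a x. c p (a *\<^sub>C x) = a *\<^sub>C c p x"
    and xs: "sorted xs" "distinct xs" "set xs \<subseteq> A" and m: "m \<in> A" "m \<notin> set xs"
  shows "foldr c (insort m xs) v = nsign m (set xs) *\<^sub>C c m (foldr c xs v)"
  using xs m(2)
proof (induction xs)
  case Nil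
  then show ?case by (simp add: nsign_def)
next
  case (Cons x xs)
  show ?case
  proof (cases "m \<le> x")
    case True
    then have "{j \<in> set (x # xs). j < m} = {}"
      using Cons.prems by auto
    then have "nsign m (set (x # xs)) = 1"
      by (simp only: nsign_def) simp
    then show ?thesis using True by simp
  next
    case False
    then have "set (x # xs) = flip x (set xs)"
      using Cons.prems by (simp add: flip_def)
    then have "nsign m (set (x # xs)) = - nsign m (set xs)"
      using False by (simp add: nsign_flip)
    then show ?thesis
      using False Cons anti[of x m "foldr c xs v"] m(1) by (simp add: scale)
  qed
qed

lemma foldr_anticommuting_member:
  fixes c :: "nat \<Rightarrow> ext \<Rightarrow> ext"
  assumes anti: "\<And>p q x. p \<in> A \<Longrightarrow> q \<in> A \<Longrightarrow> c p (c q x) = - c q (c p x)"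
    and scale: "\<And>p a x. c p (a *\<^sub>C x) = a *\<^sub>C c p x"
    and xs: "set xs \<subseteq> A" and m: "m \<in> set xs"
  shows "c m (foldr c xs v) = 0"
  using xs m
proof (induction xs)
  case (Cons x xs)
  have zero: "c p 0 = 0" for p
    using scale[of p 0 0] by simp
  show ?case
  proof (cases "x = m")
    case True
    have "c m (c m (foldr c xs v)) = - c m (c m (foldr c xs v))"
      by (rule anti) (use Cons.prems True in auto)
    then have "c m (c m (foldr c xs v)) K = - c m (c m (foldr c xs v)) K" for K
      by (metis uminus_apply)
    then show ?thesis
      using True by (simp add: fun_eq_iff zero_fun_apply)
  next
    case False
    then show ?thesis
      using Cons anti[of m x "foldr c xs v"] by (auto simp: zero subset_iff)
  qed
qed simp

lemma wedge_O_on_gen: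
  assumes "x \<in> ext_space m"
  shows "wedge (O_on_gen N n g p) x = rotop N n g True (p div n) (p mod n) x"
proof -
  have lin: "wedge (\<Sum>k\<in>A. f k *\<^sub>C y k) x = (\<Sum>k\<in>A. f k *\<^sub>C wedge (y k) x)" for A :: "nat set" and f y
  proof
    fix K
    show "wedge (\<Sum>k\<in>A. f k *\<^sub>C y k) x K = (\<Sum>k\<in>A. f k *\<^sub>C wedge (y k) x) K"
      unfolding wedge_def sum_fun_apply scaleC_fun_complex_apply sum_distrib_left sum_distrib_right
      by (subst sum.swap) (simp add: mult_ac)
  qed
  show ?thesis
    unfolding O_on_gen_def lin rotop_def
    using ext_M_eq_fop[OF assms] by (simp add: ext_M_def ve_gen_def)
qed

context
  fixes N n :: nat
  assumes n_pos: "n > 0"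
begin

definition ext_fold :: "complex mat \<Rightarrow> nat set \<Rightarrow> ext" where
  "ext_fold g I = foldr (\<lambda>m. rotop N n g True (m div n) (m mod n)) (sorted_list_of_set I) ext_one"

lemma ext_fold_ext_space: "ext_fold g I \<in> ext_space (N * n)"
  and wedge_list_O_on_gen: "wedge_list (map (O_on_gen N n g) (sorted_list_of_set I)) = ext_fold g I"
proof -
  have "wedge_list (map (O_on_gen N n g) xs) = foldr (\<lambda>m. rotop N n g True (m div n) (m mod n)) xs ext_one
    \<and> foldr (\<lambda>m. rotop N n g True (m div n) (m mod n)) xs ext_one \<in> ext_space (N * n)" for xs
    using n_pos
    by (induction xs) (auto simp: wedge_list_def ext_one_ext_space wedge_O_on_gen rotop_ext_space)
  then show "ext_fold g I \<in> ext_space (N * n)"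
    "wedge_list (map (O_on_gen N n g) (sorted_list_of_set I)) = ext_fold g I"
    by (simp_all add: ext_fold_def)
qed

lemma O_on_ext_eq: "O_on_ext N n g x = (\<Sum>I\<in>Pow {..<N * n}. x I *\<^sub>C ext_fold g I)"
  by (simp add: O_on_ext_def wedge_list_O_on_gen)

lemma O_on_ext_ext_space: "O_on_ext N n g x \<in> ext_space (N * n)"
  unfolding O_on_ext_eq by (intro ext_space_sum ext_space_scale ext_fold_ext_space)

lemma O_on_ext_add: "O_on_ext N n g (x + y) = O_on_ext N n g x + O_on_ext N n g y"
  by (simp add: O_on_ext_eq scaleC_add_left sum.distrib plus_fun_apply)

lemma O_on_ext_scaleC: "O_on_ext N n g (c *\<^sub>C x) = c *\<^sub>C O_on_ext N n g x"
  by (simp add: O_on_ext_eq cvec.scale_sum_right scaleC_fun_complex_apply)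

lemma O_on_ext_zero [simp]: "O_on_ext N n g 0 = 0"
  by (simp add: O_on_ext_eq zero_fun_apply)

lemma O_on_ext_sum: "O_on_ext N n g (\<Sum>a\<in>A. f a) = (\<Sum>a\<in>A. O_on_ext N n g (f a))"
  by (induction A rule: infinite_finite_induct) (simp_all add: O_on_ext_add)

lemma O_on_ext_diff: "O_on_ext N n g (x - y) = O_on_ext N n g x - O_on_ext N n g y"
  by (simp add: O_on_ext_eq cvec.scale_left_diff_distrib sum_subtractf minus_apply)

lemma O_on_ext_one: "O_on_ext N n g ext_one = ext_one"
proof -
  have "O_on_ext N n g ext_one = (\<Sum>I\<in>Pow {..<N * n}. if I = {} then ext_fold g I else 0)"
    unfolding O_on_ext_eq by (intro sum.cong refl) (simp add: ext_one_def)
  also have "\<dots> = ext_fold g {}"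
    by simp
  finally show ?thesis
    by (simp add: ext_fold_def)
qed

text \<open>The automorphism property of the action. \<open>ext_fold\<close> multiplies the images
  of the generators in increasing order, and putting the image of \<open>m\<close> in its place
  costs exactly the sign \<open>nsign m I\<close> carried by \<open>fop\<close>; if \<open>m\<close>
  is already present, both sides lose the term.\<close>

lemma O_on_ext_create:
  assumes m: "m < N * n"
  shows "O_on_ext N n g (fop True m x) = rotop N n g True (m div n) (m mod n) (O_on_ext N n g x)"
proof -
  let ?c = "\<lambda>m. rotop N n g True (m div n) (m mod n)"
  let ?A = "Pow {..<N * n}"
  have anti: "?c p (?c q x) = - ?c q (?c p x)" for p q x
    using rotop_anticommutator[of "p mod n" n "q mod n" N g True "p div n" g True "q div n" x] n_pos
    by (simp add: eq_neg_iff_add_eq_0)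
  have step: "?c m (ext_fold g I) = (if m \<in> I then 0 else nsign m I *\<^sub>C ext_fold g (insert m I))"
    if "I \<in> ?A" for I
  proof -
    have fin: "finite I" using that finite_subset by blast
    show ?thesis
    proof (cases "m \<in> I")
      case True
      then show ?thesis
        unfolding ext_fold_def using fin
        by (simp add: foldr_anticommuting_member[where A = UNIV and c = ?c, OF anti rotop_scaleC])
    next
      case False
      have "ext_fold g (insert m I) = nsign m I *\<^sub>C ?c m (ext_fold g I)"
        unfolding ext_fold_def using fin False
        by (simp add: foldr_anticommuting_insort[where A = UNIV and c = ?c, OF anti rotop_scaleC])
      then show ?thesis
        using False by simp
    qed
  qed
  have "?c m (O_on_ext N n g x) = (\<Sum>I\<in>?A. x I *\<^sub>C ?c m (ext_fold g I))"
    by (simp add: O_on_ext_eq rotop_sum rotop_scaleC)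
  also have "\<dots> = (\<Sum>I\<in>?A. if m \<in> I then 0 else (x I * nsign m I) *\<^sub>C ext_fold g (insert m I))"
    by (intro sum.cong refl) (simp add: step)
  also have "\<dots> = (\<Sum>I\<in>{I\<in>?A. m \<notin> I}. (x I * nsign m I) *\<^sub>C ext_fold g (insert m I))"
    by (rule sum.mono_neutral_cong_right) auto
  also have "\<dots> = (\<Sum>K\<in>{K\<in>?A. m \<in> K}. fop True m x K *\<^sub>C ext_fold g K)"
    by (rule sum.reindex_bij_witness[where i = "\<lambda>K. K - {m}" and j = "insert m"])
       (use m in \<open>auto simp: fop_def flip_def insert_absorb nsign_def
          intro!: arg_cong[where f = "\<lambda>A. (-1) ^ card A"] arg_cong2[where f = scaleC]\<close>)
  also have "\<dots> = (\<Sum>K\<in>?A. fop True m x K *\<^sub>C ext_fold g K)"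
    by (rule sum.mono_neutral_left) (auto simp: fop_def)
  finally show ?thesis
    by (simp add: O_on_ext_eq)
qed

end

lemma sum_rotate3:
  "(\<Sum>a\<in>A. \<Sum>b\<in>B. \<Sum>c\<in>C. f a b c) = (\<Sum>b\<in>B. \<Sum>c\<in>C. \<Sum>a\<in>A. f a b c)"
proof -
  have "(\<Sum>a\<in>A. \<Sum>b\<in>B. \<Sum>c\<in>C. f a b c) = (\<Sum>b\<in>B. \<Sum>a\<in>A. \<Sum>c\<in>C. f a b c)"
    by (rule sum.swap)
  also have "\<dots> = (\<Sum>b\<in>B. \<Sum>c\<in>C. \<Sum>a\<in>A. f a b c)"
    by (rule sum.cong[OF refl]) (rule sum.swap)
  finally show ?thesis .
qed

section \<open>Contractions, composition and quadratic invariants of the orthogonal group\<close>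

lemma O_group_carrier: "g \<in> O_group N \<Longrightarrow> g \<in> carrier_mat N N"
  by (simp add: O_group_def)

lemma O_group_columns:
  assumes "g \<in> O_group N" "i < N" "j < N"
  shows "(\<Sum>k<N. g $$ (k, i) * g $$ (k, j)) = (if i = j then 1 else 0)"
proof -
  have g: "g \<in> carrier_mat N N" "transpose_mat g * g = 1\<^sub>m N"
    using assms(1) by (auto simp: O_group_def)
  have "(transpose_mat g * g) $$ (i, j) = (\<Sum>k<N. g $$ (k, i) * g $$ (k, j))"
    using assms g(1) by (simp add: scalar_prod_def atLeast0LessThan)
  then show ?thesis
    using g assms by simp
qed

lemma O_group_rows:
  assumes "g \<in> O_group N" "i < N" "j < N"
  shows "(\<Sum>k<N. g $$ (i, k) * g $$ (j, k)) = (if i = j then 1 else 0)"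
proof -
  have g: "g \<in> carrier_mat N N" "transpose_mat g * g = 1\<^sub>m N"
    using assms(1) by (auto simp: O_group_def)
  then have "g * transpose_mat g = 1\<^sub>m N"
    using mat_mult_left_right_inverse[of "transpose_mat g" N g] by simp
  moreover have "(g * transpose_mat g) $$ (i, j) = (\<Sum>k<N. g $$ (i, k) * g $$ (j, k))"
    using assms g(1) by (simp add: scalar_prod_def atLeast0LessThan)
  ultimately show ?thesis
    using assms by simp
qed

text \<open>Contraction is not part of the algebra structure, so orthogonality of \<open>g\<close>
  enters here: the anticommutator of two rotated operators is a product of two columns of
  \<open>g\<close>, again a Kronecker delta. Induction over creation operators then carries the rule
  from the vacuum to every vector.\<close>

lemma O_on_ext_destroy:
  assumes g: "g \<in> O_group N" and n: "n > 0" and x: "x \<in> ext_space (N * n)" and j: "j < N" and i: "i < n"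
  shows "O_on_ext N n g (fop False (j * n + i) x) = rotop N n g False j i (O_on_ext N n g x)"
  using x
proof (induction rule: ext_space_induct)
  case (add x y)
  then show ?case by (simp add: fop_add O_on_ext_add[OF n] rotop_add)
next
  case (scale c x)
  then show ?case by (simp add: fop_scaleC O_on_ext_scaleC[OF n] rotop_scaleC)
next
  case one
  then show ?case
    by (simp add: fop_ext_one O_on_ext_zero[OF n] O_on_ext_one[OF n] rotop_def)
next
  case (create p x)
  let ?G = "O_on_ext N n g" and ?m = "j * n + i"
  let ?d = "if ?m = p then ?G x else 0"
  have pN: "p div n < N"
    using create(1) by (simp add: less_mult_imp_div_less)
  have pd: "?m = p \<longleftrightarrow> j = p div n \<and> i = p mod n"
    using index_eq_iff[OF i, of "p mod n" j "p div n"] n by simp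
  have "?G (fop False ?m (fop True p x)) = ?d - ?G (fop True p (fop False ?m x))"
    by (subst fop_anticommute) (simp add: O_on_ext_diff[OF n] O_on_ext_zero[OF n])
  also have "?G (fop True p (fop False ?m x))
      = rotop N n g True (p div n) (p mod n) (rotop N n g False j i (?G x))"
    by (simp add: O_on_ext_create[OF n create(1)] create(3))
  also have "?d - \<dots> = rotop N n g False j i (rotop N n g True (p div n) (p mod n) (?G x))"
    using rotop_anticommutator[OF i, of "p mod n" N g False j g True "p div n" "?G x"]
      O_group_columns[OF g j pN] n
    by (simp add: pd diff_eq_eq split: if_splits)
  finally show ?case
    by (simp add: O_on_ext_create[OF n create(1)])
qed

lemma O_on_ext_fop:
  assumes g: "g \<in> O_group N" and x: "x \<in> ext_space (N * n)" and j: "j < N" and i: "i < n"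
  shows "O_on_ext N n g (fop b (j * n + i) x) = rotop N n g b j i (O_on_ext N n g x)"
proof (cases b)
  case True
  have n: "n > 0" using i by simp
  show ?thesis
    using True O_on_ext_create[OF n index_less[OF i j], of g x] i by simp
next
  case False
  then show ?thesis
    using O_on_ext_destroy[OF g _ x j i] i by simp
qed

lemma O_on_ext_mult:
  assumes g: "g \<in> carrier_mat N N" and h: "h \<in> carrier_mat N N" and n: "n > 0" and x: "x \<in> ext_space (N * n)"
  shows "O_on_ext N n (g * h) x = O_on_ext N n g (O_on_ext N n h x)"
  using x
proof (induction rule: ext_space_induct)
  case (create p x)
  have pN: "p div n < N"
    using create(1) by (simp add: less_mult_imp_div_less)
  let ?y = "O_on_ext N n g (O_on_ext N n h x)" and ?i = "p mod n" and ?j = "p div n"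
  have "O_on_ext N n g (O_on_ext N n h (fop True p x))
    = O_on_ext N n g (\<Sum>k<N. h $$ (k, ?j) *\<^sub>C fop True (k * n + ?i) (O_on_ext N n h x))"
    by (simp add: O_on_ext_create[OF n create(1)] rotop_def)
  also have "\<dots> = (\<Sum>k<N. h $$ (k, ?j) *\<^sub>C rotop N n g True k ?i ?y)"
    using n by (simp add: O_on_ext_sum[OF n] O_on_ext_scaleC[OF n] O_on_ext_create[OF n index_less])
  also have "\<dots> = (\<Sum>l<N. (\<Sum>k<N. g $$ (l, k) * h $$ (k, ?j)) *\<^sub>C fop True (l * n + ?i) ?y)"
    unfolding rotop_def cvec.scale_sum_right cvec.scale_sum_left
    by (subst sum.swap) (simp add: mult.commute)
  also have "\<dots> = rotop N n (g * h) True ?j ?i ?y"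
    unfolding rotop_def using g h pN
    by (intro sum.cong refl) (simp add: scalar_prod_def atLeast0LessThan)
  finally show ?case
    by (simp add: O_on_ext_create[OF n create(1)] create(3))
qed (simp_all add: O_on_ext_add[OF n] O_on_ext_scaleC[OF n] O_on_ext_one[OF n])

lemma O_on_ext_id:
  assumes n: "n > 0" and x: "x \<in> ext_space (N * n)"
  shows "O_on_ext N n (1\<^sub>m N) x = x"
  using x
proof (induction rule: ext_space_induct)
  case (create p x)
  have pN: "p div n < N"
    using create(1) by (simp add: less_mult_imp_div_less)
  have "rotop N n (1\<^sub>m N) True (p div n) (p mod n) x
      = (\<Sum>k<N. if k = p div n then fop True (k * n + p mod n) x else 0)"
    unfolding rotop_def using pN by (intro sum.cong refl) auto
  also have "\<dots> = fop True p x"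
    using pN by simp
  finally show ?case
    by (simp add: O_on_ext_create[OF n create(1)] create(3))
qed (simp_all add: O_on_ext_add[OF n] O_on_ext_scaleC[OF n] O_on_ext_one[OF n])

text \<open>Contracting the \<open>V\<close>-indices of two operators, of whatever kinds, does not
  depend on the orthonormal basis. These quadratic invariants explain both why the orthogonal Lie
  algebra commutes with the group and why columns can be filled invariantly in pairs.\<close>

lemma sum_rotop_rotop:
  assumes g: "g \<in> O_group N"
  shows "(\<Sum>k<N. rotop N n g b k i (rotop N n g c k i' y)) = (\<Sum>k<N. fop b (k * n + i) (fop c (k * n + i') y))"
proof -
  have "(\<Sum>k<N. rotop N n g b k i (rotop N n g c k i' y))
    = (\<Sum>k<N. \<Sum>l<N. \<Sum>l'<N. (g $$ (l, k) * g $$ (l', k)) *\<^sub>C fop b (l * n + i) (fop c (l' * n + i') y))"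
    by (simp add: rotop_def fop_sum fop_scaleC cvec.scale_sum_right)
  also have "\<dots> = (\<Sum>l<N. \<Sum>l'<N. (\<Sum>k<N. g $$ (l, k) * g $$ (l', k)) *\<^sub>C fop b (l * n + i) (fop c (l' * n + i') y))"
    unfolding cvec.scale_sum_left
    by (rule sum_rotate3)
  also have "\<dots> = (\<Sum>l<N. \<Sum>l'<N. if l' = l then fop b (l * n + i) (fop c (l' * n + i') y) else 0)"
    using O_group_rows[OF g] by (intro sum.cong refl) auto
  finally show ?thesis by simp
qed

section \<open>The spinor tensor power inside the exterior algebra of \<open>V \<otimes> E\<close>\<close>

text \<open>The Clifford generators of the \<open>k\<close>-th tensor factor: for
  \<open>a < n\<close> multiplication by e_a, for \<open>a = n + i\<close> contraction with the dual
  vector of e_i; \<open>a mod n\<close> names the index of the vector in both cases.\<close>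

definition gam :: "nat \<Rightarrow> nat \<Rightarrow> nat \<Rightarrow> ext \<Rightarrow> ext" where
  "gam n k a = fop (a < n) (k * n + a mod n)"

definition dual :: "nat \<Rightarrow> nat \<Rightarrow> nat" where
  "dual n a = (if a < n then a + n else a - n)"

lemma dual_dual [simp]: "a < 2 * n \<Longrightarrow> dual n (dual n a) = a"
  by (auto simp: dual_def)

lemma dual_less [simp]: "a < 2 * n \<Longrightarrow> dual n a < 2 * n"
  by (auto simp: dual_def)

lemma dual_eq_iff: "a < 2 * n \<Longrightarrow> b < 2 * n \<Longrightarrow> dual n a = b \<longleftrightarrow> a = dual n b"
  by (auto simp: dual_def)

lemma bij_betw_dual: "bij_betw (dual n) {..<2 * n} {..<2 * n}"
  by (rule bij_betw_byWitness[where f' = "dual n"]) auto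

lemma sum_dual: "(\<Sum>a<2 * n. f (dual n a)) = (\<Sum>a<2 * n. f a)"
  by (rule sum.reindex_bij_betw[OF bij_betw_dual])

lemma gam_anticommutator:
  assumes "a < 2 * n" "b < 2 * n"
  shows "gam n k a (gam n l b x) = (if k = l \<and> b = dual n a then x else 0) - gam n l b (gam n k a x)"
proof -
  have n: "a mod n < n" "b mod n < n" using assms by auto
  have "a mod n = (if a < n then a else a - n)" "b mod n = (if b < n then b else b - n)"
    using assms by (auto simp: mod_if)
  then have "a mod n = b mod n \<and> (a < n) \<noteq> (b < n) \<longleftrightarrow> b = dual n a"
    using assms by (auto simp: dual_def)
  then show ?thesis
    unfolding gam_def by (subst fop_anticommute) (auto simp: index_eq_iff[OF n])
qed

lemma gam_add: "gam n k a (x + y) = gam n k a x + gam n k a y"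
  and gam_scaleC: "gam n k a (c *\<^sub>C x) = c *\<^sub>C gam n k a x"
  and gam_zero [simp]: "gam n k a 0 = 0"
  and gam_diff: "gam n k a (x - y) = gam n k a x - gam n k a y"
  and gam_sum: "gam n k a (\<Sum>a\<in>A. f a) = (\<Sum>b\<in>A. gam n k a (f b))"
  by (simp_all add: gam_def fop_add fop_scaleC fop_diff fop_sum)

lemma gam_ext_space: "x \<in> ext_space (N * n) \<Longrightarrow> n > 0 \<Longrightarrow> k < N \<Longrightarrow> gam n k a x \<in> ext_space (N * n)"
  unfolding gam_def by (intro fop_ext_space index_less) auto

section \<open>The orthogonal Lie algebra as quadratic elements\<close>

lemma form_mat_index:
  assumes "a < 2 * n" "b < 2 * n"
  shows "form_mat n $$ (a, b) = (if b = dual n a then 1 else 0)"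
  using assms by (auto simp: form_mat_def dual_def)

lemma o_alg_iff:
  "A \<in> o_alg n \<longleftrightarrow> A \<in> carrier_mat (2 * n) (2 * n) \<and>
     (\<forall>a<2 * n. \<forall>b<2 * n. A $$ (dual n b, dual n a) = - A $$ (a, b))"
proof (cases "A \<in> carrier_mat (2 * n) (2 * n)")
  case True
  have F: "form_mat n \<in> carrier_mat (2 * n) (2 * n)"
    by (simp add: form_mat_def mult_2)
  have "(transpose_mat A * form_mat n + form_mat n * A) $$ (a, b) = A $$ (dual n b, a) + A $$ (dual n a, b)"
    if ab: "a < 2 * n" "b < 2 * n" for a b
  proof -
    have "(transpose_mat A * form_mat n) $$ (a, b) = (\<Sum>c<2 * n. A $$ (c, a) * form_mat n $$ (c, b))"
      using True F ab by (simp add: scalar_prod_def atLeast0LessThan)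
    also have "\<dots> = (\<Sum>c<2 * n. if c = dual n b then A $$ (c, a) else 0)"
      using ab by (intro sum.cong refl) (auto simp: form_mat_index dual_eq_iff)
    also have "\<dots> = A $$ (dual n b, a)"
      using ab by simp
    finally have 1: "(transpose_mat A * form_mat n) $$ (a, b) = A $$ (dual n b, a)" .
    have "(form_mat n * A) $$ (a, b) = (\<Sum>c<2 * n. form_mat n $$ (a, c) * A $$ (c, b))"
      using True F ab by (simp add: scalar_prod_def atLeast0LessThan)
    also have "\<dots> = (\<Sum>c<2 * n. if c = dual n a then A $$ (c, b) else 0)"
      using ab by (intro sum.cong refl) (auto simp: form_mat_index)
    also have "\<dots> = A $$ (dual n a, b)"
      using ab by simp
    finally have 2: "(form_mat n * A) $$ (a, b) = A $$ (dual n a, b)" .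
    show ?thesis
      using 1 2 True F ab by simp
  qed
  then have "A \<in> o_alg n \<longleftrightarrow> (\<forall>a<2 * n. \<forall>b<2 * n. A $$ (dual n b, a) + A $$ (dual n a, b) = 0)"
    using True F by (auto simp: o_alg_def mat_eq_iff)
  also have "\<dots> \<longleftrightarrow> (\<forall>a<2 * n. \<forall>b<2 * n. A $$ (dual n b, dual n a) = - A $$ (a, b))"
    using dual_dual dual_less unfolding eq_neg_iff_add_eq_0 by metis
  finally show ?thesis
    using True by simp
qed (simp add: o_alg_def)

lemma o_alg_carrier: "A \<in> o_alg n \<Longrightarrow> A \<in> carrier_mat (2 * n) (2 * n)"
  by (simp add: o_alg_def)

lemma o_alg_dual: "A \<in> o_alg n \<Longrightarrow> a < 2 * n \<Longrightarrow> b < 2 * n \<Longrightarrow> A $$ (dual n b, dual n a) = - A $$ (a, b)"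
  by (simp add: o_alg_iff)

lemma o_alg_dual': "A \<in> o_alg n \<Longrightarrow> a < 2 * n \<Longrightarrow> b < 2 * n \<Longrightarrow> A $$ (a, dual n b) = - A $$ (b, dual n a)"
  using o_alg_dual[of A n "b" "dual n a"] by simp

text \<open>The spin action as a single quadratic expression in Clifford generators. The factor 1/2
  is there because the sum over all pairs meets every basis element of the Lie algebra twice, at
  \<open>(b, a)\<close> and at \<open>(dual n a, dual n b)\<close>.\<close>

definition spin_ext :: "nat \<Rightarrow> nat \<Rightarrow> complex mat \<Rightarrow> ext \<Rightarrow> ext" where
  "spin_ext N n A x = (\<Sum>k<N. \<Sum>a<2 * n. \<Sum>b<2 * n. (A $$ (b, a) / 2) *\<^sub>C gam n k b (gam n k (dual n a) x))"

lemma spin_ext_add: "spin_ext N n A (x + y) = spin_ext N n A x + spin_ext N n A y"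
  by (simp add: spin_ext_def gam_add scaleC_add_right sum.distrib)

lemma spin_ext_scaleC: "spin_ext N n A (c *\<^sub>C x) = c *\<^sub>C spin_ext N n A x"
  by (simp add: spin_ext_def gam_scaleC cvec.scale_sum_right mult.commute)

lemma spin_ext_zero [simp]: "spin_ext N n A 0 = 0"
  by (simp add: spin_ext_def)

lemma spin_ext_sum: "spin_ext N n A (\<Sum>a\<in>S. f a) = (\<Sum>a\<in>S. spin_ext N n A (f a))"
  by (induction S rule: infinite_finite_induct) (simp_all add: spin_ext_add)

lemma spin_ext_ext_space: "x \<in> ext_space (N * n) \<Longrightarrow> spin_ext N n A x \<in> ext_space (N * n)"
  unfolding spin_ext_def by (intro ext_space_sum ext_space_scale gam_ext_space) auto

lemma spin_ext_O_on_ext: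
  assumes g: "g \<in> O_group N" and n: "n > 0" and x: "x \<in> ext_space (N * n)"
  shows "O_on_ext N n g (spin_ext N n A x) = spin_ext N n A (O_on_ext N n g x)"
proof -
  have pair: "(\<Sum>k<N. O_on_ext N n g (gam n k b (gam n k a x))) = (\<Sum>k<N. gam n k b (gam n k a (O_on_ext N n g x)))" for a b
  proof -
    have "(\<Sum>k<N. O_on_ext N n g (gam n k b (gam n k a x)))
      = (\<Sum>k<N. rotop N n g (b < n) k (b mod n) (rotop N n g (a < n) k (a mod n) (O_on_ext N n g x)))"
      unfolding gam_def using n
      by (intro sum.cong refl) (simp add: O_on_ext_fop[OF g] x fop_ext_space index_less)
    then show ?thesis
      by (simp add: sum_rotop_rotop[OF g] gam_def)
  qed
  have alt: "spin_ext N n A y = (\<Sum>a<2 * n. \<Sum>b<2 * n. (A $$ (b, a) / 2) *\<^sub>C (\<Sum>k<N. gam n k b (gam n k (dual n a) y)))" for y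
    unfolding spin_ext_def cvec.scale_sum_right
    by (rule sum_rotate3)
  show ?thesis
    by (simp add: alt O_on_ext_sum[OF n] O_on_ext_scaleC[OF n] pair)
qed

text \<open>The commutator with a Clifford generator is the vector representation. Contracting with
  either of the two factors contributes the same, after antisymmetry of \<open>A\<close> and
  reindexing by \<open>dual\<close>, and so the factor 1/2 disappears.\<close>

lemma spin_ext_gam:
  assumes A: "A \<in> o_alg n" and l: "l < N" and c: "c < 2 * n"
  shows "spin_ext N n A (gam n l c x) = gam n l c (spin_ext N n A x) + (\<Sum>b<2 * n. A $$ (b, c) *\<^sub>C gam n l b x)"
proof -
  have tm: "gam n k b (gam n k (dual n a) (gam n l c x)) = gam n l c (gam n k b (gam n k (dual n a) x))
      + ((if k = l \<and> a = c then gam n k b x else 0) - (if k = l \<and> b = dual n c then gam n k (dual n a) x else 0))"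
    if ab: "a < 2 * n" "b < 2 * n" for k a b
  proof -
    have "gam n k b (gam n k (dual n a) (gam n l c x))
      = gam n k b ((if k = l \<and> a = c then x else 0) - gam n l c (gam n k (dual n a) x))"
      using ab c by (subst gam_anticommutator) (auto simp: dual_eq_iff)
    also have "\<dots> = (if k = l \<and> a = c then gam n k b x else 0) - gam n k b (gam n l c (gam n k (dual n a) x))"
      by (simp add: gam_diff)
    also have "gam n k b (gam n l c (gam n k (dual n a) x))
      = (if k = l \<and> b = dual n c then gam n k (dual n a) x else 0) - gam n l c (gam n k b (gam n k (dual n a) x))"
      using ab c by (subst gam_anticommutator) (auto simp: dual_eq_iff)
    finally show ?thesis
      by (simp only: algebra_simps)
  qed
  have S1: "(\<Sum>k<N. \<Sum>a<2 * n. \<Sum>b<2 * n. (A $$ (b, a) / 2) *\<^sub>C (if k = l \<and> a = c then gam n k b x else 0))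
      = (\<Sum>b<2 * n. (A $$ (b, c) / 2) *\<^sub>C gam n l b x)"
  proof -
    have "(\<Sum>k<N. \<Sum>a<2 * n. \<Sum>b<2 * n. (A $$ (b, a) / 2) *\<^sub>C (if k = l \<and> a = c then gam n k b x else 0))
      = (\<Sum>k<N. if k = l then \<Sum>a<2 * n. if a = c then \<Sum>b<2 * n. (A $$ (b, a) / 2) *\<^sub>C gam n k b x else 0 else 0)"
    proof (rule sum.cong[OF refl])
      fix k
      have "(\<Sum>b<2 * n. (A $$ (b, a) / 2) *\<^sub>C (if k = l \<and> a = c then gam n k b x else 0))
        = (if k = l then if a = c then \<Sum>b<2 * n. (A $$ (b, a) / 2) *\<^sub>C gam n k b x else 0 else 0)" for a
        by simp
      then show "(\<Sum>a<2 * n. \<Sum>b<2 * n. (A $$ (b, a) / 2) *\<^sub>C (if k = l \<and> a = c then gam n k b x else 0))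
        = (if k = l then \<Sum>a<2 * n. if a = c then \<Sum>b<2 * n. (A $$ (b, a) / 2) *\<^sub>C gam n k b x else 0 else 0)"
        by simp
    qed
    then show ?thesis using l c by simp
  qed
  have S2: "(\<Sum>k<N. \<Sum>a<2 * n. \<Sum>b<2 * n. (A $$ (b, a) / 2) *\<^sub>C (if k = l \<and> b = dual n c then gam n k (dual n a) x else 0))
      = - (\<Sum>b<2 * n. (A $$ (b, c) / 2) *\<^sub>C gam n l b x)"
  proof -
    have "(\<Sum>k<N. \<Sum>a<2 * n. \<Sum>b<2 * n. (A $$ (b, a) / 2) *\<^sub>C (if k = l \<and> b = dual n c then gam n k (dual n a) x else 0))
      = (\<Sum>k<N. if k = l then \<Sum>a<2 * n. \<Sum>b<2 * n. if b = dual n c then (A $$ (b, a) / 2) *\<^sub>C gam n k (dual n a) x else 0 else 0)"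
    proof (rule sum.cong[OF refl])
      fix k
      have "(A $$ (b, a) / 2) *\<^sub>C (if k = l \<and> b = dual n c then gam n k (dual n a) x else 0)
        = (if k = l then if b = dual n c then (A $$ (b, a) / 2) *\<^sub>C gam n k (dual n a) x else 0 else 0)" for a b
        by simp
      then show "(\<Sum>a<2 * n. \<Sum>b<2 * n. (A $$ (b, a) / 2) *\<^sub>C (if k = l \<and> b = dual n c then gam n k (dual n a) x else 0))
        = (if k = l then \<Sum>a<2 * n. \<Sum>b<2 * n. if b = dual n c then (A $$ (b, a) / 2) *\<^sub>C gam n k (dual n a) x else 0 else 0)"
        by simp
    qed
    also have "\<dots> = (\<Sum>a<2 * n. (A $$ (dual n c, a) / 2) *\<^sub>C gam n l (dual n a) x)"
      using l c by simp
    also have "\<dots> = (\<Sum>a<2 * n. (A $$ (dual n c, dual n (dual n a)) / 2) *\<^sub>C gam n l (dual n a) x)"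
      by simp
    also have "\<dots> = (\<Sum>a<2 * n. (A $$ (dual n c, dual n a) / 2) *\<^sub>C gam n l a x)"
      by (rule sum_dual[where f = "\<lambda>a. (A $$ (dual n c, dual n a) / 2) *\<^sub>C gam n l a x"])
    also have "\<dots> = - (\<Sum>b<2 * n. (A $$ (b, c) / 2) *\<^sub>C gam n l b x)"
      using c by (simp add: o_alg_dual[OF A] sum_negf)
    finally show ?thesis .
  qed
  have half: "(\<Sum>b<2 * n. (A $$ (b, c) / 2) *\<^sub>C gam n l b x) + (\<Sum>b<2 * n. (A $$ (b, c) / 2) *\<^sub>C gam n l b x)
      = (\<Sum>b<2 * n. A $$ (b, c) *\<^sub>C gam n l b x)"
    by (simp add: sum.distrib[symmetric] scaleC_add_left[symmetric])
  have "spin_ext N n A (gam n l c x) = (\<Sum>k<N. \<Sum>a<2 * n. \<Sum>b<2 * n. (A $$ (b, a) / 2) *\<^sub>C gam n l c (gam n k b (gam n k (dual n a) x)))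
     + ((\<Sum>k<N. \<Sum>a<2 * n. \<Sum>b<2 * n. (A $$ (b, a) / 2) *\<^sub>C (if k = l \<and> a = c then gam n k b x else 0))
     - (\<Sum>k<N. \<Sum>a<2 * n. \<Sum>b<2 * n. (A $$ (b, a) / 2) *\<^sub>C (if k = l \<and> b = dual n c then gam n k (dual n a) x else 0)))"
    unfolding spin_ext_def sum.distrib[symmetric] sum_subtractf[symmetric] cvec.scale_right_diff_distrib[symmetric]
      scaleC_add_right[symmetric]
    by (intro sum.cong refl arg_cong2[where f = scaleC] tm) auto
  also have "\<dots> = gam n l c (spin_ext N n A x) + (\<Sum>b<2 * n. A $$ (b, c) *\<^sub>C gam n l b x)"
    unfolding S1 S2 half[symmetric] by (simp add: spin_ext_def gam_sum gam_scaleC)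
  finally show ?thesis .
qed

text \<open>Moving the action of \<open>A\<close> through each quadratic term of \<open>B\<close> by
  \<open>spin_ext_gam\<close> leaves two corrections. The one from the outer generator has the
  matrix \<open>A * B\<close>; the one from the inner generator, once the entry of \<open>A\<close>
  is carried across the form, has the matrix \<open>B * A\<close> with a minus sign.\<close>

lemma spin_ext_commutator:
  assumes A: "A \<in> o_alg n" and B: "B \<in> o_alg n"
  shows "spin_ext N n (A * B - B * A) x = spin_ext N n A (spin_ext N n B x) - spin_ext N n B (spin_ext N n A x)"
proof -
  note cA = o_alg_carrier[OF A] and cB = o_alg_carrier[OF B]
  have idx: "(A * B - B * A) $$ (b, a) = (\<Sum>d<2 * n. A $$ (b, d) * B $$ (d, a)) - (\<Sum>d<2 * n. B $$ (b, d) * A $$ (d, a))"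
    if "a < 2 * n" "b < 2 * n" for a b
    using cA cB that by (simp add: scalar_prod_def atLeast0LessThan)
  have tm: "spin_ext N n A (gam n k b (gam n k (dual n a) x)) = gam n k b (gam n k (dual n a) (spin_ext N n A x))
      + (\<Sum>d<2 * n. A $$ (d, dual n a) *\<^sub>C gam n k b (gam n k d x))
      + (\<Sum>d<2 * n. A $$ (d, b) *\<^sub>C gam n k d (gam n k (dual n a) x))"
    if "k < N" "a < 2 * n" "b < 2 * n" for k a b
    using that by (simp add: spin_ext_gam[OF A] gam_add gam_sum gam_scaleC)
  have T1: "(\<Sum>k<N. \<Sum>a<2 * n. \<Sum>b<2 * n. (B $$ (b, a) / 2) *\<^sub>C (\<Sum>d<2 * n. A $$ (d, b) *\<^sub>C gam n k d (gam n k (dual n a) x)))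
     = (\<Sum>k<N. \<Sum>a<2 * n. \<Sum>b<2 * n. ((\<Sum>d<2 * n. A $$ (b, d) * B $$ (d, a)) / 2) *\<^sub>C gam n k b (gam n k (dual n a) x))"
  proof (rule sum.cong[OF refl], rule sum.cong[OF refl])
    fix k a
    show "(\<Sum>b<2 * n. (B $$ (b, a) / 2) *\<^sub>C (\<Sum>d<2 * n. A $$ (d, b) *\<^sub>C gam n k d (gam n k (dual n a) x)))
       = (\<Sum>b<2 * n. ((\<Sum>d<2 * n. A $$ (b, d) * B $$ (d, a)) / 2) *\<^sub>C gam n k b (gam n k (dual n a) x))"
      unfolding cvec.scale_sum_right sum_divide_distrib cvec.scale_sum_left
      by (subst sum.swap) (simp add: mult.commute)
  qed
  have T2: "(\<Sum>k<N. \<Sum>a<2 * n. \<Sum>b<2 * n. (B $$ (b, a) / 2) *\<^sub>C (\<Sum>d<2 * n. A $$ (d, dual n a) *\<^sub>C gam n k b (gam n k d x)))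
     = - (\<Sum>k<N. \<Sum>a<2 * n. \<Sum>b<2 * n. ((\<Sum>d<2 * n. B $$ (b, d) * A $$ (d, a)) / 2) *\<^sub>C gam n k b (gam n k (dual n a) x))"
    unfolding sum_negf[symmetric]
  proof (rule sum.cong[OF refl])
    fix k
    have "(\<Sum>a<2 * n. \<Sum>b<2 * n. (B $$ (b, a) / 2) *\<^sub>C (\<Sum>d<2 * n. A $$ (d, dual n a) *\<^sub>C gam n k b (gam n k d x)))
      = (\<Sum>a<2 * n. \<Sum>b<2 * n. \<Sum>d<2 * n. - ((B $$ (b, a) * A $$ (a, dual n d) / 2) *\<^sub>C gam n k b (gam n k d x)))"
    proof (rule sum.cong[OF refl], rule sum.cong[OF refl])
      fix a b assume a: "a \<in> {..<2 * n}"
      have "A $$ (d, dual n a) = - A $$ (a, dual n d)" if "d < 2 * n" for d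
        using o_alg_dual'[OF A that] a by simp
      then show "(B $$ (b, a) / 2) *\<^sub>C (\<Sum>d<2 * n. A $$ (d, dual n a) *\<^sub>C gam n k b (gam n k d x))
        = (\<Sum>d<2 * n. - ((B $$ (b, a) * A $$ (a, dual n d) / 2) *\<^sub>C gam n k b (gam n k d x)))"
        unfolding cvec.scale_sum_right by (intro sum.cong refl) simp
    qed
    also have "\<dots> = (\<Sum>d<2 * n. \<Sum>b<2 * n. \<Sum>a<2 * n. - ((B $$ (b, a) * A $$ (a, dual n d) / 2) *\<^sub>C gam n k b (gam n k d x)))"
      by (subst sum_rotate3) (rule sum.swap)
    also have "\<dots> = (\<Sum>d<2 * n. \<Sum>b<2 * n. - (((\<Sum>a<2 * n. B $$ (b, a) * A $$ (a, dual n d)) / 2) *\<^sub>C gam n k b (gam n k d x)))"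
      by (simp add: sum_negf sum_divide_distrib cvec.scale_sum_left)
    also have "\<dots> = (\<Sum>d<2 * n. \<Sum>b<2 * n. - (((\<Sum>a<2 * n. B $$ (b, a) * A $$ (a, d)) / 2) *\<^sub>C gam n k b (gam n k (dual n d) x)))"
      by (subst sum_dual[symmetric]) simp
    finally show "(\<Sum>a<2 * n. \<Sum>b<2 * n. (B $$ (b, a) / 2) *\<^sub>C (\<Sum>d<2 * n. A $$ (d, dual n a) *\<^sub>C gam n k b (gam n k d x)))
      = (\<Sum>a<2 * n. \<Sum>b<2 * n. - (((\<Sum>d<2 * n. B $$ (b, d) * A $$ (d, a)) / 2) *\<^sub>C gam n k b (gam n k (dual n a) x)))" .
  qed
  have "spin_ext N n A (spin_ext N n B x)
    = (\<Sum>k<N. \<Sum>a<2 * n. \<Sum>b<2 * n. (B $$ (b, a) / 2) *\<^sub>C spin_ext N n A (gam n k b (gam n k (dual n a) x)))"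
    by (simp add: spin_ext_def[of N n B] spin_ext_sum spin_ext_scaleC)
  also have "\<dots> = spin_ext N n B (spin_ext N n A x)
      + (\<Sum>k<N. \<Sum>a<2 * n. \<Sum>b<2 * n. (B $$ (b, a) / 2) *\<^sub>C (\<Sum>d<2 * n. A $$ (d, dual n a) *\<^sub>C gam n k b (gam n k d x)))
      + (\<Sum>k<N. \<Sum>a<2 * n. \<Sum>b<2 * n. (B $$ (b, a) / 2) *\<^sub>C (\<Sum>d<2 * n. A $$ (d, b) *\<^sub>C gam n k d (gam n k (dual n a) x)))"
    unfolding spin_ext_def[of N n B "spin_ext N n A x"] sum.distrib[symmetric] scaleC_add_right[symmetric]
    by (intro sum.cong refl arg_cong2[where f = scaleC] tm) auto
  finally have "spin_ext N n A (spin_ext N n B x) - spin_ext N n B (spin_ext N n A x)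
     = (\<Sum>k<N. \<Sum>a<2 * n. \<Sum>b<2 * n. ((\<Sum>d<2 * n. A $$ (b, d) * B $$ (d, a)) / 2) *\<^sub>C gam n k b (gam n k (dual n a) x))
     - (\<Sum>k<N. \<Sum>a<2 * n. \<Sum>b<2 * n. ((\<Sum>d<2 * n. B $$ (b, d) * A $$ (d, a)) / 2) *\<^sub>C gam n k b (gam n k (dual n a) x))"
    unfolding T1 T2 by simp
  also have "\<dots> = spin_ext N n (A * B - B * A) x"
    unfolding spin_ext_def sum_subtractf[symmetric]
    by (intro sum.cong refl) (simp add: idx cvec.scale_left_diff_distrib[symmetric] diff_divide_distrib)
  finally show ?thesis ..
qed

lemma sum_lessThan_double: "(\<Sum>a<2 * n. f a) = (\<Sum>i<n. f i) + (\<Sum>i<n. f (i + n))"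
  for f :: "nat \<Rightarrow> 'a::comm_monoid_add"
proof -
  have "{..<2 * n} = {..<n} \<union> {n..<n + n}" by auto
  moreover have "sum f ({..<n} \<union> {n..<n + n}) = sum f {..<n} + sum f {n..<n + n}"
    by (rule sum.union_disjoint) auto
  ultimately have "(\<Sum>a<2 * n. f a) = (\<Sum>i<n. f i) + (\<Sum>i\<in>{n..<n + n}. f i)"
    by simp
  also have "(\<Sum>i\<in>{n..<n + n}. f i) = (\<Sum>i<n. f (i + n))"
    using sum.shift_bounds_nat_ivl[of f 0 n n] by (simp add: atLeast0LessThan)
  finally show ?thesis .
qed

lemma sum_symmetric_square:
  fixes f :: "nat \<Rightarrow> nat \<Rightarrow> 'a::comm_monoid_add"
  assumes "\<And>i j. i < n \<Longrightarrow> j < n \<Longrightarrow> f i j = f j i" "\<And>i. i < n \<Longrightarrow> f i i = 0"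
  shows "(\<Sum>j<n. \<Sum>i<n. f i j) = (\<Sum>j<n. \<Sum>i<j. f i j + f i j)"
  using assms
proof (induction n)
  case (Suc n)
  have "(\<Sum>j<n. f n j) = (\<Sum>i<n. f i n)"
    using Suc.prems(1) by (intro sum.cong) auto
  moreover have "(\<Sum>j<n. \<Sum>i<n. f i j) = (\<Sum>j<n. \<Sum>i<j. f i j + f i j)"
    by (rule Suc.IH) (use Suc.prems in auto)
  ultimately show ?case
    using Suc.prems(2)[of n] by (simp add: sum.distrib add_ac)
qed simp

lemma ext_eq_uminus_self:
  "x = - x \<Longrightarrow> x = 0" for x :: ext
  by (auto simp: fun_eq_iff uminus_apply zero_fun_apply)

lemma fop_twice [simp]: "fop b m (fop b m x) = 0"
proof (rule ext_eq_uminus_self)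
  show "fop b m (fop b m x) = - fop b m (fop b m x)"
    using fop_anticommute[of b m b m x] by simp
qed

lemma gam_0_simps: "i < n \<Longrightarrow> gam n 0 i = fop True i" "i < n \<Longrightarrow> gam n 0 (i + n) = fop False i"
  by (simp_all add: gam_def)

text \<open>Cutting both indices at \<open>n\<close> gives four blocks. In the two off-diagonal ones
  the summand is symmetric in \<open>i\<close> and \<open>j\<close> and vanishes for
  \<open>i = j\<close>, so half of the full sum is the sum over \<open>i < j\<close>.\<close>

lemma spin_act_eq_spin_ext:
  assumes A: "A \<in> o_alg n" and y: "y \<in> ext_space n"
  shows "spin_act n A y = spin_ext 1 n A y"
proof -
  let ?M = "fop True" and ?D = "fop False"
  define f where "f a b = (A $$ (b, a) / 2) *\<^sub>C gam n 0 b (gam n 0 (dual n a) y)" for a b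
  have d: "dual n i = i + n" "dual n (i + n) = i" if "i < n" for i
    using that by (auto simp: dual_def)
  have f1: "f j i = (A $$ (i, j) / 2) *\<^sub>C ?M i (?D j y)"
    and f2: "f (j + n) (i + n) = - ((A $$ (j, i) / 2) *\<^sub>C ?D i (?M j y))"
    and f3: "f j (i + n) = (A $$ (i + n, j) / 2) *\<^sub>C ?D i (?D j y)"
    and f4: "f (j + n) i = (A $$ (i, j + n) / 2) *\<^sub>C ?M i (?M j y)" if "i < n" "j < n" for i j
    using that o_alg_dual[OF A, of j i] by (simp_all add: f_def d gam_0_simps)
  have "spin_ext 1 n A y = (\<Sum>a<2 * n. \<Sum>b<2 * n. f a b)"
    by (simp add: spin_ext_def f_def)
  also have "\<dots> = (\<Sum>j<n. \<Sum>i<n. f j i) + (\<Sum>j<n. \<Sum>i<n. f j (i + n))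
      + ((\<Sum>j<n. \<Sum>i<n. f (j + n) i) + (\<Sum>j<n. \<Sum>i<n. f (j + n) (i + n)))"
    by (simp only: sum_lessThan_double sum.distrib add_ac)
  also have "(\<Sum>j<n. \<Sum>i<n. f j (i + n)) = (\<Sum>j<n. \<Sum>i<j. A $$ (i + n, j) *\<^sub>C ?D i (?D j y))"
  proof -
    have "(\<Sum>j<n. \<Sum>i<n. f j (i + n)) = (\<Sum>j<n. \<Sum>i<j. f j (i + n) + f j (i + n))"
    proof (rule sum_symmetric_square)
      fix i j assume ij: "i < n" "j < n"
      then have "A $$ (i + n, j) = - A $$ (j + n, i)"
        using o_alg_dual[OF A, of "j + n" i] d by simp
      then show "f j (i + n) = f i (j + n)"
        using ij fop_anticommute[of False i False j y] by (simp add: f3)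
    qed (simp add: f3)
    then show ?thesis
      by (simp add: f3 scaleC_add_left[symmetric])
  qed
  also have "(\<Sum>j<n. \<Sum>i<n. f (j + n) i) = (\<Sum>j<n. \<Sum>i<j. A $$ (i, j + n) *\<^sub>C ?M i (?M j y))"
  proof -
    have "(\<Sum>j<n. \<Sum>i<n. f (j + n) i) = (\<Sum>j<n. \<Sum>i<j. f (j + n) i + f (j + n) i)"
    proof (rule sum_symmetric_square)
      fix i j assume ij: "i < n" "j < n"
      then have "A $$ (i, j + n) = - A $$ (j, i + n)"
        using o_alg_dual[OF A, of j "i + n"] d by simp
      then show "f (j + n) i = f (i + n) j"
        using ij fop_anticommute[of True i True j y] by (simp add: f4)
    qed (simp add: f4)
    then show ?thesis
      by (simp add: f4 scaleC_add_left[symmetric])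
  qed
  also have "(\<Sum>j<n. \<Sum>i<n. f (j + n) (i + n)) = - (\<Sum>i<n. \<Sum>j<n. (A $$ (i, j) / 2) *\<^sub>C ?D j (?M i y))"
    by (simp add: f2 sum_negf)
  also have "(\<Sum>j<n. \<Sum>i<n. f j i) = (\<Sum>i<n. \<Sum>j<n. (A $$ (i, j) / 2) *\<^sub>C ?M i (?D j y))"
    by (subst sum.swap) (simp add: f1)
  finally have *: "spin_ext 1 n A y = (\<Sum>i<n. \<Sum>j<n. (A $$ (i, j) / 2) *\<^sub>C ?M i (?D j y))
     + (\<Sum>j<n. \<Sum>i<j. A $$ (i + n, j) *\<^sub>C ?D i (?D j y))
     + ((\<Sum>j<n. \<Sum>i<j. A $$ (i, j + n) *\<^sub>C ?M i (?M j y))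
     + - (\<Sum>i<n. \<Sum>j<n. (A $$ (i, j) / 2) *\<^sub>C ?D j (?M i y)))" .
  have e1: "(\<Sum>i<n. \<Sum>j<n. (A $$ (i, j) / 2) *\<^sub>C (ext_M i (ext_D j y) - ext_D j (ext_M i y)))
      = (\<Sum>i<n. \<Sum>j<n. (A $$ (i, j) / 2) *\<^sub>C ?M i (?D j y)) - (\<Sum>i<n. \<Sum>j<n. (A $$ (i, j) / 2) *\<^sub>C ?D j (?M i y))"
    unfolding sum_subtractf[symmetric] cvec.scale_right_diff_distrib[symmetric]
    using y by (intro sum.cong refl) (simp add: ext_D_eq_fop ext_M_eq_fop[of _ n] fop_ext_space)
  have e2: "(\<Sum>j<n. \<Sum>i<j. A $$ (i + n, j) *\<^sub>C ext_D i (ext_D j y)) = (\<Sum>j<n. \<Sum>i<j. A $$ (i + n, j) *\<^sub>C ?D i (?D j y))"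
    by (simp add: ext_D_eq_fop)
  have e3: "(\<Sum>j<n. \<Sum>i<j. A $$ (i, j + n) *\<^sub>C ext_M i (ext_M j y)) = (\<Sum>j<n. \<Sum>i<j. A $$ (i, j + n) *\<^sub>C ?M i (?M j y))"
    using y by (simp add: ext_M_eq_fop[of _ n] fop_ext_space)
  show ?thesis
    unfolding * spin_act_def e1 e2 e3 by (simp only: add_ac diff_conv_add_uminus)
qed

section \<open>Basis tensors as index sets cut into rows\<close>

definition tensor_rows :: "nat \<Rightarrow> nat \<Rightarrow> nat set \<Rightarrow> nat \<Rightarrow> nat set" where
  "tensor_rows N n K = (\<lambda>j\<in>{..<N}. {i. i < n \<and> j * n + i \<in> K})"

definition tensor_unrows :: "nat \<Rightarrow> nat \<Rightarrow> (nat \<Rightarrow> nat set) \<Rightarrow> nat set" where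
  "tensor_unrows N n w = {j * n + i |j i. j < N \<and> i \<in> w j}"

lemma tensor_rows_PiE: "tensor_rows N n K \<in> {..<N} \<rightarrow>\<^sub>E Pow {..<n}"
  by (auto simp: tensor_rows_def)

lemma tensor_unrows_subset: "w \<in> {..<N} \<rightarrow>\<^sub>E Pow {..<n} \<Longrightarrow> tensor_unrows N n w \<subseteq> {..<N * n}"
  unfolding tensor_unrows_def by (auto intro!: index_less)

lemma tensor_rows_unrows:
  assumes "w \<in> {..<N} \<rightarrow>\<^sub>E Pow {..<n}"
  shows "tensor_rows N n (tensor_unrows N n w) = w"
proof
  fix j
  show "tensor_rows N n (tensor_unrows N n w) j = w j"
  proof (cases "j < N")
    case True
    have "i < n \<and> (\<exists>k i'. j * n + i = k * n + i' \<and> k < N \<and> i' \<in> w k) \<longleftrightarrow> i \<in> w j" for i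
    proof
      assume L: "i < n \<and> (\<exists>k i'. j * n + i = k * n + i' \<and> k < N \<and> i' \<in> w k)"
      then obtain k i' where "j * n + i = k * n + i'" "k < N" "i' \<in> w k" by blast
      moreover have "i' < n" using assms \<open>k < N\<close> \<open>i' \<in> w k\<close> by (auto simp: PiE_iff)
      ultimately show "i \<in> w j" using L index_eq_iff[of i n i' j k] by simp
    next
      assume "i \<in> w j"
      moreover have "i < n" using assms True \<open>i \<in> w j\<close> by (auto simp: PiE_iff)
      ultimately show "i < n \<and> (\<exists>k i'. j * n + i = k * n + i' \<and> k < N \<and> i' \<in> w k)"
        using True by blast
    qed
    then show ?thesis
      using True by (simp add: tensor_rows_def tensor_unrows_def)
  next
    case False
    then show ?thesis
      using assms by (simp add: tensor_rows_def PiE_iff extensional_def)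
  qed
qed

lemma tensor_unrows_rows:
  assumes "K \<subseteq> {..<N * n}"
  shows "tensor_unrows N n (tensor_rows N n K) = K"
proof -
  have "m \<in> K \<longleftrightarrow> (\<exists>j i. m = j * n + i \<and> j < N \<and> i \<in> tensor_rows N n K j)" for m
  proof
    assume "m \<in> K"
    then have "m < N * n" using assms by auto
    moreover from this have "n > 0" by (cases n) auto
    ultimately have "m div n < N" "m mod n < n"
      by (simp_all add: less_mult_imp_div_less)
    with \<open>m \<in> K\<close> show "\<exists>j i. m = j * n + i \<and> j < N \<and> i \<in> tensor_rows N n K j"
      by (intro exI[of _ "m div n"] exI[of _ "m mod n"]) (simp add: tensor_rows_def)
  qed (auto simp: tensor_rows_def)
  then show ?thesis
    by (auto simp: tensor_unrows_def)
qed

lemma wedge_list_ext_gen: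
  assumes "sorted_wrt (<) ms"
  shows "wedge_list (map ext_gen ms) = bvec (set ms)"
  using assms
proof (induction ms)
  case Nil
  then show ?case by (simp add: wedge_list_def ext_one_eq_bvec)
next
  case (Cons m ms)
  obtain b where "set ms \<subseteq> {..<b}"
    using finite_nat_set_iff_bounded[of "set ms"] by auto
  then have sp: "bvec (set ms) \<in> ext_space b" by (rule bvec_ext_space)
  have "{j \<in> set ms. j < m} = {}" "m \<notin> set ms"
    using Cons.prems by auto
  then have "nsign m (set ms) = 1"
    by (simp only: nsign_def) simp
  then have "wedge (ext_gen m) (bvec (set ms)) = bvec (set (m # ms))"
    using ext_M_eq_fop[OF sp, of m] \<open>m \<notin> set ms\<close> by (simp add: ext_M_def fop_bvec flip_def)
  then show ?case
    using Cons by (simp add: wedge_list_def)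
qed

lemma sorted_row_list:
  assumes "\<And>j. j < N \<Longrightarrow> w j \<subseteq> {..<n}"
  shows "sorted_wrt (<) (concat (map (\<lambda>j. map (\<lambda>i. j * n + i) (sorted_list_of_set (w j))) [0..<N]))
    \<and> set (concat (map (\<lambda>j. map (\<lambda>i. j * n + i) (sorted_list_of_set (w j))) [0..<N])) = tensor_unrows N n w"
  using assms
proof (induction N)
  case 0
  then show ?case by (simp add: tensor_unrows_def)
next
  case (Suc N)
  have fin: "finite (w N)" using Suc.prems[of N] finite_subset by blast
  have IH: "sorted_wrt (<) (concat (map (\<lambda>j. map (\<lambda>i. j * n + i) (sorted_list_of_set (w j))) [0..<N]))"
    "set (concat (map (\<lambda>j. map (\<lambda>i. j * n + i) (sorted_list_of_set (w j))) [0..<N])) = tensor_unrows N n w"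
    using Suc.IH Suc.prems by auto
  have lt: "x < N * n" if x: "x \<in> tensor_unrows N n w" for x
  proof -
    obtain j i where "x = j * n + i" "j < N" "i \<in> w j"
      using x by (auto simp: tensor_unrows_def)
    then show ?thesis
      using Suc.prems[of j] index_less[of i n j N] by auto
  qed
  have "sorted_wrt (<) (map (\<lambda>i. N * n + i) (sorted_list_of_set (w N)))"
    using strict_sorted_list_of_set[of "w N"] by (simp add: sorted_wrt_map)
  then have "sorted_wrt (<) (concat (map (\<lambda>j. map (\<lambda>i. j * n + i) (sorted_list_of_set (w j))) [0..<N])
      @ map (\<lambda>i. N * n + i) (sorted_list_of_set (w N)))"
    unfolding sorted_wrt_append IH(2) using IH(1) lt fin by fastforce
  moreover have "tensor_unrows (Suc N) n w = tensor_unrows N n w \<union> (\<lambda>i. N * n + i) ` w N"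
    by (auto simp: tensor_unrows_def less_Suc_eq)
  ultimately show ?case
    using IH(2) fin by simp
qed

text \<open>No signs occur: the index \<open>j * n + i\<close> orders the generators first by tensor
  factor and then inside the factor, exactly as the wedge product is written.\<close>

lemma S_tensor_to_ext_eq: "S_tensor_to_ext N n t = (\<lambda>K. if K \<subseteq> {..<N * n} then t (tensor_rows N n K) else 0)"
proof
  fix K
  let ?P = "{..<N} \<rightarrow>\<^sub>E Pow {..<n}"
  have fin: "finite ?P" by (intro finite_PiE) auto
  have wl: "wedge_list (concat (map (\<lambda>j. map (ve_gen n j) (sorted_list_of_set (w j))) [0..<N])) = bvec (tensor_unrows N n w)"
    if "w \<in> ?P" for w
  proof -
    let ?L = "concat (map (\<lambda>j. map (\<lambda>i. j * n + i) (sorted_list_of_set (w j))) [0..<N])"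
    have "\<And>j. j < N \<Longrightarrow> w j \<subseteq> {..<n}" using that by (auto simp: PiE_iff)
    from sorted_row_list[OF this] have "sorted_wrt (<) ?L" "set ?L = tensor_unrows N n w" by simp_all
    moreover have "concat (map (\<lambda>j. map (ve_gen n j) (sorted_list_of_set (w j))) [0..<N]) = map ext_gen ?L"
      by (simp add: map_concat comp_def ve_gen_def[abs_def])
    ultimately show ?thesis
      using wedge_list_ext_gen[of ?L] by simp
  qed
  have "S_tensor_to_ext N n t K = (\<Sum>w\<in>?P. t w * bvec (tensor_unrows N n w) K)"
    unfolding S_tensor_to_ext_def sum_fun_apply
    by (intro sum.cong refl) (simp add: wl fun_apply_simps)
  also have "\<dots> = (if K \<subseteq> {..<N * n} then t (tensor_rows N n K) else 0)"
  proof (cases "K \<subseteq> {..<N * n}")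
    case True
    have "(\<Sum>w\<in>?P. t w * bvec (tensor_unrows N n w) K) = (\<Sum>w\<in>?P. if w = tensor_rows N n K then t w else 0)"
      using True tensor_rows_unrows tensor_unrows_rows by (intro sum.cong refl) (auto simp: bvec_def)
    also have "\<dots> = t (tensor_rows N n K)"
      using fin tensor_rows_PiE[of N n K] by simp
    finally show ?thesis using True by simp
  next
    case False
    then have "bvec (tensor_unrows N n w) K = 0" if "w \<in> ?P" for w
      using tensor_unrows_subset[OF that] by (auto simp: bvec_def)
    then show ?thesis using False by simp
  qed
  finally show "S_tensor_to_ext N n t K = (if K \<subseteq> {..<N * n} then t (tensor_rows N n K) else 0)" .
qed

lemma S_tensor_to_ext_ext_space: "S_tensor_to_ext N n t \<in> ext_space (N * n)"
  by (simp add: S_tensor_to_ext_eq ext_space_def)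

lemma S_tensor_to_ext_add: "S_tensor_to_ext N n (s + t) = S_tensor_to_ext N n s + S_tensor_to_ext N n t"
  and S_tensor_to_ext_scaleC: "S_tensor_to_ext N n (c *\<^sub>C t) = c *\<^sub>C S_tensor_to_ext N n t"
  by (simp_all add: S_tensor_to_ext_eq fun_eq_iff fun_apply_simps)

lemma S_tensor_supported: "t \<in> S_tensor N n \<Longrightarrow> w \<notin> {..<N} \<rightarrow>\<^sub>E Pow {..<n} \<Longrightarrow> t w = 0"
  by (auto simp: S_tensor_def tensor_space_def)

lemma bij_betw_S_tensor_to_ext: "bij_betw (S_tensor_to_ext N n) (S_tensor N n) (ext_space (N * n))"
proof (rule bij_betw_imageI)
  show "inj_on (S_tensor_to_ext N n) (S_tensor N n)"
  proof (rule inj_onI)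
    fix s t assume s: "s \<in> S_tensor N n" and t: "t \<in> S_tensor N n"
      and eq: "S_tensor_to_ext N n s = S_tensor_to_ext N n t"
    show "s = t"
    proof
      fix w show "s w = t w"
      proof (cases "w \<in> {..<N} \<rightarrow>\<^sub>E Pow {..<n}")
        case True
        then show ?thesis
          using fun_cong[OF eq, of "tensor_unrows N n w"] by (simp add: S_tensor_to_ext_eq tensor_unrows_subset tensor_rows_unrows)
      next
        case False
        then show ?thesis using S_tensor_supported[OF s] S_tensor_supported[OF t] by simp
      qed
    qed
  qed
  show "S_tensor_to_ext N n ` S_tensor N n = ext_space (N * n)"
  proof
    show "S_tensor_to_ext N n ` S_tensor N n \<subseteq> ext_space (N * n)"
      using S_tensor_to_ext_ext_space by blast
    show "ext_space (N * n) \<subseteq> S_tensor_to_ext N n ` S_tensor N n"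
    proof
      fix x assume x: "x \<in> ext_space (N * n)"
      define t where "t = (\<lambda>w. if w \<in> {..<N} \<rightarrow>\<^sub>E Pow {..<n} then x (tensor_unrows N n w) else 0)"
      have "t \<in> S_tensor N n"
        by (simp add: t_def S_tensor_def tensor_space_def)
      moreover have "S_tensor_to_ext N n t = x"
      proof
        fix K
        show "S_tensor_to_ext N n t K = x K"
          using x tensor_rows_PiE[of N n K] by (auto simp: S_tensor_to_ext_eq t_def tensor_unrows_rows ext_space_def)
      qed
      ultimately show "x \<in> S_tensor_to_ext N n ` S_tensor N n" by blast
    qed
  qed
qed

lemma tensor_rows_flip:
  assumes "k < N" "p < n"
  shows "tensor_rows N n (flip (k * n + p) K) = (tensor_rows N n K)(k := flip p (tensor_rows N n K k))"
proof
  fix j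
  show "tensor_rows N n (flip (k * n + p) K) j = ((tensor_rows N n K)(k := flip p (tensor_rows N n K k))) j"
  proof (cases "j < N")
    case True
    have "i < n \<and> j * n + i \<in> flip (k * n + p) K \<longleftrightarrow>
      (if j = k then (if i = p then p \<notin> tensor_rows N n K k else i \<in> tensor_rows N n K k) else i \<in> tensor_rows N n K j)" for i
      using True assms by (auto simp: tensor_rows_def index_eq_iff)
    then have "{i. i < n \<and> j * n + i \<in> flip (k * n + p) K} =
      {i. if j = k then (if i = p then p \<notin> tensor_rows N n K k else i \<in> tensor_rows N n K k) else i \<in> tensor_rows N n K j}"
      by presburger
    also have "\<dots> = ((tensor_rows N n K)(k := flip p (tensor_rows N n K k))) j"
      by (cases "j = k") (simp_all add: flip_def, auto)
    finally show ?thesis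
      using True by (simp add: tensor_rows_def del: mem_flip)
  next
    case False
    then show ?thesis using assms by (simp add: tensor_rows_def)
  qed
qed

lemma nsign_rows:
  assumes "k < N" "p < n"
  shows "nsign (k * n + p) K = nsign (k * n) K * nsign p (tensor_rows N n K k)"
proof -
  have "{j \<in> K. j < k * n + p} = {j \<in> K. j < k * n} \<union> (\<lambda>i. k * n + i) ` {i \<in> tensor_rows N n K k. i < p}"
  proof -
    have "j \<in> (\<lambda>i. k * n + i) ` {i \<in> tensor_rows N n K k. i < p}" if "j \<in> K" "j < k * n + p" "\<not> j < k * n" for j
      using that assms by (intro image_eqI[of _ _ "j - k * n"]) (auto simp: tensor_rows_def)
    then show ?thesis using assms by (auto simp: tensor_rows_def)
  qed
  moreover have "card ({j \<in> K. j < k * n} \<union> (\<lambda>i. k * n + i) ` {i \<in> tensor_rows N n K k. i < p})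
    = card {j \<in> K. j < k * n} + card ((\<lambda>i. k * n + i) ` {i \<in> tensor_rows N n K k. i < p})"
    by (rule card_Un_disjoint) auto
  moreover have "card ((\<lambda>i. k * n + i) ` {i \<in> tensor_rows N n K k. i < p}) = card {i \<in> tensor_rows N n K k. i < p}"
    by (simp add: card_image)
  ultimately show ?thesis
    by (simp add: nsign_def power_add)
qed

text \<open>The sign coming from the tensor factors before \<open>k\<close> occurs once for each of
  the two operators and cancels; quadratic expressions therefore act on one tensor factor without a
  sign.\<close>

lemma fop_fop_rows:
  assumes k: "k < N" and p: "p < n" and q: "q < n" and K: "K \<subseteq> {..<N * n}"
  shows "fop b p (fop c q (\<lambda>s. t ((tensor_rows N n K)(k := s)))) (tensor_rows N n K k)
    = fop b (k * n + p) (fop c (k * n + q) (S_tensor_to_ext N n t)) K"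
proof -
  let ?r = "tensor_rows N n K"
  have mem: "i \<in> ?r k \<longleftrightarrow> k * n + i \<in> K" if "i < n" for i
    using k that by (simp add: tensor_rows_def)
  have sub: "flip (k * n + q) (flip (k * n + p) K) \<subseteq> {..<N * n}"
    using K index_less[OF p k] index_less[OF q k] by (simp add: flip_subset_iff)
  have r1: "tensor_rows N n (flip (k * n + p) K) = ?r(k := flip p (?r k))"
    by (rule tensor_rows_flip[OF k p])
  then have r2: "tensor_rows N n (flip (k * n + q) (flip (k * n + p) K)) = ?r(k := flip q (flip p (?r k)))"
    using tensor_rows_flip[OF k q, of "flip (k * n + p) K"] by simp
  have n1: "nsign (k * n + p) K = nsign (k * n) K * nsign p (?r k)"
    by (rule nsign_rows[OF k p])
  have n2: "nsign (k * n + q) (flip (k * n + p) K) = nsign (k * n) K * nsign q (flip p (?r k))"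
    using nsign_rows[OF k q, of "flip (k * n + p) K"] r1 by (simp add: nsign_flip)
  have m2: "q \<in> flip p (?r k) \<longleftrightarrow> k * n + q \<in> flip (k * n + p) K"
    using mem[OF p] mem[OF q] by auto
  show ?thesis
    unfolding fop_def n1 n2 m2 mem[OF p] S_tensor_to_ext_eq r2 using sub
    by (simp add: mult_ac del: mem_flip)
qed

lemma tensor_factor_ext_space:
  assumes "t \<in> S_tensor N n" "k < N"
  shows "(\<lambda>s. t (w(k := s))) \<in> ext_space n"
proof -
  have "s \<subseteq> {..<n}" if "t (w(k := s)) \<noteq> 0" for s
  proof -
    have "w(k := s) \<in> {..<N} \<rightarrow>\<^sub>E Pow {..<n}"
      using that S_tensor_supported[OF assms(1), of "w(k := s)"] by blast
    from PiE_mem[OF this, of k] show ?thesis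
      using assms(2) by auto
  qed
  then show ?thesis by (simp add: ext_space_def)
qed

lemma S_tensor_o_closed:
  assumes A: "A \<in> o_alg n" and t: "t \<in> S_tensor N n"
  shows "S_tensor_o N n A t \<in> S_tensor N n"
proof -
  have "on_factor k (spin_act n A) t w = 0" if k: "k < N" and w: "w \<notin> {..<N} \<rightarrow>\<^sub>E Pow {..<n}" for k w
  proof -
    let ?f = "\<lambda>s. t (w(k := s))"
    have f: "?f \<in> ext_space n" by (rule tensor_factor_ext_space[OF t k])
    show ?thesis
    proof (cases "w k \<subseteq> {..<n}")
      case True
      \<comment> \<open>The label is wrong at a position other than \<open>k\<close>, so the whole
        slice of \<open>t\<close> through \<open>w\<close> is 0.\<close>
      have "w(k := s) \<notin> {..<N} \<rightarrow>\<^sub>E Pow {..<n}" for s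
      proof
        assume a: "w(k := s) \<in> {..<N} \<rightarrow>\<^sub>E Pow {..<n}"
        have "w \<in> {..<N} \<rightarrow>\<^sub>E Pow {..<n}"
        proof (rule PiE_I)
          fix j assume "j \<in> {..<N}"
          then show "w j \<in> Pow {..<n}" using PiE_mem[OF a, of j] True by (cases "j = k") auto
        next
          fix j assume "j \<notin> {..<N}"
          then show "w j = undefined" using PiE_arb[OF a, of j] k by auto
        qed
        with w show False by simp
      qed
      then have "?f = 0"
        using S_tensor_supported[OF t] by (simp add: fun_eq_iff zero_fun_apply)
      then show ?thesis
        using spin_act_eq_spin_ext[OF A f] by (simp add: on_factor_def zero_fun_apply)
    next
      case False
      have "spin_act n A ?f \<in> ext_space n"
        using spin_ext_ext_space[of ?f 1 n A] f spin_act_eq_spin_ext[OF A f] by simp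
      with False show ?thesis
        by (auto simp: on_factor_def ext_space_def)
    qed
  qed
  then have zero: "S_tensor_o N n A t w = 0" if "w \<notin> {..<N} \<rightarrow>\<^sub>E Pow {..<n}" for w
    using that by (simp add: S_tensor_o_def sum_fun_apply)
  show ?thesis
    unfolding S_tensor_def tensor_space_def
  proof (intro CollectI allI impI)
    fix w assume "S_tensor_o N n A t w \<noteq> 0"
    then show "w \<in> {..<N} \<rightarrow>\<^sub>E Pow {..<n}"
      by (rule contrapos_np) (rule zero)
  qed
qed

lemma S_tensor_to_ext_spin:
  assumes A: "A \<in> o_alg n" and t: "t \<in> S_tensor N n"
  shows "S_tensor_to_ext N n (S_tensor_o N n A t) = spin_ext N n A (S_tensor_to_ext N n t)"
proof
  fix K
  show "S_tensor_to_ext N n (S_tensor_o N n A t) K = spin_ext N n A (S_tensor_to_ext N n t) K"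
  proof (cases "K \<subseteq> {..<N * n}")
    case True
    have "on_factor k (spin_act n A) t (tensor_rows N n K)
      = (\<Sum>a<2 * n. \<Sum>b<2 * n. (A $$ (b, a) / 2) * gam n k b (gam n k (dual n a) (S_tensor_to_ext N n t)) K)"
      if k: "k < N" for k
    proof -
      let ?f = "\<lambda>s. t ((tensor_rows N n K)(k := s))"
      have "on_factor k (spin_act n A) t (tensor_rows N n K) = spin_ext 1 n A ?f (tensor_rows N n K k)"
        using spin_act_eq_spin_ext[OF A tensor_factor_ext_space[OF t k]] by (simp add: on_factor_def)
      also have "\<dots> = (\<Sum>a<2 * n. \<Sum>b<2 * n. (A $$ (b, a) / 2) * gam n 0 b (gam n 0 (dual n a) ?f) (tensor_rows N n K k))"
        by (simp add: spin_ext_def sum_fun_apply fun_apply_simps)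
      also have "\<dots> = (\<Sum>a<2 * n. \<Sum>b<2 * n. (A $$ (b, a) / 2) * gam n k b (gam n k (dual n a) (S_tensor_to_ext N n t)) K)"
      proof (rule sum.cong[OF refl], rule sum.cong[OF refl])
        fix a b assume "a \<in> {..<2 * n}" "b \<in> {..<2 * n}"
        then have n: "b mod n < n" "dual n a mod n < n" by auto
        show "(A $$ (b, a) / 2) * gam n 0 b (gam n 0 (dual n a) ?f) (tensor_rows N n K k)
          = (A $$ (b, a) / 2) * gam n k b (gam n k (dual n a) (S_tensor_to_ext N n t)) K"
          using fop_fop_rows[OF k n True] by (simp add: gam_def)
      qed
      finally show ?thesis .
    qed
    moreover have "S_tensor_to_ext N n (S_tensor_o N n A t) K = (\<Sum>k<N. on_factor k (spin_act n A) t (tensor_rows N n K))"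
      using True by (simp add: S_tensor_to_ext_eq) (simp add: S_tensor_o_def sum_fun_apply)
    ultimately show ?thesis
      by (simp add: spin_ext_def sum_fun_apply fun_apply_simps)
  next
    case False
    then have "spin_ext N n A (S_tensor_to_ext N n t) K = 0"
      using spin_ext_ext_space[OF S_tensor_to_ext_ext_space[of N n t], of A] by (auto simp: ext_space_def)
    with False show ?thesis
      by (simp add: S_tensor_to_ext_eq)
  qed
qed

lemma S_tensor_to_ext_O:
  assumes n: "n > 0"
  shows "S_tensor_to_ext N n (S_tensor_O N n g t) = O_on_ext N n g (S_tensor_to_ext N n t)"
    and "S_tensor_O N n g t \<in> S_tensor N n"
proof -
  have "O_on_ext N n g (S_tensor_to_ext N n t) \<in> S_tensor_to_ext N n ` S_tensor N n"
    using O_on_ext_ext_space[OF n] bij_betw_imp_surj_on[OF bij_betw_S_tensor_to_ext] by metis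
  then show "S_tensor_to_ext N n (S_tensor_O N n g t) = O_on_ext N n g (S_tensor_to_ext N n t)"
    "S_tensor_O N n g t \<in> S_tensor N n"
    unfolding S_tensor_O_def by (rule f_inv_into_f, rule inv_into_into)
qed

section \<open>Highest weight vectors\<close>

lemma dual_inj: "a < 2 * n \<Longrightarrow> b < 2 * n \<Longrightarrow> dual n a = dual n b \<longleftrightarrow> a = b"
  by (auto simp: dual_def split: if_splits)

text \<open>Up to sign a Cartan element for \<open>c = d\<close>, the zero matrix for
  \<open>d = dual n c\<close>, and a root vector otherwise. Indexing by all pairs avoids
  distinguishing the kinds of roots; \<open>(dual n d, dual n c)\<close> names the same matrix with
  the opposite sign.\<close>

definition root_mat :: "nat \<Rightarrow> nat \<Rightarrow> nat \<Rightarrow> complex mat" where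
  "root_mat n c d = elem_mat (2 * n) c d - elem_mat (2 * n) (dual n d) (dual n c)"

lemma root_mat_carrier: "root_mat n c d \<in> carrier_mat (2 * n) (2 * n)"
  unfolding root_mat_def by (rule minus_carrier_mat) (simp add: elem_mat_def)

lemma root_mat_index:
  "a < 2 * n \<Longrightarrow> b < 2 * n \<Longrightarrow> root_mat n c d $$ (a, b) =
     (if a = c \<and> b = d then 1 else 0) - (if a = dual n d \<and> b = dual n c then 1 else 0)"
  by (simp add: root_mat_def elem_mat_def)

lemma root_mat_o_alg: "c < 2 * n \<Longrightarrow> d < 2 * n \<Longrightarrow> root_mat n c d \<in> o_alg n"
  unfolding o_alg_iff
proof (intro conjI allI impI)
  fix a b assume cd: "c < 2 * n" "d < 2 * n" and ab: "a < 2 * n" "b < 2 * n"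
  have "dual n b = c \<longleftrightarrow> b = dual n c" "dual n a = d \<longleftrightarrow> a = dual n d"
    by (rule dual_eq_iff[OF ab(2) cd(1)], rule dual_eq_iff[OF ab(1) cd(2)])
  then show "root_mat n c d $$ (dual n b, dual n a) = - root_mat n c d $$ (a, b)"
    unfolding root_mat_index[OF dual_less[OF ab(2)] dual_less[OF ab(1)]] root_mat_index[OF ab]
      dual_inj[OF ab(2) cd(2)] dual_inj[OF ab(1) cd(1)] by (simp only: conj_commute) simp
qed (rule root_mat_carrier)

lemma zero_o_alg: "0\<^sub>m (2 * n) (2 * n) \<in> o_alg n"
  unfolding o_alg_iff by auto

lemma add_o_alg: "A \<in> o_alg n \<Longrightarrow> B \<in> o_alg n \<Longrightarrow> A + B \<in> o_alg n"
  unfolding o_alg_iff by auto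

lemma smult_o_alg: "A \<in> o_alg n \<Longrightarrow> c \<cdot>\<^sub>m A \<in> o_alg n"
  unfolding o_alg_iff by auto

lemma commutator_o_alg:
  assumes A: "A \<in> o_alg n" and B: "B \<in> o_alg n"
  shows "A * B - B * A \<in> o_alg n"
proof -
  note cA = o_alg_carrier[OF A] and cB = o_alg_carrier[OF B]
  have idx: "(A * B - B * A) $$ (a, b) = (\<Sum>d<2 * n. A $$ (a, d) * B $$ (d, b)) - (\<Sum>d<2 * n. B $$ (a, d) * A $$ (d, b))"
    if "a < 2 * n" "b < 2 * n" for a b
    using cA cB that by (simp add: scalar_prod_def atLeast0LessThan)
  have tr: "(\<Sum>d<2 * n. C $$ (dual n b, d) * D $$ (d, dual n a)) = (\<Sum>d<2 * n. D $$ (a, d) * C $$ (d, b))"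
    if C: "C \<in> o_alg n" and D: "D \<in> o_alg n" and "a < 2 * n" "b < 2 * n" for C D a b
  proof -
    have "(\<Sum>d<2 * n. C $$ (dual n b, d) * D $$ (d, dual n a))
      = (\<Sum>d<2 * n. C $$ (dual n b, dual n d) * D $$ (dual n d, dual n a))"
      by (rule sum_dual[symmetric])
    also have "\<dots> = (\<Sum>d<2 * n. D $$ (a, d) * C $$ (d, b))"
      using that by (intro sum.cong refl) (simp add: o_alg_dual[OF C] o_alg_dual[OF D])
    finally show ?thesis .
  qed
  have "A * B - B * A \<in> carrier_mat (2 * n) (2 * n)"
    using cA cB by (intro minus_carrier_mat mult_carrier_mat)
  then show ?thesis
    unfolding o_alg_iff by (auto simp del: index_minus_mat simp: idx tr[OF A B] tr[OF B A])
qed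

lemma o_alg_induct [consumes 1, case_names zero add smult root]:
  assumes A: "A \<in> o_alg n"
    and zero: "P (0\<^sub>m (2 * n) (2 * n))"
    and add: "\<And>A B. A \<in> o_alg n \<Longrightarrow> B \<in> o_alg n \<Longrightarrow> P A \<Longrightarrow> P B \<Longrightarrow> P (A + B)"
    and smult: "\<And>c A. A \<in> o_alg n \<Longrightarrow> P A \<Longrightarrow> P (c \<cdot>\<^sub>m A)"
    and root: "\<And>c d. c < 2 * n \<Longrightarrow> d < 2 * n \<Longrightarrow> P (root_mat n c d)"
  shows "P A"
proof -
  \<comment> \<open>A matrix of the algebra is half the sum of its entries times the corresponding
    \<open>root_mat\<close>, since each of these is named by two pairs; the partial sums over
    \<open>S\<close> allow a finite induction.\<close>
  define AS where "AS S = mat (2 * n) (2 * n) (\<lambda>(a, b). \<Sum>(c, d)\<in>S. (A $$ (c, d) / 2) * root_mat n c d $$ (a, b))" for S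
  let ?U = "{..<2 * n} \<times> {..<2 * n}"
  have "AS S \<in> o_alg n \<and> P (AS S)" if "finite S" "S \<subseteq> ?U" for S
    using that
  proof (induction S rule: finite_induct)
    case empty
    have "AS {} = 0\<^sub>m (2 * n) (2 * n)"
      by (rule eq_matI) (simp_all add: AS_def)
    then show ?case using zero zero_o_alg by simp
  next
    case (insert z S)
    obtain c d where z: "z = (c, d)" by (cases z)
    have cd: "c < 2 * n" "d < 2 * n" using insert.prems z by auto
    have eq: "AS (insert z S) = (A $$ (c, d) / 2) \<cdot>\<^sub>m root_mat n c d + AS S"
      using insert.hyps root_mat_carrier[of n c d] by (intro eq_matI) (auto simp: AS_def z)
    have IH: "AS S \<in> o_alg n" "P (AS S)" using insert by auto
    have r: "root_mat n c d \<in> o_alg n" using cd by (rule root_mat_o_alg)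
    show ?case
      unfolding eq using IH r root[OF cd] by (intro conjI add add_o_alg smult_o_alg smult)
  qed
  moreover have "AS ?U = A"
  proof (rule eq_matI)
    fix a b assume "a < dim_row A" "b < dim_col A"
    then have ab: "a < 2 * n" "b < 2 * n" using o_alg_carrier[OF A] by auto
    have "AS ?U $$ (a, b) = (\<Sum>z\<in>?U. (if z = (a, b) then A $$ z / 2 else 0) - (if z = (dual n b, dual n a) then A $$ z / 2 else 0))"
    proof -
      have eq: "a = dual n d \<and> b = dual n c \<longleftrightarrow> (c, d) = (dual n b, dual n a)" if "c < 2 * n" "d < 2 * n" for c d
        using dual_eq_iff[OF that(2) ab(1)] dual_eq_iff[OF that(1) ab(2)] unfolding prod.inject by metis
      have "(A $$ (c, d) / 2) * root_mat n c d $$ (a, b) = (if (c, d) = (a, b) then A $$ (c, d) / 2 else 0)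
          - (if (c, d) = (dual n b, dual n a) then A $$ (c, d) / 2 else 0)" if "c < 2 * n" "d < 2 * n" for c d
      proof -
        have ind: "z * ((if P then 1 else 0) - (if Q then 1 else 0)) = (if P then z else 0) - (if Q then z else 0)"
          for z :: complex and P Q by simp
        have "a = c \<and> b = d \<longleftrightarrow> (c, d) = (a, b)" by auto
        then show ?thesis
          unfolding root_mat_index[OF ab] eq[OF that] ind by (simp only:)
      qed
      then show ?thesis
        using ab unfolding AS_def by (auto simp del: Pair_inject intro!: sum.cong)
    qed
    also have "\<dots> = A $$ (a, b) / 2 - A $$ (dual n b, dual n a) / 2"
      using ab by (simp add: sum_subtractf)
    also have "\<dots> = A $$ (a, b)"
      using ab by (simp add: o_alg_dual[OF A])
    finally show "AS ?U $$ (a, b) = A $$ (a, b)" .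
  qed (use o_alg_carrier[OF A] in \<open>auto simp: AS_def\<close>)
  ultimately show ?thesis
    by fastforce
qed

lemma o_repD:
  assumes "o_rep n W \<rho>" "A \<in> o_alg n"
  shows "x \<in> W \<Longrightarrow> \<rho> A x \<in> W"
    and "x \<in> W \<Longrightarrow> y \<in> W \<Longrightarrow> \<rho> A (x + y) = \<rho> A x + \<rho> A y"
    and "x \<in> W \<Longrightarrow> \<rho> A (c *\<^sub>C x) = c *\<^sub>C \<rho> A x"
    and "B \<in> o_alg n \<Longrightarrow> x \<in> W \<Longrightarrow> \<rho> (A + B) x = \<rho> A x + \<rho> B x"
    and "B \<in> o_alg n \<Longrightarrow> x \<in> W \<Longrightarrow> \<rho> (A * B - B * A) x = \<rho> A (\<rho> B x) - \<rho> B (\<rho> A x)"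
    and "x \<in> W \<Longrightarrow> \<rho> (c \<cdot>\<^sub>m A) x = c *\<^sub>C \<rho> A x"
    and "cvec.subspace W"
    and "\<rho> A 0 = 0"
proof -
  show "\<rho> A 0 = 0"
  proof -
    have "\<rho> A (0 *\<^sub>C 0) = 0 *\<^sub>C \<rho> A 0"
      using assms cvec.subspace_0 unfolding o_rep_def clinear_on_def by blast
    then show ?thesis by simp
  qed
qed (use assms in \<open>auto simp: o_rep_def clinear_on_def image_subset_iff\<close>)

lemma o_rep_spin_ext: "o_rep n (ext_space (N * n)) (spin_ext N n)"
proof -
  have add: "spin_ext N n (A + B) x = spin_ext N n A x + spin_ext N n B x" if "A \<in> o_alg n" "B \<in> o_alg n" for A B x
    unfolding spin_ext_def sum.distrib[symmetric] using o_alg_carrier[OF that(1)] o_alg_carrier[OF that(2)]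
    by (intro sum.cong refl) (auto simp: add_divide_distrib scaleC_add_left)
  have scale: "spin_ext N n (c \<cdot>\<^sub>m A) x = c *\<^sub>C spin_ext N n A x" if "A \<in> o_alg n" for c A x
    unfolding spin_ext_def cvec.scale_sum_right using o_alg_carrier[OF that]
    by (intro sum.cong refl) auto
  show ?thesis
    unfolding o_rep_def clinear_on_def
    by (auto simp: subspace_ext_space spin_ext_ext_space spin_ext_add spin_ext_scaleC add scale spin_ext_commutator)
qed

text \<open>The eigenvalues, on the basis of \<open>E \<oplus> E\<^sup>*\<close>, of the grading
  element with coordinates n, n - 1, ..., 1. They are distinct, and \<open>root_mat n c d\<close>
  shifts the grade by \<open>height n c - height n d\<close>, which is positive for all positive
  roots.\<close>

definition height :: "nat \<Rightarrow> nat \<Rightarrow> int" where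
  "height n a = (if a < n then int n - int a else int a - 2 * int n)"

lemma height_dual: "a < 2 * n \<Longrightarrow> height n (dual n a) = - height n a"
  by (auto simp: height_def dual_def)

lemma height_eq_iff: "a < 2 * n \<Longrightarrow> b < 2 * n \<Longrightarrow> height n a = height n b \<longleftrightarrow> a = b"
  by (auto simp: height_def)

lemma cartan_eq_root_mat: "i < n \<Longrightarrow> cartan n i = root_mat n i i"
  by (simp add: cartan_def root_mat_def dual_def)

text \<open>The pairs with \<open>height n c > height n d\<close> name precisely the positive root
  vectors, their negatives under the dual naming, and the zero matrix at
  \<open>d = dual n c\<close>.\<close>

lemma singular_vector_raise:
  assumes rep: "o_rep n W \<rho>" and x: "x \<in> singular_vectors n W \<rho> lam"
    and cd: "c < 2 * n" "d < 2 * n" "height n c > height n d"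
  shows "\<rho> (root_mat n c d) x = 0"
proof -
  have xW: "x \<in> W" and ann: "\<And>X. X \<in> pos_root_vectors n \<Longrightarrow> \<rho> X x = 0"
    using x by (auto simp: singular_vectors_def)
  have pos1: "\<rho> (root_mat n i j) x = 0" if "i < j" "j < n" for i j
  proof (rule ann)
    have "root_mat n i j = elem_mat (2 * n) i j - elem_mat (2 * n) (j + n) (i + n)"
      using that by (simp add: root_mat_def dual_def)
    then show "root_mat n i j \<in> pos_root_vectors n"
      unfolding pos_root_vectors_def using that by blast
  qed
  have pos2: "\<rho> (root_mat n i (j + n)) x = 0" if "i < j" "j < n" for i j
  proof (rule ann)
    have "root_mat n i (j + n) = elem_mat (2 * n) i (j + n) - elem_mat (2 * n) j (i + n)"
      using that by (simp add: root_mat_def dual_def)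
    then show "root_mat n i (j + n) \<in> pos_root_vectors n"
      unfolding pos_root_vectors_def using that by blast
  qed
  have neg: "root_mat n a b = (-1) \<cdot>\<^sub>m root_mat n (dual n b) (dual n a)" if "a < 2 * n" "b < 2 * n" for a b
    using root_mat_carrier[of n a b] root_mat_carrier[of n "dual n b" "dual n a"] that
    by (intro eq_matI) (auto simp: root_mat_index)
  have smult: "\<rho> (k \<cdot>\<^sub>m root_mat n a b) x = k *\<^sub>C \<rho> (root_mat n a b) x" if "a < 2 * n" "b < 2 * n" for a b k
    using o_repD(6)[OF rep root_mat_o_alg[OF that] xW] .
  show ?thesis
  proof (cases "c < n")
    case True
    show ?thesis
    proof (cases "d < n")
      case True
      then show ?thesis using \<open>c < n\<close> cd pos1[of c d] by (simp add: height_def)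
    next
      case False
      define j where "j = d - n"
      have j: "d = j + n" "j < n" using False cd by (auto simp: j_def)
      consider "c < j" | "c = j" | "j < c" by linarith
      then show ?thesis
      proof cases
        case 1
        then show ?thesis using pos2[of c j] j by simp
      next
        case 2
        then have "root_mat n c d = 0 \<cdot>\<^sub>m root_mat n c d"
          using root_mat_carrier[of n c d] cd j
          by (intro eq_matI) (auto simp: root_mat_index dual_def)
        then show ?thesis
          using smult[OF cd(1,2), of 0] by simp
      next
        case 3
        have "dual n d = j" "dual n c = c + n" using j \<open>c < n\<close> by (auto simp: dual_def)
        then show ?thesis
          using neg[OF cd(1,2)] smult[of j "c + n" "-1"] pos2[OF 3 \<open>c < n\<close>] j \<open>c < n\<close> by simp
      qed
    qed
  next
    case False
    define i where "i = c - n"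
    have i: "c = i + n" "i < n" using False cd by (auto simp: i_def)
    have "d \<ge> n" using cd False by (auto simp: height_def split: if_splits)
    define j where "j = d - n"
    have j: "d = j + n" "j < n" using \<open>d \<ge> n\<close> cd by (auto simp: j_def)
    have "j < i" using cd i j by (simp add: height_def)
    have "dual n d = j" "dual n c = i" using i j by (auto simp: dual_def)
    then show ?thesis
      using neg[OF cd(1,2)] smult[of j i "-1"] pos1[OF \<open>j < i\<close> i(2)] j i by simp
  qed
qed

text \<open>The truncation to the first \<open>m\<close> coordinates lets the grading element,
  reached at \<open>m = n\<close>, be assembled from Cartan elements one at a time.\<close>

definition height_mat :: "nat \<Rightarrow> nat \<Rightarrow> complex mat" where
  "height_mat n m = mat (2 * n) (2 * n) (\<lambda>(a, b). if a = b \<and> a mod n < m then of_int (height n a) else 0)"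

lemma height_mat_o_alg: "height_mat n m \<in> o_alg n"
proof -
  have "dual n a mod n = a mod n" if "a < 2 * n" for a
    using that by (auto simp: dual_def mod_if)
  then show ?thesis
    unfolding o_alg_iff by (auto simp: height_mat_def height_dual dual_inj)
qed

lemma height_mat_eigenvector:
  assumes rep: "o_rep n W \<rho>" and x: "x \<in> singular_vectors n W \<rho> lam" and "m \<le> n"
  shows "\<exists>c. \<rho> (height_mat n m) x = c *\<^sub>C x"
  using assms(3)
proof (induction m)
  have xW: "x \<in> W" using x by (simp add: singular_vectors_def)
  {
    case 0
    have "height_mat n 0 = 0 \<cdot>\<^sub>m height_mat n 0"
      by (rule eq_matI) (auto simp: height_mat_def)
    then show ?case
      using o_repD(6)[OF rep height_mat_o_alg[of n 0] xW, of 0] by (intro exI[of _ 0]) simp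
  next
    case (Suc m)
    then obtain c where c: "\<rho> (height_mat n m) x = c *\<^sub>C x" by auto
    have car: "\<rho> (cartan n m) x = complex_of_real (lam ! m) *\<^sub>C x"
      using x Suc.prems by (simp add: singular_vectors_def)
    have co: "cartan n m \<in> o_alg n"
      using Suc.prems root_mat_o_alg[of m n m] by (simp add: cartan_eq_root_mat)
    have "height_mat n (Suc m) = height_mat n m + of_int (height n m) \<cdot>\<^sub>m cartan n m"
    proof (rule eq_matI)
      fix a b assume "a < dim_row (height_mat n m + of_int (height n m) \<cdot>\<^sub>m cartan n m)"
        "b < dim_col (height_mat n m + of_int (height n m) \<cdot>\<^sub>m cartan n m)"
      then have ab: "a < 2 * n" "b < 2 * n"
        by (auto simp: cartan_def elem_mat_def)
      have "a mod n = m \<longleftrightarrow> a = m \<or> a = m + n"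
        using ab Suc.prems by (auto simp: mod_if)
      then show "height_mat n (Suc m) $$ (a, b) = (height_mat n m + of_int (height n m) \<cdot>\<^sub>m cartan n m) $$ (a, b)"
        using ab Suc.prems by (auto simp: height_mat_def cartan_def elem_mat_def height_def less_Suc_eq)
    qed (auto simp: height_mat_def cartan_def elem_mat_def)
    then have "\<rho> (height_mat n (Suc m)) x = c *\<^sub>C x + of_int (height n m) *\<^sub>C (complex_of_real (lam ! m) *\<^sub>C x)"
      using o_repD(4)[OF rep height_mat_o_alg[of n m] smult_o_alg[OF co] xW] o_repD(6)[OF rep co xW] c car by simp
    then show ?case
      by (metis cvec.scale_left_distrib cvec.scale_scale)
  }
qed

lemma height_mat_commutator:
  assumes "c < 2 * n" "d < 2 * n"
  shows "height_mat n n * root_mat n c d - root_mat n c d * height_mat n n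
    = of_int (height n c - height n d) \<cdot>\<^sub>m root_mat n c d"
proof (rule eq_matI)
  let ?X = "root_mat n c d"
  fix a b assume "a < dim_row (of_int (height n c - height n d) \<cdot>\<^sub>m ?X)"
    "b < dim_col (of_int (height n c - height n d) \<cdot>\<^sub>m ?X)"
  then have ab: "a < 2 * n" "b < 2 * n" using root_mat_carrier[of n c d] by auto
  have H: "height_mat n n \<in> carrier_mat (2 * n) (2 * n)" by (simp add: height_mat_def)
  have Hi: "height_mat n n $$ (a, b) = (if a = b then of_int (height n a) else 0)" if "a < 2 * n" "b < 2 * n" for a b
    using that by (simp add: height_mat_def)
  have "(height_mat n n * ?X) $$ (a, b) = (\<Sum>e<2 * n. height_mat n n $$ (a, e) * ?X $$ (e, b))"
    using ab H root_mat_carrier[of n c d] by (simp add: scalar_prod_def atLeast0LessThan)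
  also have "\<dots> = (\<Sum>e<2 * n. if e = a then of_int (height n a) * ?X $$ (e, b) else 0)"
    using ab by (intro sum.cong refl) (simp add: Hi)
  finally have 1: "(height_mat n n * ?X) $$ (a, b) = of_int (height n a) * ?X $$ (a, b)"
    using ab by simp
  have "(?X * height_mat n n) $$ (a, b) = (\<Sum>e<2 * n. ?X $$ (a, e) * height_mat n n $$ (e, b))"
    using ab H root_mat_carrier[of n c d] by (simp add: scalar_prod_def atLeast0LessThan)
  also have "\<dots> = (\<Sum>e<2 * n. if e = b then ?X $$ (a, e) * of_int (height n b) else 0)"
    using ab by (intro sum.cong refl) (simp add: Hi)
  finally have 2: "(?X * height_mat n n) $$ (a, b) = of_int (height n b) * ?X $$ (a, b)"
    using ab by simp
  have "(height_mat n n * ?X - ?X * height_mat n n) $$ (a, b) = of_int (height n a - height n b) * ?X $$ (a, b)"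
    using 1 2 ab H root_mat_carrier[of n c d] by (simp add: algebra_simps)
  then show "(height_mat n n * ?X - ?X * height_mat n n) $$ (a, b) = (of_int (height n c - height n d) \<cdot>\<^sub>m ?X) $$ (a, b)"
    using ab assms root_mat_carrier[of n c d] by (auto simp: root_mat_index height_dual)
qed (use root_mat_carrier[of n c d] in \<open>auto simp: height_mat_def\<close>)

section \<open>The hermitian form on the Fock space\<close>

definition einner :: "nat \<Rightarrow> ext \<Rightarrow> ext \<Rightarrow> complex" where
  "einner m x y = (\<Sum>K\<in>Pow {..<m}. x K * cnj (y K))"

lemma einner_add_left: "einner m (x + y) z = einner m x z + einner m y z"
  by (simp add: einner_def fun_apply_simps algebra_simps sum.distrib)

lemma einner_scale_left: "einner m (c *\<^sub>C x) z = c * einner m x z"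
  by (simp add: einner_def fun_apply_simps mult.assoc sum_distrib_left)

lemma einner_add_right: "einner m z (x + y) = einner m z x + einner m z y"
  by (simp add: einner_def fun_apply_simps algebra_simps sum.distrib)

lemma einner_scale_right: "einner m z (c *\<^sub>C x) = cnj c * einner m z x"
  by (simp add: einner_def fun_apply_simps mult_ac sum_distrib_left)

lemma einner_zero [simp]: "einner m 0 z = 0" "einner m z 0 = 0"
  by (simp_all add: einner_def zero_fun_apply)

lemma einner_diff_left: "einner m (x - y) z = einner m x z - einner m y z"
  by (simp add: einner_def fun_apply_simps algebra_simps sum_subtractf)

lemma einner_diff_right: "einner m z (x - y) = einner m z x - einner m z y"
  by (simp add: einner_def fun_apply_simps algebra_simps sum_subtractf)

lemma einner_sum_left: "einner m (\<Sum>a\<in>A. f a) z = (\<Sum>a\<in>A. einner m (f a) z)"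
  by (induction A rule: infinite_finite_induct) (simp_all add: einner_add_left)

lemma einner_sum_right: "einner m z (\<Sum>a\<in>A. f a) = (\<Sum>a\<in>A. einner m z (f a))"
  by (induction A rule: infinite_finite_induct) (simp_all add: einner_add_right)

lemma einner_self_eq_0:
  assumes "x \<in> ext_space m" "einner m x x = 0"
  shows "x = 0"
proof
  fix K
  have "complex_of_real (\<Sum>K\<in>Pow {..<m}. (cmod (x K))\<^sup>2) = 0"
    using assms(2) by (simp add: einner_def complex_norm_square del: of_real_power)
  then have "(\<Sum>K\<in>Pow {..<m}. (cmod (x K))\<^sup>2) = 0"
    by (simp only: of_real_eq_0_iff)
  then have "\<forall>K\<in>Pow {..<m}. (cmod (x K))\<^sup>2 = 0"
    by (subst (asm) sum_nonneg_eq_0_iff) auto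
  then show "x K = 0 K"
    using assms(1) by (auto simp: ext_space_def zero_fun_apply)
qed

lemma einner_fop:
  assumes p: "p < m"
  shows "einner m (fop b p x) y = einner m x (fop (\<not> b) p y)"
proof -
  have "einner m (fop b p x) y = (\<Sum>K\<in>Pow {..<m}. fop b p x (flip p K) * cnj (y (flip p K)))"
    unfolding einner_def
    by (rule sum.reindex_bij_witness[of _ "flip p" "flip p"]) (use p in \<open>auto simp: flip_subset_iff simp del: mem_flip\<close>)
  also have "\<dots> = einner m x (fop (\<not> b) p y)"
    unfolding einner_def
    by (intro sum.cong refl) (auto simp: fop_def nsign_flip, simp_all add: nsign_def)
  finally show ?thesis .
qed

lemma einner_gam:
  assumes "k < N" "a < 2 * n"
  shows "einner (N * n) (gam n k a x) y = einner (N * n) x (gam n k (dual n a) y)"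
proof -
  have "n > 0" using assms by (cases n) auto
  moreover have "dual n a mod n = a mod n" "dual n a < n \<longleftrightarrow> \<not> a < n"
    using assms by (auto simp: dual_def mod_if)
  ultimately show ?thesis
    using assms by (simp add: gam_def einner_fop index_less)
qed

lemma spin_ext_root_mat:
  assumes "c < 2 * n" "d < 2 * n"
  shows "spin_ext N n (root_mat n c d) x
    = (\<Sum>k<N. (1 / 2) *\<^sub>C (gam n k c (gam n k (dual n d) x) - gam n k (dual n d) (gam n k c x)))"
  unfolding spin_ext_def
proof (rule sum.cong[OF refl])
  fix k
  let ?g = "\<lambda>a b. (1 / 2) *\<^sub>C gam n k b (gam n k (dual n a) x)"
  have "(\<Sum>a<2 * n. \<Sum>b<2 * n. (root_mat n c d $$ (b, a) / 2) *\<^sub>C gam n k b (gam n k (dual n a) x))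
    = (\<Sum>a<2 * n. \<Sum>b<2 * n. (if a = d then if b = c then ?g a b else 0 else 0)
        - (if a = dual n c then if b = dual n d then ?g a b else 0 else 0))"
  proof (rule sum.cong[OF refl], rule sum.cong[OF refl])
    fix a b assume "a \<in> {..<2 * n}" "b \<in> {..<2 * n}"
    then have ab: "b < 2 * n" "a < 2 * n" by auto
    have ind: "(((if P \<and> Q then 1 else 0) - (if R \<and> S then 1 else 0)) / 2) *\<^sub>C v
      = (if Q then if P then (1 / 2) *\<^sub>C v else 0 else 0) - (if S then if R then (1 / 2) *\<^sub>C v else 0 else 0)"
      for P Q R S and v :: ext
      by (cases P; cases Q; cases R; cases S) simp_all
    show "(root_mat n c d $$ (b, a) / 2) *\<^sub>C gam n k b (gam n k (dual n a) x)
      = (if a = d then if b = c then ?g a b else 0 else 0) - (if a = dual n c then if b = dual n d then ?g a b else 0 else 0)"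
      unfolding root_mat_index[OF ab] by (rule ind)
  qed
  also have "\<dots> = (\<Sum>a<2 * n. if a = d then \<Sum>b<2 * n. if b = c then ?g a b else 0 else 0)
      - (\<Sum>a<2 * n. if a = dual n c then \<Sum>b<2 * n. if b = dual n d then ?g a b else 0 else 0)"
    unfolding sum_subtractf by (intro arg_cong2[where f = minus] sum.cong refl) auto
  also have "\<dots> = ?g d c - ?g (dual n c) (dual n d)"
    using assms by simp
  finally show "(\<Sum>a<2 * n. \<Sum>b<2 * n. (root_mat n c d $$ (b, a) / 2) *\<^sub>C gam n k b (gam n k (dual n a) x))
    = (1 / 2) *\<^sub>C (gam n k c (gam n k (dual n d) x) - gam n k (dual n d) (gam n k c x))"
    using assms by (simp add: cvec.scale_right_diff_distrib)
qed

text \<open>Creation and annihilation of one generator are adjoint to each other, so the adjoint of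
  a root vector is its transpose: the form is contravariant, and it is positive definite.\<close>

lemma einner_spin_ext_root_mat:
  assumes cd: "c < 2 * n" "d < 2 * n"
  shows "einner (N * n) (spin_ext N n (root_mat n c d) x) y = einner (N * n) x (spin_ext N n (root_mat n d c) y)"
  unfolding spin_ext_root_mat[OF cd] spin_ext_root_mat[OF cd(2,1)] einner_sum_left einner_sum_right
  using cd by (intro sum.cong refl)
    (simp add: einner_scale_left einner_scale_right einner_diff_left einner_diff_right einner_gam)

text \<open>The graph of the homomorphism to be constructed, as the span of what the lowering
  operators make of the pair \<open>x0\<close>, \<open>y0\<close>. Admitting only lowering operators
  keeps the top coefficient under control; stability under the whole algebra is the content of
  \<open>R_act\<close>.\<close>

inductive hw_rel :: "nat \<Rightarrow> nat \<Rightarrow> (complex mat \<Rightarrow> 'l::complex_vector \<Rightarrow> 'l) \<Rightarrow> 'l \<Rightarrow> ext \<Rightarrow> 'l \<Rightarrow> ext \<Rightarrow> bool"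
  for N n \<rho> x0 y0 where
  base: "hw_rel N n \<rho> x0 y0 x0 y0"
| lower: "hw_rel N n \<rho> x0 y0 u v \<Longrightarrow> c < 2 * n \<Longrightarrow> d < 2 * n \<Longrightarrow> height n c < height n d \<Longrightarrow>
    hw_rel N n \<rho> x0 y0 (\<rho> (root_mat n c d) u) (spin_ext N n (root_mat n c d) v)"
| add: "hw_rel N n \<rho> x0 y0 u v \<Longrightarrow> hw_rel N n \<rho> x0 y0 u' v' \<Longrightarrow> hw_rel N n \<rho> x0 y0 (u + u') (v + v')"
| scale: "hw_rel N n \<rho> x0 y0 u v \<Longrightarrow> hw_rel N n \<rho> x0 y0 (a *\<^sub>C u) (a *\<^sub>C v)"

lemma irreducible_subrep_eq:
  assumes irr: "o_irreducible n L \<rho>" and W: "cvec.subspace W" "W \<subseteq> L"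
    and inv: "\<And>A x. A \<in> o_alg n \<Longrightarrow> x \<in> W \<Longrightarrow> \<rho> A x \<in> W" and x: "x \<in> W" "x \<noteq> 0"
  shows "W = L"
proof -
  have "W = {0} \<or> W = L"
    using irr W inv unfolding o_irreducible_def by (simp add: image_subset_iff)
  then show ?thesis using x by blast
qed

context
  fixes N n :: nat and L :: "'l::complex_vector set" and \<rho> lam x0 y0
  assumes irr: "o_irreducible n L \<rho>"
    and x0: "x0 \<in> singular_vectors n L \<rho> lam" "x0 \<noteq> 0"
    and y0: "y0 \<in> singular_vectors n (ext_space (N * n)) (spin_ext N n) lam"
begin

private abbreviation (input) "\<sigma> \<equiv> spin_ext N n"
private abbreviation (input) "W \<equiv> ext_space (N * n)"
private abbreviation (input) "R \<equiv> hw_rel N n \<rho> x0 y0"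
private abbreviation (input) "ip \<equiv> einner (N * n)"

private lemma repL: "o_rep n L \<rho>"
  using irr by (simp add: o_irreducible_def)

private lemma repW: "o_rep n W \<sigma>"
  by (rule o_rep_spin_ext)

private lemma subL: "cvec.subspace L"
  using repL by (simp add: o_rep_def)

private lemma x0L: "x0 \<in> L" and y0W: "y0 \<in> W"
  using x0 y0 by (auto simp: singular_vectors_def)

private lemma R_mem: "R u v \<Longrightarrow> u \<in> L \<and> v \<in> W"
  by (induction rule: hw_rel.induct)
     (auto simp: x0L y0W root_mat_o_alg spin_ext_ext_space
       intro!: o_repD(1)[OF repL] cvec.subspace_add[OF subL] cvec.subspace_scale[OF subL] ext_space_add ext_space_scale)

private lemma R_zero: "R 0 0"
  using hw_rel.scale[OF hw_rel.base, of N n \<rho> x0 y0 0] by simp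

private lemma R_diff: "R u v \<Longrightarrow> R u' v' \<Longrightarrow> R (u - u') (v - v')"
  using hw_rel.add[OF _ hw_rel.scale[of N n \<rho> x0 y0 u' v' "-1"], of u v] by simp

text \<open>Induction over the derivation. On the starting pair raising operators give 0 and Cartan
  elements the same scalar on both sides. Past a lowering operator X an element A is moved by AX =
  [A, X] + XA, which is why the induction ranges over all A simultaneously.\<close>

private lemma R_act: "R u v \<Longrightarrow> A \<in> o_alg n \<Longrightarrow> R (\<rho> A u) (\<sigma> A v)"
proof (induction arbitrary: A rule: hw_rel.induct)
  case base
  from base show ?case
  proof (induction rule: o_alg_induct)
    case zero
    have z: "(0\<^sub>m (2 * n) (2 * n) :: complex mat) = 0 \<cdot>\<^sub>m 0\<^sub>m (2 * n) (2 * n)"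
      by (rule eq_matI) auto
    have "\<rho> (0\<^sub>m (2 * n) (2 * n)) x0 = 0"
      by (subst z, subst o_repD(6)[OF repL zero_o_alg x0L]) simp
    moreover have "\<sigma> (0\<^sub>m (2 * n) (2 * n)) y0 = 0"
      by (subst z, subst o_repD(6)[OF repW zero_o_alg y0W]) simp
    ultimately show ?case using R_zero by simp
  next
    case (add A B)
    then show ?case
      using hw_rel.add by (simp add: o_repD(4)[OF repL] o_repD(4)[OF repW] x0L y0W)
  next
    case (smult c A)
    then show ?case
      using hw_rel.scale by (simp add: o_repD(6)[OF repL] o_repD(6)[OF repW] x0L y0W)
  next
    case (root c d)
    consider "height n c > height n d" | "c = d" | "height n c < height n d"
      using height_eq_iff[OF root] by linarith
    then show ?case
    proof cases
      case 1
      then show ?thesis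
        using singular_vector_raise[OF repL x0(1) root] singular_vector_raise[OF repW y0 root] R_zero by simp
    next
      case 2
      have car: "R (\<rho> (cartan n i) x0) (\<sigma> (cartan n i) y0)" if "i < n" for i
        using x0 y0 that hw_rel.scale[OF hw_rel.base] by (simp add: singular_vectors_def)
      show ?thesis
      proof (cases "c < n")
        case True
        then show ?thesis using car 2 by (simp add: cartan_eq_root_mat)
      next
        case False
        define i where "i = c - n"
        have i: "i < n" "c = i + n" using False root by (auto simp: i_def)
        have eq: "root_mat n c c = (-1) \<cdot>\<^sub>m root_mat n i i"
        proof (rule eq_matI)
          fix a b assume "a < dim_row ((-1) \<cdot>\<^sub>m root_mat n i i)" "b < dim_col ((-1) \<cdot>\<^sub>m root_mat n i i)"
          then have ab: "a < 2 * n" "b < 2 * n" using root_mat_carrier[of n i i] by auto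
          then show "root_mat n c c $$ (a, b) = ((-1) \<cdot>\<^sub>m root_mat n i i) $$ (a, b)"
            using root_mat_carrier[of n i i] i root_mat_index[OF ab, of c c] root_mat_index[OF ab, of i i]
            by (simp add: dual_def)
        qed (use root_mat_carrier[of n i i] root_mat_carrier[of n c c] in auto)
        have io: "root_mat n i i \<in> o_alg n" using i by (intro root_mat_o_alg) auto
        show ?thesis
          using 2 eq hw_rel.scale[OF car[OF i(1)], of "-1"] i(1)
          by (simp add: o_repD(6)[OF repL io x0L] o_repD(6)[OF repW io y0W] cartan_eq_root_mat)
      qed
    next
      case 3
      then show ?thesis using hw_rel.lower[OF hw_rel.base root] by simp
    qed
  qed
next
  case (lower u v c d)
  let ?X = "root_mat n c d"
  have X: "?X \<in> o_alg n" using lower by (intro root_mat_o_alg)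
  have uv: "u \<in> L" "v \<in> W" using R_mem[OF lower.hyps(1)] by auto
  have C: "A * ?X - ?X * A \<in> o_alg n" using commutator_o_alg[OF lower.prems X] .
  have "R (\<rho> (A * ?X - ?X * A) u + \<rho> ?X (\<rho> A u)) (\<sigma> (A * ?X - ?X * A) v + \<sigma> ?X (\<sigma> A v))"
    by (intro hw_rel.add lower.IH C hw_rel.lower lower.prems lower.hyps)
  then show ?case
    by (simp add: o_repD(5)[OF repL lower.prems X uv(1)] o_repD(5)[OF repW lower.prems X uv(2)])
next
  case (add u v u' v')
  then show ?case
    using hw_rel.add[OF add.IH] R_mem
    by (simp add: o_repD(2)[OF repL add.prems] o_repD(2)[OF repW add.prems])
next
  case (scale u v a)
  then show ?case
    using hw_rel.scale[OF scale.IH] R_mem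
    by (simp add: o_repD(3)[OF repL scale.prems] o_repD(3)[OF repW scale.prems])
qed

text \<open>Vectors in \<open>L\<close> of lower height than \<open>x0\<close>; \<open>\<mu>\<close> is the height eigenvalue of \<open>x0\<close>.\<close>

private definition low :: "complex \<Rightarrow> 'l set" where
  "low \<mu> = {r \<in> L. \<exists>k\<ge>1. \<rho> (height_mat n n) r = (\<mu> - of_nat k) *\<^sub>C r}"

private lemma span_low_L: "cvec.span (low \<mu>) \<subseteq> L"
  using subL by (intro cvec.span_minimal) (auto simp: low_def)

private lemma lower_shift:
  assumes r: "r \<in> L" "\<rho> (height_mat n n) r = (\<mu> - of_nat k) *\<^sub>C r"
    and cd: "c < 2 * n" "d < 2 * n" "height n c < height n d"
  shows "\<rho> (root_mat n c d) r \<in> low \<mu>"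
proof -
  let ?X = "root_mat n c d" and ?H = "height_mat n n"
  have X: "?X \<in> o_alg n" using cd by (intro root_mat_o_alg)
  define j where "j = nat (height n d - height n c)"
  have j: "j \<ge> 1" "height n c - height n d = - int j" using cd by (auto simp: j_def)
  have "\<rho> ?H (\<rho> ?X r) = \<rho> (?H * ?X - ?X * ?H) r + \<rho> ?X (\<rho> ?H r)"
    by (simp add: o_repD(5)[OF repL height_mat_o_alg X r(1)])
  also have "\<dots> = (- of_nat j) *\<^sub>C \<rho> ?X r + (\<mu> - of_nat k) *\<^sub>C \<rho> ?X r"
    unfolding height_mat_commutator[OF cd(1,2)] j(2) r(2)
    by (simp add: o_repD(6)[OF repL X r(1)] o_repD(3)[OF repL X r(1)])
  also have "\<dots> = (\<mu> - of_nat (k + j)) *\<^sub>C \<rho> ?X r"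
    unfolding cvec.scale_left_distrib[symmetric] by (rule arg_cong[where f = "\<lambda>z. z *\<^sub>C \<rho> ?X r"]) simp
  finally have eq: "\<rho> ?H (\<rho> ?X r) = (\<mu> - of_nat (k + j)) *\<^sub>C \<rho> ?X r" .
  have "\<rho> ?X r \<in> L" by (rule o_repD(1)[OF repL X r(1)])
  moreover have "k + j \<ge> 1" using j by simp
  ultimately show ?thesis
    unfolding low_def using eq by blast
qed

text \<open>Both components carry the same top coefficient \<open>a\<close>. A lowering operator
  makes it 0 on both sides: in \<open>L\<close> because the height drops, in the Fock space because
  the adjoint is a raising operator and kills \<open>y0\<close>.\<close>

private lemma R_low:
  assumes mu: "\<rho> (height_mat n n) x0 = \<mu> *\<^sub>C x0" and "R u v"
  shows "\<exists>a r. r \<in> cvec.span (low \<mu>) \<and> u = a *\<^sub>C x0 + r \<and> ip v y0 = a * ip y0 y0"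
  using assms(2)
proof (induction rule: hw_rel.induct)
  case base
  show ?case by (intro exI[of _ 1] exI[of _ 0]) (simp add: cvec.span_zero)
next
  case (lower u v c d)
  then obtain a r where r: "r \<in> cvec.span (low \<mu>)" "u = a *\<^sub>C x0 + r" by blast
  let ?X = "root_mat n c d"
  have X: "?X \<in> o_alg n" using lower by (intro root_mat_o_alg)
  have rL: "r \<in> L" using r span_low_L by blast
  have "r \<in> L \<and> \<rho> ?X r \<in> cvec.span (low \<mu>)"
    using r(1)
  proof (rule cvec.span_induct[where P = "\<lambda>r. r \<in> L \<and> \<rho> ?X r \<in> cvec.span (low \<mu>)"])
    show "cvec.subspace {r. r \<in> L \<and> \<rho> ?X r \<in> cvec.span (low \<mu>)}"
      by (rule cvec.subspaceI)
         (auto simp: o_repD(2,3,8)[OF repL X] cvec.span_zero cvec.span_add cvec.span_scale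
           cvec.subspace_0[OF subL] cvec.subspace_add[OF subL] cvec.subspace_scale[OF subL])
  next
    fix r assume "r \<in> low \<mu>"
    then obtain k where rk: "r \<in> L" "\<rho> (height_mat n n) r = (\<mu> - of_nat k) *\<^sub>C r"
      by (auto simp: low_def)
    then show "r \<in> L \<and> \<rho> ?X r \<in> cvec.span (low \<mu>)"
      using cvec.span_base[OF lower_shift[OF rk lower.hyps(2-4)]] by simp
  qed
  moreover have "\<rho> ?X x0 \<in> cvec.span (low \<mu>)"
    using lower_shift[OF x0L _ lower.hyps(2-4), of \<mu> 0] mu by (intro cvec.span_base) simp
  ultimately have "\<rho> ?X u \<in> cvec.span (low \<mu>)"
    using r(2) rL x0L cvec.subspace_scale[OF subL x0L]
    by (simp add: o_repD(2,3)[OF repL X] cvec.span_add cvec.span_scale)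
  moreover have "ip (\<sigma> ?X v) y0 = 0"
    using einner_spin_ext_root_mat[OF lower.hyps(2,3), of N v y0]
      singular_vector_raise[OF repW y0 lower.hyps(3,2,4)] by simp
  ultimately show ?case
    by (intro exI[of _ 0] exI[of _ "\<rho> ?X u"]) simp
next
  case (add u v u' v')
  then obtain a r a' r' where "r \<in> cvec.span (low \<mu>)" "u = a *\<^sub>C x0 + r" "ip v y0 = a * ip y0 y0"
    "r' \<in> cvec.span (low \<mu>)" "u' = a' *\<^sub>C x0 + r'" "ip v' y0 = a' * ip y0 y0" by blast
  then show ?case
    by (intro exI[of _ "a + a'"] exI[of _ "r + r'"])
       (simp add: cvec.span_add scaleC_add_left einner_add_left algebra_simps)
next
  case (scale u v b)
  then obtain a r where "r \<in> cvec.span (low \<mu>)" "u = a *\<^sub>C x0 + r" "ip v y0 = a * ip y0 y0" by blast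
  then show ?case
    by (intro exI[of _ "b * a"] exI[of _ "b *\<^sub>C r"])
       (simp add: cvec.span_scale scaleC_add_right einner_scale_left)
qed

text \<open>Annihilates the eigenvectors of height \<open>\<mu> - of_nat k\<close>. Products of
  these commuting operators separate \<open>x0\<close> from the span of the lower vectors.\<close>

private definition shift :: "complex \<Rightarrow> nat \<Rightarrow> 'l \<Rightarrow> 'l" where
  "shift \<mu> k u = \<rho> (height_mat n n) u - (\<mu> - of_nat k) *\<^sub>C u"

private lemma shift_L: "u \<in> L \<Longrightarrow> shift \<mu> k u \<in> L"
  unfolding shift_def
  by (intro cvec.subspace_diff[OF subL] cvec.subspace_scale[OF subL] o_repD(1)[OF repL height_mat_o_alg])

private lemma shift_add: "u \<in> L \<Longrightarrow> v \<in> L \<Longrightarrow> shift \<mu> k (u + v) = shift \<mu> k u + shift \<mu> k v"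
  by (simp add: shift_def o_repD(2)[OF repL height_mat_o_alg] scaleC_add_right)

private lemma shift_scale: "u \<in> L \<Longrightarrow> shift \<mu> k (a *\<^sub>C u) = a *\<^sub>C shift \<mu> k u"
  by (simp add: shift_def o_repD(3)[OF repL height_mat_o_alg] cvec.scale_right_diff_distrib mult.commute)

private lemma shift_zero: "shift \<mu> k 0 = 0"
  by (simp add: shift_def o_repD(8)[OF repL height_mat_o_alg])

private lemma rho_diff: "A \<in> o_alg n \<Longrightarrow> u \<in> L \<Longrightarrow> v \<in> L \<Longrightarrow> \<rho> A (u - v) = \<rho> A u - \<rho> A v"
  using o_repD(2)[OF repL, of A u "(-1) *\<^sub>C v"] o_repD(3)[OF repL, of A v "-1"]
    cvec.subspace_scale[OF subL, of v "-1"] by simp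

private lemma shift_commute: "u \<in> L \<Longrightarrow> shift \<mu> j (shift \<mu> k u) = shift \<mu> k (shift \<mu> j u)"
proof -
  assume u: "u \<in> L"
  let ?h = "\<rho> (height_mat n n)"
  have h: "?h u \<in> L" using u by (rule o_repD(1)[OF repL height_mat_o_alg])
  have e: "shift \<mu> j (shift \<mu> k u)
    = ?h (?h u) - (\<mu> - of_nat k) *\<^sub>C ?h u - ((\<mu> - of_nat j) *\<^sub>C ?h u - ((\<mu> - of_nat j) * (\<mu> - of_nat k)) *\<^sub>C u)" for j k
    unfolding shift_def using u h cvec.subspace_scale[OF subL u]
    by (simp add: rho_diff[OF height_mat_o_alg] o_repD(3)[OF repL height_mat_o_alg] cvec.scale_right_diff_distrib)
  show ?thesis
    unfolding e by (simp add: mult.commute)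
qed

private lemma foldr_shift:
  assumes "u \<in> L"
  shows "foldr (shift \<mu>) ks u \<in> L"
    and "foldr (shift \<mu>) ks (shift \<mu> k u) = shift \<mu> k (foldr (shift \<mu>) ks u)"
    and "v \<in> L \<Longrightarrow> foldr (shift \<mu>) ks (u + v) = foldr (shift \<mu>) ks u + foldr (shift \<mu>) ks v"
    and "foldr (shift \<mu>) ks (a *\<^sub>C u) = a *\<^sub>C foldr (shift \<mu>) ks u"
    and "foldr (shift \<mu>) ks 0 = 0"
proof -
  have m: "foldr (shift \<mu>) ks w \<in> L" if "w \<in> L" for w ks
    using that by (induction ks) (auto intro: shift_L)
  show "foldr (shift \<mu>) ks u \<in> L"
    using m[OF assms] .
  show "foldr (shift \<mu>) ks (shift \<mu> k u) = shift \<mu> k (foldr (shift \<mu>) ks u)"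
    by (induction ks) (simp_all add: shift_commute m assms)
  show "foldr (shift \<mu>) ks (u + v) = foldr (shift \<mu>) ks u + foldr (shift \<mu>) ks v" if "v \<in> L"
    using that by (induction ks) (simp_all add: shift_add m assms)
  show "foldr (shift \<mu>) ks (a *\<^sub>C u) = a *\<^sub>C foldr (shift \<mu>) ks u"
    by (induction ks) (simp_all add: shift_scale m assms)
  show "foldr (shift \<mu>) ks 0 = 0"
    by (induction ks) (simp_all add: shift_zero)
qed

private lemma span_low_killed:
  assumes "r \<in> cvec.span (low \<mu>)"
  shows "r \<in> L \<and> (\<exists>ks. (\<forall>k\<in>set ks. k \<ge> 1) \<and> foldr (shift \<mu>) ks r = 0)"
  using assms
proof (rule cvec.span_induct)
  let ?P = "\<lambda>r. r \<in> L \<and> (\<exists>ks. (\<forall>k\<in>set ks. k \<ge> 1) \<and> foldr (shift \<mu>) ks r = 0)"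
  show "cvec.subspace {r. ?P r}"
  proof (rule cvec.subspaceI)
    show "0 \<in> {r. ?P r}"
      using cvec.subspace_0[OF subL] by (auto intro: exI[of _ "[]"])
  next
    fix r s assume "r \<in> {r. ?P r}" "s \<in> {r. ?P r}"
    then obtain ks js where rs: "r \<in> L" "s \<in> L" and ks: "\<forall>k\<in>set ks. k \<ge> 1" "foldr (shift \<mu>) ks r = 0"
      and js: "\<forall>k\<in>set js. k \<ge> 1" "foldr (shift \<mu>) js s = 0" by blast
    have comm: "foldr (shift \<mu>) ks (foldr (shift \<mu>) ms r) = foldr (shift \<mu>) ms (foldr (shift \<mu>) ks r)" for ms
      by (induction ms) (simp_all add: foldr_shift(1,2) rs)
    have "foldr (shift \<mu>) (ks @ js) (r + s) = foldr (shift \<mu>) ks (foldr (shift \<mu>) js r)"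
      using rs js by (simp add: foldr_shift(3))
    also have "\<dots> = 0"
      using ks rs by (simp add: comm foldr_shift(5))
    finally show "r + s \<in> {r. ?P r}"
      using rs ks js cvec.subspace_add[OF subL] by (auto intro!: exI[of _ "ks @ js"])
  next
    fix a r assume "r \<in> {r. ?P r}"
    then show "a *\<^sub>C r \<in> {r. ?P r}"
      using cvec.subspace_scale[OF subL] by (fastforce simp: foldr_shift(4))
  qed
next
  fix r assume "r \<in> low \<mu>"
  then obtain k where "k \<ge> 1" "r \<in> L" "\<rho> (height_mat n n) r = (\<mu> - of_nat k) *\<^sub>C r"
    by (auto simp: low_def)
  then show "r \<in> L \<and> (\<exists>ks. (\<forall>k\<in>set ks. k \<ge> 1) \<and> foldr (shift \<mu>) ks r = 0)"
    by (auto intro!: exI[of _ "[k]"] simp: shift_def)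
qed

text \<open>A suitable product of shifts with all \<open>k \<ge> 1\<close> kills \<open>r\<close>,
  but multiplies \<open>x0\<close> by the product of the \<open>k\<close>, which is not 0.\<close>

private lemma x0_low_independent:
  assumes mu: "\<rho> (height_mat n n) x0 = \<mu> *\<^sub>C x0"
    and r: "r \<in> cvec.span (low \<mu>)" and z: "a *\<^sub>C x0 + r = 0"
  shows "a = 0"
proof -
  obtain ks where rL: "r \<in> L" and ks: "\<forall>k\<in>set ks. k \<ge> 1" "foldr (shift \<mu>) ks r = 0"
    using span_low_killed[OF r] by blast
  have "foldr (shift \<mu>) ks x0 = of_nat (prod_list ks) *\<^sub>C x0" for ks
  proof (induction ks)
    case (Cons k ks)
    have "shift \<mu> k x0 = of_nat k *\<^sub>C x0"
      by (simp add: shift_def mu cvec.scale_left_diff_distrib)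
    then show ?case
      using Cons by (simp add: shift_scale x0L mult.commute)
  qed simp
  then have "0 = (a * of_nat (prod_list ks)) *\<^sub>C x0"
    using arg_cong[OF z, of "foldr (shift \<mu>) ks"] ks(2) rL cvec.subspace_scale[OF subL x0L]
    by (simp add: foldr_shift(3,4)[OF _ ] x0L foldr_shift(5)[OF x0L])
  moreover have "prod_list ks \<noteq> 0"
    using ks(1) by (induction ks) auto
  ultimately show ?thesis
    using x0(2) by simp
qed

text \<open>The second components lying over 0 are stable under the algebra and orthogonal to
  \<open>y0\<close>. By contravariance they are orthogonal to every second component in the graph,
  hence each is orthogonal to itself and vanishes.\<close>

private lemma R_zero_iff: "R 0 z \<Longrightarrow> z = 0"
proof -
  obtain \<mu> where mu: "\<rho> (height_mat n n) x0 = \<mu> *\<^sub>C x0"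
    using height_mat_eigenvector[OF repL x0(1) order_refl] by blast
  have perp: "ip z y0 = 0" if "R 0 z" for z
    using R_low[OF mu that] x0_low_independent[OF mu] by (metis mult_zero_left)
  have all: "R u v \<Longrightarrow> R 0 z \<Longrightarrow> ip z v = 0" for u v z
  proof (induction arbitrary: z rule: hw_rel.induct)
    case base
    then show ?case by (rule perp)
  next
    case (lower u v c d)
    have X: "root_mat n d c \<in> o_alg n" using lower by (intro root_mat_o_alg)
    have "R 0 (\<sigma> (root_mat n d c) z)"
      using R_act[OF lower.prems X] by (simp add: o_repD(8)[OF repL X])
    from lower.IH[OF this] show ?case
      using einner_spin_ext_root_mat[OF lower.hyps(3,2), of N z v] by simp
  qed (simp_all add: einner_add_right einner_scale_right)
  assume z: "R 0 z"
  then show "z = 0"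
    using all[OF z z] R_mem[OF z] einner_self_eq_0 by blast
qed

private lemma R_unique: "R u v \<Longrightarrow> R u v' \<Longrightarrow> v = v'"
  using R_zero_iff[of "v - v'"] R_diff[of u v u v'] by simp

private lemma R_total: "u \<in> L \<Longrightarrow> \<exists>v. R u v"
proof -
  have "{u. \<exists>v. R u v} = L"
  proof (rule irreducible_subrep_eq[OF irr])
    show "cvec.subspace {u. \<exists>v. R u v}"
      by (rule cvec.subspaceI) (use R_zero hw_rel.add hw_rel.scale in blast)+
    show "{u. \<exists>v. R u v} \<subseteq> L" using R_mem by blast
    show "\<rho> A x \<in> {u. \<exists>v. R u v}" if "A \<in> o_alg n" "x \<in> {u. \<exists>v. R u v}" for A x
      using that R_act by blast
    show "x0 \<in> {u. \<exists>v. R u v}" using hw_rel.base by blast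
  qed (rule x0(2))
  then show "u \<in> L \<Longrightarrow> \<exists>v. R u v" by blast
qed

lemma ex_hom_to_ext:
  "\<exists>f. f x0 = y0 \<and> (\<forall>u\<in>L. f u \<in> ext_space (N * n)) \<and> clinear_on L f \<and>
    (\<forall>A\<in>o_alg n. \<forall>u\<in>L. f (\<rho> A u) = spin_ext N n A (f u))"
proof -
  define f where "f u = (THE v. R u v)" for u
  have f: "f u = v" if "R u v" for u v
    unfolding f_def using that R_unique by blast
  have Rf: "R u (f u)" if "u \<in> L" for u
    using R_total[OF that] f by blast
  have "f x0 = y0" by (rule f[OF hw_rel.base])
  moreover have "\<forall>u\<in>L. f u \<in> W" using Rf R_mem by blast
  moreover have "clinear_on L f"
    unfolding clinear_on_def using f[OF hw_rel.add[OF Rf Rf]] f[OF hw_rel.scale[OF Rf]] by blast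
  moreover have "\<forall>A\<in>o_alg n. \<forall>u\<in>L. f (\<rho> A u) = \<sigma> A (f u)"
    using f[OF R_act[OF Rf]] by blast
  ultimately show ?thesis by blast
qed

end

section \<open>Multiplicity spaces as spaces of singular vectors\<close>

text \<open>The module axioms on the target are transported along the bijection, so only those of
  the source have to be verified.\<close>

lemma O_isomorphicI:
  assumes W: "O_module N W \<rho>" and lin: "clinear_on W f" and bij: "bij_betw f W W'"
    and eq: "\<And>g x. g \<in> O_group N \<Longrightarrow> x \<in> W \<Longrightarrow> f (\<rho> g x) = \<rho>' g (f x)"
  shows "O_isomorphic N W \<rho> W' \<rho>'"
proof -
  have sub: "cvec.subspace W"
    and cl: "\<And>g x. g \<in> O_group N \<Longrightarrow> x \<in> W \<Longrightarrow> \<rho> g x \<in> W"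
    and ladd: "\<And>g x y. g \<in> O_group N \<Longrightarrow> x \<in> W \<Longrightarrow> y \<in> W \<Longrightarrow> \<rho> g (x + y) = \<rho> g x + \<rho> g y"
    and lsc: "\<And>g c x. g \<in> O_group N \<Longrightarrow> x \<in> W \<Longrightarrow> \<rho> g (c *\<^sub>C x) = c *\<^sub>C \<rho> g x"
    and mult: "\<And>g h x. g \<in> O_group N \<Longrightarrow> h \<in> O_group N \<Longrightarrow> x \<in> W \<Longrightarrow> \<rho> (g * h) x = \<rho> g (\<rho> h x)"
    and one: "\<And>x. x \<in> W \<Longrightarrow> \<rho> (1\<^sub>m N) x = x"
    using W unfolding O_module_def clinear_on_def by (auto simp: image_subset_iff)
  have fadd: "\<And>x y. x \<in> W \<Longrightarrow> y \<in> W \<Longrightarrow> f (x + y) = f x + f y"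
    and fsc: "\<And>c x. x \<in> W \<Longrightarrow> f (c *\<^sub>C x) = c *\<^sub>C f x"
    using lin unfolding clinear_on_def by auto
  have im: "W' = f ` W" using bij by (simp add: bij_betw_def)
  note wadd = cvec.subspace_add[OF sub] and wsc = cvec.subspace_scale[OF sub]
  have group: "g * h \<in> O_group N" if "g \<in> O_group N" "h \<in> O_group N" for g h
  proof -
    have c: "g \<in> carrier_mat N N" "h \<in> carrier_mat N N" "transpose_mat g * g = 1\<^sub>m N" "transpose_mat h * h = 1\<^sub>m N"
      using that by (auto simp: O_group_def)
    have "transpose_mat (g * h) * (g * h) = transpose_mat h * (transpose_mat g * (g * h))"
      using c by (simp add: transpose_mult assoc_mult_mat[of _ N N _ N _ N])
    also have "transpose_mat g * (g * h) = h"
      using c by (simp flip: assoc_mult_mat[of _ N N _ N _ N])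
    finally show ?thesis
      using c by (simp add: O_group_def)
  qed
  have oneO: "1\<^sub>m N \<in> O_group N"
    by (simp add: O_group_def)
  have "cvec.subspace W'"
    unfolding im
  proof (rule cvec.subspaceI)
    show "0 \<in> f ` W"
      using fsc[of 0 0] cvec.subspace_0[OF sub] by force
  qed (use fadd[symmetric] fsc[symmetric] wadd wsc in auto)
  moreover have "\<rho>' g ` W' \<subseteq> W'" if "g \<in> O_group N" for g
    unfolding im using eq[OF that, symmetric] cl[OF that] by auto
  moreover have "clinear_on W' (\<rho>' g)" if g: "g \<in> O_group N" for g
    unfolding clinear_on_def im
    by (auto simp: fadd[symmetric] fsc[symmetric] eq[OF g, symmetric] wadd wsc ladd[OF g] lsc[OF g] cl[OF g])
  moreover have "\<rho>' (g * h) x = \<rho>' g (\<rho>' h x)" if g: "g \<in> O_group N" and h: "h \<in> O_group N" and "x \<in> W'" for g h x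
    using that(3) unfolding im
    by (auto simp: eq[OF g, symmetric] eq[OF h, symmetric] eq[OF group[OF g h], symmetric] cl[OF h] mult[OF g h])
  moreover have "\<rho>' (1\<^sub>m N) x = x" if "x \<in> W'" for x
    using that unfolding im by (auto simp: eq[OF oneO, symmetric] one)
  ultimately have "O_module N W' \<rho>'"
    unfolding O_module_def by simp
  then show ?thesis
    unfolding O_isomorphic_def using W lin bij eq by auto
qed

lemma S_tensor_eqI:
  assumes "s \<in> S_tensor N n" "t \<in> S_tensor N n" "S_tensor_to_ext N n s = S_tensor_to_ext N n t"
  shows "s = t"
  using assms bij_betw_imp_inj_on[OF bij_betw_S_tensor_to_ext] by (auto dest: inj_onD)

lemma subspace_S_tensor: "cvec.subspace (S_tensor N n)"
  unfolding S_tensor_def by (rule subspace_tensor_space)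

lemmas S_tensor_add = cvec.subspace_add[OF subspace_S_tensor]
  and S_tensor_scale = cvec.subspace_scale[OF subspace_S_tensor]
  and S_tensor_zero = cvec.subspace_0[OF subspace_S_tensor]

context
  fixes N n :: nat and L :: "'l::complex_vector set" and \<rho>
  assumes n: "n > 0" and rep: "o_rep n L \<rho>"
begin

private abbreviation (input) "U \<equiv> U_space N n L \<rho>"
private abbreviation (input) "J \<equiv> S_tensor_to_ext N n"

private lemma U_mem: "f \<in> U \<Longrightarrow> f x \<in> S_tensor N n"
  by (cases "x \<in> L") (auto simp: U_space_def o_Hom_def S_tensor_zero)

private lemma UD:
  assumes "f \<in> U"
  shows "x \<notin> L \<Longrightarrow> f x = 0" "x \<in> L \<Longrightarrow> y \<in> L \<Longrightarrow> f (x + y) = f x + f y" "x \<in> L \<Longrightarrow> f (c *\<^sub>C x) = c *\<^sub>C f x"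
    "A \<in> o_alg n \<Longrightarrow> x \<in> L \<Longrightarrow> f (\<rho> A x) = S_tensor_o N n A (f x)"
  using assms by (auto simp: U_space_def o_Hom_def clinear_on_def)

private lemma S_O_add:
  "s \<in> S_tensor N n \<Longrightarrow> t \<in> S_tensor N n \<Longrightarrow> S_tensor_O N n g (s + t) = S_tensor_O N n g s + S_tensor_O N n g t"
  by (rule S_tensor_eqI[of _ N n])
     (simp_all add: S_tensor_to_ext_O[OF n] S_tensor_to_ext_add O_on_ext_add[OF n] S_tensor_add)

private lemma S_O_scale:
  "s \<in> S_tensor N n \<Longrightarrow> S_tensor_O N n g (c *\<^sub>C s) = c *\<^sub>C S_tensor_O N n g s"
  by (rule S_tensor_eqI[of _ N n])
     (simp_all add: S_tensor_to_ext_O[OF n] S_tensor_to_ext_scaleC O_on_ext_scaleC[OF n] S_tensor_scale)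

private lemma S_O_zero: "S_tensor_O N n g 0 = 0"
  using S_O_scale[OF S_tensor_zero, of g 0] by simp

private lemma S_O_spin:
  assumes "g \<in> O_group N" "A \<in> o_alg n" "s \<in> S_tensor N n"
  shows "S_tensor_O N n g (S_tensor_o N n A s) = S_tensor_o N n A (S_tensor_O N n g s)"
  using assms
  by (intro S_tensor_eqI[of _ N n])
     (simp_all add: S_tensor_to_ext_O[OF n] S_tensor_to_ext_spin S_tensor_o_closed
       spin_ext_O_on_ext[OF _ n] S_tensor_to_ext_ext_space)

private lemma S_tensor_o_linear:
  assumes A: "A \<in> o_alg n" and s: "s \<in> S_tensor N n"
  shows "t \<in> S_tensor N n \<Longrightarrow> S_tensor_o N n A (s + t) = S_tensor_o N n A s + S_tensor_o N n A t"
    and "S_tensor_o N n A (c *\<^sub>C s) = c *\<^sub>C S_tensor_o N n A s"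
proof -
  show "S_tensor_o N n A (s + t) = S_tensor_o N n A s + S_tensor_o N n A t" if "t \<in> S_tensor N n"
    using that by (intro S_tensor_eqI[of _ N n])
      (simp_all add: S_tensor_to_ext_spin A s S_tensor_to_ext_add spin_ext_add S_tensor_add S_tensor_o_closed)
  show "S_tensor_o N n A (c *\<^sub>C s) = c *\<^sub>C S_tensor_o N n A s"
    by (intro S_tensor_eqI[of _ N n])
      (simp_all add: S_tensor_to_ext_spin A s S_tensor_to_ext_scaleC spin_ext_scaleC S_tensor_scale S_tensor_o_closed)
qed

lemma O_module_U_space: "O_module N U (U_act N n)"
proof -
  have Lsub: "cvec.subspace L" using rep by (simp add: o_rep_def)
  note Ladd = cvec.subspace_add[OF Lsub] and Lsc = cvec.subspace_scale[OF Lsub]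
  have U_add: "f + h \<in> U" if f: "f \<in> U" and h: "h \<in> U" for f h
    unfolding U_space_def o_Hom_def clinear_on_def
    by (auto simp: plus_fun_apply UD[OF f] UD[OF h] U_mem[OF f] U_mem[OF h] S_tensor_add Ladd Lsc
        S_tensor_o_linear scaleC_add_right add_ac)
  have U_sc: "c *\<^sub>C f \<in> U" if f: "f \<in> U" for f c
    unfolding U_space_def o_Hom_def clinear_on_def
    by (auto simp: scaleC_fun_def[of c f] UD[OF f] U_mem[OF f] S_tensor_scale Ladd Lsc
        S_tensor_o_linear scaleC_add_right mult.commute)
  have "0 \<in> U"
    unfolding U_space_def o_Hom_def clinear_on_def
    using S_tensor_o_linear(2)[OF _ S_tensor_zero, of _ 0]
    by (auto simp: zero_fun_def[where 'b = spin_tensor] S_tensor_zero)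
  then have sub: "cvec.subspace U"
    by (intro cvec.subspaceI U_add U_sc)
  have act: "U_act N n g f \<in> U" if g: "g \<in> O_group N" and f: "f \<in> U" for g f
    unfolding U_space_def o_Hom_def clinear_on_def U_act_def
    by (auto simp: UD[OF f] U_mem[OF f] S_O_zero S_O_add S_O_scale S_O_spin[OF g] S_tensor_to_ext_O(2)[OF n])
  have lin: "clinear_on U (U_act N n g)" for g
    unfolding clinear_on_def U_act_def
    by (auto simp: fun_eq_iff plus_fun_apply scaleC_fun_def[where 'b = spin_tensor] U_mem S_O_add S_O_scale)
  have mult: "U_act N n (g * h) f = U_act N n g (U_act N n h f)"
    if g: "g \<in> O_group N" and h: "h \<in> O_group N" and f: "f \<in> U" for g h f
  proof
    fix x
    show "U_act N n (g * h) f x = U_act N n g (U_act N n h f) x"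
      unfolding U_act_def using O_group_carrier[OF g] O_group_carrier[OF h]
      by (intro S_tensor_eqI[of _ N n])
         (simp_all add: S_tensor_to_ext_O[OF n] O_on_ext_mult[OF _ _ n] S_tensor_to_ext_ext_space)
  qed
  have one: "U_act N n (1\<^sub>m N) f = f" if f: "f \<in> U" for f
  proof
    fix x
    show "U_act N n (1\<^sub>m N) f x = f x"
      unfolding U_act_def
      by (intro S_tensor_eqI[of _ N n])
         (simp_all add: S_tensor_to_ext_O[OF n] O_on_ext_id[OF n] S_tensor_to_ext_ext_space U_mem[OF f])
  qed
  show ?thesis
    unfolding O_module_def using sub act lin mult one by (auto simp: image_subset_iff)
qed

text \<open>Evaluation at the highest weight vector. Two homomorphisms with the same value at
  \<open>x0\<close> agree on a nonzero submodule, which is all of \<open>L\<close>; surjectivity is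
  \<open>ex_hom_to_ext\<close>.\<close>

lemma bij_betw_U_space_singular:
  assumes irr: "o_irreducible n L \<rho>" and x0: "x0 \<in> singular_vectors n L \<rho> lam" "x0 \<noteq> 0"
  shows "bij_betw (\<lambda>f. J (f x0)) U (singular_vectors n (ext_space (N * n)) (spin_ext N n) lam)"
proof -
  let ?S = "singular_vectors n (ext_space (N * n)) (spin_ext N n) lam"
  have Lsub: "cvec.subspace L" using rep by (simp add: o_rep_def)
  have x0L: "x0 \<in> L" using x0 by (simp add: singular_vectors_def)
  have car: "cartan n i \<in> o_alg n" if "i < n" for i
    using that root_mat_o_alg[of i n i] by (simp add: cartan_eq_root_mat)
  have pos: "X \<in> o_alg n" if "X \<in> pos_root_vectors n" for X
    using that unfolding pos_root_vectors_def
  proof (elim UnE CollectE exE conjE)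
    fix i j assume "X = elem_mat (2 * n) i j - elem_mat (2 * n) (j + n) (i + n)" "i < j" "j < n"
    then show ?thesis using root_mat_o_alg[of i n j] by (simp add: root_mat_def dual_def)
  next
    fix i j assume "X = elem_mat (2 * n) i (j + n) - elem_mat (2 * n) j (i + n)" "i < j" "j < n"
    then show ?thesis using root_mat_o_alg[of i n "j + n"] by (simp add: root_mat_def dual_def)
  qed
  have inj: "inj_on (\<lambda>f. J (f x0)) U"
  proof (rule inj_onI)
    fix f h assume f: "f \<in> U" and h: "h \<in> U" and "J (f x0) = J (h x0)"
    then have eq: "f x0 = h x0" using S_tensor_eqI U_mem by blast
    have "{x \<in> L. f x = h x} = L"
    proof (rule irreducible_subrep_eq[OF irr])
      show "cvec.subspace {x \<in> L. f x = h x}"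
        by (rule cvec.subspaceI)
           (use UD(3)[OF f cvec.subspace_0[OF Lsub], of 0] UD(3)[OF h cvec.subspace_0[OF Lsub], of 0] in
             \<open>auto simp: UD[OF f] UD[OF h] cvec.subspace_0[OF Lsub] cvec.subspace_add[OF Lsub] cvec.subspace_scale[OF Lsub]\<close>)
      show "x0 \<in> {x \<in> L. f x = h x}" using eq x0L by simp
    qed (auto simp: UD[OF f] UD[OF h] o_repD(1)[OF rep] x0)
    then show "f = h"
      using UD(1)[OF f] UD(1)[OF h] by (auto simp: fun_eq_iff)
  qed
  have into: "J (f x0) \<in> ?S" if f: "f \<in> U" for f
  proof -
    have t: "spin_ext N n A (J (f x0)) = J (f (\<rho> A x0))" if "A \<in> o_alg n" for A
      using that by (simp add: UD[OF f] x0L S_tensor_to_ext_spin U_mem[OF f])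
    have z: "f 0 = 0"
      using UD(3)[OF f x0L, of 0] by simp
    have "J 0 = 0"
      using S_tensor_to_ext_scaleC[of N n 0 0] by simp
    then show ?thesis
      using x0(1) unfolding singular_vectors_def
      by (auto simp: S_tensor_to_ext_ext_space t car pos UD(3)[OF f x0L] S_tensor_to_ext_scaleC z)
  qed
  have onto: "y \<in> (\<lambda>f. J (f x0)) ` U" if y: "y \<in> ?S" for y
  proof -
    obtain f where f: "f x0 = y" "\<And>u. u \<in> L \<Longrightarrow> f u \<in> ext_space (N * n)" "clinear_on L f"
      "\<And>A u. A \<in> o_alg n \<Longrightarrow> u \<in> L \<Longrightarrow> f (\<rho> A u) = spin_ext N n A (f u)"
      using ex_hom_to_ext[OF irr x0 y] by blast
    \<comment> \<open>The value 0 outside \<open>L\<close> is the normalisation built into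
      \<open>o_Hom\<close>.\<close>
    define h where "h u = (if u \<in> L then inv_into (S_tensor N n) J (f u) else 0)" for u
    have im: "J ` S_tensor N n = ext_space (N * n)"
      using bij_betw_S_tensor_to_ext by (simp add: bij_betw_def)
    have h: "h u \<in> S_tensor N n" "J (h u) = f u" if "u \<in> L" for u
      using that f(2)[OF that] inv_into_into[of "f u" J "S_tensor N n"] f_inv_into_f[of "f u" J "S_tensor N n"]
      unfolding im by (simp_all add: h_def)
    have fl: "f (x + y) = f x + f y" "f (c *\<^sub>C x) = c *\<^sub>C f x" if "x \<in> L" "y \<in> L" for x y c
      using f(3) that by (auto simp: clinear_on_def)
    have hadd: "h (x + y) = h x + h y" if "x \<in> L" "y \<in> L" for x y
      using that cvec.subspace_add[OF Lsub that]
      by (intro S_tensor_eqI[of _ N n]) (simp_all add: h S_tensor_add S_tensor_to_ext_add fl)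
    have hsc: "h (c *\<^sub>C x) = c *\<^sub>C h x" if "x \<in> L" for x c
      using that cvec.subspace_scale[OF Lsub that]
      by (intro S_tensor_eqI[of _ N n]) (simp_all add: h S_tensor_scale S_tensor_to_ext_scaleC fl)
    have hact: "h (\<rho> A x) = S_tensor_o N n A (h x)" if "A \<in> o_alg n" "x \<in> L" for A x
      using that o_repD(1)[OF rep that]
      by (intro S_tensor_eqI[of _ N n]) (simp_all add: h S_tensor_o_closed S_tensor_to_ext_spin f(4))
    have "h \<in> U"
      unfolding U_space_def o_Hom_def clinear_on_def using h hadd hsc hact by (auto simp: h_def)
    moreover have "J (h x0) = y" using h(2)[OF x0L] f(1) by simp
    ultimately show ?thesis by blast
  qed
  show ?thesis
    using inj into onto by (auto simp: bij_betw_def)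
qed

end

section \<open>Coefficients with respect to a shifted vacuum\<close>

lemma foldr_anticommuting_move:
  fixes F :: "'i \<Rightarrow> ext \<Rightarrow> ext"
  assumes anti: "\<And>a b x. F a (F b x) = - F b (F a x)" and scale: "\<And>a c x. F a (c *\<^sub>C x) = c *\<^sub>C F a x"
  shows "F a (foldr F ys v) = (-1) ^ length ys *\<^sub>C foldr F ys (F a v)"
proof (induction ys)
  case (Cons y ys)
  have "F a (F y (foldr F ys v)) = (-1) *\<^sub>C F y (F a (foldr F ys v))"
    by (subst anti) simp
  then show ?case
    using Cons by (simp add: scale)
qed simp

lemma foldr_scale:
  fixes F :: "'i \<Rightarrow> ext \<Rightarrow> ext"
  assumes scale: "\<And>a c x. F a (c *\<^sub>C x) = c *\<^sub>C F a x"
  shows "foldr F ys (c *\<^sub>C v) = c *\<^sub>C foldr F ys v"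
  by (induction ys) (simp_all add: scale)

lemma foldr_anticommuting_swap:
  fixes F :: "'i \<Rightarrow> ext \<Rightarrow> ext"
  assumes anti: "\<And>a b x. F a (F b x) = - F b (F a x)" and scale: "\<And>a c x. F a (c *\<^sub>C x) = c *\<^sub>C F a x"
  shows "foldr F (xs @ a # ys @ b # zs) v = (-1) *\<^sub>C foldr F (xs @ b # ys @ a # zs) v"
proof -
  let ?Z = "foldr F zs v" and ?e = "(-1) ^ length ys :: complex"
  have "F a (foldr F ys (F b ?Z)) = ?e *\<^sub>C foldr F ys (F a (F b ?Z))"
    by (rule foldr_anticommuting_move[OF anti scale])
  also have "F a (F b ?Z) = (-1) *\<^sub>C F b (F a ?Z)"
    by (subst anti) simp
  also have "?e *\<^sub>C foldr F ys ((-1) *\<^sub>C F b (F a ?Z)) = (-1) *\<^sub>C (?e *\<^sub>C foldr F ys (F b (F a ?Z)))"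
    by (simp only: foldr_scale[OF scale] cvec.scale_left_commute)
  also have "?e *\<^sub>C foldr F ys (F b (F a ?Z)) = F b (foldr F ys (F a ?Z))"
    by (rule foldr_anticommuting_move[OF anti scale, symmetric])
  finally have "F a (foldr F ys (F b ?Z)) = (-1) *\<^sub>C F b (foldr F ys (F a ?Z))" .
  then show ?thesis
    by (simp only: foldr_append foldr.simps comp_apply foldr_scale[OF scale])
qed

text \<open>The exponent is quantified before \<open>F\<close> and \<open>v\<close> because it
  depends only on the position of \<open>p\<close>; in a contraction over a common letter the same
  sign has to serve every summand.\<close>

lemma foldr_anticommuting_remove1:
  assumes p: "p \<in> set (cs :: 'i list)"
  shows "\<exists>k. \<forall>F :: 'i \<Rightarrow> ext \<Rightarrow> ext. \<forall>v. (\<forall>a b x. F a (F b x) = - F b (F a x)) \<longrightarrow> (\<forall>a c x. F a (c *\<^sub>C x) = c *\<^sub>C F a x) \<longrightarrow>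
    foldr F cs v = (-1) ^ k *\<^sub>C foldr F (remove1 p cs) (F p v)"
proof -
  obtain xs ys where cs: "cs = xs @ p # ys" "p \<notin> set xs"
    using split_list_first[OF p] by blast
  show ?thesis
  proof (intro exI[of _ "length ys"] allI impI)
    fix F :: "'i \<Rightarrow> ext \<Rightarrow> ext" and v
    assume anti: "\<forall>a b x. F a (F b x) = - F b (F a x)" and scale: "\<forall>a c x. F a (c *\<^sub>C x) = c *\<^sub>C F a x"
    have "F p (foldr F ys v) = (-1) ^ length ys *\<^sub>C foldr F ys (F p v)"
      using anti scale by (intro foldr_anticommuting_move) blast+
    moreover have "foldr F xs ((-1) ^ length ys *\<^sub>C foldr F ys (F p v)) = (-1) ^ length ys *\<^sub>C foldr F xs (foldr F ys (F p v))"
      using scale by (intro foldr_scale) blast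
    ultimately show "foldr F cs v = (-1) ^ length ys *\<^sub>C foldr F (remove1 p cs) (F p v)"
      using cs by (simp add: remove1_append)
  qed
qed

lemma foldr_anticommuting_transpose:
  fixes F :: "'i \<Rightarrow> ext \<Rightarrow> ext"
  assumes anti: "\<And>a b x. F a (F b x) = - F b (F a x)" and scale: "\<And>a c x. F a (c *\<^sub>C x) = c *\<^sub>C F a x"
    and cs: "distinct cs" "a \<in> set cs" "b \<in> set cs" "a \<noteq> b"
  shows "foldr F (map (swp a b) cs) v = (-1) *\<^sub>C foldr F cs v"
proof -
  have main: "foldr F (map (swp a b) (xs @ a # ys @ b # zs)) v = (-1) *\<^sub>C foldr F (xs @ a # ys @ b # zs) v"
    if "distinct (xs @ a # ys @ b # zs)" for a b and xs ys zs :: "'i list"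
  proof -
    have fixl: "map (swp a b) us = us" if "a \<notin> set us" "b \<notin> set us" for us
      using that by (induction us) auto
    have "map (swp a b) (xs @ a # ys @ b # zs) = xs @ b # ys @ a # zs"
      using that by (simp add: fixl)
    then show ?thesis
      using foldr_anticommuting_swap[where F = F, OF anti scale, where xs = xs and a = b and ys = ys and b = a and zs = zs and v = v]
      by (simp only:)
  qed
  obtain xs us where xs: "cs = xs @ a # us" using split_list cs(2) by metis
  show ?thesis
  proof (cases "b \<in> set us")
    case True
    then obtain ys zs where "us = ys @ b # zs" using split_list by metis
    then show ?thesis using main[of xs a ys b zs] cs(1) xs by simp
  next
    case False
    then have "b \<in> set xs" using cs xs by auto
    then obtain ys zs where "xs = ys @ b # zs" using split_list by metis
    then show ?thesis using main[of ys b zs a us] cs(1) xs by (simp add: transpose_commute[of b a])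
  qed
qed

lemma foldr_anticommuting_permutes:
  fixes F :: "'i \<Rightarrow> ext \<Rightarrow> ext"
  assumes anti: "\<And>a b x. F a (F b x) = - F b (F a x)" and scale: "\<And>a c x. F a (c *\<^sub>C x) = c *\<^sub>C F a x"
    and cs: "distinct cs" and p: "p permutes set cs"
  shows "foldr F (map p cs) v = of_int (sign p) *\<^sub>C foldr F cs v"
  using p
proof (rule permutes_induct)
  show "foldr F (map id cs) v = of_int (sign id) *\<^sub>C foldr F cs v"
    by (simp add: sign_id)
next
  fix a b p assume ab: "a \<in> set cs" "b \<in> set cs" "a \<noteq> b"
    and IH: "foldr F (map p cs) v = of_int (sign p) *\<^sub>C foldr F cs v" and p: "p permutes set cs"
  have "set (map p cs) = set cs" "distinct (map p cs)"
    using permutes_image[OF p] cs permutes_inj_on[OF p] by (auto simp: distinct_map)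
  then have "foldr F (map (swp a b) (map p cs)) v = (-1) *\<^sub>C foldr F (map p cs) v"
    using ab by (intro foldr_anticommuting_transpose[OF anti scale]) auto
  moreover have "sign (swp a b \<circ> p) = - sign p"
    using ab sign_compose[OF permutation_swap_id[of a b] permutes_finite_permutation[OF p]] by (simp add: sign_swap_id)
  ultimately show "foldr F (map (swp a b \<circ> p) cs) v = of_int (sign (swp a b \<circ> p)) *\<^sub>C foldr F cs v"
    by (simp add: IH)
qed simp

text \<open>\<open>fm P m\<close> annihilates and \<open>fmd P m\<close> creates with respect to the vacuum \<open>bvec P\<close>.\<close>

definition fm :: "nat set \<Rightarrow> nat \<Rightarrow> ext \<Rightarrow> ext" where
  "fm P m = fop (m \<in> P) m"

definition fmd :: "nat set \<Rightarrow> nat \<Rightarrow> ext \<Rightarrow> ext" where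
  "fmd P m = fop (m \<notin> P) m"

lemma fm_anti: "fm P a (fm P b x) = - fm P b (fm P a x)"
  unfolding fm_def by (subst fop_anticommute) auto

lemma fm_fmd: "fmd P a (fm P b x) = (if a = b then x else 0) - fm P b (fmd P a x)"
  unfolding fm_def fmd_def by (subst fop_anticommute) auto

lemma fm_scaleC: "fm P a (c *\<^sub>C x) = c *\<^sub>C fm P a x"
  and fm_add: "fm P a (x + y) = fm P a x + fm P a y"
  and fm_diff: "fm P a (x - y) = fm P a x - fm P a y"
  and fm_zero [simp]: "fm P a 0 = 0"
  and fm_sum: "fm P a (\<Sum>s\<in>S. f s) = (\<Sum>s\<in>S. fm P a (f s))"
  by (simp_all add: fm_def fop_scaleC fop_add fop_diff fop_sum fop_minus)

lemma fmd_vacuum: "fmd P m x P = 0"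
  by (simp add: fmd_def fop_def)

lemma foldr_fm_linear:
  "foldr (\<lambda>c. fm P (h c)) cs (x + y) = foldr (\<lambda>c. fm P (h c)) cs x + foldr (\<lambda>c. fm P (h c)) cs y"
  "foldr (\<lambda>c. fm P (h c)) cs (a *\<^sub>C x) = a *\<^sub>C foldr (\<lambda>c. fm P (h c)) cs x"
  "foldr (\<lambda>c. fm P (h c)) cs 0 = 0"
  "foldr (\<lambda>c. fm P (h c)) cs (\<Sum>s\<in>S. f s) = (\<Sum>s\<in>S. foldr (\<lambda>c. fm P (h c)) cs (f s))"
  by (induction cs) (simp_all add: fm_add fm_scaleC fm_sum)

definition flips :: "nat set \<Rightarrow> nat set \<Rightarrow> nat set" where
  "flips S K = {m. (m \<in> K) \<noteq> (m \<in> S)}"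

lemma flips_insert: "m \<notin> S \<Longrightarrow> flips (insert m S) K = flips S (flip m K)"
  by (auto simp: flips_def)

lemma foldr_fm_zero:
  assumes "\<not> distinct (map h cs) \<or> (\<exists>m\<in>h ` set cs. (m \<in> K) \<noteq> (m \<in> P))"
  shows "foldr (\<lambda>c. fm P (h c)) cs x K = 0"
  using assms
proof (induction cs arbitrary: K)
  case (Cons c cs)
  show ?case
  proof (cases "(h c \<in> K) = (h c \<in> P)")
    case True
    have "\<not> distinct (map h cs) \<or> (\<exists>m\<in>h ` set cs. (m \<in> flip (h c) K) \<noteq> (m \<in> P))"
    proof (cases "h c \<in> h ` set cs")
      case True
      then show ?thesis using \<open>(h c \<in> K) = (h c \<in> P)\<close> by (intro disjI2 bexI[of _ "h c"]) auto
    next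
      case False
      then show ?thesis using Cons.prems True by auto
    qed
    from Cons.IH[OF this] show ?thesis
      by (simp add: fm_def fop_def)
  qed (auto simp: fm_def fop_def)
qed simp

text \<open>A word of annihilators with distinct indices, evaluated at a label that looks like the
  vacuum at these indices, reads off one coefficient of \<open>x\<close>: at the label excited
  exactly there. The factor \<open>s\<close> is a product of signs; what matters is that it is
  nonzero and the same for every \<open>x\<close>.\<close>

lemma foldr_fm_coeff:
  assumes "distinct (map h cs)" "\<And>m. m \<in> h ` set cs \<Longrightarrow> (m \<in> K) = (m \<in> P)"
  shows "\<exists>s. s \<noteq> 0 \<and> (\<forall>x. foldr (\<lambda>c. fm P (h c)) cs x K = s * x (flips (h ` set cs) K))"
  using assms
proof (induction cs arbitrary: K)
  case Nil
  show ?case by (intro exI[of _ 1]) (simp add: flips_def)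
next
  case (Cons c cs)
  have hc: "(h c \<in> K) = (h c \<in> P)" "h c \<notin> h ` set cs" using Cons.prems by auto
  have "\<exists>s. s \<noteq> 0 \<and> (\<forall>x. foldr (\<lambda>c. fm P (h c)) cs x (flip (h c) K) = s * x (flips (h ` set cs) (flip (h c) K)))"
  proof (rule Cons.IH)
    show "distinct (map h cs)" using Cons.prems by simp
    fix m assume m: "m \<in> h ` set cs"
    then have "m \<noteq> h c" using hc(2) by blast
    then show "(m \<in> flip (h c) K) = (m \<in> P)" using Cons.prems(2)[of m] m by simp
  qed
  then obtain s where s: "s \<noteq> 0"
    "\<And>x. foldr (\<lambda>c. fm P (h c)) cs x (flip (h c) K) = s * x (flips (h ` set cs) (flip (h c) K))" by blast
  have "foldr (\<lambda>c. fm P (h c)) (c # cs) x K = (nsign (h c) K * s) * x (flips (h ` set (c # cs)) K)" for x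
    using hc s(2)[of x] by (simp add: fm_def fop_def flips_insert)
  then show ?case
    using s(1) by (intro exI[of _ "nsign (h c) K * s"]) simp
qed

lemma foldr_fm_vacuum:
  assumes "distinct (map h cs)"
  shows "\<exists>s. s \<noteq> 0 \<and> (\<forall>x. foldr (\<lambda>c. fm P (h c)) cs x P = s * x (flips (h ` set cs) P))"
  by (rule foldr_fm_coeff[OF assms]) simp

text \<open>The excitations in column \<open>i\<close> over the vacuum: holes where the vacuum is
  filled, particles where it is empty.\<close>

definition occupancy :: "nat \<Rightarrow> nat \<Rightarrow> nat set \<Rightarrow> nat set \<Rightarrow> nat \<Rightarrow> nat set" where
  "occupancy N n P K i = {k. k < N \<and> (k * n + i \<in> K) \<noteq> (k * n + i \<in> P)}"

lemma finite_occupancy [simp]: "finite (occupancy N n P K i)"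
  by (simp add: occupancy_def)

lemma fm_index_distinct:
  fixes \<kappa> :: "'c \<Rightarrow> nat"
  assumes kap: "\<And>c. c \<in> set cs \<Longrightarrow> \<kappa> c < n" and cs: "distinct cs"
  shows "distinct (map (\<lambda>c. w c * n + \<kappa> c) cs) \<longleftrightarrow> inj_on (\<lambda>c. (w c, \<kappa> c)) (set cs)"
proof -
  have "w c * n + \<kappa> c = w c' * n + \<kappa> c' \<longleftrightarrow> (w c, \<kappa> c) = (w c', \<kappa> c')" if "c \<in> set cs" "c' \<in> set cs" for c c'
    using index_eq_iff[OF kap[OF that(1)] kap[OF that(2)]] by simp
  then show ?thesis
    using cs by (simp add: distinct_map inj_on_def)
qed

text \<open>In each column the cells are matched with the excitations, whose number is the same; the
  row of the excitation becomes the letter in the cell.\<close>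

lemma ex_word:
  assumes kap: "\<And>c. c \<in> set cs \<Longrightarrow> \<kappa> c < n" and cs: "distinct cs"
    and K: "K \<subseteq> {..<N * n}" and P: "P \<subseteq> {..<N * n}"
    and occ: "\<And>i. i < n \<Longrightarrow> card (occupancy N n P K i) = card {c \<in> set cs. \<kappa> c = i}"
  shows "\<exists>w \<in> set cs \<rightarrow>\<^sub>E {..<N}. distinct (map (\<lambda>c. w c * n + \<kappa> c) cs) \<and> flips ((\<lambda>c. w c * n + \<kappa> c) ` set cs) P = K"
proof -
  have "\<exists>b. bij_betw b {c \<in> set cs. \<kappa> c = i} (occupancy N n P K i)" if "i < n" for i
    using occ[OF that] by (intro finite_same_card_bij) auto
  then obtain b where b: "\<And>i. i < n \<Longrightarrow> bij_betw (b i) {c \<in> set cs. \<kappa> c = i} (occupancy N n P K i)"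
    by metis
  define w where "w = (\<lambda>c\<in>set cs. b (\<kappa> c) c)"
  have wb: "w c = b (\<kappa> c) c" "w c \<in> occupancy N n P K (\<kappa> c)" if "c \<in> set cs" for c
    using that bij_betw_apply[OF b[OF kap[OF that]], of c] by (auto simp: w_def)
  have "w \<in> set cs \<rightarrow>\<^sub>E {..<N}"
    using wb(2) by (auto simp: w_def occupancy_def)
  moreover have "inj_on (\<lambda>c. (w c, \<kappa> c)) (set cs)"
  proof (rule inj_onI)
    fix c c' assume c: "c \<in> set cs" "c' \<in> set cs" and eq: "(w c, \<kappa> c) = (w c', \<kappa> c')"
    then have "b (\<kappa> c) c = b (\<kappa> c) c'" using wb(1)[OF c(1)] wb(1)[OF c(2)] by (metis Pair_inject)
    then show "c = c'"
      using bij_betw_imp_inj_on[OF b[OF kap[OF c(1)]]] c eq by (auto dest: inj_onD)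
  qed
  moreover have "flips ((\<lambda>c. w c * n + \<kappa> c) ` set cs) P = K"
  proof -
    have "m \<in> (\<lambda>c. w c * n + \<kappa> c) ` set cs \<longleftrightarrow> (m \<in> K) \<noteq> (m \<in> P)" for m
    proof
      assume "m \<in> (\<lambda>c. w c * n + \<kappa> c) ` set cs"
      then show "(m \<in> K) \<noteq> (m \<in> P)" using wb(2) by (auto simp: occupancy_def)
    next
      assume ne: "(m \<in> K) \<noteq> (m \<in> P)"
      then have "m < N * n" using K P by auto
      then have n: "n > 0" by (cases n) auto
      have i: "m mod n < n" "m div n < N" using n \<open>m < N * n\<close> by (auto simp: less_mult_imp_div_less)
      then have "m div n \<in> occupancy N n P K (m mod n)" using ne by (simp add: occupancy_def)
      then have "m div n \<in> b (m mod n) ` {c \<in> set cs. \<kappa> c = m mod n}"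
        by (simp only: bij_betw_imp_surj_on[OF b[OF i(1)]])
      then obtain c where c: "c \<in> set cs" "\<kappa> c = m mod n" "b (m mod n) c = m div n"
        by auto
      then have "m = w c * n + \<kappa> c" using wb(1)[OF c(1)] by simp
      then show "m \<in> (\<lambda>c. w c * n + \<kappa> c) ` set cs" using c(1) by blast
    qed
    then show ?thesis by (auto simp: flips_def)
  qed
  ultimately show ?thesis
    using fm_index_distinct[OF kap cs, where w = w] by (intro bexI[of _ w]) simp_all
qed

text \<open>Every label in the support is reached by some word, so the coefficient tensor determines
  the vector. The column map \<open>\<kappa>\<close> is a parameter because transfers and
  contractions lead to vectors with other numbers of cells in the columns.\<close>

lemma fm_nondegenerate:
  assumes kap: "\<And>c. c \<in> set cs \<Longrightarrow> \<kappa> c < n" and cs: "distinct cs" and P: "P \<subseteq> {..<N * n}"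
    and x: "x \<in> ext_space (N * n)"
    and occ: "\<And>K i. x K \<noteq> 0 \<Longrightarrow> i < n \<Longrightarrow> card (occupancy N n P K i) = card {c \<in> set cs. \<kappa> c = i}"
    and zero: "\<And>w. w \<in> set cs \<rightarrow>\<^sub>E {..<N} \<Longrightarrow> foldr (\<lambda>c. fm P (w c * n + \<kappa> c)) cs x P = 0"
  shows "x = 0"
proof
  fix K
  show "x K = 0 K"
  proof (rule ccontr)
    assume "x K \<noteq> 0 K"
    then have nz: "x K \<noteq> 0" by (simp add: zero_fun_apply)
    then have K: "K \<subseteq> {..<N * n}" using x by (auto simp: ext_space_def)
    obtain w where w: "w \<in> set cs \<rightarrow>\<^sub>E {..<N}" "distinct (map (\<lambda>c. w c * n + \<kappa> c) cs)"
      "flips ((\<lambda>c. w c * n + \<kappa> c) ` set cs) P = K"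
      by (rule bexE[OF ex_word[OF kap cs K P occ[OF nz]]]) simp_all
    obtain s where "s \<noteq> 0" "foldr (\<lambda>c. fm P (w c * n + \<kappa> c)) cs x P = s * x K"
      using foldr_fm_vacuum[OF w(2), of P] w(3) by auto
    then show False using zero[OF w(1)] nz by simp
  qed
qed

lemma occupancy_flips:
  assumes kap: "\<And>c. c \<in> set cs \<Longrightarrow> \<kappa> c < n" and inj: "inj_on (\<lambda>c. (w c, \<kappa> c)) (set cs)"
    and w: "w \<in> set cs \<rightarrow>\<^sub>E {..<N}" and i: "i < n"
  shows "card (occupancy N n P (flips ((\<lambda>c. w c * n + \<kappa> c) ` set cs) P) i) = card {c \<in> set cs. \<kappa> c = i}"
proof -
  have "occupancy N n P (flips ((\<lambda>c. w c * n + \<kappa> c) ` set cs) P) i = w ` {c \<in> set cs. \<kappa> c = i}"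
  proof -
    have "k * n + i \<in> (\<lambda>c. w c * n + \<kappa> c) ` set cs \<longleftrightarrow> k \<in> w ` {c \<in> set cs. \<kappa> c = i}" for k
      using kap i by (auto simp: index_eq_iff image_iff)
    moreover have "k < N" if "k \<in> w ` {c \<in> set cs. \<kappa> c = i}" for k
      using that w by (auto simp: PiE_iff)
    ultimately show ?thesis
      unfolding occupancy_def flips_def by blast
  qed
  moreover have "inj_on w {c \<in> set cs. \<kappa> c = i}"
    using inj by (auto simp: inj_on_def)
  ultimately show ?thesis
    by (simp add: card_image)
qed

text \<open>For each label of the right type one word \<open>wK\<close> is chosen, and
  \<open>x\<close> is defined by the value of \<open>t\<close> there. Any other word for this label
  differs by a permutation inside the columns, under which both sides change by its sign; a word
  repeating a letter in a column gives 0 on both sides.\<close>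

lemma fm_surjective:
  fixes t :: "('c \<Rightarrow> nat) \<Rightarrow> complex"
  assumes kap: "\<And>c. c \<in> set cs \<Longrightarrow> \<kappa> c < n" and cs: "distinct cs" and P: "P \<subseteq> {..<N * n}"
    and t: "t \<in> tensor_space (set cs) {..<N}"
    and anti: "\<And>\<sigma> w. \<sigma> permutes set cs \<Longrightarrow> (\<forall>c\<in>set cs. \<kappa> (\<sigma> c) = \<kappa> c) \<Longrightarrow> t (w \<circ> \<sigma>) = of_int (sign \<sigma>) * t w"
  shows "\<exists>x \<in> ext_space (N * n).
      (\<forall>K i. x K \<noteq> 0 \<longrightarrow> i < n \<longrightarrow> card (occupancy N n P K i) = card {c \<in> set cs. \<kappa> c = i}) \<and>
      (\<forall>w \<in> set cs \<rightarrow>\<^sub>E {..<N}. foldr (\<lambda>c. fm P (w c * n + \<kappa> c)) cs x P = t w)"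
proof -
  let ?h = "\<lambda>w c. w c * n + \<kappa> c"
  let ?W = "set cs \<rightarrow>\<^sub>E {..<N}"
  define good where "good K \<longleftrightarrow> K \<subseteq> {..<N * n} \<and> (\<forall>i<n. card (occupancy N n P K i) = card {c \<in> set cs. \<kappa> c = i})" for K
  define Q where "Q K w s \<longleftrightarrow> w \<in> ?W \<and> distinct (map (?h w) cs) \<and> flips (?h w ` set cs) P = K \<and> s \<noteq> 0
      \<and> (\<forall>x. foldr (\<lambda>c. fm P (?h w c)) cs x P = s * x K)" for K w s
  have ex: "\<exists>w s. Q K w s" if "good K" for K
  proof -
    have gK: "K \<subseteq> {..<N * n}" "\<And>i. i < n \<Longrightarrow> card (occupancy N n P K i) = card {c \<in> set cs. \<kappa> c = i}"
      using \<open>good K\<close> by (auto simp: good_def)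
    obtain w where w: "w \<in> ?W" "distinct (map (?h w) cs)" "flips (?h w ` set cs) P = K"
      by (rule bexE[OF ex_word[OF kap cs gK(1) P gK(2)]]) simp_all
    obtain s where "s \<noteq> 0" "\<forall>x. foldr (\<lambda>c. fm P (?h w c)) cs x P = s * x K"
      using foldr_fm_vacuum[OF w(2), of P] unfolding w(3) by blast
    with w show ?thesis
      by (intro exI[of _ w] exI[of _ s]) (simp add: Q_def)
  qed
  then have "\<forall>K. \<exists>z. good K \<longrightarrow> Q K (fst z) (snd z)"
    by auto
  then obtain z where z: "\<And>K. good K \<Longrightarrow> Q K (fst (z K)) (snd (z K))"
    using choice[of "\<lambda>K z. good K \<longrightarrow> Q K (fst z) (snd z)"] by auto
  define wK where "wK K = fst (z K)" for K
  define sK where "sK K = snd (z K)" for K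
  have wK: "wK K \<in> ?W" "distinct (map (?h (wK K)) cs)" "flips (?h (wK K) ` set cs) P = K" "sK K \<noteq> 0"
    "\<And>x. foldr (\<lambda>c. fm P (?h (wK K) c)) cs x P = sK K * x K" if "good K" for K
    using z[OF that] unfolding Q_def wK_def sK_def by simp_all
  define x where "x K = (if good K then t (wK K) / sK K else 0)" for K
  have V: "foldr (\<lambda>c. fm P (?h w c)) cs x P = t w" if w: "w \<in> ?W" for w
  proof (cases "inj_on (\<lambda>c. (w c, \<kappa> c)) (set cs)")
    case False
    then have "\<not> distinct (map (?h w) cs)" using fm_index_distinct[OF kap cs, where w = w] by simp
    then have z: "foldr (\<lambda>c. fm P (?h w c)) cs x P = 0" by (intro foldr_fm_zero) simp
    obtain c c' where c: "c \<in> set cs" "c' \<in> set cs" "c \<noteq> c'" "w c = w c'" "\<kappa> c = \<kappa> c'"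
      using False by (auto simp: inj_on_def)
    have sw: "swp c c' permutes set cs" using c by (intro permutes_swap_id)
    have "\<forall>d\<in>set cs. \<kappa> (swp c c' d) = \<kappa> d" using c(5) by (auto simp: Transposition.transpose_def)
    from anti[OF sw this] have "t (w \<circ> swp c c') = - t w" using c(3) by (simp add: sign_swap_id)
    moreover have "w \<circ> swp c c' = w" using c(4) by (auto simp: fun_eq_iff Transposition.transpose_def)
    ultimately show ?thesis using z by simp
  next
    case True
    define K where "K = flips (?h w ` set cs) P"
    have "?h w c < N * n" if "c \<in> set cs" for c
      using that w kap[OF that] by (intro index_less) (auto simp: PiE_iff)
    then have "K \<subseteq> {..<N * n}" using P by (auto simp: K_def flips_def)
    then have good: "good K"
      unfolding good_def using occupancy_flips[OF kap True w] by (simp add: K_def)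
    let ?v = "wK K"
    have "m \<in> ?h w ` set cs \<longleftrightarrow> m \<in> ?h ?v ` set cs" for m
    proof -
      have "m \<in> flips (?h w ` set cs) P \<longleftrightarrow> m \<in> flips (?h ?v ` set cs) P"
        using wK(3)[OF good] by (simp add: K_def)
      then show ?thesis by (auto simp: flips_def)
    qed
    then have im: "?h w ` set cs = ?h ?v ` set cs" by blast
    have iv: "inj_on (?h ?v) (set cs)" and iw: "inj_on (?h w) (set cs)"
      using wK(2)[OF good] fm_index_distinct[OF kap cs, where w = w] True by (simp_all add: distinct_map)
    \<comment> \<open>Both words run through the same set of indices; \<open>\<sigma>\<close>
      matches the cells that carry equal indices and hence preserves
      \<open>\<kappa>\<close>.\<close>
    define \<sigma> where "\<sigma> c = (if c \<in> set cs then inv_into (set cs) (?h ?v) (?h w c) else c)" for c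
    have s: "\<sigma> c \<in> set cs" "?h ?v (\<sigma> c) = ?h w c" if "c \<in> set cs" for c
    proof -
      have m: "?h w c \<in> ?h ?v ` set cs" using im that by blast
      show "\<sigma> c \<in> set cs" using inv_into_into[OF m] that by (simp add: \<sigma>_def)
      show "?h ?v (\<sigma> c) = ?h w c" using f_inv_into_f[OF m] that by (simp add: \<sigma>_def)
    qed
    then have s': "?v (\<sigma> c) = w c" "\<kappa> (\<sigma> c) = \<kappa> c" if "c \<in> set cs" for c
      using that kap index_eq_iff[of "\<kappa> (\<sigma> c)" n "\<kappa> c"] by metis+
    have "inj_on \<sigma> (set cs)"
      using iw s(2) by (auto simp: inj_on_def) metis
    then have "bij_betw \<sigma> (set cs) (set cs)"
      using s(1) by (simp add: bij_betw_def endo_inj_surj image_subsetI)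
    then have perm: "\<sigma> permutes set cs"
      by (rule bij_imp_permutes) (simp add: \<sigma>_def)
    have wv: "w = ?v \<circ> \<sigma>"
    proof
      fix c show "w c = (?v \<circ> \<sigma>) c"
        using s'(1)[of c] PiE_arb[OF w, of c] PiE_arb[OF wK(1)[OF good], of c]
        by (cases "c \<in> set cs") (auto simp: \<sigma>_def)
    qed
    have "foldr (\<lambda>c. fm P (?h w c)) cs x = foldr (\<lambda>c. fm P (?h ?v c)) (map \<sigma> cs) x"
      unfolding foldr_map comp_def using s(2) by (intro foldr_cong) auto
    also have "\<dots> = of_int (sign \<sigma>) *\<^sub>C foldr (\<lambda>c. fm P (?h ?v c)) cs x"
      by (intro foldr_anticommuting_permutes cs perm fm_anti fm_scaleC)
    finally have "foldr (\<lambda>c. fm P (?h w c)) cs x P = of_int (sign \<sigma>) * (sK K * x K)"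
      using wK(5)[OF good, of x] by (simp add: scaleC_fun_complex_apply)
    also have "\<dots> = of_int (sign \<sigma>) * t ?v"
      using wK(4)[OF good] good by (simp add: x_def)
    also have "\<dots> = t w"
      using anti[OF perm, of ?v] s'(2) wv by simp
    finally show ?thesis .
  qed
  show ?thesis
  proof (intro bexI[of _ x] conjI allI impI ballI V)
    show "x \<in> ext_space (N * n)" by (auto simp: ext_space_def x_def good_def split: if_splits)
    show "card (occupancy N n P K i) = card {c \<in> set cs. \<kappa> c = i}" if "x K \<noteq> 0" "i < n" for K i
      using that by (auto simp: x_def good_def split: if_splits)
  qed
qed

section \<open>The half-filled vacuum\<close>

text \<open>The number of filled columns is even, so that the determinant of \<open>g\<close> does not appear.\<close>

definition hodge :: "nat \<Rightarrow> nat \<Rightarrow> bool" where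
  "hodge n i \<longleftrightarrow> i < 2 * (n div 2)"

definition pvac :: "nat \<Rightarrow> nat \<Rightarrow> nat set" where
  "pvac N n = {m. m < N * n \<and> hodge n (m mod n)}"

lemma pvac_subset: "pvac N n \<subseteq> {..<N * n}"
  by (auto simp: pvac_def)

lemma pvac_iff: "k < N \<Longrightarrow> i < n \<Longrightarrow> k * n + i \<in> pvac N n \<longleftrightarrow> hodge n i"
  by (simp add: pvac_def index_less)

text \<open>A label other than the vacuum differs from it at some \<open>m\<close>, so its basis
  vector arises by exciting \<open>m\<close> in another one. The group turns this operator into a
  combination of operators of the same kind in the same column, and none of their outputs has a
  vacuum component.\<close>

lemma O_on_ext_vacuum_scalar:
  assumes g: "g \<in> O_group N" and n: "n > 0" and x: "x \<in> ext_space (N * n)"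
  shows "O_on_ext N n g x (pvac N n) = O_on_ext N n g (bvec (pvac N n)) (pvac N n) * x (pvac N n)"
  using x
proof (induction rule: ext_space_induct_basis)
  case (add x y)
  then show ?case
    unfolding O_on_ext_add[OF n] plus_fun_apply[of _ _ "pvac N n"] by (simp add: algebra_simps)
next
  case (scale c x)
  then show ?case
    unfolding O_on_ext_scaleC[OF n] scaleC_fun_complex_apply[of _ _ "pvac N n"] by simp
next
  case (bvec K)
  let ?P = "pvac N n"
  show ?case
  proof (cases "K = ?P")
    case True
    then show ?thesis by (simp add: bvec_def)
  next
    case False
    then obtain m where m: "(m \<in> K) \<noteq> (m \<in> ?P)" by blast
    then have mN: "m < N * n" using bvec pvac_subset by auto
    define i where "i = m mod n"
    have i: "i < n" "m div n < N" using n mN by (auto simp: i_def less_mult_imp_div_less)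
    have mi: "m = m div n * n + i" by (simp add: i_def)
    have hm: "m \<in> ?P \<longleftrightarrow> hodge n i" using mN by (simp add: pvac_def i_def)
    define I where "I = flip m K"
    have I: "I \<subseteq> {..<N * n}" using bvec mN by (simp add: I_def flip_subset_iff)
    have "bvec K = nsign m I *\<^sub>C fop (\<not> hodge n i) m (bvec I)"
      using m hm by (simp add: fop_bvec I_def)
    then have "O_on_ext N n g (bvec K) = nsign m I *\<^sub>C O_on_ext N n g (fop (\<not> hodge n i) (m div n * n + i) (bvec I))"
      using mi by (simp add: O_on_ext_scaleC[OF n])
    also have "\<dots> = nsign m I *\<^sub>C rotop N n g (\<not> hodge n i) (m div n) i (O_on_ext N n g (bvec I))"
      by (simp only: O_on_ext_fop[OF g bvec_ext_space[OF I] i(2,1)])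
    finally have "O_on_ext N n g (bvec K) ?P = 0"
      using i by (simp add: rotop_def fun_apply_simps sum_fun_apply fop_def pvac_iff)
    then show ?thesis using False by (simp add: bvec_def)
  qed
qed

text \<open>For \<open>m = N\<close> this is one of the quadratic invariants; the shorter sums serve
  the induction that computes its powers.\<close>

definition pair_op :: "nat \<Rightarrow> nat \<Rightarrow> nat \<Rightarrow> nat \<Rightarrow> ext \<Rightarrow> ext" where
  "pair_op n i j m x = (\<Sum>k<m. fop True (k * n + i) (fop True (k * n + j) x))"

fun pair_list :: "nat \<Rightarrow> nat \<Rightarrow> nat \<Rightarrow> nat \<Rightarrow> nat list" where
  "pair_list n i j 0 = []"
| "pair_list n i j (Suc m) = pair_list n i j m @ [m * n + i, m * n + j]"

lemma pair_op_add: "pair_op n i j m (x + y) = pair_op n i j m x + pair_op n i j m y"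
  and pair_op_scaleC: "pair_op n i j m (c *\<^sub>C x) = c *\<^sub>C pair_op n i j m x"
  by (simp_all add: pair_op_def fop_add fop_scaleC sum.distrib cvec.scale_sum_right)

lemma pair_op_power_scaleC: "(pair_op n i j m ^^ r) (c *\<^sub>C x) = c *\<^sub>C (pair_op n i j m ^^ r) x"
  by (induction r) (simp_all add: pair_op_scaleC)

lemma fop_True_anti: "fop True a (fop True b x) = - fop True b (fop True a x)"
  by (subst fop_anticommute) simp

lemma set_pair_list: "set (pair_list n i j m) = (\<lambda>k. k * n + i) ` {..<m} \<union> (\<lambda>k. k * n + j) ` {..<m}"
  by (induction m) (auto simp: lessThan_Suc)

lemma distinct_pair_list:
  assumes "i < n" "j < n" "i \<noteq> j"
  shows "distinct (pair_list n i j m)"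
  using assms by (induction m) (auto simp: set_pair_list index_eq_iff)

text \<open>The last summand \<open>eta\<close> commutes with the others and has square 0, so the
  binomial expansion has two terms. The one without \<open>eta\<close> vanishes, since the shorter
  sum has already filled all its places. The factorial counts the orders of filling.\<close>

lemma pair_op_power: "(pair_op n i j m ^^ m) x = of_nat (fact m) *\<^sub>C foldr (fop True) (pair_list n i j m) x"
proof (induction m arbitrary: x)
  case 0
  then show ?case by simp
next
  case (Suc m)
  let ?S = "pair_op n i j m"
  define eta where "eta x = fop True (m * n + i) (fop True (m * n + j) x)" for x
  have S: "pair_op n i j (Suc m) x = ?S x + eta x" for x
    by (simp add: pair_op_def eta_def)
  have swap: "fop True a (fop True b (fop True c (fop True d x))) = fop True c (fop True d (fop True a (fop True b x)))" for a b c d x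
  proof -
    have "fop True a (fop True b (fop True c (fop True d x))) = fop True a (fop True c (fop True d (fop True b x)))"
      by (simp add: fop_True_anti[of b c] fop_True_anti[of b d] fop_minus)
    also have "\<dots> = fop True c (fop True d (fop True a (fop True b x)))"
      by (simp add: fop_True_anti[of a c] fop_True_anti[of a d] fop_minus)
    finally show ?thesis .
  qed
  have comm: "eta (?S x) = ?S (eta x)" for x
    by (simp add: pair_op_def eta_def fop_sum swap[of "m * n + i"])
  have commr: "eta ((?S ^^ r) x) = (?S ^^ r) (eta x)" for r x
    by (induction r) (simp_all add: comm)
  have nil: "eta (eta x) = 0" for x
    by (simp add: eta_def fop_True_anti[of "m * n + j" "m * n + i"] fop_minus)
  have eta_lin: "eta (x + y) = eta x + eta y" "eta (c *\<^sub>C x) = c *\<^sub>C eta x" for x y c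
    by (simp_all add: eta_def fop_add fop_scaleC)
  have S0: "(?S ^^ r) 0 = 0" for r
    using pair_op_power_scaleC[of r n i j m 0 0] by simp
  have binom: "(pair_op n i j (Suc m) ^^ r) x = (?S ^^ r) x + of_nat r *\<^sub>C (?S ^^ (r - 1)) (eta x)" for r x
  proof (induction r)
    case (Suc r)
    have "(pair_op n i j (Suc m) ^^ Suc r) x = ?S ((pair_op n i j (Suc m) ^^ r) x) + eta ((pair_op n i j (Suc m) ^^ r) x)"
      using S[of "(pair_op n i j (Suc m) ^^ r) x"] by simp
    also have "\<dots> = ?S ((?S ^^ r) x) + of_nat r *\<^sub>C ?S ((?S ^^ (r - 1)) (eta x)) + eta ((?S ^^ r) x)"
      unfolding Suc by (simp add: pair_op_add pair_op_scaleC eta_lin commr nil S0)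
    finally have "(pair_op n i j (Suc m) ^^ Suc r) x = ?S ((?S ^^ r) x) + of_nat r *\<^sub>C ?S ((?S ^^ (r - 1)) (eta x)) + eta ((?S ^^ r) x)" .
    moreover have "of_nat r *\<^sub>C ?S ((?S ^^ (r - 1)) (eta x)) = of_nat r *\<^sub>C (?S ^^ r) (eta x)"
      by (cases r) simp_all
    ultimately show ?case
      by (simp add: commr scaleC_add_left add_ac)
  qed simp
  have "?S (foldr (fop True) (pair_list n i j m) x) = 0"
    unfolding pair_op_def
  proof (rule sum.neutral, rule ballI)
    fix k assume "k \<in> {..<m}"
    then have "k * n + j \<in> set (pair_list n i j m)" by (auto simp: set_pair_list)
    then have "fop True (k * n + j) (foldr (fop True) (pair_list n i j m) x) = 0"
      by (intro foldr_anticommuting_member[where A = UNIV] fop_True_anti fop_scaleC) auto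
    then show "fop True (k * n + i) (fop True (k * n + j) (foldr (fop True) (pair_list n i j m) x)) = 0"
      by simp
  qed
  then have "(?S ^^ Suc m) x = 0"
    using Suc.IH by (simp add: pair_op_scaleC)
  then have "(pair_op n i j (Suc m) ^^ Suc m) x = of_nat (Suc m) *\<^sub>C (?S ^^ m) (eta x)"
    using binom[of "Suc m" x] by (simp del: funpow.simps)
  also have "\<dots> = of_nat (fact (Suc m)) *\<^sub>C foldr (fop True) (pair_list n i j (Suc m)) x"
  proof -
    have "of_nat (fact (Suc m)) = (of_nat (Suc m) * of_nat (fact m) :: complex)"
      by (simp only: fact_Suc of_nat_mult of_nat_id)
    then show ?thesis
      by (simp only: Suc.IH scaleC_scaleC foldr_append eta_def pair_list.simps foldr.simps comp_apply id_apply)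
  qed
  finally show ?case .
qed

text \<open>Built from invariant operators only, yet for \<open>a = n div 2\<close> a nonzero
  multiple of the half-filled vacuum: this is what excludes the determinant character.\<close>

fun inv_vec :: "nat \<Rightarrow> nat \<Rightarrow> nat \<Rightarrow> ext" where
  "inv_vec N n 0 = ext_one"
| "inv_vec N n (Suc a) = (pair_op n (2 * a) (2 * a + 1) N ^^ N) (inv_vec N n a)"

fun inv_list :: "nat \<Rightarrow> nat \<Rightarrow> nat \<Rightarrow> nat list" where
  "inv_list N n 0 = []"
| "inv_list N n (Suc a) = pair_list n (2 * a) (2 * a + 1) N @ inv_list N n a"

lemma inv_vec_eq: "\<exists>c. c \<noteq> 0 \<and> inv_vec N n a = c *\<^sub>C foldr (fop True) (inv_list N n a) ext_one"
proof (induction a)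
  case 0
  show ?case by (intro exI[of _ 1]) simp
next
  case (Suc a)
  then obtain c where c: "c \<noteq> 0" "inv_vec N n a = c *\<^sub>C foldr (fop True) (inv_list N n a) ext_one" by blast
  then show ?case
    by (intro exI[of _ "c * of_nat (fact N)"]) (simp add: pair_op_power foldr_scale[of "fop True", OF fop_scaleC] mult.commute)
qed

lemma inv_list:
  assumes "2 * a \<le> n"
  shows "distinct (inv_list N n a) \<and> set (inv_list N n a) = {k * n + i |k i. k < N \<and> i < 2 * a}"
  using assms
proof (induction a)
  case (Suc a)
  have IH: "distinct (inv_list N n a)" "set (inv_list N n a) = {k * n + i |k i. k < N \<and> i < 2 * a}"
    using Suc by auto
  define j where "j = 2 * a + 1"
  have j: "j < n" "2 * a < n" "j \<noteq> 2 * a" "\<And>i. i < 2 * a \<Longrightarrow> i \<noteq> j"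
    using Suc.prems by (auto simp: j_def)
  have "set (pair_list n (2 * a) j N) \<inter> set (inv_list N n a) = {}"
    using j by (fastforce simp: IH(2) set_pair_list index_eq_iff)
  moreover have "distinct (pair_list n (2 * a) j N)"
    using j by (intro distinct_pair_list) auto
  moreover have "set (pair_list n (2 * a) j N) \<union> set (inv_list N n a) = {k * n + i |k i. k < N \<and> i < 2 * Suc a}"
  proof -
    have i: "i < 2 * Suc a \<longleftrightarrow> i < 2 * a \<or> i = 2 * a \<or> i = j" for i by (auto simp: j_def)
    show ?thesis unfolding i IH(2) set_pair_list by blast
  qed
  ultimately show ?case using IH(1) by (simp add: j_def)
qed simp

lemma O_on_ext_inv_vec:
  assumes g: "g \<in> O_group N" and n: "n > 0" and "2 * a \<le> n"
  shows "inv_vec N n a \<in> ext_space (N * n) \<and> O_on_ext N n g (inv_vec N n a) = inv_vec N n a"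
  using assms(3)
proof (induction a)
  case 0
  then show ?case by (simp add: ext_one_ext_space O_on_ext_one[OF n])
next
  case (Suc a)
  have i: "2 * a < n" "2 * a + 1 < n" using Suc.prems by auto
  let ?O = "pair_op n (2 * a) (2 * a + 1) N"
  have mem: "?O x \<in> ext_space (N * n)" if "x \<in> ext_space (N * n)" for x
    unfolding pair_op_def using that i by (intro ext_space_sum fop_ext_space index_less) auto
  have inv: "O_on_ext N n g (?O x) = ?O (O_on_ext N n g x)" if "x \<in> ext_space (N * n)" for x
  proof -
    have "O_on_ext N n g (?O x) = (\<Sum>k<N. rotop N n g True k (2 * a) (rotop N n g True k (2 * a + 1) (O_on_ext N n g x)))"
      unfolding pair_op_def O_on_ext_sum[OF n]
    proof (rule sum.cong[OF refl])
      fix k assume "k \<in> {..<N}"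
      then have k: "k < N" by simp
      have "fop True (k * n + (2 * a + 1)) x \<in> ext_space (N * n)"
        using that k i by (intro fop_ext_space index_less)
      then show "O_on_ext N n g (fop True (k * n + 2 * a) (fop True (k * n + (2 * a + 1)) x))
        = rotop N n g True k (2 * a) (rotop N n g True k (2 * a + 1) (O_on_ext N n g x))"
        by (simp only: O_on_ext_fop[OF g _ k i(1)] O_on_ext_fop[OF g that k i(2)])
    qed
    then show ?thesis
      by (simp only: sum_rotop_rotop[OF g] pair_op_def)
  qed
  have "(?O ^^ r) (inv_vec N n a) \<in> ext_space (N * n) \<and> O_on_ext N n g ((?O ^^ r) (inv_vec N n a)) = (?O ^^ r) (inv_vec N n a)" for r
    using Suc by (induction r) (auto simp: mem[simplified] inv[simplified])
  then show ?case by simp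
qed

text \<open>The scalar of \<open>O_on_ext_vacuum_scalar\<close> can be computed on any vector with a
  nonzero vacuum coefficient, and \<open>inv_vec N n (n div 2)\<close> is such a vector fixed by
  \<open>g\<close>.\<close>

lemma O_on_ext_vacuum:
  assumes g: "g \<in> O_group N" and n: "n > 0" and x: "x \<in> ext_space (N * n)"
  shows "O_on_ext N n g x (pvac N n) = x (pvac N n)"
proof -
  let ?P = "pvac N n" and ?a = "n div 2"
  let ?ms = "inv_list N n ?a"
  have a: "2 * ?a \<le> n" by simp
  have ms: "distinct ?ms" "set ?ms = {k * n + i |k i. k < N \<and> i < 2 * ?a}"
    using inv_list[OF a] by auto
  have setms: "set ?ms = ?P"
  proof -
    have "m \<in> ?P \<longleftrightarrow> (\<exists>k i. m = k * n + i \<and> k < N \<and> i < 2 * ?a)" for m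
    proof
      assume "m \<in> ?P"
      then have "m = m div n * n + m mod n" "m div n < N" "m mod n < 2 * ?a"
        by (auto simp: pvac_def hodge_def less_mult_imp_div_less)
      then show "\<exists>k i. m = k * n + i \<and> k < N \<and> i < 2 * ?a" by blast
    next
      assume "\<exists>k i. m = k * n + i \<and> k < N \<and> i < 2 * ?a"
      then show "m \<in> ?P" using a by (auto simp: pvac_iff hodge_def)
    qed
    then show ?thesis using ms(2) by blast
  qed
  obtain s where s: "s \<noteq> 0" "\<And>x. foldr (\<lambda>c. fm ?P c) ?ms x ?P = s * x (flips (set ?ms) ?P)"
    using foldr_fm_vacuum[of "\<lambda>c. c" ?ms ?P] ms(1) by auto
  have "foldr (fop True) ?ms ext_one = foldr (\<lambda>c. fm ?P c) ?ms ext_one"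
    using setms by (intro foldr_cong) (auto simp: fm_def)
  moreover have "flips (set ?ms) ?P = {}"
    by (simp add: setms flips_def)
  ultimately have "foldr (fop True) ?ms ext_one ?P \<noteq> 0"
    using s by (simp add: ext_one_def)
  moreover obtain c where "c \<noteq> 0" "inv_vec N n ?a = c *\<^sub>C foldr (fop True) ?ms ext_one"
    using inv_vec_eq by blast
  ultimately have nz: "inv_vec N n ?a ?P \<noteq> 0"
    by (simp add: scaleC_fun_complex_apply)
  have "O_on_ext N n g (bvec ?P) ?P * inv_vec N n ?a ?P = inv_vec N n ?a ?P"
    using O_on_ext_vacuum_scalar[OF g n, of "inv_vec N n ?a"] O_on_ext_inv_vec[OF g n a] by simp
  then have "O_on_ext N n g (bvec ?P) ?P = 1"
    using nz by simp
  then show ?thesis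
    using O_on_ext_vacuum_scalar[OF g n x] by simp
qed

section \<open>Coefficients of a transformed vector\<close>

lemma sum_PiE_insert:
  assumes "c \<notin> S"
  shows "(\<Sum>u\<in>insert c S \<rightarrow>\<^sub>E B. f u) = (\<Sum>a\<in>B. \<Sum>u\<in>S \<rightarrow>\<^sub>E B. f (u(c := a)))"
proof -
  have inj: "inj_on (\<lambda>(y, g). g(c := y)) (B \<times> (S \<rightarrow>\<^sub>E B))"
    using inj_combinator[OF assms, of "\<lambda>_. B"] by simp
  show ?thesis
    unfolding PiE_insert_eq sum.reindex[OF inj] by (simp add: sum.cartesian_product case_prod_unfold)
qed

lemma fm_ext_space: "x \<in> ext_space (N * n) \<Longrightarrow> k < N \<Longrightarrow> i < n \<Longrightarrow> fm P (k * n + i) x \<in> ext_space (N * n)"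
  unfolding fm_def by (intro fop_ext_space index_less)

text \<open>\<open>O_on_ext_fop\<close> solved for the unrotated operator: the rows of
  \<open>g\<close> are orthonormal, so summing against row \<open>k\<close> undoes the
  rotation.\<close>

lemma fm_O_on_ext:
  assumes g: "g \<in> O_group N" and x: "x \<in> ext_space (N * n)" and k: "k < N" and i: "i < n"
  shows "fm (pvac N n) (k * n + i) (O_on_ext N n g x)
    = O_on_ext N n g (\<Sum>a<N. g $$ (k, a) *\<^sub>C fm (pvac N n) (a * n + i) x)"
proof -
  let ?G = "O_on_ext N n g" and ?b = "hodge n i"
  have n: "n > 0" using i by simp
  have fmb: "fm (pvac N n) (a * n + i) = fop ?b (a * n + i)" if "a < N" for a
    using pvac_iff[OF that i] by (simp add: fm_def)
  have "?G (\<Sum>a<N. g $$ (k, a) *\<^sub>C fm (pvac N n) (a * n + i) x) = (\<Sum>a<N. g $$ (k, a) *\<^sub>C rotop N n g ?b a i (?G x))"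
    by (simp add: O_on_ext_sum[OF n] O_on_ext_scaleC[OF n] fmb O_on_ext_fop[OF g x _ i])
  also have "\<dots> = (\<Sum>l<N. (\<Sum>a<N. g $$ (k, a) * g $$ (l, a)) *\<^sub>C fop ?b (l * n + i) (?G x))"
    unfolding rotop_def cvec.scale_sum_right cvec.scale_sum_left
    by (subst sum.swap) simp
  also have "\<dots> = (\<Sum>l<N. if l = k then fop ?b (l * n + i) (?G x) else 0)"
    using O_group_rows[OF g k] by (intro sum.cong refl) auto
  also have "\<dots> = fm (pvac N n) (k * n + i) (?G x)"
    using k by (simp add: fmb)
  finally show ?thesis ..
qed

lemma foldr_fm_ext_space:
  assumes "\<And>c. c \<in> set cs \<Longrightarrow> w c < N \<and> \<kappa> c < n" "x \<in> ext_space (N * n)"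
  shows "foldr (\<lambda>c. fm P (w c * n + \<kappa> c)) cs x \<in> ext_space (N * n)"
  using assms by (induction cs) (auto intro: fm_ext_space)

text \<open>Carrying a whole word through \<open>g\<close> produces the matrix entries of a tensor
  power of \<open>g\<close>, the kernel that appears in \<open>R_act\<close>.\<close>

lemma foldr_fm_O_on_ext:
  assumes g: "g \<in> O_group N" and n: "n > 0" and x: "x \<in> ext_space (N * n)" and cs: "distinct cs"
    and w: "\<And>c. c \<in> set cs \<Longrightarrow> w c < N \<and> \<kappa> c < n"
  shows "foldr (\<lambda>c. fm (pvac N n) (w c * n + \<kappa> c)) cs (O_on_ext N n g x)
    = O_on_ext N n g (\<Sum>u\<in>set cs \<rightarrow>\<^sub>E {..<N}. (\<Prod>c\<in>set cs. g $$ (w c, u c)) *\<^sub>C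
        foldr (\<lambda>c. fm (pvac N n) (u c * n + \<kappa> c)) cs x)"
  using cs w
proof (induction cs)
  case Nil
  then show ?case by simp
next
  case (Cons c cs)
  let ?P = "pvac N n" and ?S = "set cs"
  let ?W = "?S \<rightarrow>\<^sub>E {..<N}"
  let ?V = "\<lambda>u. foldr (\<lambda>c. fm ?P (u c * n + \<kappa> c)) cs x"
  define Y where "Y = (\<Sum>u\<in>?W. (\<Prod>c\<in>?S. g $$ (w c, u c)) *\<^sub>C ?V u)"
  have c: "c \<notin> ?S" "w c < N" "\<kappa> c < n" using Cons.prems by auto
  have V: "?V u \<in> ext_space (N * n)" if "u \<in> ?W" for u
    using that Cons.prems(2) x by (intro foldr_fm_ext_space) (auto simp: PiE_iff)
  have Y: "Y \<in> ext_space (N * n)"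
    unfolding Y_def by (intro ext_space_sum ext_space_scale V)
  have IH: "foldr (\<lambda>c. fm ?P (w c * n + \<kappa> c)) cs (O_on_ext N n g x) = O_on_ext N n g Y"
    unfolding Y_def using Cons by simp
  have upd: "foldr (\<lambda>c'. fm ?P ((u(c := a)) c' * n + \<kappa> c')) cs x = ?V u" for u a
    using c(1) by (intro foldr_cong) auto
  have updp: "(\<Prod>c'\<in>?S. g $$ (w c', (u(c := a)) c')) = (\<Prod>c'\<in>?S. g $$ (w c', u c'))" for u a
    using c(1) by (intro prod.cong) auto
  have "foldr (\<lambda>c. fm ?P (w c * n + \<kappa> c)) (c # cs) (O_on_ext N n g x)
    = O_on_ext N n g (\<Sum>a<N. g $$ (w c, a) *\<^sub>C fm ?P (a * n + \<kappa> c) Y)"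
    using fm_O_on_ext[OF g Y c(2,3)] by (simp add: IH)
  also have "(\<Sum>a<N. g $$ (w c, a) *\<^sub>C fm ?P (a * n + \<kappa> c) Y)
    = (\<Sum>a<N. \<Sum>u\<in>?W. (g $$ (w c, a) * (\<Prod>c\<in>?S. g $$ (w c, u c))) *\<^sub>C fm ?P (a * n + \<kappa> c) (?V u))"
    by (simp add: Y_def fm_sum fm_scaleC cvec.scale_sum_right)
  also have "\<dots> = (\<Sum>u\<in>set (c # cs) \<rightarrow>\<^sub>E {..<N}. (\<Prod>c\<in>set (c # cs). g $$ (w c, u c)) *\<^sub>C
        foldr (\<lambda>c. fm ?P (u c * n + \<kappa> c)) (c # cs) x)"
    using c(1) by (simp add: sum_PiE_insert upd updp fun_upd_same del: fun_upd_apply)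
  finally show ?case .
qed

text \<open>Moves one excitation from column \<open>i\<close> to column \<open>j\<close>. For
  \<open>i < j\<close> a cell moves to the left in the diagram, whose columns are numbered in the
  opposite order.\<close>

definition transfer_op :: "nat \<Rightarrow> nat \<Rightarrow> nat set \<Rightarrow> nat \<Rightarrow> nat \<Rightarrow> ext \<Rightarrow> ext" where
  "transfer_op N n P i j x = (\<Sum>k<N. fm P (k * n + i) (fmd P (k * n + j) x))"

definition trace_op :: "nat \<Rightarrow> nat \<Rightarrow> nat set \<Rightarrow> nat \<Rightarrow> nat \<Rightarrow> ext \<Rightarrow> ext" where
  "trace_op N n P i j x = (\<Sum>k<N. fm P (k * n + i) (fm P (k * n + j) x))"

lemma transfer_op_vacuum:
  assumes "i < n" "j < n" "i \<noteq> j"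
  shows "transfer_op N n P i j x P = 0"
proof -
  have "fm P (k * n + i) (fmd P (k * n + j) x) P = 0" for k
  proof -
    have "fm P (k * n + i) (fmd P (k * n + j) x) = - fmd P (k * n + j) (fm P (k * n + i) x)"
      using fm_fmd[of P "k * n + j" "k * n + i" x] assms by (simp add: index_eq_iff)
    then show ?thesis by (simp add: fmd_vacuum uminus_apply)
  qed
  then show ?thesis by (simp add: transfer_op_def sum_fun_apply)
qed

lemma transfer_op_fm:
  assumes ij: "i < n" "j < n" and ac: "a < N" "c < n"
  shows "fm P (a * n + c) (transfer_op N n P i j x)
    = transfer_op N n P i j (fm P (a * n + c) x) - (if c = j then fm P (a * n + i) x else 0)"
proof -
  have tm: "fm P (k * n + i) (fmd P (k * n + j) (fm P (a * n + c) x))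
      = fm P (a * n + c) (fm P (k * n + i) (fmd P (k * n + j) x)) + (if k = a then if c = j then fm P (k * n + i) x else 0 else 0)" for k
  proof -
    have "fm P (k * n + i) (fmd P (k * n + j) (fm P (a * n + c) x))
      = fm P (k * n + i) ((if k = a \<and> c = j then x else 0) - fm P (a * n + c) (fmd P (k * n + j) x))"
      using ij ac by (subst fm_fmd) (auto simp: index_eq_iff)
    also have "\<dots> = (if k = a \<and> c = j then fm P (k * n + i) x else 0) - fm P (k * n + i) (fm P (a * n + c) (fmd P (k * n + j) x))"
      by (simp add: fm_diff)
    also have "fm P (k * n + i) (fm P (a * n + c) (fmd P (k * n + j) x)) = - fm P (a * n + c) (fm P (k * n + i) (fmd P (k * n + j) x))"
      by (rule fm_anti)
    finally show ?thesis by (simp only: diff_minus_eq_add add.commute if_if_eq_conj)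
  qed
  have "transfer_op N n P i j (fm P (a * n + c) x)
    = fm P (a * n + c) (transfer_op N n P i j x) + (\<Sum>k<N. if k = a then if c = j then fm P (k * n + i) x else 0 else 0)"
    unfolding transfer_op_def fm_sum sum.distrib[symmetric] by (intro sum.cong refl tm)
  then show ?thesis
    using ac(1) by simp
qed

text \<open>A Leibniz rule: commuting the operator past the word relabels the cells of column
  \<open>j\<close>, one at a time, as cells of column \<open>i\<close>. The first term disappears at
  the vacuum label by \<open>transfer_op_vacuum\<close>.\<close>

lemma foldr_fm_transfer_op:
  assumes ij: "i < n" "j < n" and cs: "distinct cs" and w: "\<And>c. c \<in> set cs \<Longrightarrow> w c < N \<and> \<kappa> c < n"
  shows "foldr (\<lambda>c. fm P (w c * n + \<kappa> c)) cs (transfer_op N n P i j x)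
    = transfer_op N n P i j (foldr (\<lambda>c. fm P (w c * n + \<kappa> c)) cs x)
      - (\<Sum>p\<in>{p\<in>set cs. \<kappa> p = j}. foldr (\<lambda>c. fm P (w c * n + (\<kappa>(p := i)) c)) cs x)"
  using cs w
proof (induction cs)
  case Nil
  then show ?case by simp
next
  case (Cons c cs)
  let ?Y = "foldr (\<lambda>c. fm P (w c * n + \<kappa> c)) cs x"
  let ?Yp = "\<lambda>p. foldr (\<lambda>c. fm P (w c * n + (\<kappa>(p := i)) c)) cs x"
  have c: "c \<notin> set cs" "w c < N" "\<kappa> c < n" using Cons.prems by auto
  have IH: "foldr (\<lambda>c. fm P (w c * n + \<kappa> c)) cs (transfer_op N n P i j x)
    = transfer_op N n P i j ?Y - (\<Sum>p\<in>{p\<in>set cs. \<kappa> p = j}. ?Yp p)"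
    using Cons by simp
  have Yc: "?Yp c = ?Y"
    using c(1) by (intro foldr_cong) auto
  have up: "fm P (w c * n + (\<kappa>(p := i)) c) (?Yp p) = (if p = c then fm P (w c * n + i) ?Y else fm P (w c * n + \<kappa> c) (?Yp p))" for p
    using Yc by simp
  have sum: "(\<Sum>p\<in>{p\<in>set (c # cs). \<kappa> p = j}. fm P (w c * n + (\<kappa>(p := i)) c) (?Yp p))
    = (if \<kappa> c = j then fm P (w c * n + i) ?Y else 0) + (\<Sum>p\<in>{p\<in>set cs. \<kappa> p = j}. fm P (w c * n + \<kappa> c) (?Yp p))"
  proof -
    have r: "(\<Sum>p\<in>{p\<in>set cs. \<kappa> p = j}. fm P (w c * n + (\<kappa>(p := i)) c) (?Yp p)) = (\<Sum>p\<in>{p\<in>set cs. \<kappa> p = j}. fm P (w c * n + \<kappa> c) (?Yp p))"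
      using c(1) by (intro sum.cong refl) auto
    show ?thesis
    proof (cases "\<kappa> c = j")
      case True
      then have "{p\<in>set (c # cs). \<kappa> p = j} = insert c {p\<in>set cs. \<kappa> p = j}" by auto
      then show ?thesis using True c(1) r up[of c] by simp
    next
      case False
      then have "{p\<in>set (c # cs). \<kappa> p = j} = {p\<in>set cs. \<kappa> p = j}" by auto
      then show ?thesis using False r by simp
    qed
  qed
  have "foldr (\<lambda>c. fm P (w c * n + \<kappa> c)) (c # cs) (transfer_op N n P i j x)
    = fm P (w c * n + \<kappa> c) (transfer_op N n P i j ?Y) - (\<Sum>p\<in>{p\<in>set cs. \<kappa> p = j}. fm P (w c * n + \<kappa> c) (?Yp p))"
    by (simp add: IH fm_diff fm_sum)
  also have "\<dots> = transfer_op N n P i j (fm P (w c * n + \<kappa> c) ?Y) - (\<Sum>p\<in>{p\<in>set (c # cs). \<kappa> p = j}. fm P (w c * n + (\<kappa>(p := i)) c) (?Yp p))"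
    unfolding transfer_op_fm[OF ij c(2,3)] sum by (simp only: diff_diff_eq)
  finally show ?case by simp
qed

section \<open>Singular vectors and Weyl's construction\<close>

lemma occupancy_flip:
  assumes "k < N" "i < n" "i' < n"
  shows "occupancy N n P (flip (k * n + i) K) i' = (if i' = i then flip k (occupancy N n P K i') else occupancy N n P K i')"
proof -
  have "l \<in> occupancy N n P (flip (k * n + i) K) i' \<longleftrightarrow>
      l \<in> (if i' = i then flip k (occupancy N n P K i') else occupancy N n P K i')" for l
    using assms index_eq_iff[OF assms(3,2), of l k]
    by (cases "i' = i"; cases "l = k") (simp_all add: occupancy_def)
  then show ?thesis by blast
qed

lemma card_flip: "finite S \<Longrightarrow> card (flip k S) = (if k \<in> S then card S - 1 else card S + 1)"
  by (simp add: flip_def)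

lemma occupancy_transfer_op:
  assumes ij: "i < n" "j < n" "i \<noteq> j" and nz: "transfer_op N n P i j x K \<noteq> 0"
  obtains K' where "x K' \<noteq> 0" "card (occupancy N n P K' i) = card (occupancy N n P K i) + 1"
    "card (occupancy N n P K j) = card (occupancy N n P K' j) + 1"
    "\<And>l. l < n \<Longrightarrow> l \<noteq> i \<Longrightarrow> l \<noteq> j \<Longrightarrow> occupancy N n P K' l = occupancy N n P K l"
proof -
  obtain k where k: "k < N" and kz: "fm P (k * n + i) (fmd P (k * n + j) x) K \<noteq> 0"
    using nz unfolding transfer_op_def sum_fun_apply by (auto elim: sum.not_neutral_contains_not_neutral)
  define K' where "K' = flip (k * n + j) (flip (k * n + i) K)"
  have x: "x K' \<noteq> 0" and ki: "k \<notin> occupancy N n P K i" and kj: "k \<in> occupancy N n P K j"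
    using kz ij k by (auto simp: fm_def fmd_def fop_def K'_def occupancy_def index_eq_iff split: if_splits)
  have occ: "occupancy N n P K' l = (if l = i then flip k (occupancy N n P K i) else if l = j then flip k (occupancy N n P K j) else occupancy N n P K l)"
    if "l < n" for l
    unfolding K'_def occupancy_flip[OF k ij(2) that] occupancy_flip[OF k ij(1) that] using ij(3) by simp
  have "card (occupancy N n P K j) > 0" using kj by (auto simp: card_gt_0_iff)
  then show ?thesis
    using that[OF x] occ ij ki kj by (simp add: card_flip)
qed

lemma occupancy_trace_op:
  assumes ij: "i < n" "j < n" "i \<noteq> j" and nz: "trace_op N n P i j x K \<noteq> 0"
  obtains K' where "x K' \<noteq> 0" "card (occupancy N n P K' i) = card (occupancy N n P K i) + 1"
    "card (occupancy N n P K' j) = card (occupancy N n P K j) + 1"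
    "\<And>l. l < n \<Longrightarrow> l \<noteq> i \<Longrightarrow> l \<noteq> j \<Longrightarrow> occupancy N n P K' l = occupancy N n P K l"
proof -
  obtain k where k: "k < N" and kz: "fm P (k * n + i) (fm P (k * n + j) x) K \<noteq> 0"
    using nz unfolding trace_op_def sum_fun_apply by (auto elim: sum.not_neutral_contains_not_neutral)
  define K' where "K' = flip (k * n + j) (flip (k * n + i) K)"
  have x: "x K' \<noteq> 0" and ki: "k \<notin> occupancy N n P K i" and kj: "k \<notin> occupancy N n P K j"
    using kz ij k by (auto simp: fm_def fop_def K'_def occupancy_def index_eq_iff split: if_splits)
  have occ: "occupancy N n P K' l = (if l = i then flip k (occupancy N n P K i) else if l = j then flip k (occupancy N n P K j) else occupancy N n P K l)"
    if "l < n" for l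
    unfolding K'_def occupancy_flip[OF k ij(2) that] occupancy_flip[OF k ij(1) that] using ij(3) by simp
  then show ?thesis
    using that[OF x] ij ki kj by (simp add: card_flip)
qed

lemma transfer_op_ext_space: "x \<in> ext_space (N * n) \<Longrightarrow> i < n \<Longrightarrow> j < n \<Longrightarrow> transfer_op N n P i j x \<in> ext_space (N * n)"
  unfolding transfer_op_def fm_def fmd_def by (intro ext_space_sum fop_ext_space index_less) auto

lemma trace_op_ext_space: "x \<in> ext_space (N * n) \<Longrightarrow> i < n \<Longrightarrow> j < n \<Longrightarrow> trace_op N n P i j x \<in> ext_space (N * n)"
  unfolding trace_op_def fm_def by (intro ext_space_sum fop_ext_space index_less) auto

text \<open>The column of a cell, numbered from the right end as the basis of \<open>E\<close>.\<close>

definition cell_col :: "nat \<Rightarrow> nat \<times> nat \<Rightarrow> nat" where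
  "cell_col n c = n - 1 - snd c"

definition cell_coeff :: "nat \<Rightarrow> nat \<Rightarrow> (nat \<times> nat) list \<Rightarrow> ext \<Rightarrow> cell_tensor" where
  "cell_coeff N n cs x = (\<lambda>w. if w \<in> set cs \<rightarrow>\<^sub>E {..<N}
     then foldr (\<lambda>c. fm (pvac N n) (w c * n + cell_col n c)) cs x (pvac N n) else 0)"

text \<open>The weight condition, expressed through excitations over the half-filled vacuum.\<close>

definition typed_space :: "nat \<Rightarrow> nat \<Rightarrow> diagram \<Rightarrow> ext set" where
  "typed_space N n \<nu> = {x \<in> ext_space (N * n). \<forall>K i. x K \<noteq> 0 \<longrightarrow> i < n \<longrightarrow>
     card (occupancy N n (pvac N n) K i) = card {c \<in> \<nu>. cell_col n c = i}}"

definition hw_space :: "nat \<Rightarrow> nat \<Rightarrow> diagram \<Rightarrow> ext set" where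
  "hw_space N n \<nu> = {x \<in> typed_space N n \<nu>. \<forall>i j. i < j \<longrightarrow> j < n \<longrightarrow>
     transfer_op N n (pvac N n) i j x = 0 \<and> trace_op N n (pvac N n) i j x = 0}"

lemma cell_coeff_add: "cell_coeff N n cs (x + y) = cell_coeff N n cs x + cell_coeff N n cs y"
proof
  fix w
  show "cell_coeff N n cs (x + y) w = (cell_coeff N n cs x + cell_coeff N n cs y) w"
    unfolding plus_fun_apply[of _ _ w] cell_coeff_def foldr_fm_linear plus_fun_apply[of _ _ "pvac N n"] by simp
qed

lemma cell_coeff_scaleC: "cell_coeff N n cs (a *\<^sub>C x) = a *\<^sub>C cell_coeff N n cs x"
proof
  fix w
  show "cell_coeff N n cs (a *\<^sub>C x) w = (a *\<^sub>C cell_coeff N n cs x) w"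
    unfolding scaleC_fun_complex_apply[of _ _ w] cell_coeff_def foldr_fm_linear scaleC_fun_complex_apply[of _ _ "pvac N n"] by simp
qed

context
  fixes N n :: nat and \<nu> :: diagram and cs :: "(nat \<times> nat) list"
  assumes n: "n > 0" and young: "young_diagram \<nu>" and cols: "\<And>c. c \<in> \<nu> \<Longrightarrow> snd c < n"
    and cs: "distinct cs" "set cs = \<nu>"
begin

private abbreviation (input) "P \<equiv> pvac N n"
private abbreviation (input) "\<kappa> \<equiv> cell_col n"
private abbreviation (input) "words \<equiv> \<nu> \<rightarrow>\<^sub>E {..<N}"
private abbreviation (input) "\<Phi> \<equiv> cell_coeff N n cs"
private abbreviation (input) "vfold k w x \<equiv> foldr (\<lambda>c. fm P (w c * n + k c)) cs x"

private lemma kap: "\<kappa> c < n"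
  using n by (simp add: cell_col_def)

private lemma fin: "finite \<nu>"
  using young by (simp add: young_diagram_def)

private lemma Phi_in: "w \<in> words \<Longrightarrow> \<Phi> x w = vfold \<kappa> w x P"
  and Phi_out: "w \<notin> words \<Longrightarrow> \<Phi> x w = 0"
  by (simp_all add: cell_coeff_def cs)

private lemma W_less: "w \<in> words \<Longrightarrow> c \<in> set cs \<Longrightarrow> w c < N"
  by (auto simp: cs PiE_iff)

private lemma fold_permutes:
  assumes p: "\<sigma> permutes \<nu>"
  shows "vfold (k \<circ> \<sigma>) (w \<circ> \<sigma>) x = of_int (sign \<sigma>) *\<^sub>C vfold k w x"
proof -
  have "vfold (k \<circ> \<sigma>) (w \<circ> \<sigma>) x = foldr (\<lambda>c. fm P (w c * n + k c)) (map \<sigma> cs) x"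
    by (simp add: foldr_map comp_def)
  also have "\<dots> = of_int (sign \<sigma>) *\<^sub>C vfold k w x"
    using p cs by (intro foldr_anticommuting_permutes fm_anti fm_scaleC) simp_all
  finally show ?thesis .
qed

private lemma Phi_anti:
  assumes p: "\<sigma> permutes \<nu>" and k: "\<And>c. c \<in> \<nu> \<Longrightarrow> \<kappa> (\<sigma> c) = \<kappa> c"
  shows "\<Phi> x (w \<circ> \<sigma>) = of_int (sign \<sigma>) * \<Phi> x w"
proof (cases "w \<in> words")
  case True
  have m: "w \<circ> \<sigma> \<in> words" using True comp_permutes_PiE_iff[OF p, of w "{..<N}"] by blast
  have "vfold \<kappa> (w \<circ> \<sigma>) x = vfold (\<kappa> \<circ> \<sigma>) (w \<circ> \<sigma>) x"
    using k cs by (intro foldr_cong) auto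
  then have "vfold \<kappa> (w \<circ> \<sigma>) x P = of_int (sign \<sigma>) * vfold \<kappa> w x P"
    using fold_permutes[OF p, where k = \<kappa> and w = w and x = x] by (simp only: scaleC_fun_complex_apply[of _ _ P])
  then show ?thesis by (simp only: Phi_in[OF True] Phi_in[OF m])
next
  case False
  then have "w \<circ> \<sigma> \<notin> words" using comp_permutes_PiE_iff[OF p, of w "{..<N}"] by blast
  then show ?thesis using False by (simp add: Phi_out)
qed

text \<open>The word is read with \<open>q\<close> assigned to column \<open>j\<close>, and the
  operator sends one cell of column \<open>j\<close> back to \<open>i\<close>. If this is
  \<open>q\<close> itself, the original assignment returns; if it is \<open>p\<close>, the columns
  of \<open>p\<close> and \<open>q\<close> are interchanged, and reordering the word turns this into
  a swap of letters with a sign. So the coefficient of the transferred vector is the defect in the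
  Garnir relation for \<open>q\<close>.\<close>

private lemma Phi_transfer:
  assumes w: "w \<in> words" and q: "q \<in> \<nu>" "\<kappa> q = i" and j: "j < n" "i \<noteq> j"
  shows "vfold (\<kappa>(q := j)) w (transfer_op N n P i j x) P
    = (\<Sum>p\<in>{p\<in>\<nu>. \<kappa> p = j}. \<Phi> x (w \<circ> swp p q)) - \<Phi> x w"
proof -
  have i: "i < n" using kap[of q] q(2) by simp
  have "vfold (\<kappa>(q := j)) w (transfer_op N n P i j x)
    = transfer_op N n P i j (vfold (\<kappa>(q := j)) w x) - (\<Sum>p\<in>{p\<in>set cs. (\<kappa>(q := j)) p = j}. vfold ((\<kappa>(q := j))(p := i)) w x)"
    using W_less[OF w] kap j by (intro foldr_fm_transfer_op[OF i j(1) cs(1)]) auto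
  then have "vfold (\<kappa>(q := j)) w (transfer_op N n P i j x) P
    = - (\<Sum>p\<in>{p\<in>set cs. (\<kappa>(q := j)) p = j}. vfold ((\<kappa>(q := j))(p := i)) w x P)"
    by (simp only: minus_apply[of _ _ P] transfer_op_vacuum[OF i j] sum_fun_apply) simp
  also have "{p\<in>set cs. (\<kappa>(q := j)) p = j} = insert q {p\<in>\<nu>. \<kappa> p = j}"
    using q cs by auto
  also have "(\<Sum>p\<in>insert q {p\<in>\<nu>. \<kappa> p = j}. vfold ((\<kappa>(q := j))(p := i)) w x P)
    = vfold ((\<kappa>(q := j))(q := i)) w x P + (\<Sum>p\<in>{p\<in>\<nu>. \<kappa> p = j}. vfold ((\<kappa>(q := j))(p := i)) w x P)"
    using q j(2) fin by (intro sum.insert) auto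
  also have "(\<kappa>(q := j))(q := i) = \<kappa>"
    using q(2) by auto
  also have "(\<Sum>p\<in>{p\<in>\<nu>. \<kappa> p = j}. vfold ((\<kappa>(q := j))(p := i)) w x P) = (\<Sum>p\<in>{p\<in>\<nu>. \<kappa> p = j}. - \<Phi> x (w \<circ> swp p q))"
  proof (rule sum.cong[OF refl])
    fix p assume "p \<in> {p\<in>\<nu>. \<kappa> p = j}"
    then have p: "p \<in> \<nu>" "\<kappa> p = j" "p \<noteq> q" using q(2) j(2) by auto
    have sw: "swp p q permutes \<nu>" using p q by (intro permutes_swap_id)
    have m: "w \<circ> swp p q \<in> words" using w comp_permutes_PiE_iff[OF sw, of w "{..<N}"] by blast
    have k: "(\<kappa>(q := j))(p := i) = \<kappa> \<circ> swp p q"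
      using p q(2) by (auto simp: fun_eq_iff Transposition.transpose_def)
    have ww: "w = (w \<circ> swp p q) \<circ> swp p q"
      by (simp add: comp_assoc)
    have "vfold ((\<kappa>(q := j))(p := i)) w x = vfold (\<kappa> \<circ> swp p q) ((w \<circ> swp p q) \<circ> swp p q) x"
      unfolding k using ww by metis
    also have "\<dots> = (-1) *\<^sub>C vfold \<kappa> (w \<circ> swp p q) x"
      unfolding fold_permutes[OF sw] using p(3) by (simp add: sign_swap_id)
    finally have "vfold ((\<kappa>(q := j))(p := i)) w x P = (-1) * vfold \<kappa> (w \<circ> swp p q) x P"
      by (simp only: scaleC_fun_complex_apply[of _ _ P])
    then show "vfold ((\<kappa>(q := j))(p := i)) w x P = - \<Phi> x (w \<circ> swp p q)"
      unfolding Phi_in[OF m] by simp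
  qed
  finally show ?thesis
    unfolding Phi_in[OF w] by (simp add: sum_negf)
qed

text \<open>Pulling \<open>q\<close> and then \<open>p\<close> to the inner end of the word costs a
  sign that depends on neither \<open>x\<close> nor \<open>w\<close>; the sum over the common letter
  then assembles \<open>trace_op\<close>.\<close>

private lemma Phi_trace:
  assumes pq: "p \<in> \<nu>" "q \<in> \<nu>" "p \<noteq> q"
  shows "\<exists>cs' e. e \<noteq> 0 \<and> distinct cs' \<and> set cs' = \<nu> - {p, q} \<and>
    (\<forall>x w. (\<forall>a<N. w(p := a, q := a) \<in> words) \<longrightarrow> (\<Sum>a<N. \<Phi> x (w(p := a, q := a)))
      = e * foldr (\<lambda>c. fm P (w c * n + \<kappa> c)) cs' (trace_op N n P (\<kappa> p) (\<kappa> q) x) P)"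
proof -
  define cq where "cq = remove1 q cs"
  define cs' where "cs' = remove1 p cq"
  have q: "q \<in> set cs" using pq cs by simp
  have dq: "distinct cq" "set cq = \<nu> - {q}" using cs by (auto simp: cq_def)
  then have p: "p \<in> set cq" using pq by simp
  have d': "distinct cs'" "set cs' = \<nu> - {p, q}" using dq by (auto simp: cs'_def)
  obtain k1 where k1: "\<And>(F :: nat \<times> nat \<Rightarrow> ext \<Rightarrow> ext) v. \<forall>a b x. F a (F b x) = - F b (F a x) \<Longrightarrow> \<forall>a c x. F a (c *\<^sub>C x) = c *\<^sub>C F a x \<Longrightarrow>
      foldr F cs v = (-1) ^ k1 *\<^sub>C foldr F cq (F q v)"
    using foldr_anticommuting_remove1[OF q] unfolding cq_def by blast
  obtain k2 where k2: "\<And>(F :: nat \<times> nat \<Rightarrow> ext \<Rightarrow> ext) v. \<forall>a b x. F a (F b x) = - F b (F a x) \<Longrightarrow> \<forall>a c x. F a (c *\<^sub>C x) = c *\<^sub>C F a x \<Longrightarrow>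
      foldr F cq v = (-1) ^ k2 *\<^sub>C foldr F cs' (F p v)"
    using foldr_anticommuting_remove1[OF p] unfolding cs'_def by blast
  let ?e = "(-1) ^ k1 * (-1) ^ k2 :: complex"
  have "(\<Sum>a<N. \<Phi> x (w(p := a, q := a))) = ?e * foldr (\<lambda>c. fm P (w c * n + \<kappa> c)) cs' (trace_op N n P (\<kappa> p) (\<kappa> q) x) P"
    if w: "\<forall>a<N. w(p := a, q := a) \<in> words" for x w
  proof -
    have "\<Phi> x (w(p := a, q := a)) = ?e * foldr (\<lambda>c. fm P (w c * n + \<kappa> c)) cs' (fm P (a * n + \<kappa> p) (fm P (a * n + \<kappa> q) x)) P"
      if a: "a < N" for a
    proof -
      let ?F = "\<lambda>c. fm P ((w(p := a, q := a)) c * n + \<kappa> c)"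
      have F: "\<forall>a b x. ?F a (?F b x) = - ?F b (?F a x)" "\<forall>a c x. ?F a (c *\<^sub>C x) = c *\<^sub>C ?F a x"
        by (intro allI fm_anti, intro allI fm_scaleC)
      have Fpq: "?F p = fm P (a * n + \<kappa> p)" "?F q = fm P (a * n + \<kappa> q)"
        using pq(3) by auto
      have "foldr ?F cs x = ?e *\<^sub>C foldr ?F cs' (?F p (?F q x))"
        unfolding k1[OF F] k2[OF F] by (simp only: scaleC_scaleC)
      also have "foldr ?F cs' (?F p (?F q x)) = foldr (\<lambda>c. fm P (w c * n + \<kappa> c)) cs' (?F p (?F q x))"
        using d'(2) by (intro foldr_cong) auto
      finally have "foldr ?F cs x P = ?e * foldr (\<lambda>c. fm P (w c * n + \<kappa> c)) cs' (fm P (a * n + \<kappa> p) (fm P (a * n + \<kappa> q) x)) P"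
        unfolding Fpq by (simp only: scaleC_fun_complex_apply[of _ _ P])
      then show ?thesis
        using w a by (simp only: Phi_in)
    qed
    then show ?thesis
      unfolding trace_op_def foldr_fm_linear(4) sum_fun_apply sum_distrib_left by simp
  qed
  then show ?thesis
    using d' by (intro exI[of _ cs'] exI[of _ ?e]) simp
qed

text \<open>Contractions inside one column vanish by antisymmetry, so tracelessness is a condition
  on pairs of different columns, as in \<open>hw_space\<close>.\<close>

private lemma trace_same_column:
  assumes "p \<in> \<nu>" "q \<in> \<nu>" "p \<noteq> q" "\<kappa> p = \<kappa> q"
  shows "\<Phi> x (w(p := a, q := a)) = 0"
proof (cases "w(p := a, q := a) \<in> words")
  case True
  have "\<not> inj_on (\<lambda>c. (w(p := a, q := a)) c * n + \<kappa> c) (set cs)"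
    using assms cs unfolding inj_on_def by (intro notI) (auto dest!: bspec[of _ _ p] bspec[of _ _ q])
  then have "\<not> distinct (map (\<lambda>c. (w(p := a, q := a)) c * n + \<kappa> c) cs)"
    by (simp add: distinct_map del: fun_upd_apply)
  then show ?thesis
    unfolding Phi_in[OF True] by (intro foldr_fm_zero disjI1)
qed (simp add: Phi_out)

private lemma typedD:
  assumes "x \<in> typed_space N n \<nu>"
  shows "x \<in> ext_space (N * n)" "x K \<noteq> 0 \<Longrightarrow> i < n \<Longrightarrow> card (occupancy N n P K i) = card {c \<in> \<nu>. \<kappa> c = i}"
  using assms by (auto simp: typed_space_def)

text \<open>The transferred vector has one cell more in column \<open>j\<close> and one fewer in
  column \<open>i\<close>, so nondegeneracy is applied with \<open>q\<close> assigned to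
  \<open>j\<close>. If column \<open>i\<close> has no cell, there is no excitation to move.\<close>

private lemma transfer_zeroI:
  assumes x: "x \<in> typed_space N n \<nu>" and ij: "i < n" "j < n" "i \<noteq> j"
    and rel: "\<And>q w. q \<in> \<nu> \<Longrightarrow> \<kappa> q = i \<Longrightarrow> w \<in> words \<Longrightarrow> (\<Sum>p\<in>{p\<in>\<nu>. \<kappa> p = j}. \<Phi> x (w \<circ> swp p q)) = \<Phi> x w"
  shows "transfer_op N n P i j x = 0"
proof (cases "\<exists>q\<in>\<nu>. \<kappa> q = i")
  case True
  then obtain q where q: "q \<in> \<nu>" "\<kappa> q = i" by blast
  let ?k = "\<kappa>(q := j)"
  show ?thesis
  proof (rule fm_nondegenerate[where \<kappa> = ?k and cs = cs and P = P])
    show "?k c < n" for c using kap ij by simp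
    show "distinct cs" "P \<subseteq> {..<N * n}" using cs pvac_subset by auto
    show "transfer_op N n P i j x \<in> ext_space (N * n)"
      using typedD(1)[OF x] ij by (intro transfer_op_ext_space)
    show "vfold ?k w (transfer_op N n P i j x) P = 0" if "w \<in> set cs \<rightarrow>\<^sub>E {..<N}" for w
      using that rel[OF q, of w] Phi_transfer[OF _ q ij(2,3), of w x] unfolding cs(2) by simp
    fix K l assume nz: "transfer_op N n P i j x K \<noteq> 0" and l: "l < n"
    obtain K' where K': "x K' \<noteq> 0" "card (occupancy N n P K' i) = card (occupancy N n P K i) + 1"
      "card (occupancy N n P K j) = card (occupancy N n P K' j) + 1"
      "\<And>l. l < n \<Longrightarrow> l \<noteq> i \<Longrightarrow> l \<noteq> j \<Longrightarrow> occupancy N n P K' l = occupancy N n P K l"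
      using occupancy_transfer_op[OF ij nz] by metis
    have ci: "{c \<in> \<nu>. \<kappa> c = i} = insert q {c \<in> set cs. ?k c = i}" "q \<notin> {c \<in> set cs. ?k c = i}"
      using q cs ij by auto
    have cj: "{c \<in> set cs. ?k c = j} = insert q {c \<in> \<nu>. \<kappa> c = j}" "q \<notin> {c \<in> \<nu>. \<kappa> c = j}"
      using q cs ij by auto
    have cl: "{c \<in> set cs. ?k c = l} = {c \<in> \<nu>. \<kappa> c = l}" if "l \<noteq> i" "l \<noteq> j"
      using q cs that by auto
    consider "l = i" | "l = j" | "l \<noteq> i" "l \<noteq> j" by blast
    then show "card (occupancy N n P K l) = card {c \<in> set cs. ?k c = l}"
    proof cases
      case 1
      have "card {c \<in> \<nu>. \<kappa> c = i} = card {c \<in> set cs. ?k c = i} + 1"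
        unfolding ci(1) using ci(2) by (subst card_insert_disjoint) auto
      then show ?thesis using typedD(2)[OF x K'(1) ij(1)] K'(2) 1 by simp
    next
      case 2
      have "card {c \<in> set cs. ?k c = j} = card {c \<in> \<nu>. \<kappa> c = j} + 1"
        unfolding cj(1) using cj(2) fin by (subst card_insert_disjoint) auto
      then show ?thesis using typedD(2)[OF x K'(1) ij(2)] K'(3) 2 by simp
    next
      case 3
      then show ?thesis using typedD(2)[OF x K'(1) l] K'(4)[OF l] cl by simp
    qed
  qed
next
  case False
  show ?thesis
  proof (rule ccontr)
    assume "transfer_op N n P i j x \<noteq> 0"
    then obtain K where "transfer_op N n P i j x K \<noteq> 0" by (auto simp: fun_eq_iff zero_fun_apply)
    from occupancy_transfer_op[OF ij this] obtain K' where "x K' \<noteq> 0"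
      "card (occupancy N n P K' i) = card (occupancy N n P K i) + 1" by metis
    moreover have "{c \<in> \<nu>. \<kappa> c = i} = {}" using False by blast
    ultimately show False using typedD(2)[OF x _ ij(1), of K'] by simp
  qed
qed

text \<open>The contraction removes a cell from each of two columns, so nondegeneracy is applied to
  the cells other than \<open>p\<close> and \<open>q\<close>. If one of the columns is empty, there
  is nothing to contract.\<close>

private lemma trace_zeroI:
  assumes x: "x \<in> typed_space N n \<nu>" and ij: "i < n" "j < n" "i \<noteq> j"
    and rel: "\<And>p q w. p \<in> \<nu> \<Longrightarrow> q \<in> \<nu> \<Longrightarrow> p \<noteq> q \<Longrightarrow> (\<Sum>a<N. \<Phi> x (w(p := a, q := a))) = 0"
  shows "trace_op N n P i j x = 0"
proof (cases "(\<exists>p\<in>\<nu>. \<kappa> p = i) \<and> (\<exists>q\<in>\<nu>. \<kappa> q = j)")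
  case True
  then obtain p q where pq: "p \<in> \<nu>" "\<kappa> p = i" "q \<in> \<nu>" "\<kappa> q = j" by blast
  then have ne: "p \<noteq> q" using ij by auto
  obtain cs' e where "e \<noteq> 0 \<and> distinct cs' \<and> set cs' = \<nu> - {p, q} \<and>
    (\<forall>x w. (\<forall>a<N. w(p := a, q := a) \<in> words) \<longrightarrow> (\<Sum>a<N. \<Phi> x (w(p := a, q := a)))
      = e * foldr (\<lambda>c. fm P (w c * n + \<kappa> c)) cs' (trace_op N n P (\<kappa> p) (\<kappa> q) x) P)"
    using Phi_trace[OF pq(1,3) ne] by (elim exE) (rule that)
  then have e: "e \<noteq> 0" "distinct cs'" "set cs' = \<nu> - {p, q}"
    "\<And>x w. \<forall>a<N. w(p := a, q := a) \<in> words \<Longrightarrow> (\<Sum>a<N. \<Phi> x (w(p := a, q := a)))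
      = e * foldr (\<lambda>c. fm P (w c * n + \<kappa> c)) cs' (trace_op N n P (\<kappa> p) (\<kappa> q) x) P"
    by simp_all
  show ?thesis
  proof (rule fm_nondegenerate[where \<kappa> = \<kappa> and cs = cs' and P = P])
    show "\<kappa> c < n" for c by (rule kap)
    show "distinct cs'" "P \<subseteq> {..<N * n}" using e pvac_subset by auto
    show "trace_op N n P i j x \<in> ext_space (N * n)"
      using typedD(1)[OF x] ij by (intro trace_op_ext_space)
    show "foldr (\<lambda>c. fm P (w c * n + \<kappa> c)) cs' (trace_op N n P i j x) P = 0" if w: "w \<in> set cs' \<rightarrow>\<^sub>E {..<N}" for w
    proof -
      have "w(p := a, q := a) \<in> words" if "a < N" for a
      proof (rule PiE_I)
        fix c assume "c \<in> \<nu>"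
        then show "(w(p := a, q := a)) c \<in> {..<N}" using PiE_mem[OF w, of c] e(3) that by auto
      next
        fix c assume "c \<notin> \<nu>"
        then show "(w(p := a, q := a)) c = undefined" using PiE_arb[OF w, of c] e(3) pq by auto
      qed
      then show ?thesis
        using e(4)[of w x] rel[OF pq(1,3) ne, of w] e(1) pq by simp
    qed
    fix K l assume nz: "trace_op N n P i j x K \<noteq> 0" and l: "l < n"
    obtain K' where K': "x K' \<noteq> 0" "card (occupancy N n P K' i) = card (occupancy N n P K i) + 1"
      "card (occupancy N n P K' j) = card (occupancy N n P K j) + 1"
      "\<And>l. l < n \<Longrightarrow> l \<noteq> i \<Longrightarrow> l \<noteq> j \<Longrightarrow> occupancy N n P K' l = occupancy N n P K l"
      using occupancy_trace_op[OF ij nz] by metis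
    have ci: "{c \<in> \<nu>. \<kappa> c = i} = insert p {c \<in> set cs'. \<kappa> c = i}" "p \<notin> {c \<in> set cs'. \<kappa> c = i}"
      unfolding e(3) using pq ij by blast+
    have cj: "{c \<in> \<nu>. \<kappa> c = j} = insert q {c \<in> set cs'. \<kappa> c = j}" "q \<notin> {c \<in> set cs'. \<kappa> c = j}"
      unfolding e(3) using pq ij by blast+
    have cl: "{c \<in> set cs'. \<kappa> c = l} = {c \<in> \<nu>. \<kappa> c = l}" if "l \<noteq> i" "l \<noteq> j"
      unfolding e(3) using pq that by blast
    consider "l = i" | "l = j" | "l \<noteq> i" "l \<noteq> j" by blast
    then show "card (occupancy N n P K l) = card {c \<in> set cs'. \<kappa> c = l}"
    proof cases
      case 1
      have "card {c \<in> \<nu>. \<kappa> c = i} = card {c \<in> set cs'. \<kappa> c = i} + 1"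
        unfolding ci(1) using ci(2) by (subst card_insert_disjoint) auto
      then show ?thesis using typedD(2)[OF x K'(1) ij(1)] K'(2) 1 by simp
    next
      case 2
      have "card {c \<in> \<nu>. \<kappa> c = j} = card {c \<in> set cs'. \<kappa> c = j} + 1"
        unfolding cj(1) using cj(2) by (subst card_insert_disjoint) auto
      then show ?thesis using typedD(2)[OF x K'(1) ij(2)] K'(3) 2 by simp
    next
      case 3
      then show ?thesis using typedD(2)[OF x K'(1) l] K'(4)[OF l] cl by simp
    qed
  qed
next
  case False
  show ?thesis
  proof (rule ccontr)
    assume "trace_op N n P i j x \<noteq> 0"
    then obtain K where "trace_op N n P i j x K \<noteq> 0" by (auto simp: fun_eq_iff zero_fun_apply)
    from occupancy_trace_op[OF ij this] obtain K' where "x K' \<noteq> 0"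
      "card (occupancy N n P K' i) = card (occupancy N n P K i) + 1"
      "card (occupancy N n P K' j) = card (occupancy N n P K j) + 1" by metis
    moreover have "{c \<in> \<nu>. \<kappa> c = i} = {} \<or> {c \<in> \<nu>. \<kappa> c = j} = {}" using False by blast
    ultimately show False using typedD(2)[OF x _ ij(1), of K'] typedD(2)[OF x _ ij(2), of K'] by fastforce
  qed
qed

private lemma kappa_eq_iff: "p \<in> \<nu> \<Longrightarrow> k < n \<Longrightarrow> \<kappa> p = n - 1 - k \<longleftrightarrow> snd p = k"
  using cols[of p] by (auto simp: cell_col_def)

private lemma column_group_iff:
  "\<sigma> permutes \<nu> \<Longrightarrow> (\<forall>c\<in>\<nu>. \<kappa> (\<sigma> c) = \<kappa> c) \<longleftrightarrow> \<sigma> \<in> column_group \<nu>"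
proof -
  assume p: "\<sigma> permutes \<nu>"
  have "\<kappa> (\<sigma> c) = \<kappa> c \<longleftrightarrow> snd (\<sigma> c) = snd c" if "c \<in> \<nu>" for c
    using kappa_eq_iff[of "\<sigma> c" "snd c"] permutes_in_image[OF p, of c] cols[OF that] that by (simp add: cell_col_def)
  then show ?thesis using p by (simp add: column_group_def)
qed

lemma bij_betw_cell_coeff: "bij_betw \<Phi> (hw_space N n \<nu>) (R_space N \<nu>)"
proof -
  have R: "R_space N \<nu> = garnir_space N \<nu> \<inter> traceless N \<nu>"
    by (simp add: R_space_def schur_space_eq_garnir_space[OF young])
  have into: "\<Phi> x \<in> R_space N \<nu>" if x: "x \<in> hw_space N n \<nu>" for x
  proof -
    have ts: "\<Phi> x \<in> tensor_space \<nu> {..<N}"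
      unfolding tensor_space_def
    proof (intro CollectI allI impI)
      fix w assume "\<Phi> x w \<noteq> 0"
      then show "w \<in> words" by (rule contrapos_np) (rule Phi_out)
    qed
    have anti: "\<Phi> x (w \<circ> \<sigma>) = of_int (sign \<sigma>) * \<Phi> x w" if "\<sigma> \<in> column_group \<nu>" for \<sigma> w
      using that column_group_iff[OF column_group_permutes[OF that]]
      by (intro Phi_anti column_group_permutes) auto
    have rel: "(\<Sum>p\<in>{p\<in>\<nu>. snd p = k}. \<Phi> x (w \<circ> swp p q)) = \<Phi> x w" if q: "q \<in> \<nu>" and k: "k < snd q" for q k w
    proof (cases "w \<in> words")
      case True
      \<comment> \<open>The numbering is reversed: an earlier column \<open>k\<close> of the diagram
        is a larger index \<open>j\<close>.\<close>
      define j where "j = n - 1 - k"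
      have kn: "k < n" using k cols[OF q] by simp
      have ij: "\<kappa> q < j" "j < n" using k cols[OF q] by (auto simp: cell_col_def j_def)
      have "{p\<in>\<nu>. snd p = k} = {p\<in>\<nu>. \<kappa> p = j}"
        using kappa_eq_iff[OF _ kn] by (auto simp: j_def)
      moreover have "transfer_op N n P (\<kappa> q) j x = 0" using x ij by (simp add: hw_space_def)
      then have "vfold (\<kappa>(q := j)) w (transfer_op N n P (\<kappa> q) j x) P = 0"
        by (simp only: foldr_fm_linear(3) zero_fun_apply[of P])
      ultimately show ?thesis
        using Phi_transfer[OF True q refl ij(2), of x] ij(1) by simp
    next
      case False
      have "\<Phi> x (w \<circ> swp p q) = 0" if "p \<in> \<nu>" for p
      proof -
        have "swp p q permutes \<nu>" using that q by (intro permutes_swap_id)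
        then have "w \<circ> swp p q \<notin> words" using False comp_permutes_PiE_iff[of "swp p q" \<nu> w "{..<N}"] by blast
        then show ?thesis by (rule Phi_out)
      qed
      then show ?thesis using False by (simp add: Phi_out)
    qed
    have tr: "(\<Sum>a<N. \<Phi> x (w(p := a, q := a))) = 0" if pq: "p \<in> \<nu>" "q \<in> \<nu>" "p \<noteq> q" and lt: "\<kappa> p < \<kappa> q" for p q w
    proof (cases "\<forall>a<N. w(p := a, q := a) \<in> words")
      case True
      have "trace_op N n P (\<kappa> p) (\<kappa> q) x = 0" using x lt kap by (simp add: hw_space_def)
      then have "foldr (\<lambda>c. fm P (w c * n + \<kappa> c)) cs' (trace_op N n P (\<kappa> p) (\<kappa> q) x) P = 0" for cs'
        by (simp only: foldr_fm_linear(3) zero_fun_apply[of P])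
      then show ?thesis using Phi_trace[OF pq] True by auto
    next
      case False
      \<comment> \<open>Whether such a label is admissible does not depend on the letter
        \<open>a < N\<close>: if one of them is not, none is, and every summand is 0.\<close>
      have "w(p := a, q := a) \<notin> words" if a: "a < N" for a
      proof
        assume m: "w(p := a, q := a) \<in> words"
        have "w(p := b, q := b) \<in> words" if "b < N" for b
        proof (rule PiE_I)
          fix c assume "c \<in> \<nu>"
          then show "(w(p := b, q := b)) c \<in> {..<N}" using PiE_mem[OF m, of c] that by (auto split: if_splits)
        next
          fix c assume "c \<notin> \<nu>"
          then show "(w(p := b, q := b)) c = undefined" using PiE_arb[OF m, of c] pq by (auto split: if_splits)
        qed
        then show False using False by simp
      qed
      then show ?thesis by (simp add: Phi_out)
    qed
    have "(\<Sum>a<N. \<Phi> x (w(p := a, q := a))) = 0" if pq: "p \<in> \<nu>" "q \<in> \<nu>" "p \<noteq> q" for p q w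
    proof -
      consider "\<kappa> p < \<kappa> q" | "\<kappa> q < \<kappa> p" | "\<kappa> p = \<kappa> q" by linarith
      then show ?thesis
      proof cases
        case 1
        then show ?thesis by (rule tr[OF pq])
      next
        case 2
        have "w(p := a, q := a) = w(q := a, p := a)" for a using pq(3) by (rule fun_upd_twist)
        then show ?thesis using tr[OF pq(2,1) pq(3)[symmetric] 2, of w] by simp
      next
        case 3
        then show ?thesis using trace_same_column[OF pq] by simp
      qed
    qed
    then show ?thesis
      unfolding R using ts anti rel by (simp add: garnir_space_def traceless_def)
  qed
  have inj: "inj_on \<Phi> (hw_space N n \<nu>)"
  proof (rule inj_onI)
    fix x y assume xy: "x \<in> hw_space N n \<nu>" "y \<in> hw_space N n \<nu>" and eq: "\<Phi> x = \<Phi> y"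
    then have ty: "x \<in> typed_space N n \<nu>" "y \<in> typed_space N n \<nu>" by (auto simp: hw_space_def)
    have "x - y = 0"
    proof (rule fm_nondegenerate[where \<kappa> = \<kappa> and cs = cs and P = P])
      show "\<kappa> c < n" for c by (rule kap)
      show "distinct cs" "P \<subseteq> {..<N * n}" using cs pvac_subset by auto
      show "x - y \<in> ext_space (N * n)" using typedD(1)[OF ty(1)] typedD(1)[OF ty(2)] by (rule ext_space_diff)
      show "card (occupancy N n P K i) = card {c \<in> set cs. \<kappa> c = i}" if "(x - y) K \<noteq> 0" "i < n" for K i
      proof -
        have "x K \<noteq> 0 \<or> y K \<noteq> 0" using that(1) by (auto simp: minus_apply[of _ _ K])
        then show ?thesis using typedD(2)[OF ty(1) _ that(2)] typedD(2)[OF ty(2) _ that(2)] cs by auto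
      qed
      show "vfold \<kappa> w (x - y) P = 0" if "w \<in> set cs \<rightarrow>\<^sub>E {..<N}" for w
      proof -
        have w: "w \<in> words" using that cs by simp
        have "x - y = x + (-1) *\<^sub>C y" by simp
        then have "vfold \<kappa> w (x - y) = vfold \<kappa> w x + (-1) *\<^sub>C vfold \<kappa> w y"
          by (simp only: foldr_fm_linear)
        then have "vfold \<kappa> w (x - y) P = vfold \<kappa> w x P - vfold \<kappa> w y P"
          by (simp only: plus_fun_apply[of _ _ P] scaleC_fun_complex_apply[of _ _ P]) simp
        then show ?thesis using fun_cong[OF eq, of w] unfolding Phi_in[OF w] by simp
      qed
    qed
    then show "x = y" by simp
  qed
  have onto: "t \<in> \<Phi> ` hw_space N n \<nu>" if t: "t \<in> R_space N \<nu>" for t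
  proof -
    have g: "t \<in> garnir_space N \<nu>" and tr: "t \<in> traceless N \<nu>" using t R by auto
    have ts: "t \<in> tensor_space (set cs) {..<N}" using g cs by (simp add: garnir_space_def)
    have anti: "t (w \<circ> \<sigma>) = of_int (sign \<sigma>) * t w" if "\<sigma> permutes set cs" "\<forall>c\<in>set cs. \<kappa> (\<sigma> c) = \<kappa> c" for \<sigma> w
      using g that column_group_iff[of \<sigma>] unfolding cs(2) by (simp add: garnir_space_def)
    obtain x where x: "x \<in> ext_space (N * n)"
      "\<And>K i. x K \<noteq> 0 \<Longrightarrow> i < n \<Longrightarrow> card (occupancy N n P K i) = card {c \<in> set cs. \<kappa> c = i}"
      "\<And>w. w \<in> set cs \<rightarrow>\<^sub>E {..<N} \<Longrightarrow> vfold \<kappa> w x P = t w"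
      by (rule bexE[OF fm_surjective[where cs = cs and \<kappa> = \<kappa> and n = n and P = P and N = N and t = t,
            OF kap cs(1) pvac_subset ts anti]]) simp_all
    have ty: "x \<in> typed_space N n \<nu>" using x cs by (simp add: typed_space_def)
    have Px: "\<Phi> x = t"
    proof
      fix w show "\<Phi> x w = t w"
      proof (cases "w \<in> words")
        case True
        then show ?thesis using x(3)[of w] cs by (simp add: Phi_in)
      next
        case False
        then have "t w = 0" using ts cs by (auto simp: tensor_space_def)
        then show ?thesis using False by (simp add: Phi_out)
      qed
    qed
    have "transfer_op N n P i j x = 0" if ij: "i < j" "j < n" for i j
    proof (rule transfer_zeroI[OF ty])
      show "i < n" "j < n" "i \<noteq> j" using ij by auto
      fix q w assume q: "q \<in> \<nu>" "\<kappa> q = i"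
      define k where "k = n - 1 - j"
      have k: "k < snd q" "k < n" "j = n - 1 - k" using ij q cols[OF q(1)] by (auto simp: k_def cell_col_def)
      have "{p\<in>\<nu>. \<kappa> p = j} = {p\<in>\<nu>. snd p = k}" using kappa_eq_iff[OF _ k(2)] k(3) by auto
      then show "(\<Sum>p\<in>{p\<in>\<nu>. \<kappa> p = j}. \<Phi> x (w \<circ> swp p q)) = \<Phi> x w"
        using g q(1) k(1) by (simp add: Px garnir_space_def)
    qed
    moreover have "trace_op N n P i j x = 0" if ij: "i < j" "j < n" for i j
    proof (rule trace_zeroI[OF ty])
      show "i < n" "j < n" "i \<noteq> j" using ij by auto
      show "(\<Sum>a<N. \<Phi> x (w(p := a, q := a))) = 0" if "p \<in> \<nu>" "q \<in> \<nu>" "p \<noteq> q" for p q w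
        using tr that by (simp add: Px traceless_def)
    qed
    ultimately have "x \<in> hw_space N n \<nu>" using ty by (simp add: hw_space_def)
    then show ?thesis using Px by blast
  qed
  show ?thesis
    using inj into onto by (auto simp: bij_betw_def)
qed

text \<open>Once the word has been carried through \<open>g\<close>, only a vacuum coefficient is
  left to be read off, and this is unchanged by \<open>g\<close>.\<close>

lemma cell_coeff_O_on_ext:
  assumes g: "g \<in> O_group N" and x: "x \<in> ext_space (N * n)"
  shows "\<Phi> (O_on_ext N n g x) = R_act N \<nu> g (\<Phi> x)"
proof
  fix w
  show "\<Phi> (O_on_ext N n g x) w = R_act N \<nu> g (\<Phi> x) w"
  proof (cases "w \<in> words")
    case True
    define Y where "Y = (\<Sum>u\<in>words. (\<Prod>c\<in>\<nu>. g $$ (w c, u c)) *\<^sub>C vfold \<kappa> u x)"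
    have f: "vfold \<kappa> u x \<in> ext_space (N * n)" if "u \<in> words" for u
      using W_less[OF that] kap x by (intro foldr_fm_ext_space) auto
    have Y: "Y \<in> ext_space (N * n)"
      unfolding Y_def by (intro ext_space_sum ext_space_scale f)
    have "vfold \<kappa> w (O_on_ext N n g x) = O_on_ext N n g Y"
      using foldr_fm_O_on_ext[OF g n x cs(1), of w \<kappa>] W_less[OF True] kap by (simp add: Y_def cs(2))
    then have "\<Phi> (O_on_ext N n g x) w = Y P"
      unfolding Phi_in[OF True] using O_on_ext_vacuum[OF g n Y] by simp
    also have "\<dots> = (\<Sum>u\<in>words. (\<Prod>c\<in>\<nu>. g $$ (w c, u c)) * \<Phi> x u)"
      unfolding Y_def sum_fun_apply scaleC_fun_complex_apply[of _ _ P] by (intro sum.cong refl) (simp add: Phi_in)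
    finally show ?thesis using True by (simp add: R_act_def)
  next
    case False
    then show ?thesis by (simp add: R_act_def Phi_out)
  qed
qed

end

section \<open>Root vectors and Cartan elements on the exterior algebra\<close>

lemma pos_root_vectors_eq:
  "pos_root_vectors n = {root_mat n i j |i j. i < j \<and> j < n} \<union> {root_mat n i (j + n) |i j. i < j \<and> j < n}"
proof -
  have "root_mat n i j = elem_mat (2 * n) i j - elem_mat (2 * n) (j + n) (i + n)" if "i < j" "j < n" for i j
    using that by (simp add: root_mat_def dual_def)
  moreover have "root_mat n i (j + n) = elem_mat (2 * n) i (j + n) - elem_mat (2 * n) j (i + n)" if "i < j" "j < n" for i j
    using that by (simp add: root_mat_def dual_def)
  ultimately show ?thesis
    unfolding pos_root_vectors_def by (intro arg_cong2[where f = "(\<union>)"] Collect_cong) metis+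
qed

lemma spin_ext_raise:
  assumes "i < j" "j < n"
  shows "spin_ext N n (root_mat n i j) x = (\<Sum>k<N. fop True (k * n + i) (fop False (k * n + j) x))"
    and "spin_ext N n (root_mat n i (j + n)) x = (\<Sum>k<N. fop True (k * n + i) (fop True (k * n + j) x))"
proof -
  have half: "(1 / 2) *\<^sub>C (y - - y) = y" for y :: ext
  proof -
    have "(1 / 2) *\<^sub>C (y - - y) = (1 / 2 + 1 / 2) *\<^sub>C y"
      by (simp only: diff_minus_eq_add scaleC_add_right scaleC_add_left)
    then show ?thesis by simp
  qed
  have anti: "fop b (k * n + j) (fop True (k * n + i) x) = - fop True (k * n + i) (fop b (k * n + j) x)" for b k
    using assms by (subst fop_anticommute) (simp add: index_eq_iff)
  have d: "dual n j = j + n" "dual n (j + n) = j" and g: "gam n k i = fop True (k * n + i)"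
    "gam n k j = fop True (k * n + j)" "gam n k (j + n) = fop False (k * n + j)" for k
    using assms by (auto simp: dual_def gam_def)
  show "spin_ext N n (root_mat n i j) x = (\<Sum>k<N. fop True (k * n + i) (fop False (k * n + j) x))"
    using assms by (simp only: spin_ext_root_mat d g anti half)
  show "spin_ext N n (root_mat n i (j + n)) x = (\<Sum>k<N. fop True (k * n + i) (fop True (k * n + j) x))"
    using assms by (simp only: spin_ext_root_mat d g anti half)
qed

text \<open>The number operator of column \<open>i\<close>, shifted by \<open>N / 2\<close> because
  the spin action antisymmetrises the product of creation and annihilation.\<close>

lemma spin_ext_cartan:
  assumes i: "i < n"
  shows "spin_ext N n (cartan n i) x K = (of_nat (card {k. k < N \<and> k * n + i \<in> K}) - of_nat N / 2) * x K"
proof -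
  have d: "dual n i = i + n" and g: "gam n k i = fop True (k * n + i)" "gam n k (i + n) = fop False (k * n + i)" for k
    using i by (auto simp: dual_def gam_def)
  have "spin_ext N n (cartan n i) x K = (\<Sum>k<N. (1 / 2) * (fop True (k * n + i) (fop False (k * n + i) x) K
      - fop False (k * n + i) (fop True (k * n + i) x) K))"
    using i by (simp add: cartan_eq_root_mat spin_ext_root_mat d g sum_fun_apply
        scaleC_fun_complex_apply[of _ _ K] minus_apply[of _ _ K])
  also have "\<dots> = (\<Sum>k<N. (if k * n + i \<in> K then 1 else 0) * x K - x K / 2)"
    by (intro sum.cong refl) (auto simp: fop_def nsign_flip)
  also have "\<dots> = (\<Sum>k<N. if k * n + i \<in> K then 1 else 0) * x K - of_nat N * (x K / 2)"
    by (simp add: sum_subtractf sum_distrib_right)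
  also have "(\<Sum>k<N. if k * n + i \<in> K then 1 else 0) = (of_nat (card {k. k < N \<and> k * n + i \<in> K}) :: complex)"
    by (simp add: sum.If_cases Int_def lessThan_def)
  finally show ?thesis by (simp add: algebra_simps)
qed

text \<open>For \<open>i < j < n\<close> column \<open>i\<close> is always exchanged. If column
  \<open>j\<close> is exchanged as well, the transfer is the root vector of h_i^* - h_j^* and the
  trace that of h_i^* + h_j^*; otherwise \<open>n\<close> is odd, \<open>j = n - 1\<close>, and the
  two are interchanged. The pair of conditions is the same in both cases.\<close>

lemma singular_vectors_eq_hw_space:
  assumes data: "\<And>i. i < n \<Longrightarrow> r i \<le> N" "\<And>i. i < n \<Longrightarrow> lam ! i = real (r i) - real N / 2"
    "\<And>i. i < n \<Longrightarrow> card {c \<in> \<nu>. cell_col n c = i} = (if hodge n i then N - r i else r i)"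
  shows "singular_vectors n (ext_space (N * n)) (spin_ext N n) lam = hw_space N n \<nu>"
proof -
  let ?P = "pvac N n"
  have occ: "card (occupancy N n ?P K i) = card {c \<in> \<nu>. cell_col n c = i} \<longleftrightarrow> card {k. k < N \<and> k * n + i \<in> K} = r i"
    if i: "i < n" for K i
  proof (cases "hodge n i")
    case True
    define A where "A = {k. k < N \<and> k * n + i \<in> K}"
    have o: "occupancy N n ?P K i = {..<N} - A"
      using True pvac_iff[OF _ i] by (auto simp: occupancy_def A_def)
    have "A \<subseteq> {..<N}" by (auto simp: A_def)
    then have "card A \<le> N" "card ({..<N} - A) = N - card A"
      using card_mono[of "{..<N}" A] by (auto simp: card_Diff_subset finite_subset)
    moreover have "card {c \<in> \<nu>. cell_col n c = i} = N - r i" "r i \<le> N"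
      using data(1,3)[OF i] True by simp_all
    ultimately show ?thesis
      unfolding A_def[symmetric] o by simp arith
  next
    case False
    then have "occupancy N n ?P K i = {k. k < N \<and> k * n + i \<in> K}"
      using pvac_iff[OF _ i] by (auto simp: occupancy_def)
    then show ?thesis using data(3)[OF i] False by simp
  qed
  have weight: "spin_ext N n (cartan n i) x = complex_of_real (lam ! i) *\<^sub>C x \<longleftrightarrow>
      (\<forall>K. x K \<noteq> 0 \<longrightarrow> card (occupancy N n ?P K i) = card {c \<in> \<nu>. cell_col n c = i})" if i: "i < n" for x i
  proof -
    have lam: "complex_of_real (lam ! i) = of_nat (r i) - of_nat N / 2"
      using data(2)[OF i] by simp
    have "spin_ext N n (cartan n i) x = complex_of_real (lam ! i) *\<^sub>C x \<longleftrightarrow>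
      (\<forall>K. (of_nat (card {k. k < N \<and> k * n + i \<in> K}) - of_nat N / 2) * x K = (of_nat (r i) - of_nat N / 2) * x K)"
      unfolding fun_eq_iff spin_ext_cartan[OF i] scaleC_fun_complex_apply lam ..
    also have "\<dots> \<longleftrightarrow> (\<forall>K. x K \<noteq> 0 \<longrightarrow> card {k. k < N \<and> k * n + i \<in> K} = r i)"
      by auto
    finally show ?thesis using occ[OF i] by simp
  qed
  have raise: "spin_ext N n (root_mat n i j) x = 0 \<and> spin_ext N n (root_mat n i (j + n)) x = 0 \<longleftrightarrow>
      transfer_op N n ?P i j x = 0 \<and> trace_op N n ?P i j x = 0" if ij: "i < j" "j < n" for i j x
  proof -
    have hi: "hodge n i" using ij by (simp add: hodge_def)
    have f: "fm ?P (k * n + i) = fop True (k * n + i)" "fm ?P (k * n + j) = fop (hodge n j) (k * n + j)"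
      "fmd ?P (k * n + j) = fop (\<not> hodge n j) (k * n + j)" if "k < N" for k
      using pvac_iff[OF that, of i n] pvac_iff[OF that, of j n] ij hi by (auto simp: fm_def fmd_def)
    have t: "transfer_op N n ?P i j x = (\<Sum>k<N. fop True (k * n + i) (fop (\<not> hodge n j) (k * n + j) x))"
      "trace_op N n ?P i j x = (\<Sum>k<N. fop True (k * n + i) (fop (hodge n j) (k * n + j) x))"
      unfolding transfer_op_def trace_op_def by (simp_all add: f)
    show ?thesis
      unfolding t spin_ext_raise[OF ij] by (cases "hodge n j") auto
  qed
  have pos: "(\<forall>X\<in>pos_root_vectors n. spin_ext N n X x = 0) \<longleftrightarrow>
      (\<forall>i j. i < j \<longrightarrow> j < n \<longrightarrow> transfer_op N n ?P i j x = 0 \<and> trace_op N n ?P i j x = 0)" for x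
  proof -
    have "(\<forall>X\<in>pos_root_vectors n. spin_ext N n X x = 0) \<longleftrightarrow>
      (\<forall>i j. i < j \<longrightarrow> j < n \<longrightarrow> spin_ext N n (root_mat n i j) x = 0 \<and> spin_ext N n (root_mat n i (j + n)) x = 0)"
      unfolding pos_root_vectors_eq by blast
    then show ?thesis using raise by simp
  qed
  show ?thesis
    unfolding singular_vectors_def hw_space_def typed_space_def pos using weight by auto
qed

section \<open>Diagrams\<close>

text \<open>The two parity cases of \<open>F_map\<close> in one formula: an exchanged column counts
  holes, an unexchanged one particles. The list runs from the last row of the cell diagram to the
  first.\<close>

definition col_lengths :: "nat \<Rightarrow> nat list \<Rightarrow> nat list \<Rightarrow> nat list" where
  "col_lengths n l r = map (\<lambda>j. if hodge n (n - 1 - j) then l ! (n - 1 - j) else r ! (n - 1 - j)) [0..<n]"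

lemma col_lengths_nth:
  "j < n \<Longrightarrow> col_lengths n l r ! j = (if hodge n (n - 1 - j) then l ! (n - 1 - j) else r ! (n - 1 - j))"
  by (simp add: col_lengths_def)

lemma F_map_eq:
  assumes "length l = n" "length r = n" "n > 0"
  shows "F_map (l, r) = of_columns (col_lengths n l r)"
proof (cases "even n")
  case True
  then have "rev l = col_lengths n l r"
    using assms by (intro nth_equalityI) (auto simp: col_lengths_def rev_nth hodge_def)
  then show ?thesis using True assms by simp
next
  case False
  have h: "hodge n i \<longleftrightarrow> i < n - 1" for i
    using False by (simp add: hodge_def)
  have "last r # rev (butlast l) = col_lengths n l r"
  proof (rule nth_equalityI)
    fix j assume "j < length (last r # rev (butlast l))"
    then have "j < n" using assms by simp
    moreover have "r \<noteq> []" using assms by auto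
    ultimately show "(last r # rev (butlast l)) ! j = col_lengths n l r ! j"
      using assms by (cases j) (auto simp: col_lengths_def h rev_nth nth_butlast last_conv_nth)
  qed (use assms in \<open>auto simp: col_lengths_def\<close>)
  then show ?thesis using False assms by simp
qed

lemma column_length_of_columns: "j < length c \<Longrightarrow> column_length (of_columns c) j = c ! j"
  by (simp add: column_length_def of_columns_def)

lemma young_diagram_of_columns:
  assumes "\<And>j. j + 1 < length c \<Longrightarrow> c ! (j + 1) \<le> c ! j"
  shows "young_diagram (of_columns c)"
proof -
  have mono: "c ! j \<le> c ! j'" if "j' \<le> j" "j < length c" for j j'
    using that
  proof (induction rule: dec_induct)
    case (step m)
    then show ?case using assms[of m] by simp
  qed simp
  have "of_columns c \<subseteq> {..<Suc (Max (set c))} \<times> {..<length c}"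
    by (auto simp: of_columns_def less_Suc_eq_le) (meson List.finite_set Max_ge less_imp_le nth_mem order_trans)
  then have "finite (of_columns c)" by (rule finite_subset) simp
  then show ?thesis
    unfolding young_diagram_def of_columns_def using mono by (auto dest: order.strict_trans2 le_less_trans) fastforce+
qed

lemma young_diagram_eq_columns:
  assumes "young_diagram \<nu>"
  shows "(i, j) \<in> \<nu> \<longleftrightarrow> i < column_length \<nu> j"
proof -
  let ?S = "{i. (i, j) \<in> \<nu>}"
  have fin: "finite ?S"
    using assms by (intro finite_subset[OF _ finite_imageI[of \<nu> fst]]) (force simp: young_diagram_def)+
  have down: "i' \<in> ?S" if "i \<in> ?S" "i' \<le> i" for i i'
    using assms that unfolding young_diagram_def by blast
  have "?S = {..<card ?S}"
  proof (rule card_subset_eq[symmetric])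
    show "{..<card ?S} \<subseteq> ?S"
    proof
      fix i assume i: "i \<in> {..<card ?S}"
      show "i \<in> ?S"
      proof (rule ccontr)
        assume "i \<notin> ?S"
        then have "?S \<subseteq> {..<i}" using down by (meson lessThan_iff not_le subsetI)
        then have "card ?S \<le> i" using card_mono[of "{..<i}" ?S] by simp
        then show False using i by simp
      qed
    qed
  qed (use fin in auto)
  then show ?thesis unfolding column_length_def by blast
qed

text \<open>The inequalities \<open>r ! (n - 1) \<le> r ! (n - 2)\<close> and
  \<open>l ! (n - 1) \<le> r ! (n - 2)\<close> become statements about the first two columns. For
  even \<open>n\<close> the former is their order and the latter the bound \<open>N\<close> on their
  sum; for odd \<open>n\<close> the roles are exchanged.\<close>

lemma cell_diagrams_col_lengths:
  assumes n: "n \<ge> 2" and lr: "(l, r) \<in> cell_diagrams N n"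
  shows "F_map (l, r) = of_columns (col_lengths n l r)" "of_columns (col_lengths n l r) \<in> SYD N n"
proof -
  have len: "length l = n" "length r = n" and sum: "\<And>i. i < n \<Longrightarrow> r ! i + l ! i = N"
    and dec: "\<And>i. i + 1 < n \<Longrightarrow> r ! i \<ge> r ! (i + 1)" and last: "r ! (n - 2) \<ge> l ! (n - 1)"
    using lr by (auto simp: cell_diagrams_def)
  show "F_map (l, r) = of_columns (col_lengths n l r)"
    using F_map_eq[OF len] n by simp
  let ?c = "col_lengths n l r"
  have c: "?c ! j = (if hodge n (n - 1 - j) then l ! (n - 1 - j) else r ! (n - 1 - j))" if "j < n" for j
    using that by (simp add: col_lengths_def)
  have lc: "length ?c = n" by (simp add: col_lengths_def)
  have h: "hodge n i" if "i + 1 < n" for i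
    using that by (simp add: hodge_def)
  have s1: "r ! (n - 1) + l ! (n - 1) = N" and s2: "r ! (n - 2) + l ! (n - 2) = N"
    using sum[of "n - 1"] sum[of "n - 2"] n by auto
  have d1: "r ! (n - 2) \<ge> r ! (n - 1)"
    using dec[of "n - 2"] n by (simp add: Suc_diff_Suc numeral_2_eq_2)
  have c0: "?c ! 0 = (if hodge n (n - 1) then l ! (n - 1) else r ! (n - 1))" and c1: "?c ! 1 = l ! (n - 2)"
    using c[of 0] c[of 1] h[of "n - 2"] n by (auto simp: numeral_2_eq_2)
  have step: "?c ! (j + 1) \<le> ?c ! j" if "j + 1 < length ?c" for j
  proof (cases "j = 0")
    case True
    then show ?thesis using c0 c1 s1 s2 d1 last by auto
  next
    case False
    define i where "i = n - 1 - (j + 1)"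
    have i: "i + 2 < n" "n - 1 - j = i + 1" "n - 1 - (j + 1) = i" using that False lc by (auto simp: i_def)
    have "l ! i \<le> l ! (i + 1)" using dec[of i] sum[of i] sum[of "i + 1"] i by simp
    then show ?thesis
      using c[of j] c[of "j + 1"] h[of i] h[of "i + 1"] i that lc by simp
  qed
  have "column_length (of_columns ?c) 0 + column_length (of_columns ?c) 1 \<le> N"
    using c0 c1 s1 s2 d1 last n by (simp add: column_length_of_columns lc)
  moreover have "\<forall>(i, j)\<in>of_columns ?c. j < n"
    by (auto simp: of_columns_def lc)
  ultimately show "of_columns ?c \<in> SYD N n"
    using young_diagram_of_columns[OF step] by (simp add: SYD_def)
qed

lemma bij_betw_F_map:
  assumes n: "n \<ge> 2"
  shows "bij_betw F_map (cell_diagrams N n) (SYD N n)"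
proof (rule bij_betw_imageI)
  show "inj_on F_map (cell_diagrams N n)"
  proof (rule inj_onI, clarify)
    fix l r l' r' assume a: "(l, r) \<in> cell_diagrams N n" "(l', r') \<in> cell_diagrams N n" and eq: "F_map (l, r) = F_map (l', r')"
    have len: "length l = n" "length r = n" "length l' = n" "length r' = n"
      and sum: "\<And>i. i < n \<Longrightarrow> r ! i + l ! i = N" "\<And>i. i < n \<Longrightarrow> r' ! i + l' ! i = N"
      using a by (auto simp: cell_diagrams_def)
    have "col_lengths n l r ! j = col_lengths n l' r' ! j" if "j < n" for j
      using that eq column_length_of_columns[of j "col_lengths n l r"] column_length_of_columns[of j "col_lengths n l' r'"]
        cell_diagrams_col_lengths(1)[OF n a(1)] cell_diagrams_col_lengths(1)[OF n a(2)]
      by (simp add: col_lengths_def)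
    note cl = this
    have "(if hodge n i then l ! i else r ! i) = (if hodge n i then l' ! i else r' ! i)" if "i < n" for i
    proof -
      have j: "n - 1 - i < n" "n - 1 - (n - 1 - i) = i" using that by auto
      show ?thesis using cl[OF j(1)] unfolding col_lengths_nth[OF j(1)] j(2) .
    qed
    then have "l ! i = l' ! i \<and> r ! i = r' ! i" if "i < n" for i
      using that sum[OF that] by (cases "hodge n i") fastforce+
    then show "l = l' \<and> r = r'" using len by (auto intro: nth_equalityI)
  qed
  show "F_map ` cell_diagrams N n = SYD N n"
  proof
    show "F_map ` cell_diagrams N n \<subseteq> SYD N n"
      using cell_diagrams_col_lengths[OF n] by auto
    show "SYD N n \<subseteq> F_map ` cell_diagrams N n"
    proof
      fix \<nu> assume nu: "\<nu> \<in> SYD N n"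
      then have y: "young_diagram \<nu>" and cols: "\<And>i j. (i, j) \<in> \<nu> \<Longrightarrow> j < n" and s: "column_length \<nu> 0 + column_length \<nu> 1 \<le> N"
        by (auto simp: SYD_def)
      let ?c = "column_length \<nu>"
      have mono: "?c j \<le> ?c j'" if "j' \<le> j" for j j'
      proof (rule ccontr)
        assume "\<not> ?c j \<le> ?c j'"
        then have "(?c j', j) \<in> \<nu>" using young_diagram_eq_columns[OF y] by simp
        then have "(?c j', j') \<in> \<nu>" using y that unfolding young_diagram_def by blast
        then show False using young_diagram_eq_columns[OF y] by simp
      qed
      have cN: "?c j \<le> N" for j using mono[of 0 j] s by simp
      \<comment> \<open>The inverse map: a column length gives \<open>l\<close> in an exchanged
        column and \<open>r\<close> in the other case. By \<open>cN\<close> the subtraction from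
        \<open>N\<close> never truncates.\<close>
      define l where "l = map (\<lambda>i. if hodge n i then ?c (n - 1 - i) else N - ?c (n - 1 - i)) [0..<n]"
      define r where "r = map (\<lambda>i. if hodge n i then N - ?c (n - 1 - i) else ?c (n - 1 - i)) [0..<n]"
      have li: "l ! i = (if hodge n i then ?c (n - 1 - i) else N - ?c (n - 1 - i))"
        and ri: "r ! i = (if hodge n i then N - ?c (n - 1 - i) else ?c (n - 1 - i))" if "i < n" for i
        using that by (auto simp: l_def r_def)
      have h: "hodge n i" if "i + 1 < n" for i
        using that by (simp add: hodge_def)
      have "(l, r) \<in> cell_diagrams N n"
        unfolding cell_diagrams_def
      proof (intro CollectI case_prodI conjI allI impI)
        show "length l = n" "length r = n" by (simp_all add: l_def r_def)
        show "r ! i + l ! i = N" if "i < n" for i using that cN by (simp add: li ri)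
        show "r ! (i + 1) \<le> r ! i" if "i + 1 < n" for i
        proof (cases "hodge n (i + 1)")
          case True
          have "?c (n - 1 - i) \<le> ?c (n - 1 - (i + 1))" by (rule mono) simp
          then show ?thesis using that h[OF that] True ri[of i] ri[of "i + 1"] by (simp add: diff_le_mono2)
        next
          case False
          then have "i + 1 = n - 1" using h[of "i + 1"] that by linarith
          then have "n - 1 - (i + 1) = 0" "n - 1 - i = 1" by auto
          then show ?thesis using that h[OF that] False s by (simp add: ri)
        qed
        have e: "n - 1 - (n - 2) = 1" "hodge n (n - 2)" using n h[of "n - 2"] by auto
        show "l ! (n - 1) \<le> r ! (n - 2)"
          using n s mono[of 0 1] e by (simp add: li ri) arith
      qed
      moreover have "F_map (l, r) = \<nu>"
      proof -
        have "col_lengths n l r = map ?c [0..<n]"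
        proof (rule nth_equalityI)
          fix j assume "j < length (col_lengths n l r)"
          then have "j < n" by (simp add: col_lengths_def)
          then have j: "n - 1 - j < n" "n - 1 - (n - 1 - j) = j" "j < n" by auto
          then show "col_lengths n l r ! j = map ?c [0..<n] ! j"
            using li[OF j(1)] ri[OF j(1)] by (simp add: col_lengths_def)
        qed (simp add: col_lengths_def)
        moreover have "(i, j) \<in> of_columns (map ?c [0..<n]) \<longleftrightarrow> (i, j) \<in> \<nu>" for i j
          using young_diagram_eq_columns[OF y, of i j] cols[of i j] by (auto simp: of_columns_def)
        ultimately show ?thesis
          using F_map_eq[of l n r] n by (auto simp: l_def r_def)
      qed
      ultimately show "\<nu> \<in> F_map ` cell_diagrams N n" by force
    qed
  qed
qed

text \<open>All entries of the spinor weights are \<plusminus>1/2, so a coordinate of a sum of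
  \<open>N\<close> weights is the number of plus signs minus \<open>N / 2\<close>.\<close>

lemma Delta_setD:
  assumes n: "n \<ge> 2" and N: "N \<ge> 1" and lam: "lam \<in> Delta_set N n"
  shows "length lam = n" "lam \<in> P_plus n" "\<And>i. i < n \<Longrightarrow> \<exists>a\<le>N. lam ! i = real a - real N / 2"
proof -
  obtain mus where mus: "mus \<in> T_set N n" "lam = weight_sum n mus"
    using lam by (auto simp: Delta_set_def)
  then have len: "length mus = N" and P: "set mus \<subseteq> P_S n" and pl: "\<forall>k\<in>{1..N}. weight_sum n (take k mus) \<in> P_plus n"
    by (auto simp: T_set_def)
  show "length lam = n" by (simp add: mus weight_sum_def)
  show "lam \<in> P_plus n" using pl[rule_format, of N] N len mus by simp
  fix i assume i: "i < n"
  have "\<exists>a\<le>length ms. (\<Sum>mu\<leftarrow>ms. mu ! i) = real a - real (length ms) / 2" if "set ms \<subseteq> P_S n" for ms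
    using that
  proof (induction ms)
    case (Cons m ms)
    then obtain a where a: "a \<le> length ms" "(\<Sum>mu\<leftarrow>ms. mu ! i) = real a - real (length ms) / 2" by auto
    have "length m = n" "set m \<subseteq> {1/2, -1/2}" using Cons.prems by (auto simp: P_S_def)
    then have "m ! i \<in> {1/2, -1/2}" using i nth_mem[of i m] by blast
    then consider "m ! i = 1/2" | "m ! i = -1/2" by blast
    then show ?case
    proof cases
      case 1
      then show ?thesis using a by (intro exI[of _ "Suc a"]) (auto simp: field_simps)
    next
      case 2
      then show ?thesis using a by (intro exI[of _ a]) (auto simp: field_simps)
    qed
  qed simp
  from this[OF P] show "\<exists>a\<le>N. lam ! i = real a - real N / 2"
    using i len by (simp add: mus weight_sum_def)
qed

theorem theorem6p1:
  fixes n N :: nat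
  assumes "n \<ge> 2" and "N \<ge> 1"
  shows "bij_betw F_map (cell_diagrams N n) (SYD N n) \<and>
    (\<forall>lam\<in>Delta_set N n. \<forall>(L :: 'l::complex_vector set) \<rho>. is_L n lam L \<rho> \<longrightarrow>
       O_isomorphic N (U_space N n L \<rho>) (U_act N n)
         (R_space N (F_map (D_of N lam))) (R_act N (F_map (D_of N lam))))"
proof (intro conjI ballI allI impI)
  show "bij_betw F_map (cell_diagrams N n) (SYD N n)"
    by (rule bij_betw_F_map[OF assms(1)])
next
  fix lam and L :: "'l set" and \<rho>
  assume lam: "lam \<in> Delta_set N n" and L: "is_L n lam L \<rho>"
  have n: "n > 0" using assms by simp
  note len = Delta_setD(1)[OF assms lam] and plus = Delta_setD(2)[OF assms lam]
  have "\<forall>i. \<exists>a. i < n \<longrightarrow> a \<le> N \<and> lam ! i = real a - real N / 2"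
    using Delta_setD(3)[OF assms lam] by blast
  \<comment> \<open>\<open>a i\<close> is the number of cells to the right of the axis in row
    \<open>i\<close>, known to be a natural number before \<open>D_of\<close> rounds.\<close>
  then obtain a where a: "\<And>i. i < n \<Longrightarrow> a i \<le> N" "\<And>i. i < n \<Longrightarrow> lam ! i = real (a i) - real N / 2"
    by metis
  define l where "l = fst (D_of N lam)"
  define r where "r = snd (D_of N lam)"
  have lr: "D_of N lam = (l, r)" by (simp add: l_def r_def)
  have llen: "length l = n" "length r = n" by (simp_all add: l_def r_def D_of_def len)
  have ri: "r ! i = a i" and li: "l ! i = N - a i" if "i < n" for i
  proof -
    have "real N / 2 + lam ! i = real (a i)" "real N / 2 - lam ! i = real (N - a i)"
      using a[OF that] by (auto simp: of_nat_diff)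
    then show "r ! i = a i" "l ! i = N - a i"
      using that by (simp_all add: l_def r_def D_of_def len del: of_nat_diff)
  qed
  have mono: "a (i + 1) \<le> a i" if "i + 1 < n" for i
  proof -
    have "lam ! (i + 1) \<le> lam ! i"
    proof (cases "i + 2 < n")
      case True
      then show ?thesis using plus by (simp add: P_plus_def)
    next
      case False
      \<comment> \<open>The comparison of the last two coordinates is contained in the bound on the
        absolute value.\<close>
      then have i: "i = n - 2" "i + 1 = n - 1" using that by auto
      have "\<bar>lam ! (n - 1)\<bar> \<le> lam ! (n - 2)" using plus by (simp add: P_plus_def)
      then show ?thesis
        using arg_cong[OF i(2), of "nth lam"] arg_cong[OF i(1), of "nth lam"] by linarith
    qed
    then show ?thesis using a(2)[OF that] a(2)[of i] that by simp
  qed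
  have cd: "(l, r) \<in> cell_diagrams N n"
    unfolding cell_diagrams_def
  proof (intro CollectI case_prodI conjI allI impI)
    show "length l = n" "length r = n" by (rule llen)+
    show "r ! i + l ! i = N" if "i < n" for i using a(1)[OF that] by (simp add: ri li that)
    show "r ! (i + 1) \<le> r ! i" if "i + 1 < n" for i using mono[OF that] that by (simp add: ri)
    have nn: "n - 1 < n" "n - 2 < n" using n by auto
    have "\<bar>lam ! (n - 1)\<bar> \<le> lam ! (n - 2)" using plus by (simp add: P_plus_def)
    \<comment> \<open>The other sign in the absolute value makes the sum of the last two coordinates
      nonnegative, which is the condition linking the last two rows.\<close>
    then have "real N \<le> real (a (n - 2) + a (n - 1))"
      using a(2)[OF nn(1)] a(2)[OF nn(2)] by simp
    then have "N \<le> a (n - 2) + a (n - 1)"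
      by (simp only: of_nat_le_iff)
    then show "l ! (n - 1) \<le> r ! (n - 2)"
      unfolding ri[OF nn(2)] li[OF nn(1)] by simp
  qed
  define \<nu> where "\<nu> = F_map (D_of N lam)"
  have nu: "\<nu> = of_columns (col_lengths n l r)" "\<nu> \<in> SYD N n"
    using cell_diagrams_col_lengths[OF assms(1) cd] by (simp_all add: \<nu>_def lr)
  then have young: "young_diagram \<nu>" and cols: "\<And>c. c \<in> \<nu> \<Longrightarrow> snd c < n"
    by (auto simp: SYD_def)
  have card: "card {c \<in> \<nu>. cell_col n c = i} = (if hodge n i then N - a i else a i)" if i: "i < n" for i
  proof -
    let ?j = "n - 1 - i"
    have j: "?j < n" "n - 1 - ?j = i" using i by auto
    have "{c \<in> \<nu>. cell_col n c = i} = (\<lambda>b. (b, ?j)) ` {..<col_lengths n l r ! ?j}"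
      using i by (auto simp: nu(1) of_columns_def cell_col_def col_lengths_def)
    then have "card {c \<in> \<nu>. cell_col n c = i} = col_lengths n l r ! ?j"
      by (simp add: card_image inj_on_def)
    then show ?thesis using i j by (simp add: col_lengths_def ri li)
  qed
  have sing: "singular_vectors n (ext_space (N * n)) (spin_ext N n) lam = hw_space N n \<nu>"
    by (rule singular_vectors_eq_hw_space[where r = a]) (use a card in auto)
  obtain x0 where irr: "o_irreducible n L \<rho>" and x0: "x0 \<in> singular_vectors n L \<rho> lam" "x0 \<noteq> 0"
    using L by (auto simp: is_L_def)
  have rep: "o_rep n L \<rho>" using irr by (simp add: o_irreducible_def)
  obtain cs where cs: "distinct cs" "set cs = \<nu>"
    using finite_distinct_list[of \<nu>] young by (auto simp: young_diagram_def)
  let ?ev = "\<lambda>f :: 'l \<Rightarrow> spin_tensor. S_tensor_to_ext N n (f x0)"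
  let ?f = "\<lambda>f :: 'l \<Rightarrow> spin_tensor. cell_coeff N n cs (?ev f)"
  \<comment> \<open>Evaluation at \<open>x0\<close> reaches the singular vectors in the Fock space,
    and their coefficients at the cells are the tensors of Weyl's construction.\<close>
  have bij: "bij_betw ?f (U_space N n L \<rho>) (R_space N \<nu>)"
    using bij_betw_trans[OF bij_betw_U_space_singular[OF n rep irr x0, of N, unfolded sing]
        bij_betw_cell_coeff[OF n young cols cs, of N]]
    by (simp add: comp_def)
  have lin: "clinear_on (U_space N n L \<rho>) ?f"
    unfolding clinear_on_def
    by (auto simp: plus_fun_apply[of _ _ x0] scaleC_fun_def[where 'b = spin_tensor] S_tensor_to_ext_add S_tensor_to_ext_scaleC
        cell_coeff_add cell_coeff_scaleC)
  have "O_isomorphic N (U_space N n L \<rho>) (U_act N n) (R_space N \<nu>) (R_act N \<nu>)"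
  proof (rule O_isomorphicI[OF O_module_U_space[OF n rep] lin bij])
    fix g f assume "g \<in> O_group N" "f \<in> U_space N n L \<rho>"
    then show "?f (U_act N n g f) = R_act N \<nu> g (?f f)"
      by (simp add: U_act_def S_tensor_to_ext_O(1)[OF n]
          cell_coeff_O_on_ext[OF n young cols cs] S_tensor_to_ext_ext_space)
  qed
  then show "O_isomorphic N (U_space N n L \<rho>) (U_act N n)
      (R_space N (F_map (D_of N lam))) (R_act N (F_map (D_of N lam)))"
    by (simp add: \<nu>_def)
qed

end
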